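(* Let $h\colon\mathbb{H}\to\mathbb{H}$ be a doubly parabolic inner function of the upper half-plane with Denjoy-Wolff point at $\infty$, and let $T\colon\mathbb{R}\to\mathbb{R}$ be its extension to $\mathbb{R}$. For $x\in\mathbb{R}$, $h^k(x)$ means $T^k(x)$. Let $\lambda$ be the push-forward to $\mathbb{R}$ of normalized Lebesgue measure on $\partial\mathbb{D}$. (a) Let $E\subset\mathbb{R}$ be a compact interval, and let $$S_nE(x)=\#\{0\le k\le n-1:h^k(x)\in E\}=\sum_{k=0}^{n-1}\mathbb{1}_E\circ h^k(x).$$ Then, for all $\varepsilon\in(0,\tfrac12)$, $$\lim_{n\to\infty}\frac{S_nE(x)}{n^{\frac12-\varepsilon}}=\infty\quad\text{for }\lambda\text{-almost every }x\in\mathbb{R}.$$ (b) Let $E\subset\mathbb{R}$ be a compact interval, and let $E_n=\{x\in E:\tau_E(x)=n\}$, where $\tau_E(x)\in\mathbb{N}$ denotes the first return time of $x\in E$ to $E$, i.e. $\tau_E(x)=\min\{k\ge1:h^k(x)\in E\}$. Then $\lambda(E_n)\sim\frac1{n\sqrt n}$. (c) Let $E\subset\mathbb{R}$ be a compact interval, and let $F=\mathbb{R}\setminus E$. Assume $E$ is large enough (that is, it contains a suitable fixed compact interval). Let $$F_n=\{x\in F:h(x),\dots,h^{n-1}(x)\in F,\ h^n(x)\notin F\}.$$ Then $\lambda(F_n)\sim\frac1{\sqrt n}$.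
   Context: An inner function is a holomorphic map $g\colon\mathbb{D}\to\mathbb{D}$ whose radial limits $g^*$ lie in $\partial\mathbb{D}$ for Lebesgue-almost every point of $\partial\mathbb{D}$. Its Denjoy-Wolff point is the point to which all interior orbits converge. $g$ is doubly parabolic if its Denjoy-Wolff point $p$ lies in $\partial\mathbb{D}$, $g$ is holomorphic in a neighbourhood of $p$, and near $p$ $$g(z)=p+(z-p)+c(z-p)^3+\dots,\qquad c\ne0.$$ A doubly parabolic inner function $h\colon\mathbb{H}\to\mathbb{H}$ with Denjoy-Wolff point at $\infty$ is a map $h=M\circ g\circ M^{-1}$, with $g$ doubly parabolic with Denjoy-Wolff point $p$ and $M\colon\mathbb{D}\to\mathbb{H}$ a Möbius transformation of $\mathbb{D}$ onto the upper half-plane with $M(p)=\infty$; $T$ is its boundary extension (by radial limits), defined almost everywhere on $\mathbb{R}$, and $\lambda$ is the push-forward of normalized Lebesgue measure on $\partial\mathbb{D}$ under $M$. Notation. $A\lesssim B$ means that $A\le CB$ for some constant $C>0$ (not depending on $n$); $A\sim B$ means that both $A\lesssim B$ and $B\lesssim A$.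
   Formalization: In (c), λ(F_n) is replaced by the Lebesgue measure of F_n, since the F_n are disjoint and λ is finite, so the stated lower bound fails. In (b), the lower bound is for all large n, since some E_n may be empty. Compact intervals are nondegenerate. *)

theory Defs
  imports "HOL-Analysis.Analysis" "HOL-Library.Landau_Symbols" "HOL-Library.Extended_Nat"
begin

definition circle_measure :: "complex measure" where
  "circle_measure = distr (uniform_measure lborel {0..<2 * pi}) borel cis"

definition upper_half_plane :: "complex set" where
  "upper_half_plane = {w. Im w > 0}"

definition inner_function :: "(complex \<Rightarrow> complex) \<Rightarrow> bool" where
  "inner_function g \<longleftrightarrow>
     g holomorphic_on ball 0 1 \<and> g ` ball 0 1 \<subseteq> ball 0 1 \<and>
     (AE \<zeta> in circle_measure. \<exists>l\<in>sphere 0 1. ((\<lambda>r. g (of_real r * \<zeta>)) \<longlongrightarrow> l) (at_left 1))"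

definition Denjoy_Wolff_point :: "(complex \<Rightarrow> complex) \<Rightarrow> complex \<Rightarrow> bool" where
  "Denjoy_Wolff_point g p \<longleftrightarrow> (\<forall>z\<in>ball 0 1. (\<lambda>n. (g ^^ n) z) \<longlonglongrightarrow> p)"

text \<open>Only the values of \<open>g\<close> on the open unit disc are meaningful, so being holomorphic in a
  neighbourhood of \<open>p\<close> means that \<open>g\<close> has a holomorphic extension \<open>G\<close> to a disc around \<open>p\<close>.\<close>

definition doubly_parabolic :: "(complex \<Rightarrow> complex) \<Rightarrow> complex \<Rightarrow> bool" where
  "doubly_parabolic g p \<longleftrightarrow>
     inner_function g \<and> p \<in> sphere 0 1 \<and> Denjoy_Wolff_point g p \<and>
     (\<exists>G r c. r > 0 \<and> G holomorphic_on ball p r \<and> (\<forall>z \<in> ball p r \<inter> ball 0 1. G z = g z) \<and>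
        c \<noteq> 0 \<and> (\<lambda>z. G z - (p + (z - p) + c * (z - p) ^ 3)) \<in> O[at p](\<lambda>z. (z - p) ^ 4))"

text \<open>A Moebius transformation of the unit disc onto the upper half-plane with \<open>M p = \<infinity>\<close>; the
  latter is expressed by the vanishing of the denominator at \<open>p\<close>.\<close>

definition moebius_to_UHP :: "(complex \<Rightarrow> complex) \<Rightarrow> complex \<Rightarrow> bool" where
  "moebius_to_UHP M p \<longleftrightarrow>
     (\<exists>a b c d. a * d - b * c \<noteq> 0 \<and> c * p + d = 0 \<and> (\<forall>z. M z = (a * z + b) / (c * z + d))) \<and>
     M ` ball 0 1 = upper_half_plane"

definition UHP_inverse :: "(complex \<Rightarrow> complex) \<Rightarrow> complex \<Rightarrow> complex \<Rightarrow> complex" where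
  "UHP_inverse M p = the_inv_into (cball 0 1 - {p}) M"

definition doubly_parabolic_UHP ::
  "(complex \<Rightarrow> complex) \<Rightarrow> (complex \<Rightarrow> complex) \<Rightarrow> (complex \<Rightarrow> complex) \<Rightarrow> complex \<Rightarrow> bool" where
  "doubly_parabolic_UHP h g M p \<longleftrightarrow>
     doubly_parabolic g p \<and> moebius_to_UHP M p \<and>
     (\<forall>w\<in>upper_half_plane. h w = M (g (UHP_inverse M p w)))"

text \<open>The extension \<open>T\<close> of \<open>h\<close> to the real line: the limit of \<open>h\<close> along the image under \<open>M\<close> of
  the radius of the disc ending at \<open>M\<^sup>-\<^sup>1 x\<close>. It exists and is real for almost every \<open>x\<close>; at
  the remaining points the value is irrelevant, because the points whose orbit ever meets this
  exceptional null set form a null set.\<close>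

definition boundary_extension ::
  "(complex \<Rightarrow> complex) \<Rightarrow> (complex \<Rightarrow> complex) \<Rightarrow> complex \<Rightarrow> real \<Rightarrow> real" where
  "boundary_extension h M p x =
     Re (Lim (at_left 1) (\<lambda>r. h (M (of_real r * UHP_inverse M p (of_real x)))))"

text \<open>\<open>M\<close> is real on the unit circle without \<open>p\<close>, so \<open>Re\<close> only changes the type.\<close>

definition pushforward_measure :: "(complex \<Rightarrow> complex) \<Rightarrow> real measure" where
  "pushforward_measure M = distr circle_measure borel (\<lambda>\<zeta>. Re (M \<zeta>))"

definition visits :: "(real \<Rightarrow> real) \<Rightarrow> real set \<Rightarrow> nat \<Rightarrow> real \<Rightarrow> nat" where
  "visits T E n x = card {k. k < n \<and> (T ^^ k) x \<in> E}"

text \<open>The value is \<open>\<infinity>\<close> at points that never return.\<close>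

definition first_return_time :: "(real \<Rightarrow> real) \<Rightarrow> real set \<Rightarrow> real \<Rightarrow> enat" where
  "first_return_time T E x = Inf {enat k | k. k \<ge> 1 \<and> (T ^^ k) x \<in> E}"

definition return_set :: "(real \<Rightarrow> real) \<Rightarrow> real set \<Rightarrow> nat \<Rightarrow> real set" where
  "return_set T E n = {x \<in> E. first_return_time T E x = enat n}"

definition excursion_set :: "(real \<Rightarrow> real) \<Rightarrow> real set \<Rightarrow> nat \<Rightarrow> real set" where
  "excursion_set T F n =
     {x \<in> F. (\<forall>k. 1 \<le> k \<and> k \<le> n - 1 \<longrightarrow> (T ^^ k) x \<in> F) \<and> (T ^^ n) x \<notin> F}"

definition lesssim :: "(nat \<Rightarrow> real) \<Rightarrow> (nat \<Rightarrow> real) \<Rightarrow> bool" (infix "\<lesssim>" 50) where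
  "A \<lesssim> B \<longleftrightarrow> (\<exists>C>0. \<forall>n\<ge>1. A n \<le> C * B n)"

text \<open>The same bound, required for all sufficiently large \<open>n\<close> only.\<close>

definition eventually_lesssim :: "(nat \<Rightarrow> real) \<Rightarrow> (nat \<Rightarrow> real) \<Rightarrow> bool" (infix "\<lesssim>\<^sub>\<infinity>" 50) where
  "A \<lesssim>\<^sub>\<infinity> B \<longleftrightarrow> (\<exists>C>0. \<forall>\<^sub>F n in sequentially. A n \<le> C * B n)"

text \<open>The sets \<open>excursion_set T F n\<close> with \<open>n \<ge> 1\<close> are pairwise disjoint. Hence their measures
  cannot be of order \<open>1 / sqrt n\<close> for a finite measure such as \<open>pushforward_measure M\<close>. The
  measure with that rate is the \<open>T\<close>-invariant one, Lebesgue measure on the line. On a compact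
  interval, as for the return times, the two measures are comparable.\<close>

lemma excursion_set_finite_measure:
  assumes "finite_measure \<mu>"
  shows "\<not> (\<lambda>n. 1 / sqrt n) \<lesssim>\<^sub>\<infinity> (\<lambda>n. measure \<mu> (excursion_set T F n))"
proof
  interpret finite_measure \<mu> by fact
  assume "(\<lambda>n. 1 / sqrt n) \<lesssim>\<^sub>\<infinity> (\<lambda>n. measure \<mu> (excursion_set T F n))"
  then obtain C N where C: "C > 0"
    and le: "\<And>n. n \<ge> N \<Longrightarrow> 1 / sqrt n \<le> C * measure \<mu> (excursion_set T F n)"
    by (auto simp: eventually_lesssim_def eventually_sequentially)
  define D where "D n = excursion_set T F (n + Suc N)" for n
  have low: "1 / sqrt (n + Suc N) \<le> C * measure \<mu> (D n)" for n
    using le[of "n + Suc N"] by (simp add: D_def)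
  have sets: "D n \<in> sets \<mu>" for n
  proof (rule ccontr)
    assume "D n \<notin> sets \<mu>"
    then have "measure \<mu> (D n) = 0" by (rule measure_notin_sets)
    with low[of n] have "1 / sqrt (n + Suc N) \<le> 0" by simp
    then show False by (simp add: divide_le_0_iff not_le del: of_nat_add of_nat_Suc)
  qed
  have disj: "excursion_set T F m \<inter> excursion_set T F n = {}" if "1 \<le> m" "m < n" for m n
  proof -
    have "m \<le> n - 1" using that by simp
    then show ?thesis using that unfolding excursion_set_def by auto
  qed
  have "D m \<inter> D n = {}" if "m \<noteq> n" for m n
    using disj[of "m + Suc N" "n + Suc N"] disj[of "n + Suc N" "m + Suc N"] that
    by (cases "m < n") (auto simp: D_def)
  then have "disjoint_family D" by (auto simp: disjoint_family_on_def)
  then have "summable (\<lambda>n. measure \<mu> (D n))"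
    using finite_measure_UNION[of D] sets by (auto simp: sums_iff)
  then have "summable (\<lambda>n. C * measure \<mu> (D n))" by (rule summable_mult)
  then have "summable (\<lambda>n. 1 / sqrt (n + Suc N))"
    by (rule summable_comparison_test'[where N = 0]) (use low in auto)
  then have "summable (\<lambda>n. 1 / sqrt (real n))"
    using summable_iff_shift[of "\<lambda>n. 1 / sqrt (real n)" "Suc N"] by simp
  moreover have "1 / sqrt (real n) = real n powr (-1/2)" for n
    by (simp add: powr_minus_divide powr_half_sqrt)
  ultimately show False by (simp add: summable_real_powr_iff)
qed

end

theory Submission
  imports Defs "HOL-Probability.Probability" "HOL-Complex_Analysis.Complex_Analysis"
    "HOL-Real_Asymp.Real_Asymp"
begin

text \<open>The harmonic measure of the half-plane seen from \<open>w\<close> is the Cauchy distribution \<open>cauchy w\<close>,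
  and the image of \<open>cauchy w\<close> under \<open>T\<close> is \<open>cauchy (h w)\<close>. Letting \<open>w\<close> tend to infinity, \<open>T\<close>
  preserves Lebesgue measure, and near infinity \<open>T x = x - \<kappa> / x + O(1 / x\<^sup>2)\<close> with \<open>\<kappa> > 0\<close>. Hence
  an orbit starting at distance about \<open>sqrt n\<close> needs about \<open>n\<close> steps to come back, and pulling
  back a fundamental interval of \<open>T\<close> along a tail yields sets of measure about \<open>1 / sqrt n\<close>, which
  gives (c) and, for large intervals, the upper bound in (b). The bound passes to a subinterval \<open>E\<close>
  of a large interval \<open>K\<close> by splitting paths at a visit to \<open>K\<close> around half time, which improves the
  exponent of the decay step by step up to \<open>3 / 2\<close>. The return times truncated at \<open>n\<close> then have
  integral \<open>O(sqrt n)\<close>, which gives (a) with the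
  Borel-Cantelli lemma. For the lower bound in (b), let \<open>N\<close> be minimal such that a fixed proportion
  of neighbourhoods of infinity is reached from the interval under \<open>T ^^ N\<close>. Comparing Poisson
  kernels shows that \<open>N\<close> exists and that, up to smaller sets, the points reaching a pulled back
  set far out at time \<open>N\<close> have not returned before.\<close>

section \<open>First returns in measure-preserving systems\<close>

text \<open>Inside a compact interval no continuity, Markov structure or distortion bound for
  \<open>T\<close> is at hand. The two sources of information are one-dimensional analysis on the
  tails and inequalities between Poisson kernels; the latter become inequalities for
  \<open>T\<close> because it carries harmonic measures to harmonic measures. Pieces of orbits are
  not independent. To join them nevertheless, the upper bounds hold for all Borel targets
  \<open>S\<close> and are linear in the measure of \<open>S\<close>, so that the starting points of
  the next piece can serve as target. A path between visits to a small \<open>E\<close> may visit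
  the large interval arbitrarily often, and multiplying the bounds of its excursions loses the rate;
  hence the gradual improvement of the exponent, starting from 0. In the lower bound, early returns
  might use up the mass that travels to infinity. The minimality of \<open>N\<close> makes their
  share of smaller order. The mass may moreover leave through an end point of \<open>E\<close>
  alone. There the kernels do not localise inside \<open>E\<close>, and the boundary values of
  \<open>h ^^ N\<close> next to that point have to be constructed by reflection.\<close>

lemma sum_inverse_sqrt_le: "(\<Sum>n<M. 1 / sqrt (real n + 1)) \<le> 2 * sqrt (real M)"
proof (induction M)
  case (Suc M)
  have "1 / sqrt (real M + 1) \<le> 2 * sqrt (real M + 1) - 2 * sqrt (real M)"
  proof -
    have "2 * (sqrt (real M + 1) - sqrt (real M)) * (sqrt (real M + 1) + sqrt (real M)) = 2"
      by (simp add: algebra_simps flip: power2_eq_square)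
    moreover have "(sqrt (real M + 1) + sqrt (real M)) \<le> 2 * sqrt (real M + 1)" by simp
    ultimately have "2 \<le> 2 * (sqrt (real M + 1) - sqrt (real M)) * (2 * sqrt (real M + 1))"
      by (metis mult_left_mono real_sqrt_le_iff diff_ge_0_iff_ge le_add_same_cancel1 mult_nonneg_nonneg zero_le_numeral zero_le_one)
    then show ?thesis by (simp add: field_simps)
  qed
  with Suc show ?case by (simp add: add.commute)
qed simp

lemma sum_powr_le:
  assumes "0 < \<beta>" "\<beta> \<le> 1"
  shows "(\<Sum>t\<le>n. (real t + 1) powr (\<beta> - 1)) \<le> (real n + 1) powr \<beta> / \<beta>"
proof (induction n)
  case 0 with assms show ?case by simp
next
  case (Suc n)
  have "\<exists>z>real n + 1. z < real n + 2 \<and> (real n + 2) powr \<beta> - (real n + 1) powr \<beta> = ((real n + 2) - (real n + 1)) * (\<beta> * z powr (\<beta> - 1))"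
    by (rule MVT2) (auto intro!: derivative_eq_intros)
  then obtain z where z: "z > real n + 1" "z < real n + 2" "(real n + 2) powr \<beta> - (real n + 1) powr \<beta> = \<beta> * z powr (\<beta> - 1)"
    by auto
  have "(real n + 2) powr (\<beta> - 1) \<le> z powr (\<beta> - 1)"
    using z assms by (intro powr_mono2') auto
  then have "(real n + 2) powr (\<beta> - 1) \<le> ((real n + 2) powr \<beta> - (real n + 1) powr \<beta>) / \<beta>"
    using z assms by (simp add: field_simps)
  then have "(\<Sum>t\<le>n. (real t + 1) powr (\<beta> - 1)) + (real n + 2) powr (\<beta> - 1) \<le> (real n + 2) powr \<beta> / \<beta>"
    using Suc unfolding diff_divide_distrib by linarith
  moreover have "real (Suc n) + 1 = real n + 2" by simp
  ultimately show ?case unfolding sum.atMost_Suc by (simp only:)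
qed

lemma sum_powr_bounded:
  assumes "\<alpha> > 1"
  obtains c where "c > 0" "\<And>n. (\<Sum>t\<le>n. (real t + 1) powr (- \<alpha>)) \<le> c"
proof -
  have "summable (\<lambda>n. real n powr (-\<alpha>))" using assms by (simp add: summable_real_powr_iff)
  then have s: "summable (\<lambda>n. (real n + 1) powr (-\<alpha>))"
    using summable_iff_shift[of "\<lambda>n. real n powr (-\<alpha>)" 1] by (simp add: add.commute)
  show ?thesis
  proof
    show "1 + (\<Sum>n. (real n + 1) powr (-\<alpha>)) > 0"
      using suminf_nonneg[OF s] by simp
    show "(\<Sum>t\<le>n. (real t + 1) powr (-\<alpha>)) \<le> 1 + (\<Sum>n. (real n + 1) powr (-\<alpha>))" for n
      using sum_le_suminf[OF s, of "{..n}"] by simp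
  qed
qed

lemma sum_triangle:
  fixes f :: "nat \<Rightarrow> nat \<Rightarrow> 'a::comm_monoid_add"
  shows "(\<Sum>n<M. \<Sum>j\<le>n. f n j) = (\<Sum>j<M. \<Sum>n=j..<M. f n j)"
proof (induction M)
  case (Suc M)
  have "(\<Sum>j<Suc M. \<Sum>n=j..<Suc M. f n j) = (\<Sum>j<Suc M. (\<Sum>n=j..<M. f n j) + f M j)"
    by (intro sum.cong) (auto simp: sum.atLeastLessThan_Suc)
  also have "\<dots> = (\<Sum>j<M. \<Sum>n=j..<M. f n j) + (\<Sum>j\<le>M. f M j)"
    by (simp add: sum.distrib lessThan_Suc_atMost[symmetric] add.assoc)
  finally show ?case using Suc by simp
qed simp

section \<open>Maps preserving Lebesgue measure on the line\<close>

locale lebesgue_preserving =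
  fixes T :: "real \<Rightarrow> real"
  assumes T_measurable [measurable]: "T \<in> borel_measurable borel"
    and distr_T: "distr lborel borel T = lborel"
begin

lemma funpow_measurable [measurable]: "(T ^^ n) \<in> borel_measurable borel"
proof (induction n)
  case (Suc n)
  then have "(\<lambda>x. T ((T ^^ n) x)) \<in> borel_measurable borel" by measurable
  then show ?case by (simp add: comp_def)
qed simp

lemma sets_vimage_funpow [measurable]: "S \<in> sets borel \<Longrightarrow> (T ^^ n) -` S \<in> sets borel"
  using measurable_sets[OF funpow_measurable, of S n] by simp

lemma emeasure_vimage: "S \<in> sets borel \<Longrightarrow> emeasure lborel (T -` S) = emeasure lborel S"
  using arg_cong[OF distr_T, of "\<lambda>M. emeasure M S"] by (subst (asm) emeasure_distr) auto

lemma emeasure_vimage_funpow: "S \<in> sets borel \<Longrightarrow> emeasure lborel ((T ^^ n) -` S) = emeasure lborel S"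
proof (induction n)
  case (Suc n)
  have "(T ^^ Suc n) -` S = T -` ((T ^^ n) -` S)" by (auto simp: funpow_swap1)
  then show ?case using Suc emeasure_vimage[of "(T ^^ n) -` S"] by (simp add: sets_vimage_funpow del: funpow.simps)
qed simp

lemma measure_vimage_funpow: "S \<in> sets borel \<Longrightarrow> measure lborel ((T ^^ n) -` S) = measure lborel S"
  by (simp add: measure_def emeasure_vimage_funpow)

lemma measure_vimage: "S \<in> sets borel \<Longrightarrow> measure lborel (T -` S) = measure lborel S"
  by (simp add: measure_def emeasure_vimage)

lemma fmeasurable_vimage_funpow:
  "S \<in> fmeasurable lborel \<Longrightarrow> (T ^^ n) -` S \<in> fmeasurable lborel"
  by (auto simp: fmeasurable_def emeasure_vimage_funpow)

lemma fmeasurable_vimage: "S \<in> fmeasurable lborel \<Longrightarrow> T -` S \<in> fmeasurable lborel"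
  using fmeasurable_vimage_funpow[of S 1] by simp

lemma AE_funpow:
  assumes "AE x in lborel. P x"
  shows "AE x in lborel. P ((T ^^ n) x)"
proof -
  obtain N where N: "{x. \<not> P x} \<subseteq> N" "N \<in> sets borel" "emeasure lborel N = 0"
    using AE_E[OF assms] by auto
  then have "(T ^^ n) -` N \<in> null_sets lborel"
    by (auto intro!: null_setsI simp: emeasure_vimage_funpow sets_vimage_funpow)
  then show ?thesis by (rule AE_I') (use N in auto)
qed

end

text \<open>\<open>excursion\<close> and \<open>entrance\<close> bound densities: they hold for
  every Borel \<open>S\<close> in \<open>K\<close> with a factor linear in its measure, so
  \<open>S\<close> may be the set of starting points of a later piece of path. \<open>mixing\<close>
  is the link between \<open>K\<close> and \<open>E\<close>: every \<open>S\<close> in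
  \<open>K\<close> is hit from \<open>E\<close> at the fixed time \<open>i0\<close> in proportion to
  its size.\<close>

locale return_estimates = lebesgue_preserving +
  fixes K E :: "real set" and C \<delta> :: real and i0 :: nat
  assumes K_fmeasurable: "K \<in> fmeasurable lborel"
    and E_borel [measurable]: "E \<in> sets borel" and E_subset: "E \<subseteq> K"
    and C_pos: "C > 0" and \<delta>_pos: "\<delta> > 0"
    and excursion: "\<And>S m. S \<in> sets borel \<Longrightarrow> S \<subseteq> K \<Longrightarrow> m \<ge> 1 \<Longrightarrow>
        measure lborel {x\<in>K. (\<forall>l. 1 \<le> l \<and> l < m \<longrightarrow> (T ^^ l) x \<notin> K) \<and> (T ^^ m) x \<in> S}
          \<le> C / (real m * sqrt m) * measure lborel S"
    and entrance: "\<And>S m. S \<in> sets borel \<Longrightarrow> S \<subseteq> K \<Longrightarrow>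
        measure lborel {x. (\<forall>l<m. (T ^^ l) x \<notin> K) \<and> (T ^^ m) x \<in> S}
          \<le> C / sqrt (real m + 1) * measure lborel S"
    and mixing: "\<And>S. S \<in> sets borel \<Longrightarrow> S \<subseteq> K \<Longrightarrow>
        \<delta> * measure lborel S \<le> measure lborel (E \<inter> (T ^^ i0) -` S)"
begin

text \<open>Paths into \<open>S\<close> that avoid \<open>E\<close> at the times strictly between
  start and end. Both ends are exempt, so that a path can be cut at a visit to \<open>K\<close> or
  \<open>E\<close> into pieces of the same kind.\<close>

definition from_K :: "nat \<Rightarrow> real set \<Rightarrow> real set" where
  "from_K n S = {x\<in>K. (\<forall>l. 1 \<le> l \<and> l < n \<longrightarrow> (T ^^ l) x \<notin> E) \<and> (T ^^ n) x \<in> S}"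

definition from_E :: "nat \<Rightarrow> real set \<Rightarrow> real set" where
  "from_E n S = {x\<in>E. (\<forall>l. 1 \<le> l \<and> l < n \<longrightarrow> (T ^^ l) x \<notin> E) \<and> (T ^^ n) x \<in> S}"

definition from_all :: "nat \<Rightarrow> real set \<Rightarrow> real set" where
  "from_all n S = {x. (\<forall>l. 1 \<le> l \<and> l < n \<longrightarrow> (T ^^ l) x \<notin> E) \<and> (T ^^ n) x \<in> S}"

definition excursions :: "nat \<Rightarrow> real set \<Rightarrow> real set" where
  "excursions m S = {x\<in>K. (\<forall>l. 1 \<le> l \<and> l < m \<longrightarrow> (T ^^ l) x \<notin> K) \<and> (T ^^ m) x \<in> S}"

definition entrances :: "nat \<Rightarrow> real set \<Rightarrow> real set" where
  "entrances m S = {x. (\<forall>l<m. (T ^^ l) x \<notin> K) \<and> (T ^^ m) x \<in> S}"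

lemma K_borel [measurable]: "K \<in> sets borel"
  using K_fmeasurable by (simp add: fmeasurable_def)

lemma fmeasurable_subset_K: "S \<in> sets borel \<Longrightarrow> S \<subseteq> K \<Longrightarrow> S \<in> fmeasurable lborel"
  using fmeasurableI2[OF K_fmeasurable] by auto

lemma sets_from [measurable]:
  assumes [measurable]: "S \<in> sets borel"
  shows "from_K n S \<in> sets borel" "from_E n S \<in> sets borel" "from_all n S \<in> sets borel"
    "excursions n S \<in> sets borel" "entrances n S \<in> sets borel"
proof -
  have "{x \<in> space borel. x \<in> K \<and> (\<forall>l. 1 \<le> l \<and> l < n \<longrightarrow> (T ^^ l) x \<notin> E) \<and> (T ^^ n) x \<in> S} \<in> sets borel"
    by measurable
  then show "from_K n S \<in> sets borel" by (simp add: from_K_def)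
  have "{x \<in> space borel. x \<in> E \<and> (\<forall>l. 1 \<le> l \<and> l < n \<longrightarrow> (T ^^ l) x \<notin> E) \<and> (T ^^ n) x \<in> S} \<in> sets borel"
    by measurable
  then show "from_E n S \<in> sets borel" by (simp add: from_E_def)
  have "{x \<in> space borel. (\<forall>l. 1 \<le> l \<and> l < n \<longrightarrow> (T ^^ l) x \<notin> E) \<and> (T ^^ n) x \<in> S} \<in> sets borel"
    by measurable
  then show "from_all n S \<in> sets borel" by (simp add: from_all_def)
  have "{x \<in> space borel. x \<in> K \<and> (\<forall>l. 1 \<le> l \<and> l < n \<longrightarrow> (T ^^ l) x \<notin> K) \<and> (T ^^ n) x \<in> S} \<in> sets borel"
    by measurable
  then show "excursions n S \<in> sets borel" by (simp add: excursions_def)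
  have "{x \<in> space borel. (\<forall>l<n. (T ^^ l) x \<notin> K) \<and> (T ^^ n) x \<in> S} \<in> sets borel"
    by measurable
  then show "entrances n S \<in> sets borel" by (simp add: entrances_def)
qed

context
  fixes S :: "real set"
  assumes S [measurable]: "S \<in> sets borel" and SK: "S \<subseteq> K"
begin

lemma fmeasurable_from:
  "from_K n S \<in> fmeasurable lborel" "from_E n S \<in> fmeasurable lborel" "from_all n S \<in> fmeasurable lborel"
proof -
  have f: "(T ^^ n) -` S \<in> fmeasurable lborel"
    by (rule fmeasurable_vimage_funpow[OF fmeasurable_subset_K[OF S SK]])
  show "from_all n S \<in> fmeasurable lborel"
    by (rule fmeasurableI2[OF f]) (auto simp: from_all_def sets_from[unfolded from_all_def])
  show "from_K n S \<in> fmeasurable lborel"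
    by (rule fmeasurableI2[OF f]) (auto simp: from_K_def sets_from[unfolded from_K_def])
  show "from_E n S \<in> fmeasurable lborel"
    by (rule fmeasurableI2[OF f]) (auto simp: from_E_def sets_from[unfolded from_E_def])
qed

text \<open>Under \<open>T\<close> the condition at time 1 becomes a condition on the starting
  point, which removes exactly the paths that start in \<open>E\<close>. Since \<open>T\<close>
  preserves the measure, the measures of \<open>from_E\<close> are differences of consecutive values
  of \<open>from_all\<close> and telescope in \<open>sum_from_E\<close>.\<close>

lemma from_all_Suc:
  assumes "n \<ge> 1"
  shows "from_all (Suc n) S = T -` (from_all n S - from_E n S)"
proof -
  have 1: "(\<forall>l. 1 \<le> l \<and> l < Suc n \<longrightarrow> (T ^^ l) x \<notin> E) \<longleftrightarrow>
     T x \<notin> E \<and> (\<forall>l. 1 \<le> l \<and> l < n \<longrightarrow> (T ^^ l) (T x) \<notin> E)" (is "?L = ?R") for x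
  proof
    assume L: ?L
    have "(T ^^ 1) x \<notin> E" using L[rule_format, of 1] assms by simp
    moreover have "(T ^^ l) (T x) \<notin> E" if "1 \<le> l \<and> l < n" for l
      using L[rule_format, of "Suc l"] that by (simp add: funpow_swap1)
    ultimately show ?R by simp
  next
    assume R: ?R
    show ?L
    proof (intro allI impI)
      fix l assume l: "1 \<le> l \<and> l < Suc n"
      show "(T ^^ l) x \<notin> E"
      proof (cases "l = 1")
        case False
        with l have "1 \<le> l - 1 \<and> l - 1 < n" by auto
        then have "(T ^^ (l - 1)) (T x) \<notin> E" using R by blast
        moreover have "(T ^^ l) x = (T ^^ (l - 1)) (T x)"
          using l by (cases l) (auto simp: funpow_swap1)
        ultimately show ?thesis by simp
      qed (use R in simp)
    qed
  qed
  show ?thesis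
    unfolding from_all_def from_E_def
    by (auto simp: 1 funpow_swap1 simp del: One_nat_def)
qed

lemma measure_from_all_Suc:
  assumes "n \<ge> 1"
  shows "measure lborel (from_all (Suc n) S) = measure lborel (from_all n S) - measure lborel (from_E n S)"
proof -
  have "measure lborel (from_all (Suc n) S) = measure lborel (from_all n S - from_E n S)"
    unfolding from_all_Suc[OF assms] by (intro measure_vimage sets.Diff sets_from S)
  also have "\<dots> = measure lborel (from_all n S) - measure lborel (from_E n S)"
    by (rule measure_Diff)
      (use fmeasurable_from[of n] in \<open>auto simp: fmeasurable_def from_all_def from_E_def\<close>)
  finally show ?thesis .
qed

lemma from_all_0: "from_all 0 S = S" and from_K_0: "from_K 0 S = S"
  using SK by (auto simp: from_all_def from_K_def)

lemma from_all_1: "measure lborel (from_all (Suc 0) S) = measure lborel S"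
proof -
  have "from_all (Suc 0) S = T -` S" by (auto simp: from_all_def)
  then show ?thesis by (simp add: measure_vimage)
qed

lemma measure_from_all_antimono: "m \<le> n \<Longrightarrow> measure lborel (from_all n S) \<le> measure lborel (from_all m S)"
proof (induction n rule: dec_induct)
  case (step n)
  have "measure lborel (from_all (Suc n) S) \<le> measure lborel (from_all n S)"
    by (cases "n = 0") (auto simp: from_all_0 from_all_1 measure_from_all_Suc)
  with step show ?case by simp
qed simp

lemma measure_from_all_le: "measure lborel (from_all n S) \<le> measure lborel S"
  using measure_from_all_antimono[of 0 n] by (simp add: from_all_0)

lemma measure_from_K_le: "measure lborel (from_K n S) \<le> measure lborel S"
proof -
  have "measure lborel (from_K n S) \<le> measure lborel (from_all n S)"
    by (rule measure_mono_fmeasurable) (auto simp: fmeasurable_from sets_from, auto simp: from_K_def from_all_def)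
  then show ?thesis using measure_from_all_le[of n] by simp
qed

lemma sum_from_E:
  assumes "1 \<le> m" "m \<le> n"
  shows "(\<Sum>k=m..<n. measure lborel (from_E k S)) = measure lborel (from_all m S) - measure lborel (from_all n S)"
  using assms(2)
proof (induction n rule: dec_induct)
  case (step n)
  then show ?case using measure_from_all_Suc[of n] assms by simp
qed simp

text \<open>By \<open>mixing\<close> the set \<open>from_K n S\<close> is reached from
  \<open>E\<close> after \<open>i0\<close> steps. Such an orbit, cut at its last visit to
  \<open>E\<close> up to time \<open>i0\<close>, becomes a path that starts in \<open>E\<close> and
  takes \<open>n + l\<close> steps with \<open>l \<le> i0\<close>.\<close>

lemma mixing_from_K: "\<delta> * measure lborel (from_K n S) \<le> (\<Sum>l\<le>i0. measure lborel (from_E (n + l) S))"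
proof -
  have "E \<inter> (T ^^ i0) -` from_K n S \<subseteq> (\<Union>l\<in>{..i0}. (T ^^ (i0 - l)) -` from_E (n + l) S)"
  proof
    fix x assume x: "x \<in> E \<inter> (T ^^ i0) -` from_K n S"
    define J where "J = {j. j \<le> i0 \<and> (T ^^ j) x \<in> E}"
    have fJ: "finite J" "0 \<in> J" using x by (auto simp: J_def)
    define j where "j = Max J"
    have j: "j \<in> J" "\<And>k. k \<in> J \<Longrightarrow> k \<le> j" unfolding j_def using fJ by (auto intro!: Max_in Max_ge)
    define l where "l = i0 - j"
    have l: "l \<le> i0" "i0 - l = j" "i0 = l + j" using j by (auto simp: l_def J_def)
    have z: "(T ^^ k) ((T ^^ j) x) = (T ^^ (k + j)) x" for k by (simp add: funpow_add)
    have "(T ^^ j) x \<in> from_E (n + l) S"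
      unfolding from_E_def
    proof (intro CollectI conjI allI impI)
      show "(T ^^ j) x \<in> E" using j by (simp add: J_def)
      have "(T ^^ n) ((T ^^ i0) x) \<in> S" using x by (simp add: from_K_def)
      then show "(T ^^ (n + l)) ((T ^^ j) x) \<in> S"
        unfolding z l(3) by (simp add: funpow_add add.assoc)
      fix k assume k: "1 \<le> k \<and> k < n + l"
      show "(T ^^ k) ((T ^^ j) x) \<notin> E"
      proof (cases "k \<le> l")
        case True
        then have "k + j \<notin> J" using j(2)[of "k + j"] k by auto
        then show ?thesis using True l(3) unfolding z by (auto simp: J_def)
      next
        case False
        then have "1 \<le> k - l \<and> k - l < n" using k by auto
        then have "(T ^^ (k - l)) ((T ^^ i0) x) \<notin> E" using x unfolding from_K_def by blast
        moreover have "(T ^^ (k - l)) ((T ^^ i0) x) = (T ^^ (k + j)) x"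
        proof -
          have "k + j = (k - l) + i0" using False l(3) by simp
          then show ?thesis by (simp only: funpow_add comp_def)
        qed
        ultimately show ?thesis unfolding z by simp
      qed
    qed
    then show "x \<in> (\<Union>l\<in>{..i0}. (T ^^ (i0 - l)) -` from_E (n + l) S)"
      using l(1,2) by (intro UN_I[of l]) auto
  qed
  then have "measure lborel (E \<inter> (T ^^ i0) -` from_K n S)
      \<le> measure lborel (\<Union>l\<in>{..i0}. (T ^^ (i0 - l)) -` from_E (n + l) S)"
    by (rule measure_mono_fmeasurable)
      (auto intro!: fmeasurable.finite_UN fmeasurable_vimage_funpow fmeasurable_from sets.Int)
  also have "\<dots> \<le> (\<Sum>l\<le>i0. measure lborel ((T ^^ (i0 - l)) -` from_E (n + l) S))"
    by (rule measure_UNION_le) auto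
  also have "\<dots> = (\<Sum>l\<le>i0. measure lborel (from_E (n + l) S))"
    by (simp add: measure_vimage_funpow)
  finally show ?thesis using mixing[of "from_K n S"] by (auto simp: from_K_def sets_from[unfolded from_K_def])
qed

text \<open>Each of the \<open>i0 + 1\<close> shifted sums of \<open>from_E\<close> telescopes and
  is bounded by the measure of \<open>from_all a S\<close>.\<close>

lemma sum_from_K_tail:
  assumes "1 \<le> a" "a \<le> b"
  shows "(\<Sum>n=a..<b. measure lborel (from_K n S)) \<le> (real i0 + 1) / \<delta> * measure lborel (from_all a S)"
proof -
  have "\<delta> * (\<Sum>n=a..<b. measure lborel (from_K n S)) \<le> (\<Sum>n=a..<b. \<Sum>l\<le>i0. measure lborel (from_E (n + l) S))"
    unfolding sum_distrib_left by (intro sum_mono mixing_from_K)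
  also have "\<dots> = (\<Sum>l\<le>i0. \<Sum>n=a..<b. measure lborel (from_E (n + l) S))" by (rule sum.swap)
  also have "\<dots> = (\<Sum>l\<le>i0. \<Sum>n=a+l..<b+l. measure lborel (from_E n S))"
    by (simp add: sum.shift_bounds_nat_ivl)
  also have "\<dots> \<le> (\<Sum>l\<le>i0. measure lborel (from_all a S))"
  proof (rule sum_mono)
    fix l
    show "(\<Sum>n=a+l..<b+l. measure lborel (from_E n S)) \<le> measure lborel (from_all a S)"
      using assms measure_from_all_antimono[of a "a + l"] measure_nonneg[of lborel "from_all (b + l) S"]
        sum_from_E[of "a + l" "b + l"] by linarith
  qed
  also have "\<dots> = (real i0 + 1) * measure lborel (from_all a S)" by simp
  finally show ?thesis using \<delta>_pos by (simp add: field_simps)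
qed

lemma sum_from_K: "(\<Sum>n<b. measure lborel (from_K n S)) \<le> (1 + (real i0 + 1) / \<delta>) * measure lborel S"
proof (cases b)
  case (Suc b')
  have "(\<Sum>n<b. measure lborel (from_K n S)) = measure lborel S + (\<Sum>n=1..<b. measure lborel (from_K n S))"
    unfolding lessThan_atLeast0 Suc by (simp add: sum.atLeast_Suc_lessThan from_K_0)
  also have "\<dots> \<le> measure lborel S + (real i0 + 1) / \<delta> * measure lborel (from_all 1 S)"
    using sum_from_K_tail[of 1 b] Suc by simp
  finally show ?thesis by (simp add: from_all_1 algebra_simps)
qed (use \<delta>_pos in \<open>simp add: divide_nonneg_pos\<close>)

text \<open>Cut at the first visit to \<open>K\<close>; there is one, since the path ends in
  \<open>S \<subseteq> K\<close>. \<open>entrance\<close> bounds the part before it, and the rest is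
  a path counted by \<open>from_K\<close>.\<close>

lemma measure_from_all_le_sum:
  "measure lborel (from_all n S) \<le> (\<Sum>j\<le>n. C / sqrt (real (n - j) + 1) * measure lborel (from_K j S))"
proof -
  have "from_all n S \<subseteq> (\<Union>j\<in>{..n}. entrances (n - j) (from_K j S))"
  proof
    fix x assume x: "x \<in> from_all n S"
    define t where "t = (LEAST t. (T ^^ t) x \<in> K)"
    have n: "(T ^^ n) x \<in> K" using x SK by (auto simp: from_all_def)
    have t: "(T ^^ t) x \<in> K" "t \<le> n" unfolding t_def by (rule LeastI, rule n) (rule Least_le, rule n)
    have t': "(T ^^ l) x \<notin> K" if "l < t" for l using that not_less_Least unfolding t_def by blast
    have z: "(T ^^ k) ((T ^^ t) x) = (T ^^ (k + t)) x" for k by (simp add: funpow_add)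
    have "(T ^^ t) x \<in> from_K (n - t) S"
      using x t unfolding from_K_def from_all_def by (auto simp: z)
    then have "x \<in> entrances (n - (n - t)) (from_K (n - t) S)"
      using t t' by (auto simp: entrances_def)
    then show "x \<in> (\<Union>j\<in>{..n}. entrances (n - j) (from_K j S))" by (intro UN_I[of "n - t"]) auto
  qed
  moreover have "(\<Union>j\<in>{..n}. entrances (n - j) (from_K j S)) \<in> fmeasurable lborel"
  proof (rule fmeasurable.finite_UN)
    fix j assume "j \<in> {..n}"
    show "entrances (n - j) (from_K j S) \<in> fmeasurable lborel"
      by (rule fmeasurableI2[OF fmeasurable_vimage_funpow[OF fmeasurable_from(1), of "n - j" j]])
        (auto simp: entrances_def sets_from[unfolded entrances_def])
  qed simp
  ultimately have "measure lborel (from_all n S) \<le> measure lborel (\<Union>j\<in>{..n}. entrances (n - j) (from_K j S))"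
    by (intro measure_mono_fmeasurable) auto
  also have "\<dots> \<le> (\<Sum>j\<le>n. measure lborel (entrances (n - j) (from_K j S)))"
    by (rule measure_UNION_le) auto
  also have "\<dots> \<le> (\<Sum>j\<le>n. C / sqrt (real (n - j) + 1) * measure lborel (from_K j S))"
    unfolding entrances_def by (intro sum_mono entrance) (auto simp: from_K_def sets_from[unfolded from_K_def])
  finally show ?thesis .
qed

text \<open>The measures decrease in time, so \<open>M\<close> times the one at time
  \<open>M\<close> is at most the sum over \<open>n < M\<close>. Summing the convolution of the
  previous lemma separates its factors: the entrance terms give \<open>2 * sqrt M\<close>, and the
  sum of \<open>from_K\<close> is bounded.\<close>

lemma measure_from_all_tail:
  assumes "M \<ge> 1"
  shows "measure lborel (from_all M S) \<le> 2 * C * (1 + (real i0 + 1) / \<delta>) / sqrt M * measure lborel S"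
proof -
  define V where "V j = measure lborel (from_K j S)" for j
  have V0: "V j \<ge> 0" for j by (simp add: V_def)
  have "M * measure lborel (from_all M S) = (\<Sum>n<M. measure lborel (from_all M S))" by simp
  also have "\<dots> \<le> (\<Sum>n<M. measure lborel (from_all n S))"
    by (intro sum_mono measure_from_all_antimono) auto
  also have "\<dots> \<le> (\<Sum>n<M. \<Sum>j\<le>n. C / sqrt (real (n - j) + 1) * V j)"
    unfolding V_def by (intro sum_mono measure_from_all_le_sum)
  also have "\<dots> = (\<Sum>j<M. \<Sum>n=j..<M. C / sqrt (real (n - j) + 1) * V j)"
    by (rule sum_triangle)
  also have "\<dots> \<le> (\<Sum>j<M. 2 * C * sqrt M * V j)"
  proof (rule sum_mono)
    fix j assume j: "j \<in> {..<M}"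
    have "(\<Sum>n=j..<M. C / sqrt (real (n - j) + 1) * V j) = C * V j * (\<Sum>n=0+j..<(M - j) + j. 1 / sqrt (real (n - j) + 1))"
      using j by (simp add: sum_distrib_left mult_ac)
    also have "\<dots> = C * V j * (\<Sum>n<M - j. 1 / sqrt (real n + 1))"
      unfolding sum.shift_bounds_nat_ivl by (simp add: lessThan_atLeast0)
    also have "\<dots> \<le> C * V j * (2 * sqrt M)"
      using C_pos V0[of j] order_trans[OF sum_inverse_sqrt_le[of "M - j"], of "2 * sqrt M"] by (intro mult_left_mono) auto
    finally show "(\<Sum>n=j..<M. C / sqrt (real (n - j) + 1) * V j) \<le> 2 * C * sqrt M * V j" by (simp add: mult_ac)
  qed
  also have "\<dots> = 2 * C * sqrt M * (\<Sum>j<M. V j)" by (simp add: sum_distrib_left)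
  also have "\<dots> \<le> 2 * C * sqrt M * ((1 + (real i0 + 1) / \<delta>) * measure lborel S)"
    using C_pos unfolding V_def by (intro mult_left_mono sum_from_K) auto
  finally have *: "M * measure lborel (from_all M S) \<le> 2 * C * sqrt M * ((1 + (real i0 + 1) / \<delta>) * measure lborel S)" .
  have M: "real M = sqrt M * sqrt M" by simp
  have "sqrt M * measure lborel (from_all M S) \<le> 2 * C * ((1 + (real i0 + 1) / \<delta>) * measure lborel S)"
  proof (rule mult_left_le_imp_le)
    show "sqrt M * (sqrt M * measure lborel (from_all M S)) \<le> sqrt M * (2 * C * ((1 + (real i0 + 1) / \<delta>) * measure lborel S))"
      using * unfolding mult.assoc[symmetric] M[symmetric] by (simp add: mult_ac)
    show "sqrt M > 0" using assms by simp
  qed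
  then show ?thesis using assms by (simp add: field_simps)
qed

end

end

section \<open>Improving the decay exponent\<close>

lemma powr_minus_three_halves:
  assumes "x > 0"
  shows "(x::real) powr (- (3 / 2)) = 1 / (x * sqrt x)"
proof -
  have "x powr (3 / 2) = x powr (1 + 1 / 2)" by simp
  also have "\<dots> = x * sqrt x" using assms unfolding powr_add by (simp only: powr_half_sqrt powr_one less_imp_le)
  finally show ?thesis by (simp add: powr_minus_divide)
qed

context return_estimates
begin

definition decay_bound :: "(nat \<Rightarrow> real) \<Rightarrow> bool" where
  "decay_bound f \<longleftrightarrow> (\<forall>n S. S \<in> sets borel \<longrightarrow> S \<subseteq> K \<longrightarrow> measure lborel (from_K n S) \<le> f n * measure lborel S)"

lemma from_K_subset: "from_K n S \<subseteq> K"
  by (auto simp: from_K_def)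

lemma excursions_subset: "excursions n S \<subseteq> K"
  by (auto simp: excursions_def)

text \<open>In a pair, \<open>t\<close> is the last time up to \<open>n / 2\<close> with a visit to
  \<open>K\<close>, and \<open>n - j\<close> is the time of the next visit; the excursion between
  them lasts \<open>n - t - j \<ge> 1\<close> steps.\<close>

definition splits :: "nat \<Rightarrow> (nat \<times> nat) set" where
  "splits n = {(t, j). 2 * t \<le> n \<and> 2 * j < n}"

lemma finite_splits: "finite (splits n)"
  by (rule finite_subset[of _ "{..n} \<times> {..n}"]) (auto simp: splits_def)

text \<open>The excursion from \<open>K\<close> across the middle of the time interval cuts the path
  into three pieces. The known decay \<open>f\<close> applies to the first, the excursion bound to
  the second. The third keeps its measure, because its sum over \<open>j\<close> is controlled
  better than its single values.\<close>

lemma from_K_midpoint: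
  assumes f: "decay_bound f" "\<And>n. f n \<ge> 0" and n: "n \<ge> 1" and S: "S \<in> sets borel" "S \<subseteq> K"
  shows "measure lborel (from_K n S) \<le>
    (\<Sum>(t, j)\<in>splits n. f t * (C * real (n - t - j) powr (- (3 / 2))) * measure lborel (from_K j S))"
proof -
  have "from_K n S \<subseteq> (\<Union>(t, j)\<in>splits n. from_K t (excursions (n - t - j) (from_K j S)))"
  proof
    fix x assume x: "x \<in> from_K n S"
    define I where "I = {t. 2 * t \<le> n \<and> (T ^^ t) x \<in> K}"
    have I: "finite I" "0 \<in> I" using x by (auto simp: I_def from_K_def intro: finite_subset[of _ "{..n}"])
    define t where "t = Max I"
    have t: "t \<in> I" "\<And>k. k \<in> I \<Longrightarrow> k \<le> t" unfolding t_def using I by (auto intro!: Max_in Max_ge)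
    define u where "u = (LEAST u. t < u \<and> (T ^^ u) x \<in> K)"
    have n': "t < n \<and> (T ^^ n) x \<in> K" using t(1) x S n by (auto simp: from_K_def I_def)
    have u: "t < u \<and> (T ^^ u) x \<in> K" "u \<le> n" unfolding u_def by (rule LeastI, rule n') (rule Least_le, rule n')
    have u': "(T ^^ l) x \<notin> K" if "t < l" "l < u" for l
      using that not_less_Least[of l "\<lambda>u. t < u \<and> (T ^^ u) x \<in> K"] unfolding u_def by blast
    have "u \<notin> I" using t(2)[of u] u by auto
    then have nu: "2 * (n - u) < n" using u by (auto simp: I_def)
    have zt: "(T ^^ k) ((T ^^ t) x) = (T ^^ (k + t)) x" for k by (simp add: funpow_add)
    have zu: "(T ^^ k) ((T ^^ u) x) = (T ^^ (k + u)) x" for k by (simp add: funpow_add)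
    have U: "(T ^^ u) x \<in> from_K (n - u) S"
      using x u unfolding from_K_def by (auto simp: zu)
    have "(T ^^ t) x \<in> excursions (u - t) (from_K (n - u) S)"
      unfolding excursions_def
    proof (intro CollectI conjI allI impI)
      show "(T ^^ t) x \<in> K" using t by (simp add: I_def)
      show "(T ^^ (u - t)) ((T ^^ t) x) \<in> from_K (n - u) S" using U u unfolding zt by simp
      show "(T ^^ l) ((T ^^ t) x) \<notin> K" if "1 \<le> l \<and> l < u - t" for l
        unfolding zt by (rule u') (use that in auto)
    qed
    then have "x \<in> from_K t (excursions (u - t) (from_K (n - u) S))"
      using x t(1) n' unfolding from_K_def by (auto simp: I_def)
    moreover have "u - t = n - t - (n - u)" using u by simp
    moreover have "(t, n - u) \<in> splits n" using t(1) nu by (auto simp: splits_def I_def)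
    ultimately show "x \<in> (\<Union>(t, j)\<in>splits n. from_K t (excursions (n - t - j) (from_K j S)))"
      by (intro UN_I[of "(t, n - u)"]) auto
  qed
  moreover have "(\<Union>(t, j)\<in>splits n. from_K t (excursions (n - t - j) (from_K j S))) \<in> fmeasurable lborel"
    by (intro fmeasurable.finite_UN finite_splits) (auto intro!: fmeasurable_from sets_from excursions_subset S)
  ultimately have "measure lborel (from_K n S)
      \<le> measure lborel (\<Union>(t, j)\<in>splits n. from_K t (excursions (n - t - j) (from_K j S)))"
    by (intro measure_mono_fmeasurable) (auto intro: sets_from S)
  also have "\<dots> \<le> (\<Sum>p\<in>splits n. measure lborel (case p of (t, j) \<Rightarrow> from_K t (excursions (n - t - j) (from_K j S))))"
    by (rule measure_UNION_le[OF finite_splits]) (auto intro: sets_from S)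
  also have "\<dots> \<le> (\<Sum>(t, j)\<in>splits n. f t * (C * real (n - t - j) powr (- (3 / 2))) * measure lborel (from_K j S))"
  proof (rule sum_mono)
    fix p assume p: "p \<in> splits n"
    obtain t j where tj: "p = (t, j)" by fastforce
    define m where "m = n - t - j"
    have m: "m \<ge> 1" using p by (auto simp: tj m_def splits_def)
    have "measure lborel (from_K t (excursions m (from_K j S))) \<le> f t * measure lborel (excursions m (from_K j S))"
      using f(1) S by (auto simp: decay_bound_def sets_from excursions_subset)
    also have "\<dots> \<le> f t * (C / (real m * sqrt m) * measure lborel (from_K j S))"
      unfolding excursions_def
      by (intro mult_left_mono excursion f(2) m sets_from from_K_subset S)
    also have "C / (real m * sqrt m) = C * real m powr (- (3 / 2))"
      using m by (subst powr_minus_three_halves) auto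
    finally show "measure lborel (case p of (t, j) \<Rightarrow> from_K t (excursions (n - t - j) (from_K j S)))
      \<le> (case p of (t, j) \<Rightarrow> f t * (C * real (n - t - j) powr (- (3 / 2))) * measure lborel (from_K j S))"
      by (simp add: tj m_def mult.assoc)
  qed
  finally show ?thesis .
qed

text \<open>\<open>\<alpha>\<close> is the known exponent, \<open>\<beta>\<close> the growth
  exponent of its partial sums. If the middle excursion lasts at least \<open>n / 4\<close>, it
  contributes the exponent \<open>3 / 2\<close>, and the sum over the first piece costs
  \<open>\<beta>\<close>. Otherwise both outer pieces are longer than \<open>n / 4\<close>: the
  first decays with \<open>\<alpha>\<close>, and the tail sum over the last one gains
  \<open>1 / 2\<close>.\<close>

lemma decay_bound_step:
  assumes bd: "decay_bound (\<lambda>n. A * (real n + 1) powr (- \<alpha>))" and A: "A \<ge> 0" and \<alpha>: "\<alpha> \<ge> 0"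
    and sm: "\<And>n. (\<Sum>t\<le>n. (real t + 1) powr (- \<alpha>)) \<le> \<Sigma> * (real n + 1) powr \<beta>"
    and \<gamma>: "\<gamma> \<le> 3 / 2 - \<beta>" "\<gamma> \<le> \<alpha> + 1 / 2"
  obtains A' where "A' \<ge> 0" "decay_bound (\<lambda>n. A' * (real n + 1) powr (- \<gamma>))"
proof -
  define c where "c = 1 + (real i0 + 1) / \<delta>"
  define e where "e = (real i0 + 1) / \<delta>"
  have ce: "c \<ge> 0" "e \<ge> 0" using \<delta>_pos by (auto simp: c_def e_def)
  obtain R where R: "R > 0" "\<And>n. (\<Sum>t\<le>n. (real t + 1) powr (- (3 / 2))) \<le> R"
    using sum_powr_bounded[of "3/2"] by auto
  have \<Sigma>: "\<Sigma> \<ge> 0" using sm[of 0] by simp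
  define A1 where "A1 = C * 8 powr (3 / 2) * A * \<Sigma> * c"
  define A2 where "A2 = A * 8 powr \<alpha> * C * R * (e * (2 * C * c * sqrt 8))"
  have A12: "A1 \<ge> 0" "A2 \<ge> 0" using A \<Sigma> ce C_pos R by (auto simp: A1_def A2_def)
  let ?f = "\<lambda>t. A * (real t + 1) powr (- \<alpha>)"
  let ?r = "\<lambda>m. C * real m powr (- (3 / 2))"
  show ?thesis
  proof
    show "1 + A1 + A2 \<ge> 0" using A12 by simp
    show "decay_bound (\<lambda>n. (1 + A1 + A2) * (real n + 1) powr (- \<gamma>))"
      unfolding decay_bound_def
    proof (intro allI impI)
      fix n :: nat and S :: "real set"
      assume S: "S \<in> sets borel" "S \<subseteq> K"
      define V where "V j = measure lborel (from_K j S)" for j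
      have V0: "V j \<ge> 0" for j by (simp add: V_def)
      show "measure lborel (from_K n S) \<le> (1 + A1 + A2) * (real n + 1) powr (- \<gamma>) * measure lborel S"
      proof (cases "n = 0")
        case True
        have "measure lborel (from_K n S) \<le> 1 * measure lborel S"
          using measure_from_K_le[OF S] by simp
        also have "\<dots> \<le> (1 + A1 + A2) * measure lborel S"
          using A12 by (intro mult_right_mono) auto
        finally show ?thesis using True by simp
      next
        case False
        \<comment> \<open>Comparing with \<open>(n + 1) / 8\<close> instead of \<open>n / 4\<close>
          absorbs the shift by one, since \<open>n \<ge> 1\<close>.\<close>
        define N where "N = real n + 1"
        have N: "N > 0" "N \<ge> 1" by (auto simp: N_def)
        define P1 where "P1 = {(t, j)\<in>splits n. n \<le> 4 * (n - t - j)}"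
        define P2 where "P2 = {(t, j)\<in>splits n. 4 * (n - t - j) < n}"
        have P: "splits n = P1 \<union> P2" "P1 \<inter> P2 = {}" "finite P1" "finite P2"
          using finite_splits[of n] by (auto simp: P1_def P2_def elim!: rev_finite_subset)
        have s1: "(\<Sum>(t, j)\<in>P1. ?f t * ?r (n - t - j) * V j) \<le> A1 * N powr (\<beta> - 3 / 2) * measure lborel S"
        proof -
          have "(\<Sum>(t, j)\<in>P1. ?f t * ?r (n - t - j) * V j) \<le> (\<Sum>(t, j)\<in>P1. ?f t * (C * (N / 8) powr (- (3 / 2))) * V j)"
          proof (intro sum_mono, clarify)
            fix t j assume "(t, j) \<in> P1"
            then have "N / 8 \<le> real (n - t - j)" using False by (auto simp: P1_def N_def)
            then show "?f t * ?r (n - t - j) * V j \<le> ?f t * (C * (N / 8) powr (- (3 / 2))) * V j"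
              using A V0 C_pos N by (intro mult_left_mono mult_right_mono powr_mono2') auto
          qed
          also have "\<dots> \<le> (\<Sum>(t, j)\<in>{..n} \<times> {..<n}. ?f t * (C * (N / 8) powr (- (3 / 2))) * V j)"
            by (rule sum_mono2) (use V0 A C_pos in \<open>auto simp: P1_def splits_def\<close>)
          also have "\<dots> = (\<Sum>(t, j)\<in>{..n} \<times> {..<n}. (C * (N / 8) powr (- (3 / 2)) * (A * (real t + 1) powr (- \<alpha>))) * V j)"
            by (simp add: mult_ac)
          also have "\<dots> = (\<Sum>t\<le>n. C * (N / 8) powr (- (3 / 2)) * (A * (real t + 1) powr (- \<alpha>))) * (\<Sum>j<n. V j)"
            by (simp only: sum.cartesian_product[symmetric] sum_product)
          also have "\<dots> = C * (N / 8) powr (- (3 / 2)) * (A * (\<Sum>t\<le>n. (real t + 1) powr (- \<alpha>))) * (\<Sum>j<n. V j)"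
            by (simp add: sum_distrib_left)
          also have "\<dots> \<le> C * (N / 8) powr (- (3 / 2)) * (A * (\<Sigma> * N powr \<beta>)) * (c * measure lborel S)"
            using sum_from_K[OF S, of n] sm[of n] C_pos A V0 \<Sigma>
            by (intro mult_mono mult_left_mono) (auto simp: V_def c_def N_def intro!: sum_nonneg)
          also have "\<dots> = A1 * N powr (\<beta> - 3 / 2) * measure lborel S"
          proof -
            have "(N / 8) powr (- (3 / 2)) = 8 powr (3 / 2) * N powr (- (3 / 2))"
              using N by (simp add: powr_divide powr_minus field_simps)
            moreover have "N powr (\<beta> - 3 / 2) = N powr \<beta> * N powr (- (3 / 2))"
              by (simp flip: powr_add)
            ultimately show ?thesis by (simp add: A1_def mult_ac)
          qed
          finally show ?thesis .
        qed
        \<comment> \<open>Pairs in \<open>P2\<close> satisfy \<open>4 * j > n\<close>, that is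
          \<open>j \<ge> a\<close>, so only a tail of the sum over \<open>j\<close> occurs.\<close>
        define a where "a = n div 4 + 1"
        have a: "a \<ge> 1" "N / 8 \<le> real a" by (auto simp: a_def N_def)
        have an: "(\<Sum>j=a..<n. V j) \<le> e * (2 * C * c * sqrt 8 * N powr (- 1 / 2) * measure lborel S)"
        proof (cases "a \<le> n")
          case True
          have "(\<Sum>j=a..<n. V j) \<le> e * measure lborel (from_all a S)"
            using sum_from_K_tail[OF S a(1) True] by (simp add: V_def e_def)
          also have "\<dots> \<le> e * (2 * C * c / sqrt a * measure lborel S)"
            using measure_from_all_tail[OF S a(1)] ce by (intro mult_left_mono) (auto simp: c_def)
          also have "1 / sqrt a \<le> 1 / sqrt (N / 8)"
            using a N by (intro divide_left_mono) auto
          then have "2 * C * c / sqrt a \<le> 2 * C * c * sqrt 8 * N powr (- 1 / 2)"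
            using C_pos ce N mult_left_mono[of "1 / sqrt a" "1 / sqrt (N / 8)" "2 * C * c"]
            by (simp add: powr_minus powr_half_sqrt real_sqrt_divide field_simps)
          then have "e * (2 * C * c / sqrt a * measure lborel S) \<le> e * (2 * C * c * sqrt 8 * N powr (- 1 / 2) * measure lborel S)"
            using ce by (intro mult_left_mono mult_right_mono) auto
          finally show ?thesis .
        qed (use ce C_pos in auto)
        have s2: "(\<Sum>(t, j)\<in>P2. ?f t * ?r (n - t - j) * V j) \<le> A2 * N powr (- \<alpha> - 1 / 2) * measure lborel S"
        proof -
          have "(\<Sum>(t, j)\<in>P2. ?f t * ?r (n - t - j) * V j) \<le> (\<Sum>(t, j)\<in>P2. A * (N / 8) powr (- \<alpha>) * ?r (n - t - j) * V j)"
          proof (intro sum_mono, clarify)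
            fix t j assume "(t, j) \<in> P2"
            then have "N / 8 \<le> real t + 1" by (auto simp: P2_def N_def splits_def)
            then show "?f t * ?r (n - t - j) * V j \<le> A * (N / 8) powr (- \<alpha>) * ?r (n - t - j) * V j"
              using A V0 C_pos N \<alpha> by (intro mult_left_mono mult_right_mono powr_mono2') auto
          qed
          also have "\<dots> = A * (N / 8) powr (- \<alpha>) * C * (\<Sum>(t, j)\<in>P2. real (n - t - j) powr (- (3 / 2)) * V j)"
            by (simp add: sum_distrib_left case_prod_unfold mult_ac)
          \<comment> \<open>For fixed \<open>j\<close> the time \<open>t\<close> is replaced by the
            length of the excursion minus one, over which the weights are summable.\<close>
          also have "(\<Sum>(t, j)\<in>P2. real (n - t - j) powr (- (3 / 2)) * V j)
              = (\<Sum>(m, j)\<in>(\<lambda>(t, j). (n - t - j - 1, j)) ` P2. (real m + 1) powr (- (3 / 2)) * V j)"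
          proof (subst sum.reindex)
            show "inj_on (\<lambda>(t, j). (n - t - j - 1, j)) P2"
              by (auto simp: inj_on_def P2_def splits_def)
            have "real (n - t - j) = real (n - t - j - 1) + 1" if "(t, j) \<in> P2" for t j
              using that by (auto simp: P2_def splits_def)
            then show "(\<Sum>(t, j)\<in>P2. real (n - t - j) powr (- (3 / 2)) * V j) =
              sum ((\<lambda>(m, j). (real m + 1) powr (- (3 / 2)) * V j) \<circ> (\<lambda>(t, j). (n - t - j - 1, j))) P2"
              by (intro sum.cong) auto
          qed
          also have "\<dots> \<le> (\<Sum>(m, j)\<in>{..n} \<times> {a..<n}. (real m + 1) powr (- (3 / 2)) * V j)"
          proof (rule sum_mono2)
            show "(\<lambda>(t, j). (n - t - j - 1, j)) ` P2 \<subseteq> {..n} \<times> {a..<n}"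
              by (auto simp: P2_def splits_def a_def)
          qed (use V0 in auto)
          also have "\<dots> = (\<Sum>m\<le>n. (real m + 1) powr (- (3 / 2))) * (\<Sum>j=a..<n. V j)"
            by (simp add: sum.cartesian_product[symmetric] sum_product)
          also have "\<dots> \<le> R * (e * (2 * C * c * sqrt 8 * N powr (- 1 / 2) * measure lborel S))"
            using R an V0 by (intro mult_mono) (auto intro!: sum_nonneg simp: less_imp_le)
          finally have "(\<Sum>(t, j)\<in>P2. ?f t * ?r (n - t - j) * V j) \<le>
             A * (N / 8) powr (- \<alpha>) * C * (R * (e * (2 * C * c * sqrt 8 * N powr (- 1 / 2) * measure lborel S)))"
            using A C_pos by (simp add: mult_left_mono)
          also have "\<dots> = A2 * N powr (- \<alpha> - 1 / 2) * measure lborel S"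
          proof -
            have "(N / 8) powr (- \<alpha>) = 8 powr \<alpha> * N powr (- \<alpha>)"
              using N by (simp add: powr_divide powr_minus field_simps)
            moreover have "N powr (- \<alpha> - 1 / 2) = N powr (- \<alpha>) * N powr (- 1 / 2)"
              by (simp flip: powr_add)
            ultimately show ?thesis by (simp add: A2_def mult_ac)
          qed
          finally show ?thesis .
        qed
        have "measure lborel (from_K n S) \<le> (\<Sum>(t, j)\<in>splits n. ?f t * ?r (n - t - j) * V j)"
          unfolding V_def by (rule from_K_midpoint[OF bd _ _ S]) (use A False in auto)
        also have "\<dots> = (\<Sum>(t, j)\<in>P1. ?f t * ?r (n - t - j) * V j) + (\<Sum>(t, j)\<in>P2. ?f t * ?r (n - t - j) * V j)"
          unfolding P(1) by (rule sum.union_disjoint) (use P in auto)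
        also have "\<dots> \<le> A1 * N powr (\<beta> - 3 / 2) * measure lborel S + A2 * N powr (- \<alpha> - 1 / 2) * measure lborel S"
          using s1 s2 by simp
        also have "\<dots> \<le> A1 * N powr (- \<gamma>) * measure lborel S + A2 * N powr (- \<gamma>) * measure lborel S"
          using \<gamma> A12 N by (intro add_mono mult_left_mono mult_right_mono powr_mono) auto
        also have "\<dots> \<le> (1 + A1 + A2) * N powr (- \<gamma>) * measure lborel S"
          by (simp add: algebra_simps)
        finally show ?thesis by (simp add: N_def)
      qed
    qed
  qed
qed

text \<open>The exponents are 0, 1/2, 1, 5/4, 3/2. At exponent 1 the partial sums are logarithmic;
  bounding them by a multiple of \<open>(n + 1) powr (1 / 4)\<close> costs only the detour through
  5/4. The value 3/2 is the exponent of the excursions themselves and is a fixed point of the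
  improvement.\<close>

lemma decay_bound_three_halves:
  obtains A where "A \<ge> 0" "decay_bound (\<lambda>n. A * (real n + 1) powr (- (3 / 2)))"
proof -
  have 0: "decay_bound (\<lambda>n. 1 * (real n + 1) powr (- 0))"
    by (simp add: decay_bound_def measure_from_K_le)
  obtain A1 where A1: "A1 \<ge> 0" "decay_bound (\<lambda>n. A1 * (real n + 1) powr (- (1 / 2)))"
    by (rule decay_bound_step[OF 0, of 1 1 "1/2"]) (use sum_powr_le[of 1] in auto)
  have s': "(\<Sum>t\<le>n. (real t + 1) powr (- (1 / 2))) \<le> 2 * (real n + 1) powr (1/2)" for n
    using sum_powr_le[of "1/2" n] by simp
  obtain A2 where A2: "A2 \<ge> 0" "decay_bound (\<lambda>n. A2 * (real n + 1) powr (- 1))"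
    by (rule decay_bound_step[OF A1(2,1) _ s', of 1]) auto
  have s: "(\<Sum>t\<le>n. (real t + 1) powr (- 1)) \<le> 4 * (real n + 1) powr (1/4)" for n
  proof -
    have "(\<Sum>t\<le>n. (real t + 1) powr (- 1)) \<le> (\<Sum>t\<le>n. (real t + 1) powr (1/4 - 1))"
      by (intro sum_mono powr_mono) auto
    then show ?thesis using sum_powr_le[of "1/4" n] by simp
  qed
  obtain A3 where A3: "A3 \<ge> 0" "decay_bound (\<lambda>n. A3 * (real n + 1) powr (- (5/4)))"
    by (rule decay_bound_step[OF A2(2,1) _ s, of "5/4"]) auto
  obtain c where c: "c > 0" "\<And>n. (\<Sum>t\<le>n. (real t + 1) powr (- (5/4))) \<le> c"
    using sum_powr_bounded[of "5/4"] by auto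
  show ?thesis
    by (rule decay_bound_step[OF A3(2,1), of c 0 "3/2"]) (use c that in auto)
qed

lemma first_return_bound:
  obtains A where "A > 0"
    "\<And>n. n \<ge> 1 \<Longrightarrow> measure lborel (from_E n E) \<le> A / (real n * sqrt n)"
proof -
  obtain A where A: "A \<ge> 0" "decay_bound (\<lambda>n. A * (real n + 1) powr (- (3 / 2)))"
    by (rule decay_bound_three_halves)
  show ?thesis
  proof
    show "A * measure lborel E + 1 > 0" using A by (simp add: add_nonneg_pos)
    fix n :: nat assume n: "n \<ge> 1"
    have "measure lborel (from_E n E) \<le> measure lborel (from_K n E)"
      using E_subset by (intro measure_mono_fmeasurable fmeasurable_from sets_from) (auto simp: from_E_def from_K_def)
    also have "\<dots> \<le> A * (real n + 1) powr (- (3 / 2)) * measure lborel E"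
      using A(2) E_subset by (auto simp: decay_bound_def)
    also have "\<dots> \<le> A * real n powr (- (3 / 2)) * measure lborel E"
      using A n by (intro mult_left_mono mult_right_mono powr_mono2') auto
    also have "real n powr (- (3 / 2)) = 1 / (real n * sqrt n)"
      using n by (intro powr_minus_three_halves) simp
    finally show "measure lborel (from_E n E) \<le> (A * measure lborel E + 1) / (real n * sqrt n)"
      using n by (simp add: field_simps)
  qed
qed

end

section \<open>Visits to an interval\<close>

lemma sum_min_le_sqrt:
  fixes w :: "nat \<Rightarrow> real"
  assumes "\<And>m. 0 \<le> w m" "\<And>m. m \<ge> 1 \<Longrightarrow> w m \<le> c / sqrt m" "w 0 \<le> c" "c \<ge> 0"
  shows "(\<Sum>m<n. w m) \<le> 3 * c * sqrt n"
proof (cases n)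
  case (Suc n')
  have "(\<Sum>m<n. w m) = w 0 + (\<Sum>m<n'. w (Suc m))" unfolding Suc by (rule sum.lessThan_Suc_shift)
  also have "\<dots> \<le> c + (\<Sum>m<n'. c * (1 / sqrt (real m + 1)))"
    using assms(2)[of "Suc _"] by (intro add_mono assms sum_mono) (auto simp: add.commute)
  also have "\<dots> = c + c * (\<Sum>m<n'. 1 / sqrt (real m + 1))" by (simp add: sum_distrib_left)
  also have "\<dots> \<le> c * sqrt n + c * (2 * sqrt n)"
  proof (intro add_mono mult_left_mono)
    show "(\<Sum>m<n'. 1 / sqrt (real m + 1)) \<le> 2 * sqrt n"
      using sum_inverse_sqrt_le[of n'] by (rule order_trans) (simp add: Suc)
    show "c \<le> c * sqrt n" using assms(4) Suc by (intro mult_le_cancel_left1[THEN iffD2]) auto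
  qed (use assms in auto)
  finally show ?thesis by (simp add: algebra_simps)
qed simp

section \<open>Successive returns and the number of visits\<close>

context lebesgue_preserving
begin

definition first_returns :: "real set \<Rightarrow> nat \<Rightarrow> real set \<Rightarrow> real set" where
  "first_returns E m S = {x\<in>E. (\<forall>l. 1 \<le> l \<and> l < m \<longrightarrow> (T ^^ l) x \<notin> E) \<and> (T ^^ m) x \<in> S}"

definition non_return :: "real set \<Rightarrow> nat \<Rightarrow> real set" where
  "non_return E n = {x\<in>E. \<forall>l. 1 \<le> l \<and> l \<le> n \<longrightarrow> (T ^^ l) x \<notin> E}"

text \<open>The visit at time 0 counts. For \<open>S \<subseteq> E\<close> the time \<open>l\<close>
  is thus that of return number \<open>i\<close>, which lands in \<open>S\<close>;
  \<open>i = 0\<close> forces \<open>l = 0\<close>.\<close>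

definition return_at :: "real set \<Rightarrow> nat \<Rightarrow> nat \<Rightarrow> real set \<Rightarrow> real set" where
  "return_at E i l S = {x\<in>E. (T ^^ l) x \<in> S \<and> visits T E l x = i}"

end

locale returning = lebesgue_preserving +
  fixes E :: "real set" and C :: real
  assumes E_fmeasurable: "E \<in> fmeasurable lborel" and C_pos: "C > 0"
    and tail: "\<And>n. n \<ge> 1 \<Longrightarrow> measure lborel (non_return E n) \<le> C / sqrt n"
begin

lemma E_borel [measurable]: "E \<in> sets borel"
  using E_fmeasurable by (simp add: fmeasurable_def)

lemma visits_Suc: "visits T E (Suc n) x = visits T E n x + (if (T ^^ n) x \<in> E then 1 else 0)"
proof -
  have eq: "{k. k < Suc n \<and> (T ^^ k) x \<in> E} = {k. k < n \<and> (T ^^ k) x \<in> E} \<union> (if (T ^^ n) x \<in> E then {n} else {})"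
    by (auto simp: less_Suc_eq)
  then show ?thesis unfolding visits_def
    by (subst eq, subst card_Un_disjoint) auto
qed

lemma visits_0 [simp]: "visits T E 0 x = 0" by (simp add: visits_def)

lemma visits_mono: "m \<le> n \<Longrightarrow> visits T E m x \<le> visits T E n x"
  unfolding visits_def by (rule card_mono) auto

lemma visits_measurable [measurable]: "(\<lambda>x. visits T E n x) \<in> measurable borel (count_space UNIV)"
proof (induction n)
  case (Suc n)
  then show ?case unfolding visits_Suc by measurable
qed simp

lemma visits_add: "visits T E (m + n) x = visits T E m x + visits T E n ((T ^^ m) x)"
proof (induction n)
  case (Suc n)
  have "(T ^^ (m + n)) x = (T ^^ n) ((T ^^ m) x)" by (simp add: add.commute[of m] funpow_add)
  then show ?case using Suc by (simp add: visits_Suc)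
qed simp

lemma sets_return [measurable]:
  assumes [measurable]: "S \<in> sets borel"
  shows "first_returns E m S \<in> sets borel" "return_at E i l S \<in> sets borel" "non_return E m \<in> sets borel"
proof -
  have "{x\<in>space borel. x \<in> E \<and> (\<forall>l. 1 \<le> l \<and> l < m \<longrightarrow> (T ^^ l) x \<notin> E) \<and> (T ^^ m) x \<in> S} \<in> sets borel"
    by measurable
  then show "first_returns E m S \<in> sets borel" by (simp add: first_returns_def)
  have "{x\<in>space borel. x \<in> E \<and> (T ^^ l) x \<in> S \<and> visits T E l x = i} \<in> sets borel" by measurable
  then show "return_at E i l S \<in> sets borel" by (simp add: return_at_def)
  have "{x\<in>space borel. x \<in> E \<and> (\<forall>l. 1 \<le> l \<and> l \<le> m \<longrightarrow> (T ^^ l) x \<notin> E)} \<in> sets borel" by measurable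
  then show "non_return E m \<in> sets borel" by (simp add: non_return_def)
qed

lemma fmeasurable_E_subset: "S \<in> sets borel \<Longrightarrow> S \<subseteq> E \<Longrightarrow> S \<in> fmeasurable lborel"
  using fmeasurableI2[OF E_fmeasurable] by auto

lemma fmeasurable_return:
  assumes "S \<in> sets borel"
  shows "first_returns E m S \<in> fmeasurable lborel" "return_at E i l S \<in> fmeasurable lborel"
    "non_return E m \<in> fmeasurable lborel"
  by (intro fmeasurable_E_subset sets_return assms; auto simp: first_returns_def return_at_def non_return_def)+

text \<open>Splitting \<open>T\<^sup>-\<^sup>M S\<close> according to the last visit to \<open>E\<close> before time \<open>M\<close>.\<close>

lemma sum_first_returns:
  assumes S: "S \<in> sets borel" "S \<subseteq> E"
  shows "(\<Sum>m=1..M. measure lborel (first_returns E m S)) \<le> measure lborel S"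
proof -
  have "(\<Sum>m=1..M. measure lborel (first_returns E m S))
      = (\<Sum>m=1..M. measure lborel ((T ^^ (M - m)) -` first_returns E m S))"
    by (simp add: measure_vimage_funpow sets_return S)
  also have "\<dots> = measure lborel (\<Union>m\<in>{1..M}. (T ^^ (M - m)) -` first_returns E m S)"
  proof (rule measure_finite_Union[symmetric])
    show "(\<lambda>m. (T ^^ (M - m)) -` first_returns E m S) ` {1..M} \<subseteq> sets lborel"
      by (auto intro!: sets_vimage_funpow sets_return S)
    show "disjoint_family_on (\<lambda>m. (T ^^ (M - m)) -` first_returns E m S) {1..M}"
    proof -
      have False if "m \<in> {1..M}" "k \<in> {1..M}" "m < k" "(T ^^ (M - m)) x \<in> first_returns E m S"
        "(T ^^ (M - k)) x \<in> first_returns E k S" for m k x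
      proof -
        have "1 \<le> k - m \<and> k - m < k" using that by auto
        then have "(T ^^ (k - m)) ((T ^^ (M - k)) x) \<notin> E" using that(5) unfolding first_returns_def by blast
        moreover have "M - m = (k - m) + (M - k)" using that by auto
        then have "(T ^^ (k - m)) ((T ^^ (M - k)) x) = (T ^^ (M - m)) x" by (simp only: funpow_add comp_def)
        ultimately show False using that by (auto simp: first_returns_def)
      qed
      note disj = this
      show ?thesis
        unfolding disjoint_family_on_def
      proof (intro ballI impI equals0I)
        fix m k x
        assume mk: "m \<in> {1..M}" "k \<in> {1..M}" "m \<noteq> k"
          and x: "x \<in> (T ^^ (M - m)) -` first_returns E m S \<inter> (T ^^ (M - k)) -` first_returns E k S"
        then show False using disj[of m k x] disj[of k m x] by (cases "m < k") auto
      qed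
    qed
    show "emeasure lborel ((T ^^ (M - m)) -` first_returns E m S) \<noteq> \<infinity>" if "m \<in> {1..M}" for m
      using fmeasurableD2[OF fmeasurable_vimage_funpow[OF fmeasurable_return(1)[OF S(1)]], of "M - m" m] by simp
  qed simp
  also have "\<dots> \<le> measure lborel ((T ^^ M) -` S)"
  proof (rule measure_mono_fmeasurable)
    show "(\<Union>m\<in>{1..M}. (T ^^ (M - m)) -` first_returns E m S) \<subseteq> (T ^^ M) -` S"
    proof
      fix x assume "x \<in> (\<Union>m\<in>{1..M}. (T ^^ (M - m)) -` first_returns E m S)"
      then obtain m where m: "m \<in> {1..M}" "(T ^^ m) ((T ^^ (M - m)) x) \<in> S" by (auto simp: first_returns_def)
      then have "M = m + (M - m)" by auto
      then have "(T ^^ M) x = (T ^^ m) ((T ^^ (M - m)) x)" by (metis funpow_add comp_apply)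
      with m show "x \<in> (T ^^ M) -` S" by simp
    qed
  qed (auto intro!: sets_vimage_funpow sets_return S fmeasurable_vimage_funpow fmeasurable_E_subset)
  finally show ?thesis by (simp add: measure_vimage_funpow S)
qed

text \<open>The sets for different \<open>l\<close> are disjoint: their union consists of the points
  whose return number \<open>i\<close> lands in \<open>S\<close> before time \<open>M\<close>. Its
  measure is at most that of \<open>S\<close> because the first return map does not increase measure
  (\<open>sum_first_returns\<close>); induction on \<open>i\<close> splits off the last
  return.\<close>

lemma sum_return_at:
  assumes S: "S \<in> sets borel" "S \<subseteq> E"
  shows "(\<Sum>l<M. measure lborel (return_at E i l S)) \<le> measure lborel S"
  using S
proof (induction i arbitrary: M S)
  case 0
  have "return_at E 0 l S \<subseteq> (if l = 0 then S else {})" for l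
  proof -
    have "visits T E l x \<noteq> 0" if "l > 0" "x \<in> E" for x
      using visits_mono[of 1 l x] that by (auto simp: visits_Suc)
    then show ?thesis by (auto simp: return_at_def)
  qed
  then have "measure lborel (return_at E 0 l S) \<le> (if l = 0 then measure lborel S else 0)" for l
    using measure_mono_fmeasurable[of "return_at E 0 l S" "if l = 0 then S else {}" lborel]
      fmeasurable_E_subset[OF 0] sets_return(2)[OF 0(1)] by (auto split: if_splits)
  then have "(\<Sum>l<M. measure lborel (return_at E 0 l S)) \<le> (\<Sum>l<M. if l = 0 then measure lborel S else 0)"
    by (rule sum_mono)
  also have "\<dots> \<le> measure lborel S" by (simp add: sum.delta)
  finally show ?case .
next
  case (Suc i)
  have sub: "return_at E (Suc i) l S \<subseteq> (\<Union>m\<in>{1..l}. return_at E i (l - m) (first_returns E m S))" for l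
  proof
    fix x assume x: "x \<in> return_at E (Suc i) l S"
    define J where "J = {j. j < l \<and> (T ^^ j) x \<in> E}"
    have cJ: "card J = Suc i" using x by (simp add: J_def return_at_def visits_def)
    have fJ: "finite J" "J \<noteq> {}" using cJ card_gt_0_iff[of J] by auto
    define j where "j = Max J"
    have j: "j \<in> J" "\<And>k. k \<in> J \<Longrightarrow> k \<le> j" unfolding j_def using fJ by (auto intro!: Max_in Max_ge)
    have jl: "j < l" "(T ^^ j) x \<in> E" using j by (auto simp: J_def)
    have z: "(T ^^ k) ((T ^^ j) x) = (T ^^ (k + j)) x" for k by (simp add: funpow_add)
    have "(T ^^ j) x \<in> first_returns E (l - j) S"
      unfolding first_returns_def
    proof (intro CollectI conjI allI impI)
      show "(T ^^ (l - j)) ((T ^^ j) x) \<in> S" using x jl unfolding z by (simp add: return_at_def)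
      fix k assume k: "1 \<le> k \<and> k < l - j"
      then have "k + j \<notin> J" using j(2)[of "k + j"] by auto
      then show "(T ^^ k) ((T ^^ j) x) \<notin> E" using k unfolding z by (auto simp: J_def)
    qed (use jl in auto)
    moreover have "visits T E j x = i"
    proof -
      have "J = insert j {k. k < j \<and> (T ^^ k) x \<in> E}" using j by (force simp: J_def)
      then have "card J = Suc (card {k. k < j \<and> (T ^^ k) x \<in> E})" by simp
      then show ?thesis using cJ by (simp add: visits_def)
    qed
    ultimately have "x \<in> return_at E i (l - (l - j)) (first_returns E (l - j) S)"
      using x jl by (simp add: return_at_def)
    then show "x \<in> (\<Union>m\<in>{1..l}. return_at E i (l - m) (first_returns E m S))"
      using jl by (intro UN_I[of "l - j"]) auto
  qed
  have fr: "first_returns E m S \<in> sets borel" "first_returns E m S \<subseteq> E" for m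
    by (intro sets_return Suc.prems) (auto simp: first_returns_def)
  have "(\<Sum>l<M. measure lborel (return_at E (Suc i) l S))
      \<le> (\<Sum>l<M. \<Sum>m=1..l. measure lborel (return_at E i (l - m) (first_returns E m S)))"
  proof (rule sum_mono)
    fix l
    have "measure lborel (return_at E (Suc i) l S)
        \<le> measure lborel (\<Union>m\<in>{1..l}. return_at E i (l - m) (first_returns E m S))"
      by (intro measure_mono_fmeasurable sub)
        (auto intro!: sets_return Suc.prems fmeasurable.finite_UN fmeasurable_return)
    also have "\<dots> \<le> (\<Sum>m=1..l. measure lborel (return_at E i (l - m) (first_returns E m S)))"
      by (rule measure_UNION_le) (auto intro!: sets_return Suc.prems)
    finally show "measure lborel (return_at E (Suc i) l S) \<le> \<dots>" .
  qed
  also have "\<dots> = (\<Sum>(l, m)\<in>Sigma {..<M} (\<lambda>l. {1..l}). measure lborel (return_at E i (l - m) (first_returns E m S)))"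
    by (subst sum.Sigma) auto
  also have "\<dots> = (\<Sum>(k, m)\<in>(\<lambda>(l, m). (l - m, m)) ` Sigma {..<M} (\<lambda>l. {1..l}). measure lborel (return_at E i k (first_returns E m S)))"
    by (subst sum.reindex) (auto simp: inj_on_def case_prod_unfold)
  also have "\<dots> \<le> (\<Sum>(k, m)\<in>{..<M} \<times> {1..M}. measure lborel (return_at E i k (first_returns E m S)))"
    by (rule sum_mono2) auto
  also have "\<dots> = (\<Sum>m=1..M. \<Sum>k<M. measure lborel (return_at E i k (first_returns E m S)))"
    by (subst sum.cartesian_product[symmetric]) (rule sum.swap)
  also have "\<dots> \<le> (\<Sum>m=1..M. measure lborel (first_returns E m S))"
    by (intro sum_mono Suc.IH fr)
  also have "\<dots> \<le> measure lborel S" by (rule sum_first_returns[OF Suc.prems])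
  finally show ?case .
qed

text \<open>If a point of \<open>E\<close> has at most \<open>k\<close> visits before time \<open>n\<close>, the return times truncated
  at \<open>n\<close> of these visits add up to at least \<open>n\<close>; \<open>n_gaps\<close> is the sum over all visits of
  the number of \<open>m < n\<close> for which the return takes longer than \<open>m\<close>.\<close>

lemma few_visits_gap:
  assumes "x \<in> E" "visits T E n x \<le> k"
  shows "n \<le> card {(i, l, m). i < k \<and> l < n \<and> m < n \<and> x \<in> return_at E i l (non_return E m)}"
proof -
  define last where "last t = Max {j. j \<le> t \<and> (T ^^ j) x \<in> E}" for t
  have last: "last t \<le> t" "(T ^^ last t) x \<in> E" "\<And>j. j \<le> t \<Longrightarrow> (T ^^ j) x \<in> E \<Longrightarrow> j \<le> last t" for t
  proof -
    let ?J = "{j. j \<le> t \<and> (T ^^ j) x \<in> E}"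
    have J: "finite ?J" "0 \<in> ?J" using assms by auto
    then have "Max ?J \<in> ?J" by (intro Max_in) auto
    then show "last t \<le> t" "(T ^^ last t) x \<in> E" unfolding last_def by auto
    show "j \<le> last t" if "j \<le> t" "(T ^^ j) x \<in> E" for j
      unfolding last_def by (rule Max_ge[OF J(1)]) (use that in simp)
  qed
  \<comment> \<open>The time \<open>t\<close> is the sum of the last two components, hence
    \<open>g\<close> is injective.\<close>
  define g where "g t = (visits T E (last t) x, last t, t - last t)" for t
  have "inj_on g {..<n}"
  proof (rule inj_onI)
    fix s t assume "g s = g t"
    then show "s = t" using last(1)[of s] last(1)[of t] by (auto simp: g_def)
  qed
  then have "n = card (g ` {..<n})" by (simp add: card_image)
  also have "\<dots> \<le> card {(i, l, m). i < k \<and> l < n \<and> m < n \<and> x \<in> return_at E i l (non_return E m)}"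
  proof (rule card_mono)
    show "finite {(i, l, m). i < k \<and> l < n \<and> m < n \<and> x \<in> return_at E i l (non_return E m)}"
      by (rule finite_subset[of _ "{..<k} \<times> {..<n} \<times> {..<n}"]) auto
    show "g ` {..<n} \<subseteq> {(i, l, m). i < k \<and> l < n \<and> m < n \<and> x \<in> return_at E i l (non_return E m)}"
    proof (rule image_subsetI)
      fix t assume t: "t \<in> {..<n}"
      have "Suc (visits T E (last t) x) = visits T E (Suc (last t)) x" using last(2)[of t] by (simp add: visits_Suc)
      also have "\<dots> \<le> visits T E n x" using t last(1)[of t] by (intro visits_mono) auto
      finally have "visits T E (last t) x < k" using assms by simp
      moreover have "(T ^^ last t) x \<in> non_return E (t - last t)"
        unfolding non_return_def
      proof (intro CollectI conjI allI impI)
        show "(T ^^ last t) x \<in> E" by (rule last(2))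
        fix j assume j: "1 \<le> j \<and> j \<le> t - last t"
        have "j + last t \<le> t" using j last(1)[of t] by linarith
        then have "(T ^^ (j + last t)) x \<notin> E" using last(3)[of "j + last t" t] j by auto
        then show "(T ^^ j) ((T ^^ last t) x) \<notin> E" by (simp add: funpow_add)
      qed
      ultimately show "g t \<in> {(i, l, m). i < k \<and> l < n \<and> m < n \<and> x \<in> return_at E i l (non_return E m)}"
        using t last(1)[of t] assms by (auto simp: g_def return_at_def)
    qed
  qed
  finally show ?thesis .
qed

text \<open>Integrating \<open>few_visits_gap\<close> gives \<open>n\<close> times the measure of
  the set on the left. On the right the sum over \<open>l\<close> costs nothing by
  \<open>sum_return_at\<close>; there remain \<open>k\<close> copies of the sum of the
  \<open>non_return\<close> measures, which is of order \<open>sqrt n\<close>.\<close>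

lemma measure_few_visits:
  assumes "n \<ge> 1"
  shows "measure lborel {x\<in>E. visits T E n x \<le> k} \<le> 3 * (C + measure lborel E) * real k / sqrt n"
proof -
  let ?A = "{x\<in>E. visits T E n x \<le> k}"
  have [measurable]: "?A \<in> sets borel"
  proof -
    have "{x\<in>space borel. x \<in> E \<and> visits T E n x \<le> k} \<in> sets borel" by measurable
    then show ?thesis by simp
  qed
  define I where "I = {..<k} \<times> {..<n} \<times> {..<n}"
  have fI: "finite I" by (simp add: I_def)
  have fm: "return_at E i l (non_return E m) \<in> fmeasurable lborel" for i l m
    by (intro fmeasurable_return sets_return(3)) auto
  have card: "real (card {(i, l, m). i < k \<and> l < n \<and> m < n \<and> x \<in> return_at E i l (non_return E m)})
      = (\<Sum>(i, l, m)\<in>I. indicator (return_at E i l (non_return E m)) x)" for x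
  proof -
    have "(\<Sum>p\<in>I. indicator (case p of (i, l, m) \<Rightarrow> return_at E i l (non_return E m)) x) =
       real (card {p\<in>I. x \<in> (case p of (i, l, m) \<Rightarrow> return_at E i l (non_return E m))})"
      using fI by (simp add: indicator_def sum.If_cases Int_def)
    moreover have "{p\<in>I. x \<in> (case p of (i, l, m) \<Rightarrow> return_at E i l (non_return E m))}
       = {(i, l, m). i < k \<and> l < n \<and> m < n \<and> x \<in> return_at E i l (non_return E m)}"
      by (auto simp: I_def)
    ultimately show ?thesis by (simp add: case_prod_unfold)
  qed
  have "real n * measure lborel ?A = (\<integral>x. real n * indicator ?A x \<partial>lborel)" by simp
  also have "\<dots> \<le> (\<integral>x. (\<Sum>(i, l, m)\<in>I. indicator (return_at E i l (non_return E m)) x) \<partial>lborel)"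
  proof (rule integral_mono)
    show "integrable lborel (\<lambda>x. real n * indicator ?A x)"
      using fmeasurable_E_subset[of ?A] by (auto simp: fmeasurable_def)
    show "integrable lborel (\<lambda>x. \<Sum>(i, l, m)\<in>I. indicator (return_at E i l (non_return E m)) x :: real)"
      unfolding case_prod_unfold using fm by (intro Bochner_Integration.integrable_sum) (auto simp: fmeasurable_def)
    show "real n * indicator ?A x \<le> (\<Sum>(i, l, m)\<in>I. indicator (return_at E i l (non_return E m)) x)" for x
      using few_visits_gap[of x n k] unfolding card[symmetric] by (auto simp: indicator_def)
  qed
  also have "\<dots> = (\<Sum>(i, l, m)\<in>I. measure lborel (return_at E i l (non_return E m)))"
    unfolding case_prod_unfold using fm by (subst Bochner_Integration.integral_sum) (auto simp: fmeasurable_def)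
  also have "\<dots> = (\<Sum>i<k. \<Sum>m<n. \<Sum>l<n. measure lborel (return_at E i l (non_return E m)))"
  proof -
    have "(\<Sum>(i, l, m)\<in>I. measure lborel (return_at E i l (non_return E m)))
        = (\<Sum>i<k. \<Sum>l<n. \<Sum>m<n. measure lborel (return_at E i l (non_return E m)))"
      by (simp add: I_def sum.cartesian_product)
    also have "\<dots> = (\<Sum>i<k. \<Sum>m<n. \<Sum>l<n. measure lborel (return_at E i l (non_return E m)))"
      by (intro sum.cong sum.swap refl)
    finally show ?thesis .
  qed
  also have "\<dots> \<le> (\<Sum>i<k. \<Sum>m<n. measure lborel (non_return E m))"
    by (intro sum_mono sum_return_at sets_return(3)) (auto simp: non_return_def)
  also have "\<dots> = real k * (\<Sum>m<n. measure lborel (non_return E m))" by simp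
  also have "\<dots> \<le> real k * (3 * (C + measure lborel E) * sqrt n)"
  proof (intro mult_left_mono sum_min_le_sqrt)
    fix m :: nat assume "m \<ge> 1"
    then have "measure lborel (non_return E m) \<le> C / sqrt m" by (rule tail)
    also have "\<dots> \<le> (C + measure lborel E) / sqrt m" by (intro divide_right_mono) auto
    finally show "measure lborel (non_return E m) \<le> (C + measure lborel E) / sqrt m" .
  next
    show "measure lborel (non_return E 0) \<le> C + measure lborel E"
      using C_pos by (simp add: non_return_def)
  qed (use C_pos in auto)
  finally have *: "real n * measure lborel ?A \<le> real k * (3 * (C + measure lborel E) * sqrt n)" .
  have M: "real n = sqrt n * sqrt n" by simp
  have "sqrt n * measure lborel ?A \<le> real k * (3 * (C + measure lborel E))"
  proof (rule mult_left_le_imp_le)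
    show "sqrt n * (sqrt n * measure lborel ?A) \<le> sqrt n * (real k * (3 * (C + measure lborel E)))"
      using * unfolding mult.assoc[symmetric] M[symmetric] by (simp add: mult_ac)
    show "sqrt n > 0" using assms by simp
  qed
  then show ?thesis using assms by (simp add: field_simps)
qed

lemma AE_visits_E:
  assumes \<epsilon>: "0 < \<epsilon>" "\<epsilon> < 1 / 2"
  shows "AE x in lborel. x \<in> E \<longrightarrow>
    filterlim (\<lambda>n. real (visits T E n x) / real n powr (1 / 2 - \<epsilon>)) at_top sequentially"
proof -
  define D where "D = 3 * (C + measure lborel E)"
  have D: "D \<ge> 0" using C_pos by (simp add: D_def)
  \<comment> \<open>Halfway between \<open>1 / 2 - \<epsilon>\<close> and \<open>1 / 2\<close>: the
    upper half of the gap makes the measures of the sets \<open>A j\<close> summable, the lower half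
    makes the quotient diverge.\<close>
  define s where "s = 1 / 2 - \<epsilon> / 2"
  have s: "s > 0" using \<epsilon> by (simp add: s_def)
  define k where "k j = nat \<lfloor>2 powr (real j * s)\<rfloor>" for j
  define A where "A j = {x\<in>E. visits T E (2 ^ j) x \<le> k j}" for j
  have A_sets: "A j \<in> sets lborel" for j
  proof -
    have "{x\<in>space borel. x \<in> E \<and> visits T E (2 ^ j) x \<le> k j} \<in> sets borel" by measurable
    then show ?thesis by (simp add: A_def)
  qed
  have "A j \<in> fmeasurable lborel" for j
    using A_sets by (intro fmeasurable_E_subset) (auto simp: A_def)
  then have A_fin: "emeasure lborel (A j) < \<infinity>" for j
    by (simp add: fmeasurable_def)
  have bound: "measure lborel (A j) \<le> D * (2 powr (- \<epsilon> / 2)) ^ j" for j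
  proof -
    have "measure lborel (A j) \<le> D * real (k j) / sqrt (real (2 ^ j))"
      using measure_few_visits[of "2 ^ j" "k j"] by (simp add: A_def D_def)
    also have "\<dots> \<le> D * 2 powr (real j * s) / sqrt (real (2 ^ j))"
      using D by (intro divide_right_mono mult_left_mono) (auto simp: k_def)
    also have "sqrt (real (2 ^ j)) = 2 powr (real j / 2)"
      by (simp add: powr_half_sqrt[symmetric] powr_realpow[symmetric] powr_powr)
    also have "2 powr (real j * s) = 2 powr (real j * (- \<epsilon> / 2)) * 2 powr (real j / 2)"
      by (simp add: s_def algebra_simps flip: powr_add)
    then have "D * 2 powr (real j * s) / 2 powr (real j / 2) = D * 2 powr (real j * (- \<epsilon> / 2))" by simp
    also have "2 powr (real j * (- \<epsilon> / 2)) = (2 powr (- \<epsilon> / 2)) ^ j"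
      by (simp add: powr_powr mult.commute flip: powr_realpow)
    finally show ?thesis .
  qed
  have "summable (\<lambda>j. measure lborel (A j))"
  proof (rule summable_comparison_test')
    have "2 powr (- \<epsilon> / 2) < 2 powr (0::real)" using \<epsilon> by (intro powr_less_mono) auto
    then show "summable (\<lambda>j. D * (2 powr (- \<epsilon> / 2)) ^ j)"
      by (intro summable_mult summable_geometric) auto
    show "norm (measure lborel (A j)) \<le> D * (2 powr (- \<epsilon> / 2)) ^ j" if "j \<ge> 0" for j
      using bound[of j] by simp
  qed
  then have "AE x in lborel. eventually (\<lambda>j. x \<in> space lborel - A j) sequentially"
    using A_sets A_fin by (intro borel_cantelli_AE1) auto
  then show ?thesis
  proof (eventually_elim, intro impI)
    fix x assume ev: "eventually (\<lambda>j. x \<in> space lborel - A j) sequentially" and x: "x \<in> E"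
    obtain J where J: "\<And>j. j \<ge> J \<Longrightarrow> x \<notin> A j"
      using ev unfolding eventually_sequentially by auto
    show "filterlim (\<lambda>n. real (visits T E n x) / real n powr (1 / 2 - \<epsilon>)) at_top sequentially"
    proof (rule filterlim_at_top_mono)
      show "filterlim (\<lambda>n::nat. 2 powr (- s) * real n powr (\<epsilon> / 2)) at_top sequentially"
        using \<epsilon> by real_asymp
      show "eventually (\<lambda>n. 2 powr (- s) * real n powr (\<epsilon> / 2) \<le> real (visits T E n x) / real n powr (1 / 2 - \<epsilon>)) sequentially"
        using eventually_ge_at_top[of "2 ^ J"]
      proof eventually_elim
        fix n :: nat assume n: "2 ^ J \<le> n"
        have n1: "1 \<le> n" using n by (rule order_trans[rotated]) simp
        then obtain j where j: "2 ^ j \<le> n" "n < 2 ^ (j + 1)" using ex_power_ivl1[of 2 n] by auto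
        have "(2::nat) ^ J < 2 ^ (j + 1)" using n j by linarith
        then have "J \<le> j" using power_less_imp_less_exp[of "2::nat" J "j + 1"] by simp
        then have "visits T E (2 ^ j) x > k j" using J[of j] x by (auto simp: A_def)
        then have "2 powr (real j * s) \<le> real (visits T E (2 ^ j) x)"
          unfolding k_def by linarith
        also have "\<dots> \<le> real (visits T E n x)" using visits_mono[OF j(1)] by simp
        finally have v: "2 powr (real j * s) \<le> real (visits T E n x)" .
        have "real n < 2 powr (real j + 1)"
          using j(2) by (simp add: powr_add powr_realpow flip: of_nat_less_iff[where 'a=real])
        then have "real n powr s \<le> (2 powr (real j + 1)) powr s"
          using s by (intro powr_mono2) auto
        also have "\<dots> = 2 powr s * 2 powr (real j * s)"
          by (simp only: powr_powr powr_add[symmetric]) (simp add: algebra_simps)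
        finally have "2 powr (- s) * real n powr s \<le> 2 powr (real j * s)"
          by (simp add: powr_minus field_simps)
        with v have "2 powr (- s) * real n powr s \<le> real (visits T E n x)" by linarith
        moreover have "real n powr s = real n powr (\<epsilon> / 2) * real n powr (1 / 2 - \<epsilon>)"
          by (simp add: s_def algebra_simps flip: powr_add)
        ultimately show "2 powr (- s) * real n powr (\<epsilon> / 2) \<le> real (visits T E n x) / real n powr (1 / 2 - \<epsilon>)"
          using n1 by (simp add: field_simps)
      qed
    qed
  qed
qed

text \<open>Preimages of null sets are null, so almost every orbit meets \<open>E\<close> in a point
  with the property of \<open>AE_visits_E\<close>. Starting \<open>l\<close> steps earlier changes
  the normalisation by at most the factor \<open>(l + 1) powr a\<close>.\<close>

lemma AE_visits:
  assumes \<epsilon>: "0 < \<epsilon>" "\<epsilon> < 1 / 2" and hit: "AE x in lborel. \<exists>l. (T ^^ l) x \<in> E"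
  shows "AE x in lborel. filterlim (\<lambda>n. real (visits T E n x) / real n powr (1 / 2 - \<epsilon>)) at_top sequentially"
proof -
  define a where "a = 1 / 2 - \<epsilon>"
  have a: "a > 0" using \<epsilon> by (simp add: a_def)
  have "AE x in lborel. \<forall>l. (T ^^ l) x \<in> E \<longrightarrow>
      filterlim (\<lambda>n. real (visits T E n ((T ^^ l) x)) / real n powr a) at_top sequentially"
    unfolding AE_all_countable a_def by (intro allI AE_funpow AE_visits_E \<epsilon>)
  with hit show ?thesis
  proof eventually_elim
    case (elim x)
    then obtain l where lim: "filterlim (\<lambda>n. real (visits T E n ((T ^^ l) x)) / real n powr a) at_top sequentially"
      by blast
    define c where "c = (real l + 1) powr (- a)"
    have c: "c > 0" by (simp add: c_def)
    have "filterlim (\<lambda>n. real (visits T E n x) / real n powr a) at_top sequentially"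
      unfolding filterlim_at_top
    proof
      fix Z :: real
      have "eventually (\<lambda>n. Z / c \<le> real (visits T E n ((T ^^ l) x)) / real n powr a) sequentially"
        using lim by (simp add: filterlim_at_top)
      then have "eventually (\<lambda>n. Z \<le> real (visits T E (n + l) x) / real (n + l) powr a) sequentially"
        using eventually_ge_at_top[of 1]
      proof eventually_elim
        case (elim n)
        have "real (n + l) \<le> (real l + 1) * real n"
          using elim(2) mult_left_mono[of 1 "real n" "real l"] by (simp add: algebra_simps)
        then have "real (n + l) powr a \<le> ((real l + 1) * real n) powr a"
          using a by (intro powr_mono2) auto
        also have "\<dots> = (real l + 1) powr a * real n powr a" by (simp add: powr_mult)
        also have "\<dots> = real n powr a / c" by (simp add: c_def powr_minus divide_inverse)
        finally have le: "real (n + l) powr a \<le> real n powr a / c" .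
        have "Z \<le> c * (real (visits T E n ((T ^^ l) x)) / real n powr a)"
          using elim(1) c by (simp add: field_simps)
        also have "\<dots> = real (visits T E n ((T ^^ l) x)) / (real n powr a / c)" by simp
        also have "\<dots> \<le> real (visits T E n ((T ^^ l) x)) / real (n + l) powr a"
          using le elim(2) c by (intro divide_left_mono) auto
        also have "\<dots> \<le> real (visits T E (n + l) x) / real (n + l) powr a"
          using visits_add[of l n x] by (intro divide_right_mono) (auto simp: add.commute)
        finally show ?case .
      qed
      then show "eventually (\<lambda>n. Z \<le> real (visits T E n x) / real n powr a) sequentially"
        by (rule eventually_sequentially_seg[THEN iffD1])
    qed
    then show ?case by (simp add: a_def)
  qed
qed

lemma AE_returns: "AE x in lborel. x \<in> E \<longrightarrow> (\<forall>n. \<exists>m\<ge>n. (T ^^ m) x \<in> E)"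
proof -
  have "(\<Inter>n. non_return E (Suc n)) \<in> null_sets lborel"
  proof (rule null_setsI)
    show "(\<Inter>n. non_return E (Suc n)) \<in> sets lborel" using sets_return(3) by auto
    have "emeasure lborel (\<Inter>n. non_return E (Suc n)) \<le> ennreal e" if "e > 0" for e
    proof -
      have "eventually (\<lambda>n. C / sqrt (Suc n) < e) sequentially" using C_pos that by real_asymp
      then obtain n where n: "C / sqrt (Suc n) < e" using eventually_happens by force
      have "emeasure lborel (\<Inter>n. non_return E (Suc n)) \<le> emeasure lborel (non_return E (Suc n))"
        using sets_return(3) by (intro emeasure_mono) auto
      also have "\<dots> = ennreal (measure lborel (non_return E (Suc n)))"
        by (rule emeasure_eq_measure2[OF fmeasurable_return(3)[of "{}"]]) simp
      also have "\<dots> \<le> ennreal e" using tail[of "Suc n"] n by (intro ennreal_leI) auto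
      finally show ?thesis .
    qed
    then show "emeasure lborel (\<Inter>n. non_return E (Suc n)) = 0"
      by (metis ennreal_le_epsilon add_0 le_zero_eq)
  qed
  then have "AE x in lborel. x \<notin> (\<Inter>n. non_return E (Suc n))" by (rule AE_not_in)
  then have "AE x in lborel. \<forall>l. (T ^^ l) x \<notin> (\<Inter>n. non_return E (Suc n))"
    unfolding AE_all_countable by (intro allI AE_funpow)
  then show ?thesis
  proof eventually_elim
    case (elim x)
    have step: "\<exists>m\<ge>1. (T ^^ m) y \<in> E" if "y \<in> E" "y \<notin> (\<Inter>n. non_return E (Suc n))" for y
      using that by (auto simp: non_return_def)
    show ?case
    proof (intro impI allI)
      fix n assume x: "x \<in> E"
      show "\<exists>m\<ge>n. (T ^^ m) x \<in> E"
      proof (induction n)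
        case (Suc n)
        then obtain m where m: "m \<ge> n" "(T ^^ m) x \<in> E" by blast
        obtain k where k: "k \<ge> 1" "(T ^^ k) ((T ^^ m) x) \<in> E"
          using step[OF m(2)] elim by blast
        then have "(T ^^ (k + m)) x \<in> E" by (simp add: funpow_add)
        then show ?case using k m by (intro exI[of _ "k + m"]) auto
      qed (use x in \<open>auto intro!: exI[of _ 0]\<close>)
    qed
  qed
qed

end

context return_estimates
begin

lemma from_E_eq: "from_E n S = first_returns E n S"
  by (simp add: from_E_def first_returns_def)

lemma returning_E: "returning T E (2 * C * (1 + (real i0 + 1) / \<delta>) * (measure lborel E + 1))"
proof
  have c: "2 * C * (1 + (real i0 + 1) / \<delta>) > 0" (is "?c > 0")
    using C_pos \<delta>_pos by (intro mult_pos_pos add_pos_nonneg) auto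
  show "E \<in> fmeasurable lborel" using E_subset by (intro fmeasurable_subset_K) auto
  show "?c * (measure lborel E + 1) > 0" by (intro mult_pos_pos[OF c] add_nonneg_pos) auto
  have E: "E \<in> sets borel" "E \<subseteq> K" using E_subset by auto
  \<comment> \<open>Both sides start at the measure of \<open>E\<close> and lose the same first
    return measure in each step. This turns a bound for paths that end in \<open>E\<close> into one
    for points that leave \<open>E\<close>.\<close>
  have dual: "measure lborel (non_return E n) = measure lborel (from_all (Suc n) E)" for n
  proof (induction n)
    case 0
    show ?case using from_all_1[OF E] by (simp add: non_return_def)
  next
    case (Suc n)
    have m: "non_return E n \<in> sets borel" for n
    proof -
      have "{x\<in>space borel. x \<in> E \<and> (\<forall>l. 1 \<le> l \<and> l \<le> n \<longrightarrow> (T ^^ l) x \<notin> E)} \<in> sets borel" by measurable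
      then show ?thesis by (simp add: non_return_def)
    qed
    have "non_return E (Suc n) = non_return E n - from_E (Suc n) E"
      by (auto simp: non_return_def from_E_def le_Suc_eq less_Suc_eq_le)
    moreover have "from_E (Suc n) E \<subseteq> non_return E n" by (auto simp: non_return_def from_E_def)
    ultimately have "measure lborel (non_return E (Suc n)) = measure lborel (non_return E n) - measure lborel (from_E (Suc n) E)"
      using m sets_from(2)[OF E(1)] fmeasurableI2[OF \<open>E \<in> fmeasurable lborel\<close>, of "non_return E n"]
      by (auto intro!: measure_Diff simp: non_return_def fmeasurable_def less_top[symmetric])
    then show ?case using Suc measure_from_all_Suc[OF E, of "Suc n"] by simp
  qed
  show "measure lborel (non_return E n) \<le> ?c * (measure lborel E + 1) / sqrt n" if "n \<ge> 1" for n
  proof -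
    have "measure lborel (non_return E n) \<le> measure lborel (from_all n E)"
      using measure_from_all_antimono[OF E, of n "Suc n"] by (simp add: dual)
    also have "\<dots> \<le> ?c / sqrt n * measure lborel E" by (rule measure_from_all_tail[OF E that])
    also have "\<dots> \<le> ?c / sqrt n * (measure lborel E + 1)" using c by (intro mult_left_mono) auto
    finally show ?thesis by simp
  qed
qed

text \<open>The measures of \<open>from_K n K\<close> have a finite sum, so almost every point lies
  in finitely many of these sets. A point of \<open>K\<close> that keeps returning to
  \<open>K\<close> without ever meeting \<open>E\<close> lies in infinitely many.\<close>

lemma AE_K_hits_E:
  assumes "AE x in lborel. x \<in> K \<longrightarrow> (\<forall>n. \<exists>m\<ge>n. (T ^^ m) x \<in> K)"
  shows "AE x in lborel. x \<in> K \<longrightarrow> (\<exists>l. (T ^^ l) x \<in> E)"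
proof -
  have KK: "K \<in> sets borel" "K \<subseteq> K" by auto
  define A where "A n = from_K n K" for n
  have "summable (\<lambda>n. measure lborel (A n))"
    using sum_from_K[OF KK] by (intro bounded_imp_summable[of _ "(1 + (real i0 + 1) / \<delta>) * measure lborel K"])
      (auto simp: A_def simp flip: lessThan_Suc_atMost simp del: sum.lessThan_Suc)
  then have "AE x in lborel. eventually (\<lambda>n. x \<in> space lborel - A n) sequentially"
    using fmeasurable_from(1)[OF KK] by (intro borel_cantelli_AE1) (auto simp: A_def fmeasurable_def)
  with assms show ?thesis
  proof eventually_elim
    case (elim x)
    show ?case
    proof (intro impI, rule ccontr)
      assume x: "x \<in> K" and "\<nexists>l. (T ^^ l) x \<in> E"
      moreover obtain N where "\<And>n. n \<ge> N \<Longrightarrow> x \<notin> A n" using elim by (auto simp: eventually_sequentially)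
      moreover obtain m where "m \<ge> N" "(T ^^ m) x \<in> K" using elim x by blast
      ultimately show False by (auto simp: A_def from_K_def)
    qed
  qed
qed

end

section \<open>Orbits near infinity\<close>

lemma Icc_fmeasurable [simp, intro]: "{a..b::real} \<in> fmeasurable lborel"
  by (auto simp: fmeasurable_def emeasure_lborel_Icc_eq)

text \<open>For \<open>T x = x - \<kappa> / x + O(1 / x^2)\<close> both \<open>T' x\<close> and
  \<open>x / T x\<close> equal \<open>1 + \<kappa> / x^2\<close> up to terms of order
  \<open>1 / x^3\<close>. The shift by \<open>A\<close> outweighs these errors, so that
  \<open>T'\<close> is squeezed between two exact quotients; the constants in the other assumptions
  are deliberately crude.\<close>

locale right_tail = lebesgue_preserving +
  fixes T' :: "real \<Rightarrow> real" and \<kappa> A R :: real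
  assumes deriv: "\<And>x. x \<ge> R \<Longrightarrow> (T has_real_derivative T' x) (at x)"
    and cont_T': "continuous_on {R..} T'"
    and \<kappa>_pos: "\<kappa> > 0" and A_nonneg: "A \<ge> 0" and R_pos: "R > 0" and A_le_R: "A \<le> R"
    and T_ge: "\<And>x. x \<ge> R \<Longrightarrow> T x \<ge> x / 2 + A"
    and step_ge: "\<And>x. x \<ge> R \<Longrightarrow> \<kappa> / (2 * x) \<le> x - T x"
    and step_le: "\<And>x. x \<ge> R \<Longrightarrow> x - T x \<le> 2 * \<kappa> / x"
    and T'_ge: "\<And>x. x \<ge> R \<Longrightarrow> (x + A) / (T x + A) \<le> T' x"
    and T'_le: "\<And>x. x \<ge> R \<Longrightarrow> T' x \<le> (x - A) / (T x - A)"
begin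

lemma T_less: "x \<ge> R \<Longrightarrow> T x < x"
  using step_ge[of x] \<kappa>_pos R_pos by (smt (verit) divide_pos_pos)

lemma T_pos: "x \<ge> R \<Longrightarrow> 0 < T x" and T_gt_A: "x \<ge> R \<Longrightarrow> A < T x"
  using T_ge[of x] R_pos A_nonneg by auto

lemma T'_minus_1_le: assumes "x \<ge> R" shows "T' x - 1 \<le> 4 * \<kappa> / x\<^sup>2"
proof -
  have x: "x > 0" using assms R_pos by simp
  have "T' x - 1 \<le> (x - A) / (T x - A) - 1" using T'_le[OF assms] by simp
  also have "\<dots> = (x - T x) / (T x - A)" using T_gt_A[OF assms] by (simp add: field_simps)
  also have "\<dots> \<le> (2 * \<kappa> / x) / (x / 2)"
    using step_le[OF assms] T_ge[OF assms] T_less[OF assms] x \<kappa>_pos by (intro frac_le) auto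
  also have "\<dots> = 4 * \<kappa> / x\<^sup>2" by (simp add: power2_eq_square)
  finally show ?thesis .
qed

lemma T'_minus_1_ge: assumes "x \<ge> R" shows "\<kappa> / (4 * x\<^sup>2) \<le> T' x - 1"
proof -
  have x: "x > 0" "A \<le> x" using assms R_pos A_le_R by auto
  have "\<kappa> / (4 * x\<^sup>2) = (\<kappa> / (2 * x)) / (2 * x)" by (simp add: power2_eq_square)
  also have "\<dots> \<le> (x - T x) / (T x + A)"
    using step_ge[OF assms] T_less[OF assms] T_pos[OF assms] x A_nonneg \<kappa>_pos by (intro frac_le) auto
  also have "\<dots> = (x + A) / (T x + A) - 1" using T_pos[OF assms] A_nonneg by (simp add: field_simps)
  also have "\<dots> \<le> T' x - 1" using T'_ge[OF assms] by simp
  finally show ?thesis .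
qed

lemma T'_gt_1: assumes "x \<ge> R" shows "T' x > 1"
proof -
  have "\<kappa> / (4 * x\<^sup>2) > 0" using \<kappa>_pos assms R_pos by simp
  then show ?thesis using T'_minus_1_ge[OF assms] by simp
qed

lemma T_strict_mono: assumes "R \<le> x" "x < x'" shows "T x < T x'"
proof (rule DERIV_pos_imp_increasing[OF assms(2)])
  fix y assume "x \<le> y" "y \<le> x'"
  then have "R \<le> y" using assms by simp
  then show "\<exists>d. (T has_real_derivative d) (at y) \<and> d > 0"
    using deriv[of y] T'_gt_1[of y] by (intro exI[of _ "T' y"]) auto
qed

lemma T_less_iff: "R \<le> x \<Longrightarrow> R \<le> x' \<Longrightarrow> T x < T x' \<longleftrightarrow> x < x'"
  using T_strict_mono[of x x'] T_strict_mono[of x' x] by (cases x x' rule: linorder_cases) auto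

lemma T_le_iff: "R \<le> x \<Longrightarrow> R \<le> x' \<Longrightarrow> T x \<le> T x' \<longleftrightarrow> x \<le> x'"
  using T_less_iff[of x' x] by (auto simp: not_less[symmetric])

lemma T_surj: assumes "T R \<le> z" shows "\<exists>x\<ge>R. T x = z"
proof -
  define v where "v = max R (z + 2 * \<kappa> / R)"
  have v: "v \<ge> R" by (simp add: v_def)
  have "v - T v \<le> 2 * \<kappa> / v" by (rule step_le[OF v])
  also have "\<dots> \<le> 2 * \<kappa> / R" using v R_pos \<kappa>_pos by (intro divide_left_mono) auto
  finally have "z \<le> T v" by (auto simp: v_def)
  moreover have "continuous_on {R..v} T"
    by (intro DERIV_continuous_on[of _ _ T'] DERIV_subset[OF deriv]) auto
  ultimately show ?thesis using IVT'[of T R z v] assms v by auto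
qed

section \<open>Fundamental intervals and their pull-backs along the tail\<close>

definition inv_T :: "real \<Rightarrow> real" where "inv_T z = (SOME x. x \<ge> R \<and> T x = z)"

text \<open>\<open>level n\<close> reaches \<open>R\<close> after \<open>n\<close> steps in the
  tail. By \<open>pull_below\<close> the points after \<open>level n\<close> up to
  \<open>level (Suc n)\<close> are those that need exactly \<open>Suc n\<close> steps to get to
  \<open>R\<close> or below.\<close>

primrec level :: "nat \<Rightarrow> real" where
  "level 0 = R"
| "level (Suc n) = inv_T (level n)"

lemma inv_T: assumes "T R \<le> z" shows "inv_T z \<ge> R" "T (inv_T z) = z"
proof -
  have "inv_T z \<ge> R \<and> T (inv_T z) = z"
    unfolding inv_T_def by (rule someI_ex) (use T_surj[OF assms] in blast)
  then show "inv_T z \<ge> R" "T (inv_T z) = z" by auto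
qed

lemma level_ge: "level n \<ge> R"
proof (induction n)
  case (Suc n)
  then have "T R \<le> level n" using T_less[of R] by simp
  then show ?case using inv_T by simp
qed simp

lemma T_level: "T (level (Suc n)) = level n"
  using level_ge[of n] T_less[of R] inv_T[of "level n"] by simp

lemma level_less_Suc: "level n < level (Suc n)"
  using T_less[OF level_ge[of "Suc n"]] T_level[of n] by simp

lemma level_step: "\<kappa> / (2 * level (Suc n)) \<le> level (Suc n) - level n"
  "level (Suc n) - level n \<le> 2 * \<kappa> / level (Suc n)"
  using step_ge[OF level_ge[of "Suc n"]] step_le[OF level_ge[of "Suc n"]] T_level[of n] by auto

text \<open>A step in the tail has size about \<open>\<kappa> / x\<close>, so the square changes by
  an almost constant amount. This is the origin of the rate \<open>sqrt n\<close>.\<close>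

lemma level_square: "R\<^sup>2 + real n * (\<kappa> / 2) \<le> (level n)\<^sup>2" "(level n)\<^sup>2 \<le> R\<^sup>2 + 4 * \<kappa> * real n"
proof -
  have *: "R\<^sup>2 + real n * (\<kappa> / 2) \<le> (level n)\<^sup>2 \<and> (level n)\<^sup>2 \<le> R\<^sup>2 + 4 * \<kappa> * real n"
  proof (induction n)
    case (Suc n)
    define y z where "y = level n" and "z = level (Suc n)"
    have yz: "y > 0" "z > 0" "y < z" "\<kappa> / (2 * z) \<le> z - y" "z - y \<le> 2 * \<kappa> / z"
      using level_ge[of n] level_ge[of "Suc n"] R_pos level_less_Suc[of n] level_step[of n] by (auto simp: y_def z_def)
    have "z\<^sup>2 - y\<^sup>2 = (z - y) * (z + y)" by (simp add: power2_eq_square algebra_simps)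
    moreover have "(z - y) * (z + y) \<ge> \<kappa> / (2 * z) * z"
      using yz \<kappa>_pos by (intro mult_mono) auto
    moreover have "(z - y) * (z + y) \<le> 2 * \<kappa> / z * (2 * z)"
      using yz \<kappa>_pos by (intro mult_mono) auto
    ultimately have d: "z\<^sup>2 - y\<^sup>2 \<ge> \<kappa> / 2" "z\<^sup>2 - y\<^sup>2 \<le> 4 * \<kappa>" using yz by auto
    have n: "real (Suc n) * (\<kappa> / 2) = real n * (\<kappa> / 2) + \<kappa> / 2"
      "4 * \<kappa> * real (Suc n) = 4 * \<kappa> * real n + 4 * \<kappa>"
      by (simp_all add: algebra_simps)
    show ?case using Suc d unfolding y_def z_def n by linarith
  qed simp
  then show "R\<^sup>2 + real n * (\<kappa> / 2) \<le> (level n)\<^sup>2" "(level n)\<^sup>2 \<le> R\<^sup>2 + 4 * \<kappa> * real n" by auto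
qed

lemma level_bounds:
  obtains c C where "c > 0" "C > 0" "\<And>n. c * sqrt (real n + 1) \<le> level n" "\<And>n. level n \<le> C * sqrt (real n + 1)"
proof
  define c where "c = min (R\<^sup>2) (\<kappa> / 2)"
  define C where "C = max (R\<^sup>2) (4 * \<kappa>)"
  have cC: "c > 0" "C > 0" using R_pos \<kappa>_pos by (auto simp: c_def C_def less_max_iff_disj)
  then show "sqrt c > 0" "sqrt C > 0" by auto
  fix n
  have l: "level n \<ge> 0" using level_ge[of n] R_pos by simp
  have "c * (real n + 1) = c + real n * c" by (simp add: algebra_simps)
  also have "\<dots> \<le> R\<^sup>2 + real n * (\<kappa> / 2)" by (intro add_mono mult_left_mono) (auto simp: c_def)
  also have "\<dots> \<le> (level n)\<^sup>2" by (rule level_square)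
  finally have "sqrt (c * (real n + 1)) \<le> level n" using l by (intro real_le_lsqrt)
  then show "sqrt c * sqrt (real n + 1) \<le> level n" by (simp add: real_sqrt_mult)
  have "(level n)\<^sup>2 \<le> R\<^sup>2 + 4 * \<kappa> * real n" by (rule level_square)
  also have "\<dots> \<le> C + C * real n" by (intro add_mono mult_right_mono) (auto simp: C_def)
  also have "\<dots> = C * (real n + 1)" by (simp add: algebra_simps)
  finally have "level n \<le> sqrt (C * (real n + 1))" by (rule real_le_rsqrt)
  then show "level n \<le> sqrt C * sqrt (real n + 1)" by (simp add: real_sqrt_mult)
qed

definition pull :: "nat \<Rightarrow> real set \<Rightarrow> real set" where
  "pull m S = {x. (\<forall>l<m. R < (T ^^ l) x) \<and> (T ^^ m) x \<in> S}"

lemma pull_0 [simp]: "pull 0 S = S" by (simp add: pull_def)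

lemma pull_Suc: "pull (Suc m) S = {x. R < x \<and> T x \<in> pull m S}"
proof -
  have "(\<forall>l<Suc m. R < (T ^^ l) x) \<longleftrightarrow> R < x \<and> (\<forall>l<m. R < (T ^^ l) (T x))" for x
    unfolding All_less_Suc2 by (simp add: funpow_swap1)
  then show ?thesis unfolding pull_def by (auto simp: funpow_swap1)
qed

lemma sets_pull [measurable]: "S \<in> sets borel \<Longrightarrow> pull m S \<in> sets borel"
proof -
  assume [measurable]: "S \<in> sets borel"
  have "{x\<in>space borel. (\<forall>l<m. R < (T ^^ l) x) \<and> (T ^^ m) x \<in> S} \<in> sets borel" by measurable
  then show ?thesis by (simp add: pull_def)
qed

lemma pull_below: "pull (Suc m) {..R} = {level m<..level (Suc m)}"
proof (induction m)
  case 0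
  have "R < x \<and> T x \<le> R \<longleftrightarrow> R < x \<and> x \<le> level 1" for x
    using T_le_iff[of x "level 1"] level_ge[of 1] T_level[of 0] by (cases "R \<le> x") auto
  then show ?case unfolding pull_Suc by (auto simp: greaterThanAtMost_def)
next
  case (Suc m)
  have *: "R < x \<and> level m < T x \<and> T x \<le> level (Suc m) \<longleftrightarrow> level (Suc m) < x \<and> x \<le> level (Suc (Suc m))" for x
    using T_le_iff[of x "level (Suc (Suc m))"] T_less_iff[of "level (Suc m)" x] level_ge[of "Suc m"]
      level_ge[of "Suc (Suc m)"] T_level[of m] T_level[of "Suc m"]
    by (cases "R \<le> x") (auto simp del: level.simps)
  show ?case unfolding pull_Suc[of "Suc m"] Suc
    by (rule set_eqI) (simp only: mem_Collect_eq greaterThanAtMost_iff *)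
qed

lemma pull_mono: "S \<subseteq> S' \<Longrightarrow> pull m S \<subseteq> pull m S'"
  by (auto simp: pull_def)

lemma level_mono: "m \<le> n \<Longrightarrow> level m \<le> level n"
  by (rule lift_Suc_mono_le) (use level_less_Suc in \<open>auto intro: less_imp_le\<close>)

text \<open>By monotonicity a point coming from above \<open>R\<close> lands above
  \<open>T R\<close>, so \<open>{T R<..R}\<close> is a fundamental interval: every descent from the
  tail to \<open>R\<close> or below ends in it.\<close>

lemma pull_subset:
  assumes "S \<subseteq> {T R<..R}"
  shows "pull m S \<subseteq> {T R<..level m}" "pull (Suc m) S \<subseteq> {level m<..level (Suc m)}"
proof -
  show *: "pull (Suc m) S \<subseteq> {level m<..level (Suc m)}" for m
  proof -
    have "S \<subseteq> {..R}" using assms by auto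
    then show ?thesis using pull_below[of m] pull_mono[of S "{..R}" "Suc m"] by simp
  qed
  show "pull m S \<subseteq> {T R<..level m}"
    using assms *[of "m - 1"] level_ge[of "m - 1"] T_less[of R] by (cases m) force+
qed

lemma substitution:
  assumes "f \<in> borel_measurable borel" "R < v"
  shows "(\<integral>\<^sup>+y. f y * indicator {T R..T v} y \<partial>lborel) = (\<integral>\<^sup>+x. f (T x) * ennreal (T' x) * indicator {R..v} x \<partial>lborel)"
  by (rule nn_integral_substitution_aux)
    (use assms T'_gt_1 in \<open>auto intro: deriv continuous_on_subset[OF cont_T'] less_imp_le[OF less_trans[of 0 1]]\<close>)

text \<open>The weights \<open>x + A\<close> and \<open>x - A\<close> are chosen such that they are sub- and
  superharmonic along the pull-back, so that no infinite products of derivatives occur.\<close>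

lemma
  assumes J: "J \<in> sets borel" "J \<subseteq> {T R<..T v}" and v: "R < v"
  shows pull_weight_plus: "(\<integral>\<^sup>+x. ennreal (x + A) * indicator {x. R < x \<and> T x \<in> J} x \<partial>lborel) \<le> (\<integral>\<^sup>+x. ennreal (x + A) * indicator J x \<partial>lborel)"
    and pull_weight_minus: "(\<integral>\<^sup>+x. ennreal (x - A) * indicator J x \<partial>lborel) \<le> (\<integral>\<^sup>+x. ennreal (x - A) * indicator {x. R < x \<and> T x \<in> J} x \<partial>lborel)"
    and pull_measure: "emeasure lborel J = (\<integral>\<^sup>+x. ennreal (T' x) * indicator {x. R < x \<and> T x \<in> J} x \<partial>lborel)"
proof -
  have ind: "indicator J (T x) * indicator {R..v} x = (indicator {x. R < x \<and> T x \<in> J} x :: ennreal)" for x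
  proof (cases "R \<le> x")
    case True
    then have "x \<le> v" if "T x \<in> J" using that J v T_le_iff[of x v] by auto
    moreover have "x \<noteq> R" if "T x \<in> J" using that J by auto
    ultimately show ?thesis using True by (auto simp: indicator_def)
  qed (auto simp: indicator_def)
  have sub: "(\<integral>\<^sup>+y. g y * indicator J y \<partial>lborel) = (\<integral>\<^sup>+x. g (T x) * ennreal (T' x) * indicator {x. R < x \<and> T x \<in> J} x \<partial>lborel)"
    if [measurable]: "g \<in> borel_measurable borel" for g
  proof -
    have [measurable]: "J \<in> sets borel" by fact
    have "(\<integral>\<^sup>+y. g y * indicator J y \<partial>lborel) = (\<integral>\<^sup>+y. (g y * indicator J y) * indicator {T R..T v} y \<partial>lborel)"
      using J(2) by (intro nn_integral_cong) (auto simp: indicator_def)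
    also have "\<dots> = (\<integral>\<^sup>+x. (g (T x) * indicator J (T x)) * ennreal (T' x) * indicator {R..v} x \<partial>lborel)"
      by (rule substitution[OF _ v]) measurable
    also have "\<dots> = (\<integral>\<^sup>+x. g (T x) * ennreal (T' x) * indicator {x. R < x \<and> T x \<in> J} x \<partial>lborel)"
      by (intro nn_integral_cong) (simp flip: ind add: mult_ac)
    finally show ?thesis .
  qed
  show "(\<integral>\<^sup>+x. ennreal (x + A) * indicator {x. R < x \<and> T x \<in> J} x \<partial>lborel) \<le> (\<integral>\<^sup>+x. ennreal (x + A) * indicator J x \<partial>lborel)"
  proof (subst sub)
    show "(\<integral>\<^sup>+x. ennreal (x + A) * indicator {x. R < x \<and> T x \<in> J} x \<partial>lborel) \<le>
        (\<integral>\<^sup>+x. ennreal (T x + A) * ennreal (T' x) * indicator {x. R < x \<and> T x \<in> J} x \<partial>lborel)"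
    proof (intro nn_integral_mono)
      fix x
      show "ennreal (x + A) * indicator {x. R < x \<and> T x \<in> J} x \<le> ennreal (T x + A) * ennreal (T' x) * indicator {x. R < x \<and> T x \<in> J} x"
      proof (cases "R < x")
        case True
        then have "x + A \<le> (T x + A) * T' x" using T'_ge[of x] T_pos[of x] A_nonneg by (simp add: field_simps)
        then have "ennreal (x + A) \<le> ennreal (T x + A) * ennreal (T' x)"
          using True T_pos[of x] A_nonneg by (subst ennreal_mult''[symmetric]) (use T'_gt_1[of x] in \<open>auto intro: ennreal_leI\<close>)
        then show ?thesis by (intro mult_right_mono) auto
      qed simp
    qed
  qed measurable
  show "(\<integral>\<^sup>+x. ennreal (x - A) * indicator J x \<partial>lborel) \<le> (\<integral>\<^sup>+x. ennreal (x - A) * indicator {x. R < x \<and> T x \<in> J} x \<partial>lborel)"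
  proof (subst sub)
    show "(\<integral>\<^sup>+x. ennreal (T x - A) * ennreal (T' x) * indicator {x. R < x \<and> T x \<in> J} x \<partial>lborel) \<le>
        (\<integral>\<^sup>+x. ennreal (x - A) * indicator {x. R < x \<and> T x \<in> J} x \<partial>lborel)"
    proof (intro nn_integral_mono)
      fix x
      show "ennreal (T x - A) * ennreal (T' x) * indicator {x. R < x \<and> T x \<in> J} x \<le> ennreal (x - A) * indicator {x. R < x \<and> T x \<in> J} x"
      proof (cases "R < x")
        case True
        then have "(T x - A) * T' x \<le> x - A" using T'_le[of x] T_gt_A[of x] by (simp add: field_simps)
        then have "ennreal (T x - A) * ennreal (T' x) \<le> ennreal (x - A)"
          using True T_gt_A[of x] by (subst ennreal_mult''[symmetric]) (use T'_gt_1[of x] in \<open>auto intro: ennreal_leI\<close>)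
        then show ?thesis by (intro mult_right_mono) auto
      qed simp
    qed
  qed measurable
  show "emeasure lborel J = (\<integral>\<^sup>+x. ennreal (T' x) * indicator {x. R < x \<and> T x \<in> J} x \<partial>lborel)"
    using sub[of "\<lambda>_. 1"] J by simp
qed

lemma vimage_pull_eq: "{x. R < x \<and> T x \<in> J} = T -` J \<inter> {R<..}"
  by auto

lemma measure_pull_Suc:
  assumes J: "J \<in> sets borel" "J \<subseteq> {T R<..T v}" and v: "R < v"
    and u: "R \<le> u" "{x. R < x \<and> T x \<in> J} \<subseteq> {u..}"
  defines "J' \<equiv> {x. R < x \<and> T x \<in> J}"
  shows "J \<in> fmeasurable lborel" "J' \<in> fmeasurable lborel"
    "measure lborel J \<le> (1 + 4 * \<kappa> / u\<^sup>2) * measure lborel J'"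
    "(1 + \<kappa> / (4 * v\<^sup>2)) * measure lborel J' \<le> measure lborel J"
proof -
  have [measurable]: "J \<in> sets borel" by fact
  show J_fm: "J \<in> fmeasurable lborel"
    by (rule fmeasurableI2[of "{T R..T v}"]) (use J in auto)
  have J'_sets [measurable]: "J' \<in> sets borel" unfolding J'_def vimage_pull_eq by measurable
  have J'_v: "x \<le> v" if "x \<in> J'" for x
    using that J v T_le_iff[of x v] by (auto simp: J'_def)
  show J'_fm: "J' \<in> fmeasurable lborel"
    by (rule fmeasurableI2[of "{R..v}"]) (use J'_v in \<open>auto simp: J'_def vimage_pull_eq[symmetric] J'_sets[unfolded J'_def]\<close>)
  have u0: "u > 0" using u R_pos by simp
  have "emeasure lborel J \<le> (\<integral>\<^sup>+x. ennreal (1 + 4 * \<kappa> / u\<^sup>2) * indicator J' x \<partial>lborel)"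
    unfolding pull_measure[OF J v] J'_def[symmetric]
  proof (intro nn_integral_mono)
    fix x
    show "ennreal (T' x) * indicator J' x \<le> ennreal (1 + 4 * \<kappa> / u\<^sup>2) * indicator J' x"
    proof (cases "x \<in> J'")
      case True
      then have x: "R < x" "u \<le> x" using u by (auto simp: J'_def)
      have "4 * \<kappa> / x\<^sup>2 \<le> 4 * \<kappa> / u\<^sup>2" using x u0 \<kappa>_pos by (intro divide_left_mono power_mono) auto
      then have "T' x \<le> 1 + 4 * \<kappa> / u\<^sup>2" using T'_minus_1_le[of x] x by simp
      then show ?thesis by (intro mult_right_mono ennreal_leI) auto
    qed simp
  qed
  also have "\<dots> = ennreal (1 + 4 * \<kappa> / u\<^sup>2) * emeasure lborel J'"
    by (rule nn_integral_cmult_indicator) simp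
  finally show "measure lborel J \<le> (1 + 4 * \<kappa> / u\<^sup>2) * measure lborel J'"
    using \<kappa>_pos by (simp add: emeasure_eq_measure2[OF J_fm] emeasure_eq_measure2[OF J'_fm] ennreal_mult''[symmetric] del: ennreal_plus)
  have "ennreal (1 + \<kappa> / (4 * v\<^sup>2)) * emeasure lborel J' = (\<integral>\<^sup>+x. ennreal (1 + \<kappa> / (4 * v\<^sup>2)) * indicator J' x \<partial>lborel)"
    by (rule nn_integral_cmult_indicator[symmetric]) simp
  also have "\<dots> \<le> emeasure lborel J"
    unfolding pull_measure[OF J v] J'_def[symmetric]
  proof (intro nn_integral_mono)
    fix x
    show "ennreal (1 + \<kappa> / (4 * v\<^sup>2)) * indicator J' x \<le> ennreal (T' x) * indicator J' x"
    proof (cases "x \<in> J'")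
      case True
      then have x: "R < x" "x \<le> v" using J'_v by (auto simp: J'_def)
      have "\<kappa> / (4 * v\<^sup>2) \<le> \<kappa> / (4 * x\<^sup>2)" using x R_pos \<kappa>_pos v by (intro divide_left_mono mult_left_mono power_mono) auto
      then have "1 + \<kappa> / (4 * v\<^sup>2) \<le> T' x" using T'_minus_1_ge[of x] x by simp
      then show ?thesis by (intro mult_right_mono ennreal_leI) auto
    qed simp
  qed
  finally show "(1 + \<kappa> / (4 * v\<^sup>2)) * measure lborel J' \<le> measure lborel J"
    using \<kappa>_pos by (simp add: emeasure_eq_measure2[OF J_fm] emeasure_eq_measure2[OF J'_fm] ennreal_mult''[symmetric] del: ennreal_plus)
qed

context
  fixes S :: "real set"
  assumes S: "S \<in> sets borel" "S \<subseteq> {T R<..R}"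
begin

lemma fmeasurable_pull: "pull m S \<in> fmeasurable lborel"
  by (rule fmeasurableI2[of "{T R..level m}"]) (use pull_subset(1)[OF S(2), of m] sets_pull[OF S(1)] in auto)

lemma pull_subset_T: "pull m S \<subseteq> {T R<..T (level (Suc m))}"
  using pull_subset(1)[OF S(2)] T_level by simp

lemma R_less_level: "R < level (Suc m)"
  using level_less_Suc[of m] level_ge[of m] by simp

lemma pull_weights:
  "(\<integral>\<^sup>+x. ennreal (x + A) * indicator (pull m S) x \<partial>lborel) \<le> (\<integral>\<^sup>+x. ennreal (x + A) * indicator S x \<partial>lborel)"
  "(\<integral>\<^sup>+x. ennreal (x - A) * indicator S x \<partial>lborel) \<le> (\<integral>\<^sup>+x. ennreal (x - A) * indicator (pull m S) x \<partial>lborel)"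
proof -
  note * = sets_pull[OF S(1)] pull_subset_T R_less_level
  show "(\<integral>\<^sup>+x. ennreal (x + A) * indicator (pull m S) x \<partial>lborel) \<le> (\<integral>\<^sup>+x. ennreal (x + A) * indicator S x \<partial>lborel)"
  proof (induction m)
    case (Suc m)
    show ?case unfolding pull_Suc by (rule order_trans[OF pull_weight_plus[OF *] Suc])
  qed simp
  show "(\<integral>\<^sup>+x. ennreal (x - A) * indicator S x \<partial>lborel) \<le> (\<integral>\<^sup>+x. ennreal (x - A) * indicator (pull m S) x \<partial>lborel)"
  proof (induction m)
    case (Suc m)
    show ?case unfolding pull_Suc by (rule order_trans[OF Suc pull_weight_minus[OF *]])
  qed simp
qed

text \<open>The pulled back set lies above \<open>level m\<close> and \<open>S\<close> below
  \<open>R\<close>. Evaluating the weight \<open>x + A\<close> at these ends turns the weighted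
  inequality into one for Lebesgue measure; \<open>measure_pull_ge\<close> uses \<open>x - A\<close>
  in the same way.\<close>

lemma measure_pull_le: "(level m + A) * measure lborel (pull (Suc m) S) \<le> (R + A) * measure lborel S"
proof -
  have m [measurable]: "pull (Suc m) S \<in> sets borel" "S \<in> sets borel" by (intro sets_pull S)+
  have Sfm: "S \<in> fmeasurable lborel" using fmeasurable_pull[of 0] by simp
  have "ennreal (level m + A) * emeasure lborel (pull (Suc m) S) = (\<integral>\<^sup>+x. ennreal (level m + A) * indicator (pull (Suc m) S) x \<partial>lborel)"
    by (rule nn_integral_cmult_indicator[symmetric]) simp
  also have "\<dots> \<le> (\<integral>\<^sup>+x. ennreal (x + A) * indicator (pull (Suc m) S) x \<partial>lborel)"
    using pull_subset(2)[OF S(2), of m] by (intro nn_integral_mono) (force simp: indicator_def intro!: ennreal_leI)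
  also have "\<dots> \<le> (\<integral>\<^sup>+x. ennreal (x + A) * indicator S x \<partial>lborel)" by (rule pull_weights)
  also have "\<dots> \<le> (\<integral>\<^sup>+x. ennreal (R + A) * indicator S x \<partial>lborel)"
    using S(2) by (intro nn_integral_mono) (force simp: indicator_def intro!: ennreal_leI)
  also have "\<dots> = ennreal (R + A) * emeasure lborel S"
    by (rule nn_integral_cmult_indicator) simp
  finally show ?thesis
    using level_ge[of m] R_pos A_nonneg
    by (simp add: emeasure_eq_measure2[OF fmeasurable_pull] emeasure_eq_measure2[OF Sfm] ennreal_mult''[symmetric] del: ennreal_plus)
qed

lemma measure_pull_ge: "(T R - A) * measure lborel S \<le> level m * measure lborel (pull m S)"
proof -
  have m [measurable]: "pull m S \<in> sets borel" "S \<in> sets borel" by (intro sets_pull S)+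
  have Sfm: "S \<in> fmeasurable lborel" using fmeasurable_pull[of 0] by simp
  have "ennreal (T R - A) * emeasure lborel S = (\<integral>\<^sup>+x. ennreal (T R - A) * indicator S x \<partial>lborel)"
    by (rule nn_integral_cmult_indicator[symmetric]) simp
  also have "\<dots> \<le> (\<integral>\<^sup>+x. ennreal (x - A) * indicator S x \<partial>lborel)"
    using S(2) by (intro nn_integral_mono) (force simp: indicator_def intro!: ennreal_leI)
  also have "\<dots> \<le> (\<integral>\<^sup>+x. ennreal (x - A) * indicator (pull m S) x \<partial>lborel)" by (rule pull_weights)
  also have "\<dots> \<le> (\<integral>\<^sup>+x. ennreal (level m) * indicator (pull m S) x \<partial>lborel)"
    using pull_subset(1)[OF S(2), of m] A_nonneg by (intro nn_integral_mono) (force simp: indicator_def intro!: ennreal_leI)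
  also have "\<dots> = ennreal (level m) * emeasure lborel (pull m S)"
    by (rule nn_integral_cmult_indicator) simp
  finally show ?thesis
    using level_ge[of m] R_pos T_gt_A[of R]
    by (simp add: emeasure_eq_measure2[OF fmeasurable_pull] emeasure_eq_measure2[OF Sfm] ennreal_mult''[symmetric] del: ennreal_plus)
qed

text \<open>\<open>T\<close> preserves the measure while its tail branch is slightly expanding. The
  mass lost along that branch must come from points outside of the tail, and the loss is a fraction
  \<open>4 * \<kappa> / (level m)^2\<close>. This is the extra factor \<open>1 / m\<close> of an
  excursion from the core compared with an entrance.\<close>

lemma measure_vimage_pull:
  assumes "m \<ge> 1"
  shows "measure lborel (T -` pull m S - pull (Suc m) S) \<le> 4 * \<kappa> / (level m)\<^sup>2 * measure lborel (pull m S)"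
proof -
  have sub: "pull (Suc m) S \<subseteq> T -` pull m S" by (auto simp: pull_Suc)
  have fm: "T -` pull m S \<in> fmeasurable lborel" by (intro fmeasurable_vimage fmeasurable_pull)
  have "measure lborel (T -` pull m S - pull (Suc m) S) = measure lborel (T -` pull m S) - measure lborel (pull (Suc m) S)"
    using fm sub by (intro measure_Diff) (auto simp: fmeasurable_def sets_pull[OF S(1)] less_top[symmetric])
  also have "\<dots> = measure lborel (pull m S) - measure lborel (pull (Suc m) S)"
    using measure_vimage[OF sets_pull[OF S(1)]] by simp
  also have "\<dots> \<le> 4 * \<kappa> / (level m)\<^sup>2 * measure lborel (pull (Suc m) S)"
  proof -
    have "{x. R < x \<and> T x \<in> pull m S} \<subseteq> {level m..}"
      using pull_subset(2)[OF S(2), of m] unfolding pull_Suc by auto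
    from measure_pull_Suc(3)[OF sets_pull[OF S(1)] pull_subset_T R_less_level level_ge this]
    show ?thesis unfolding pull_Suc by (simp add: algebra_simps)
  qed
  also have "\<dots> \<le> 4 * \<kappa> / (level m)\<^sup>2 * measure lborel (pull m S)"
  proof -
    have "measure lborel (pull (Suc m) S) \<le> measure lborel (T -` pull m S)"
      by (rule measure_mono_fmeasurable[OF sub _ fm]) (simp add: sets_pull[OF S(1)])
    then show ?thesis
      using measure_vimage[OF sets_pull[OF S(1)]] \<kappa>_pos by (intro mult_left_mono) auto
  qed
  finally show ?thesis .
qed

end

end

context right_tail
begin

lemma measure_pull_bounds:
  obtains C where "C > 0"
    "\<And>S m. S \<in> sets borel \<Longrightarrow> S \<subseteq> {T R<..R} \<Longrightarrow> measure lborel (pull m S) \<le> C / sqrt (real m + 1) * measure lborel S"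
    "\<And>S m. S \<in> sets borel \<Longrightarrow> S \<subseteq> {T R<..R} \<Longrightarrow> m \<ge> 1 \<Longrightarrow>
      measure lborel (T -` pull m S - pull (Suc m) S) \<le> C / (real (Suc m) * sqrt (real (Suc m))) * measure lborel S"
proof -
  obtain c where c: "c > 0" "\<And>n. c * sqrt (real n + 1) \<le> level n"
    by (rule level_bounds) metis
  define C1 where "C1 = 1 + 2 * (R + A) / c"
  have C1: "C1 \<ge> 1" using R_pos A_nonneg c by (simp add: C1_def)
  have *: "measure lborel (pull m S) \<le> C1 / sqrt (real m + 1) * measure lborel S"
    if S: "S \<in> sets borel" "S \<subseteq> {T R<..R}" for S m
  proof (cases m)
    case 0
    have "1 * measure lborel S \<le> C1 * measure lborel S" using C1 by (intro mult_right_mono) auto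
    with 0 show ?thesis by simp
  next
    case (Suc k)
    have "c * sqrt (real k + 1) * measure lborel (pull m S) \<le> (level k + A) * measure lborel (pull m S)"
      using c(2)[of k] A_nonneg by (intro mult_right_mono) auto
    also have "\<dots> \<le> (R + A) * measure lborel S" unfolding Suc by (rule measure_pull_le[OF S])
    finally have 1: "measure lborel (pull m S) \<le> (R + A) / (c * sqrt (real k + 1)) * measure lborel S"
      using c by (simp add: field_simps)
    have "sqrt (real m + 1) \<le> sqrt (4 * (real k + 1))" by (simp add: Suc)
    also have "sqrt (4 * (real k + 1)) = 2 * sqrt (real k + 1)" by (subst real_sqrt_mult) simp
    finally have "sqrt (real m + 1) \<le> 2 * sqrt (real k + 1)" .
    then have "2 * (R + A) / c / (2 * sqrt (real k + 1)) \<le> 2 * (R + A) / c / sqrt (real m + 1)"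
      using c R_pos A_nonneg by (intro divide_left_mono) auto
    moreover have "(R + A) / (c * sqrt (real k + 1)) = 2 * (R + A) / c / (2 * sqrt (real k + 1))"
    proof -
      have "2 * (R + A) / c / (2 * sqrt (real k + 1)) = (2 * (R + A)) / (2 * (c * sqrt (real k + 1)))"
        by (simp only: divide_divide_eq_left mult.left_commute)
      also have "\<dots> = (R + A) / (c * sqrt (real k + 1))" by (rule mult_divide_mult_cancel_left) simp
      finally show ?thesis by simp
    qed
    ultimately have "(R + A) / (c * sqrt (real k + 1)) \<le> 2 * (R + A) / c / sqrt (real m + 1)" by simp
    also have "\<dots> \<le> C1 / sqrt (real m + 1)" by (intro divide_right_mono) (auto simp: C1_def)
    finally show ?thesis using 1 by (meson measure_nonneg mult_right_mono order_trans)
  qed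
  define C2 where "C2 = 4 * \<kappa> / c\<^sup>2 * C1"
  have C2: "C2 > 0" using \<kappa>_pos c C1 by (simp add: C2_def)
  show ?thesis
  proof
    show "C1 + C2 > 0" using C1 C2 by simp
    fix S m assume S: "S \<in> sets borel" "S \<subseteq> {T R<..R}"
    have "C1 / sqrt (real m + 1) * measure lborel S \<le> (C1 + C2) / sqrt (real m + 1) * measure lborel S"
      using C2 by (intro mult_right_mono divide_right_mono) auto
    then show "measure lborel (pull m S) \<le> (C1 + C2) / sqrt (real m + 1) * measure lborel S"
      using *[OF S, of m] by simp
    assume m: "m \<ge> 1"
    have l: "c\<^sup>2 * (real m + 1) \<le> (level m)\<^sup>2"
      using power_mono[OF c(2)[of m], of 2] c(1) by (simp add: power_mult_distrib)
    have "measure lborel (T -` pull m S - pull (Suc m) S) \<le> 4 * \<kappa> / (level m)\<^sup>2 * measure lborel (pull m S)"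
      by (rule measure_vimage_pull[OF S m])
    also have "\<dots> \<le> 4 * \<kappa> / (c\<^sup>2 * (real m + 1)) * (C1 / sqrt (real m + 1) * measure lborel S)"
      using \<kappa>_pos c l *[OF S, of m] level_ge[of m] R_pos
      by (intro mult_mono divide_left_mono) (auto intro!: mult_pos_pos)
    also have "\<dots> = C2 / (real (Suc m) * sqrt (real (Suc m))) * measure lborel S"
      by (simp add: C2_def add.commute)
    also have "\<dots> \<le> (C1 + C2) / (real (Suc m) * sqrt (real (Suc m))) * measure lborel S"
      using C1 by (intro mult_right_mono divide_right_mono) auto
    finally show "measure lborel (T -` pull m S - pull (Suc m) S) \<le> (C1 + C2) / (real (Suc m) * sqrt (real (Suc m))) * measure lborel S" .
  qed
qed

lemma measure_pull_lower:
  obtains c where "c > 0"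
    "\<And>S m. S \<in> sets borel \<Longrightarrow> S \<subseteq> {T R<..R} \<Longrightarrow> c / sqrt (real m + 1) * measure lborel S \<le> measure lborel (pull m S)"
proof -
  obtain C where C: "C > 0" "\<And>n. level n \<le> C * sqrt (real n + 1)"
    by (rule level_bounds) metis
  show ?thesis
  proof
    show "(T R - A) / C > 0" using T_gt_A[of R] C by simp
    fix S m assume S: "S \<in> sets borel" "S \<subseteq> {T R<..R}"
    have "(T R - A) * measure lborel S \<le> level m * measure lborel (pull m S)" by (rule measure_pull_ge[OF S])
    also have "\<dots> \<le> (C * sqrt (real m + 1)) * measure lborel (pull m S)"
      using C by (intro mult_right_mono) auto
    finally show "(T R - A) / C / sqrt (real m + 1) * measure lborel S \<le> measure lborel (pull m S)"
      using C by (simp add: field_simps)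
  qed
qed

lemma level_diff_bounds:
  obtains c C where "c > 0" "C > 0"
    "\<And>n. n \<ge> 1 \<Longrightarrow> c / sqrt n \<le> level n - level (n - 1)"
    "\<And>n. n \<ge> 1 \<Longrightarrow> level n - level (n - 1) \<le> C / sqrt n"
proof -
  obtain c C where cC: "c > 0" "C > 0" "\<And>n. c * sqrt (real n + 1) \<le> level n" "\<And>n. level n \<le> C * sqrt (real n + 1)"
    by (rule level_bounds) metis
  show ?thesis
  proof
    show "\<kappa> / (2 * (C * 2)) > 0" "2 * \<kappa> / c > 0" using cC \<kappa>_pos by auto
    fix n :: nat assume n: "n \<ge> 1"
    have l: "level n > 0" using level_ge[of n] R_pos by simp
    have step: "\<kappa> / (2 * level n) \<le> level n - level (n - 1)" "level n - level (n - 1) \<le> 2 * \<kappa> / level n"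
      using level_step[of "n - 1"] n by (cases n; simp)+
    have "sqrt (real n + 1) \<le> sqrt (4 * real n)" using n by simp
    then have "sqrt (real n + 1) \<le> 2 * sqrt n" by (simp add: real_sqrt_mult)
    then have "level n \<le> C * (2 * sqrt n)" using cC(4)[of n] cC(2) by (meson mult_left_mono order_trans less_imp_le)
    then have "\<kappa> / (2 * (C * (2 * sqrt n))) \<le> \<kappa> / (2 * level n)"
      using l \<kappa>_pos cC n by (intro divide_left_mono) auto
    with step show "\<kappa> / (2 * (C * 2)) / sqrt n \<le> level n - level (n - 1)" by (simp add: mult.assoc)
    have "c * sqrt n \<le> c * sqrt (real n + 1)" using cC by simp
    then have "c * sqrt n \<le> level n" using cC(3)[of n] by linarith
    then have "2 * \<kappa> / level n \<le> 2 * \<kappa> / (c * sqrt n)"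
      using l \<kappa>_pos cC n by (intro divide_left_mono) auto
    with step show "level n - level (n - 1) \<le> 2 * \<kappa> / c / sqrt n" by simp
  qed
qed

lemma level_tendsto: "filterlim level at_top sequentially"
proof -
  obtain c where c: "c > 0" "\<And>n. c * sqrt (real n + 1) \<le> level n"
    by (rule level_bounds) metis
  show ?thesis
    by (rule filterlim_at_top_mono[of "\<lambda>n. c * sqrt (real n + 1)"]) (use c in \<open>real_asymp, auto\<close>)
qed

end

section \<open>The two tails and the compact core between them\<close>

lemma measure_uminus_vimage:
  "S \<in> sets borel \<Longrightarrow> measure lborel (uminus -` S) = measure lborel (S :: real set)"
  using measure_distr[of uminus lborel borel S] by (simp add: lborel_distr_uminus)

locale two_tails = right_tail T T' \<kappa> A b + L: right_tail "\<lambda>x. - T (- x)" "\<lambda>x. T' (- x)" \<kappa> A c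
  for T T' :: "real \<Rightarrow> real" and \<kappa> A b c :: real
begin

definition core :: "real set" where "core = {- c..b}"

lemma funpow_mirror: "((\<lambda>x. - T (- x)) ^^ n) x = - (T ^^ n) (- x)"
  by (induction n) auto

text \<open>Points right of the core have positive images and points left of it negative ones, so an
  orbit cannot change sides without visiting the core.\<close>

lemma stays_right:
  assumes "b < x" "\<And>l. l < m \<Longrightarrow> (T ^^ l) x \<notin> core"
  shows "l < m \<Longrightarrow> b < (T ^^ l) x"
proof (induction l)
  case (Suc l)
  then have "b < (T ^^ l) x" by simp
  then have "0 < T ((T ^^ l) x)" by (intro T_pos) auto
  then show ?case using assms(2)[OF Suc.prems] L.R_pos by (auto simp: core_def)
qed (use assms in simp)

lemma stays_left:
  assumes "x < - c" "\<And>l. l < m \<Longrightarrow> (T ^^ l) x \<notin> core"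
  shows "l < m \<Longrightarrow> (T ^^ l) x < - c"
proof (induction l)
  case (Suc l)
  then have "(T ^^ l) x < - c" by simp
  then have "0 < - T (- (- (T ^^ l) x))" by (intro L.T_pos) auto
  then show ?case using assms(2)[OF Suc.prems] R_pos by (auto simp: core_def)
qed (use assms in simp)

lemma enters_right: assumes "b < x" "\<And>l. l < m \<Longrightarrow> (T ^^ l) x \<notin> core" "(T ^^ m) x \<in> S" "m \<ge> 1"
  shows "x \<in> pull m (S \<inter> {T b<..})"
proof -
  have "b < (T ^^ (m - 1)) x" using assms by (intro stays_right[of x m]) auto
  then have "T b < T ((T ^^ (m - 1)) x)" by (intro T_strict_mono) auto
  also have "T ((T ^^ (m - 1)) x) = (T ^^ m) x" using assms(4) by (cases m) auto
  finally show ?thesis using stays_right[OF assms(1,2)] assms(3) by (auto simp: pull_def)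
qed

lemma enters_left: assumes "x < - c" "\<And>l. l < m \<Longrightarrow> (T ^^ l) x \<notin> core" "(T ^^ m) x \<in> S" "m \<ge> 1"
  shows "- x \<in> L.pull m (uminus -` S \<inter> {- T (- c)<..})"
proof -
  have "(T ^^ (m - 1)) x < - c" using assms by (intro stays_left[of x m]) auto
  then have "- T (- c) < - T (- (- (T ^^ (m - 1)) x))" by (intro L.T_strict_mono) auto
  also have "T (- (- (T ^^ (m - 1)) x)) = (T ^^ m) x" using assms(4) by (cases m) auto
  finally show ?thesis using stays_left[OF assms(1,2)] assms(3)
    by (auto simp: L.pull_def funpow_mirror less_minus_iff)
qed

lemma core_fmeasurable: "core \<in> fmeasurable lborel"
  by (simp add: core_def)

lemma S_right: "S \<subseteq> core \<Longrightarrow> S \<inter> {T b<..} \<subseteq> {T b<..b}"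
  and S_left: "S \<subseteq> core \<Longrightarrow> uminus -` S \<inter> {- T (- c)<..} \<subseteq> {- T (- c)<..c}"
  by (auto simp: core_def)

lemma measure_S_right: "S \<in> sets borel \<Longrightarrow> S \<subseteq> core \<Longrightarrow> measure lborel (S \<inter> {T b<..}) \<le> measure lborel S"
  by (rule measure_mono_fmeasurable) (auto intro: fmeasurableI2[OF core_fmeasurable])

lemma sets_S_left: "S \<in> sets borel \<Longrightarrow> uminus -` S \<inter> {- T (- c)<..} \<in> sets borel"
  using measurable_sets[of uminus borel borel S] by auto

lemma measure_S_left:
  assumes S: "S \<in> sets borel" "S \<subseteq> core"
  shows "measure lborel (uminus -` S \<inter> {- T (- c)<..}) \<le> measure lborel S"
proof -
  have "measure lborel (uminus -` S \<inter> {- T (- c)<..}) \<le> measure lborel (uminus -` S)"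
  proof (rule measure_mono_fmeasurable)
    show "uminus -` S \<in> fmeasurable lborel"
      by (rule fmeasurableI2[of "{-b..c}"]) (use S measurable_sets[of uminus borel borel S] in \<open>auto simp: core_def\<close>)
  qed (use sets_S_left[OF S(1)] in auto)
  then show ?thesis using measure_uminus_vimage[OF S(1)] by simp
qed

lemma entrance_estimate:
  obtains C where "C > 0" "\<And>S m. S \<in> sets borel \<Longrightarrow> S \<subseteq> core \<Longrightarrow>
    measure lborel {x. (\<forall>l<m. (T ^^ l) x \<notin> core) \<and> (T ^^ m) x \<in> S} \<le> C / sqrt (real m + 1) * measure lborel S"
proof -
  obtain C1 where C1: "C1 > 0" "\<And>S m. S \<in> sets borel \<Longrightarrow> S \<subseteq> {T b<..b} \<Longrightarrow> measure lborel (pull m S) \<le> C1 / sqrt (real m + 1) * measure lborel S"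
    by (rule measure_pull_bounds) metis
  obtain C2 where C2: "C2 > 0" "\<And>S m. S \<in> sets borel \<Longrightarrow> S \<subseteq> {- T (- c)<..c} \<Longrightarrow> measure lborel (L.pull m S) \<le> C2 / sqrt (real m + 1) * measure lborel S"
    by (rule L.measure_pull_bounds) metis
  show ?thesis
  proof
    show "C1 + C2 + 1 > 0" using C1 C2 by simp
    fix S m assume S: "S \<in> sets borel" "S \<subseteq> core"
    let ?U = "{x. (\<forall>l<m. (T ^^ l) x \<notin> core) \<and> (T ^^ m) x \<in> S}"
    let ?S1 = "S \<inter> {T b<..}" let ?S2 = "uminus -` S \<inter> {- T (- c)<..}"
    show "measure lborel ?U \<le> (C1 + C2 + 1) / sqrt (real m + 1) * measure lborel S"
    proof (cases "m = 0")
      case True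
      have "1 * measure lborel S \<le> (C1 + C2 + 1) * measure lborel S"
        using C1 C2 by (intro mult_right_mono) auto
      with True show ?thesis by simp
    next
      case False
      have sets: "pull m ?S1 \<in> sets borel" "L.pull m ?S2 \<in> sets borel"
        using S by (auto intro!: sets_pull L.sets_pull sets_S_left)
      then have sets': "uminus -` L.pull m ?S2 \<in> sets borel"
        using measurable_sets[of uminus borel borel, OF _ sets(2)] by simp
      have fm2: "L.pull m ?S2 \<in> fmeasurable lborel"
        by (rule L.fmeasurable_pull[OF sets_S_left[OF S(1)] S_left[OF S(2)]])
      have fm: "pull m ?S1 \<in> fmeasurable lborel" "uminus -` L.pull m ?S2 \<in> fmeasurable lborel"
      proof -
        show "pull m ?S1 \<in> fmeasurable lborel" using S by (intro fmeasurable_pull S_right) auto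
        have "emeasure lborel (uminus -` L.pull m ?S2) = emeasure lborel (L.pull m ?S2)"
          using emeasure_distr[of uminus lborel borel "L.pull m ?S2"] sets(2) by (simp add: lborel_distr_uminus)
        then show "uminus -` L.pull m ?S2 \<in> fmeasurable lborel"
          using fm2 sets' by (auto simp: fmeasurable_def)
      qed
      have sub: "?U \<subseteq> pull m ?S1 \<union> uminus -` L.pull m ?S2"
      proof
        fix x assume x: "x \<in> ?U"
        then have "x \<notin> core" using False by (auto dest: spec[of _ 0])
        then consider "b < x" | "x < - c" by (force simp: core_def)
        then show "x \<in> pull m ?S1 \<union> uminus -` L.pull m ?S2"
        proof cases
          case 1 then show ?thesis using enters_right[of x m S] x False by auto
        next
          case 2 then show ?thesis using enters_left[of x m S] x False by auto
        qed
      qed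
      have U: "?U \<in> sets lborel"
      proof -
        have [measurable]: "S \<in> sets borel" "core \<in> sets borel" using S by (auto simp: core_def)
        have "{x\<in>space borel. (\<forall>l<m. (T ^^ l) x \<notin> core) \<and> (T ^^ m) x \<in> S} \<in> sets borel" by measurable
        then show ?thesis by simp
      qed
      have "measure lborel ?U \<le> measure lborel (pull m ?S1 \<union> uminus -` L.pull m ?S2)"
        by (rule measure_mono_fmeasurable[OF sub U]) (use fm in auto)
      also have "\<dots> \<le> measure lborel (pull m ?S1) + measure lborel (uminus -` L.pull m ?S2)"
        by (rule measure_Un_le) (use sets sets' in auto)
      also have "measure lborel (uminus -` L.pull m ?S2) = measure lborel (L.pull m ?S2)"
        by (rule measure_uminus_vimage[OF sets(2)])
      also have "measure lborel (pull m ?S1) + measure lborel (L.pull m ?S2)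
          \<le> C1 / sqrt (real m + 1) * measure lborel ?S1 + C2 / sqrt (real m + 1) * measure lborel ?S2"
        using S by (intro add_mono C1(2) C2(2) S_right S_left sets_S_left) auto
      also have "\<dots> \<le> C1 / sqrt (real m + 1) * measure lborel S + C2 / sqrt (real m + 1) * measure lborel S"
        using C1 C2 by (intro add_mono mult_left_mono measure_S_right measure_S_left S) auto
      also have "\<dots> = (C1 + C2) / sqrt (real m + 1) * measure lborel S"
        by (simp add: add_divide_distrib distrib_right)
      also have "\<dots> \<le> (C1 + C2 + 1) / sqrt (real m + 1) * measure lborel S"
        by (intro mult_right_mono divide_right_mono) auto
      finally show ?thesis .
    qed
  qed
qed

text \<open>After one step the orbit is in a tail and enters the core \<open>m - 1\<close> steps
  later. Its second point thus lies in a pulled back set although its first one lies in the core,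
  and such points are what \<open>measure_vimage_pull\<close> measures. For \<open>m = 1\<close>
  invariance gives the bound.\<close>

lemma excursion_estimate:
  obtains C where "C > 0" "\<And>S m. S \<in> sets borel \<Longrightarrow> S \<subseteq> core \<Longrightarrow> m \<ge> 1 \<Longrightarrow>
    measure lborel {x\<in>core. (\<forall>l. 1 \<le> l \<and> l < m \<longrightarrow> (T ^^ l) x \<notin> core) \<and> (T ^^ m) x \<in> S}
      \<le> C / (real m * sqrt m) * measure lborel S"
proof -
  obtain C1 where C1: "C1 > 0" "\<And>S m. S \<in> sets borel \<Longrightarrow> S \<subseteq> {T b<..b} \<Longrightarrow> m \<ge> 1 \<Longrightarrow>
      measure lborel (T -` pull m S - pull (Suc m) S) \<le> C1 / (real (Suc m) * sqrt (real (Suc m))) * measure lborel S"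
    by (rule measure_pull_bounds) metis
  obtain C2 where C2: "C2 > 0" "\<And>S m. S \<in> sets borel \<Longrightarrow> S \<subseteq> {- T (- c)<..c} \<Longrightarrow> m \<ge> 1 \<Longrightarrow>
      measure lborel ((\<lambda>x. - T (- x)) -` L.pull m S - L.pull (Suc m) S) \<le> C2 / (real (Suc m) * sqrt (real (Suc m))) * measure lborel S"
    by (rule L.measure_pull_bounds) metis
  show ?thesis
  proof
    show "C1 + C2 + 1 > 0" using C1 C2 by simp
    fix S m assume S: "S \<in> sets borel" "S \<subseteq> core" and m: "(m::nat) \<ge> 1"
    let ?U = "{x\<in>core. (\<forall>l. 1 \<le> l \<and> l < m \<longrightarrow> (T ^^ l) x \<notin> core) \<and> (T ^^ m) x \<in> S}"
    let ?S1 = "S \<inter> {T b<..}" let ?S2 = "uminus -` S \<inter> {- T (- c)<..}"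
    have U: "?U \<in> sets lborel"
    proof -
      have [measurable]: "S \<in> sets borel" "core \<in> sets borel" using S by (auto simp: core_def)
      have "{x\<in>space borel. x \<in> core \<and> (\<forall>l. 1 \<le> l \<and> l < m \<longrightarrow> (T ^^ l) x \<notin> core) \<and> (T ^^ m) x \<in> S} \<in> sets borel" by measurable
      then show ?thesis by simp
    qed
    show "measure lborel ?U \<le> (C1 + C2 + 1) / (real m * sqrt m) * measure lborel S"
    proof (cases "m = 1")
      case True
      have "measure lborel ?U \<le> measure lborel (T -` S)"
        using U S by (intro measure_mono_fmeasurable fmeasurable_vimage fmeasurableI2[OF core_fmeasurable]) (auto simp: True)
      also have "\<dots> = 1 * measure lborel S" using measure_vimage[OF S(1)] by simp
      also have "\<dots> \<le> (C1 + C2 + 1) * measure lborel S"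
        using C1 C2 by (intro mult_right_mono) auto
      finally show ?thesis using True by simp
    next
      case False
      define k where "k = m - 1"
      have k: "m = Suc k" "k \<ge> 1" using m False by (auto simp: k_def)
      let ?V1 = "T -` pull k ?S1 - pull (Suc k) ?S1"
      let ?V2 = "(\<lambda>x. - T (- x)) -` L.pull k ?S2 - L.pull (Suc k) ?S2"
      have S2: "?S2 \<in> sets borel" "?S2 \<subseteq> {- T (- c)<..c}" using sets_S_left[OF S(1)] S_left[OF S(2)] .
      have S1: "?S1 \<in> sets borel" "?S1 \<subseteq> {T b<..b}" using S S_right by auto
      have sets: "?V1 \<in> sets borel" "?V2 \<in> sets borel"
      proof -
        have "T -` pull k ?S1 \<in> sets borel" using sets_vimage_funpow[OF sets_pull[OF S1(1)], of 1 k] by simp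
        then show "?V1 \<in> sets borel" by (intro sets.Diff sets_pull S1)
        have "(\<lambda>x. - T (- x)) -` L.pull k ?S2 \<in> sets borel" using L.sets_vimage_funpow[OF L.sets_pull[OF S2(1)], of 1 k] by simp
        then show "?V2 \<in> sets borel" by (intro sets.Diff L.sets_pull S2)
      qed
      have sets': "uminus -` ?V2 \<in> sets borel"
        using measurable_sets[OF _ sets(2), of uminus borel] by simp
      have fm: "?V1 \<in> fmeasurable lborel" "uminus -` ?V2 \<in> fmeasurable lborel"
      proof -
        show "?V1 \<in> fmeasurable lborel"
          by (rule fmeasurableI2[OF fmeasurable_vimage[OF fmeasurable_pull[OF S1]]]) (use sets in auto)
        have "?V2 \<in> fmeasurable lborel"
          by (rule fmeasurableI2[OF L.fmeasurable_vimage[OF L.fmeasurable_pull[OF S2]]]) (use sets in auto)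
        moreover have "emeasure lborel (uminus -` ?V2) = emeasure lborel ?V2"
          using emeasure_distr[of uminus lborel borel ?V2] sets(2) by (simp add: lborel_distr_uminus)
        ultimately show "uminus -` ?V2 \<in> fmeasurable lborel"
          using sets' by (auto simp: fmeasurable_def)
      qed
      have sub: "?U \<subseteq> ?V1 \<union> uminus -` ?V2"
      proof
        fix x assume x: "x \<in> ?U"
        have out: "(T ^^ l) (T x) \<notin> core" if "l < k" for l
        proof -
          have "1 \<le> Suc l \<and> Suc l < m" using that k by simp
          then have "(T ^^ Suc l) x \<notin> core" using x by blast
          then show ?thesis by (simp add: funpow_swap1)
        qed
        have inS: "(T ^^ k) (T x) \<in> S" using x k by (simp add: funpow_swap1)
        have xK: "\<not> b < x" "\<not> c < - x" using x by (auto simp: core_def)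
        have "T x \<notin> core" using out[of 0] k by simp
        then consider "b < T x" | "T x < - c" by (force simp: core_def)
        then show "x \<in> ?V1 \<union> uminus -` ?V2"
        proof cases
          case 1 then show ?thesis using enters_right[OF 1 out inS k(2)] xK by (auto simp: pull_Suc)
        next
          case 2 then show ?thesis using enters_left[OF 2 out inS k(2)] xK by (auto simp: L.pull_Suc)
        qed
      qed
      have "measure lborel ?U \<le> measure lborel (?V1 \<union> uminus -` ?V2)"
        by (rule measure_mono_fmeasurable[OF sub U]) (use fm in auto)
      also have "\<dots> \<le> measure lborel ?V1 + measure lborel (uminus -` ?V2)"
        by (rule measure_Un_le) (use sets sets' in auto)
      also have "measure lborel (uminus -` ?V2) = measure lborel ?V2"
        by (rule measure_uminus_vimage[OF sets(2)])
      also have "measure lborel ?V1 + measure lborel ?V2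
          \<le> C1 / (real m * sqrt m) * measure lborel ?S1 + C2 / (real m * sqrt m) * measure lborel ?S2"
        unfolding k(1) by (intro add_mono C1(2) C2(2) S1 S2 k(2))
      also have "\<dots> \<le> C1 / (real m * sqrt m) * measure lborel S + C2 / (real m * sqrt m) * measure lborel S"
        using C1 C2 by (intro add_mono mult_left_mono measure_S_right measure_S_left S) auto
      also have "\<dots> = (C1 + C2) / (real m * sqrt m) * measure lborel S"
        by (simp add: add_divide_distrib distrib_right)
      also have "\<dots> \<le> (C1 + C2 + 1) / (real m * sqrt m) * measure lborel S"
        by (intro mult_right_mono divide_right_mono) auto
      finally show ?thesis .
    qed
  qed
qed

text \<open>Reduces (c) to the gaps between consecutive levels, which are \<open>\<kappa>\<close>
  divided by the level up to constant factors.\<close>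

lemma excursion_set_eq:
  assumes "n \<ge> 1"
  shows "excursion_set T (UNIV - core) n = {level (n - 1)<..level n} \<union> {- L.level n..<- L.level (n - 1)}"
proof -
  obtain k where k: "n = Suc k" using assms by (cases n) auto
  have all: "(x \<in> UNIV - core \<and> (\<forall>k. 1 \<le> k \<and> k \<le> n - 1 \<longrightarrow> (T ^^ k) x \<in> UNIV - core)) \<longleftrightarrow> (\<forall>l<n. (T ^^ l) x \<notin> core)" for x
  proof -
    have "(\<forall>l<n. (T ^^ l) x \<notin> core) \<longleftrightarrow> (T ^^ 0) x \<notin> core \<and> (\<forall>l. 1 \<le> l \<and> l \<le> n - 1 \<longrightarrow> (T ^^ l) x \<notin> core)"
      unfolding k by (auto simp: less_Suc_eq_le) (metis One_nat_def Suc_leI funpow_0 neq0_conv)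
    then show ?thesis by auto
  qed
  have eq: "excursion_set T (UNIV - core) n = {x. (\<forall>l<n. (T ^^ l) x \<notin> core) \<and> (T ^^ n) x \<in> core}"
    unfolding excursion_set_def using all by auto
  have iff: "(\<forall>l<n. (T ^^ l) x \<notin> core) \<and> (T ^^ n) x \<in> core \<longleftrightarrow> x \<in> pull n {..b} \<or> - x \<in> L.pull n {..c}" for x
  proof
    assume x: "(\<forall>l<n. (T ^^ l) x \<notin> core) \<and> (T ^^ n) x \<in> core"
    then have "x \<notin> core" using assms by (auto dest: spec[of _ 0])
    then consider "b < x" | "x < - c" by (force simp: core_def)
    then show "x \<in> pull n {..b} \<or> - x \<in> L.pull n {..c}"
    proof cases
      case 1 then show ?thesis using enters_right[of x n core] x assms by (auto simp: pull_def core_def)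
    next
      case 2 then show ?thesis using enters_left[of x n core] x assms by (auto simp: L.pull_def core_def)
    qed
  next
    assume "x \<in> pull n {..b} \<or> - x \<in> L.pull n {..c}"
    then show "(\<forall>l<n. (T ^^ l) x \<notin> core) \<and> (T ^^ n) x \<in> core"
    proof
      assume x: "x \<in> pull n {..b}"
      then have "b < (T ^^ k) x" by (auto simp: pull_def k)
      then have "0 < T ((T ^^ k) x)" by (intro T_pos) simp
      then show ?thesis using x L.R_pos by (auto simp: pull_def core_def k)
    next
      assume x: "- x \<in> L.pull n {..c}"
      then have "\<forall>l<n. c < - (T ^^ l) x" "- (T ^^ n) x \<le> c" by (auto simp: L.pull_def funpow_mirror)
      moreover from this have "c < - (T ^^ k) x" by (auto simp: k)
      then have "0 < - T (- (- (T ^^ k) x))" by (intro L.T_pos) simp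
      ultimately show ?thesis using R_pos by (auto simp: core_def k)
    qed
  qed
  show ?thesis
    unfolding eq iff unfolding k pull_below L.pull_below by (auto simp del: level.simps L.level.simps)
qed

lemma measure_excursion_set:
  assumes "n \<ge> 1"
  shows "measure lborel (excursion_set T (UNIV - core) n) = (level n - level (n - 1)) + (L.level n - L.level (n - 1))"
proof -
  have l: "level (n - 1) \<le> level n" "L.level (n - 1) \<le> L.level n" by (intro level_mono L.level_mono; simp)+
  have "measure lborel ({level (n - 1)<..level n} \<union> {- L.level n..<- L.level (n - 1)})
      = measure lborel {level (n - 1)<..level n} + measure lborel {- L.level n..<- L.level (n - 1)}"
  proof (rule measure_Union)
    have "level (n - 1) > 0" "L.level (n - 1) > 0" using level_ge[of "n - 1"] L.level_ge[of "n - 1"] R_pos L.R_pos by auto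
    then show "{level (n - 1)<..level n} \<inter> {- L.level n..<- L.level (n - 1)} = {}" by auto
  qed (use l in simp_all)
  then show ?thesis using l by (simp add: excursion_set_eq[OF assms])
qed

lemma excursion_set_asymptotics:
  "(\<lambda>n. measure lborel (excursion_set T (UNIV - core) n)) \<lesssim> (\<lambda>n. 1 / sqrt (real n))"
  "(\<lambda>n. 1 / sqrt (real n)) \<lesssim> (\<lambda>n. measure lborel (excursion_set T (UNIV - core) n))"
proof -
  obtain c1 C1 where 1: "c1 > 0" "C1 > 0"
    "\<And>n. n \<ge> 1 \<Longrightarrow> c1 / sqrt n \<le> level n - level (n - 1)" "\<And>n. n \<ge> 1 \<Longrightarrow> level n - level (n - 1) \<le> C1 / sqrt n"
    by (rule level_diff_bounds) metis
  obtain c2 C2 where 2: "c2 > 0" "C2 > 0"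
    "\<And>n. n \<ge> 1 \<Longrightarrow> c2 / sqrt n \<le> L.level n - L.level (n - 1)" "\<And>n. n \<ge> 1 \<Longrightarrow> L.level n - L.level (n - 1) \<le> C2 / sqrt n"
    by (rule L.level_diff_bounds) metis
  have "measure lborel (excursion_set T (UNIV - core) n) \<le> (C1 + C2) * (1 / sqrt n)" if "n \<ge> 1" for n
    using 1(4)[OF that] 2(4)[OF that] unfolding measure_excursion_set[OF that] by (simp add: add_divide_distrib)
  then show "(\<lambda>n. measure lborel (excursion_set T (UNIV - core) n)) \<lesssim> (\<lambda>n. 1 / sqrt (real n))"
    unfolding lesssim_def using 1 2 by (intro exI[of _ "C1 + C2"]) auto
  have "1 / sqrt n \<le> 1 / (c1 + c2) * measure lborel (excursion_set T (UNIV - core) n)" if "n \<ge> 1" for n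
  proof -
    have "(c1 + c2) * (1 / sqrt n) \<le> measure lborel (excursion_set T (UNIV - core) n)"
      using 1(3)[OF that] 2(3)[OF that] unfolding measure_excursion_set[OF that] by (simp add: add_divide_distrib)
    then have "1 / (c1 + c2) * ((c1 + c2) * (1 / sqrt n)) \<le> 1 / (c1 + c2) * measure lborel (excursion_set T (UNIV - core) n)"
      using 1 2 by (intro mult_left_mono) auto
    then show ?thesis using 1(1) 2(1) by simp
  qed
  then show "(\<lambda>n. 1 / sqrt (real n)) \<lesssim> (\<lambda>n. measure lborel (excursion_set T (UNIV - core) n))"
    unfolding lesssim_def using 1 2 by (intro exI[of _ "1 / (c1 + c2)"]) auto
qed

end

section \<open>Harmonic measures\<close>

definition poisson :: "complex \<Rightarrow> real \<Rightarrow> real" where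
  "poisson w x = Im w / (pi * ((x - Re w)\<^sup>2 + (Im w)\<^sup>2))"

definition cauchy :: "complex \<Rightarrow> real measure" where
  "cauchy w = density lborel (\<lambda>x. ennreal (poisson w x))"

lemma poisson_measurable [measurable]: "poisson w \<in> borel_measurable borel"
  unfolding poisson_def by measurable

lemma poisson_pos: "Im w > 0 \<Longrightarrow> poisson w x > 0"
  by (simp add: poisson_def add_nonneg_pos)

lemma poisson_nonneg: "Im w > 0 \<Longrightarrow> poisson w x \<ge> 0"
  using poisson_pos[of w x] by simp

lemma sets_cauchy [simp, measurable_cong]: "sets (cauchy w) = sets borel"
  and space_cauchy [simp]: "space (cauchy w) = UNIV"
  by (simp_all add: cauchy_def)

lemma emeasure_cauchy: "S \<in> sets borel \<Longrightarrow> emeasure (cauchy w) S = (\<integral>\<^sup>+x. ennreal (poisson w x) * indicator S x \<partial>lborel)"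
  by (simp add: cauchy_def emeasure_density)

lemma emeasure_cauchy_atLeast:
  assumes "Im w > 0"
  shows "emeasure (cauchy w) {x..} = ennreal (1 / 2 - arctan ((x - Re w) / Im w) / pi)"
proof -
  have "((\<lambda>x. arctan ((x - Re w) / Im w) / pi) \<longlongrightarrow> (pi / 2) / pi) at_top"
  proof (intro tendsto_intros)
    have "filterlim (\<lambda>x. (x - Re w) / Im w) at_top at_top" using assms by real_asymp
    then show "((\<lambda>x. arctan ((x - Re w) / Im w)) \<longlongrightarrow> pi / 2) at_top"
      by (rule filterlim_compose[OF tendsto_arctan_at_top])
  qed simp
  moreover have "((\<lambda>x. arctan ((x - Re w) / Im w) / pi) has_real_derivative poisson w x) (at x)" for x
  proof -
    have "((\<lambda>x. arctan ((x - Re w) / Im w) / pi) has_real_derivative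
      (inverse (1 + ((x - Re w) / Im w)\<^sup>2) * (1 / Im w)) / pi) (at x)"
      using assms by (auto intro!: derivative_eq_intros)
    moreover have "(inverse (1 + ((x - Re w) / Im w)\<^sup>2) * (1 / Im w)) / pi = poisson w x"
    proof -
      have "1 + ((x - Re w) / Im w)\<^sup>2 = ((x - Re w)\<^sup>2 + (Im w)\<^sup>2) / (Im w)\<^sup>2"
        using assms by (simp add: field_simps)
      then show ?thesis using assms by (simp add: poisson_def power2_eq_square)
    qed
    ultimately show ?thesis by simp
  qed
  ultimately have "(\<integral>\<^sup>+t. ennreal (poisson w t) * indicator {x..} t \<partial>lborel)
      = ennreal ((pi / 2) / pi - arctan ((x - Re w) / Im w) / pi)"
    by (intro nn_integral_FTC_atLeast) (use assms in \<open>auto intro: poisson_nonneg\<close>)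
  then show ?thesis by (simp add: emeasure_cauchy)
qed

lemma prob_space_cauchy: "Im w > 0 \<Longrightarrow> prob_space (cauchy w)"
proof
  assume w: "Im w > 0"
  have "(\<lambda>n. emeasure (cauchy w) {- real n..}) \<longlonglongrightarrow> emeasure (cauchy w) (\<Union>n. {- real n..})"
    by (rule Lim_emeasure_incseq) (auto simp: incseq_def)
  moreover have "(\<Union>n. {- real n..}) = UNIV"
    by (auto simp: minus_le_iff intro!: real_arch_simple)
  moreover have "(\<lambda>n. ennreal (1 / 2 - arctan ((- real n - Re w) / Im w) / pi)) \<longlonglongrightarrow> ennreal (1 / 2 - (- (pi / 2)) / pi)"
  proof (intro tendsto_ennrealI tendsto_intros)
    have "filterlim (\<lambda>n. (- real n - Re w) / Im w) at_bot sequentially" using w by real_asymp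
    then show "(\<lambda>n. arctan ((- real n - Re w) / Im w)) \<longlonglongrightarrow> - (pi / 2)"
      by (rule filterlim_compose[OF tendsto_arctan_at_bot])
  qed simp
  ultimately have "emeasure (cauchy w) UNIV = ennreal (1 / 2 - (- (pi / 2)) / pi)"
    by (intro LIMSEQ_unique[of "\<lambda>n. emeasure (cauchy w) {- real n..}"]) (simp_all add: emeasure_cauchy_atLeast[OF w])
  then show "emeasure (cauchy w) (space (cauchy w)) = 1" by simp
qed

lemma real_distribution_cauchy: "Im w > 0 \<Longrightarrow> real_distribution (cauchy w)"
  using prob_space_cauchy[of w] by (simp add: real_distribution_def real_distribution_axioms_def)

lemma integrable_poisson:
  assumes "Im w > 0"
  shows "integrable lborel (poisson w)" "(\<integral>x. poisson w x \<partial>lborel) = 1"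
proof -
  interpret prob_space "cauchy w" by (rule prob_space_cauchy[OF assms])
  have 1: "(\<integral>\<^sup>+x. ennreal (poisson w x) \<partial>lborel) = 1"
    using emeasure_space_1 emeasure_cauchy[of UNIV w] by simp
  show "integrable lborel (poisson w)"
    by (rule integrableI_nonneg) (use 1 poisson_nonneg[OF assms] in auto)
  show "(\<integral>x. poisson w x \<partial>lborel) = 1"
    by (subst integral_eq_nn_integral) (use 1 poisson_nonneg[OF assms] in auto)
qed

lemma measure_cauchy:
  assumes "Im w > 0" "S \<in> sets borel"
  shows "measure (cauchy w) S = (\<integral>x. poisson w x * indicator S x \<partial>lborel)"
  unfolding measure_def emeasure_cauchy[OF assms(2)]
  by (subst integral_eq_nn_integral)
    (use assms poisson_nonneg[OF assms(1)] in \<open>auto intro!: arg_cong[where f = enn2real] nn_integral_cong simp: ennreal_mult' split: split_indicator\<close>)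

lemma integrable_poisson_indicator:
  assumes "Im w > 0" "S \<in> sets borel"
  shows "integrable lborel (\<lambda>x. poisson w x * indicator S x)"
  using integrable_real_mult_indicator[OF _ integrable_poisson(1)[OF assms(1)], of S] assms(2) by simp

text \<open>If \<open>Im w\<close> is large and \<open>Re w\<close> small compared with it, both
  constants are close to \<open>1 / (pi * Im w)\<close>. On bounded sets rescaled harmonic measures
  thus approximate Lebesgue measure.\<close>

lemma measure_cauchy_bounds:
  assumes w: "Im w > 0" and S: "S \<in> sets borel" "S \<subseteq> {- \<rho>..\<rho>}"
  shows "measure (cauchy w) S \<le> 1 / (pi * Im w) * measure lborel S"
    "Im w / (pi * ((\<rho> + \<bar>Re w\<bar>)\<^sup>2 + (Im w)\<^sup>2)) * measure lborel S \<le> measure (cauchy w) S"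
proof -
  have fm: "S \<in> fmeasurable lborel" by (rule fmeasurableI2[of "{- \<rho>..\<rho>}"]) (use S in auto)
  have int: "integrable lborel (\<lambda>x. c * indicator S x :: real)" for c
    using fm by (auto simp: fmeasurable_def)
  have "measure (cauchy w) S \<le> (\<integral>x. 1 / (pi * Im w) * indicator S x \<partial>lborel)"
    unfolding measure_cauchy[OF w S(1)]
  proof (intro integral_mono int integrable_poisson_indicator w S mult_right_mono)
    fix x
    have "poisson w x \<le> Im w / (pi * (0 + (Im w)\<^sup>2))"
      unfolding poisson_def using w by (intro divide_left_mono mult_left_mono add_right_mono mult_pos_pos add_nonneg_pos) auto
    then show "poisson w x \<le> 1 / (pi * Im w)" using w by (simp add: power2_eq_square)
  qed simp
  then show "measure (cauchy w) S \<le> 1 / (pi * Im w) * measure lborel S" using fm by (simp add: fmeasurable_def)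
  have "(\<integral>x. Im w / (pi * ((\<rho> + \<bar>Re w\<bar>)\<^sup>2 + (Im w)\<^sup>2)) * indicator S x \<partial>lborel) \<le> measure (cauchy w) S"
    unfolding measure_cauchy[OF w S(1)]
  proof (intro integral_mono int integrable_poisson_indicator w S)
    fix x
    show "Im w / (pi * ((\<rho> + \<bar>Re w\<bar>)\<^sup>2 + (Im w)\<^sup>2)) * indicator S x \<le> poisson w x * indicator S x"
    proof (cases "x \<in> S")
      case True
      then have "\<bar>x - Re w\<bar> \<le> \<bar>\<rho> + \<bar>Re w\<bar>\<bar>" using S by force
      then have "(x - Re w)\<^sup>2 \<le> (\<rho> + \<bar>Re w\<bar>)\<^sup>2" by (simp only: abs_le_square_iff)
      then show ?thesis unfolding poisson_def using w True
        by (intro mult_right_mono divide_left_mono mult_left_mono add_right_mono mult_pos_pos add_nonneg_pos) auto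
    qed simp
  qed
  then show "Im w / (pi * ((\<rho> + \<bar>Re w\<bar>)\<^sup>2 + (Im w)\<^sup>2)) * measure lborel S \<le> measure (cauchy w) S"
    using fm by (simp add: fmeasurable_def)
qed

section \<open>Parabolic maps of the half-plane and their boundary maps\<close>

lemma cesaro_zero:
  fixes d :: "nat \<Rightarrow> 'a::real_normed_vector"
  assumes "d \<longlonglongrightarrow> 0"
  shows "(\<lambda>n. (1 / real n) *\<^sub>R (\<Sum>k<n. d k)) \<longlonglongrightarrow> 0"
proof (rule LIMSEQ_I)
  fix e :: real assume e: "e > 0"
  obtain N where N: "\<And>n. n \<ge> N \<Longrightarrow> norm (d n) < e / 2"
    using LIMSEQ_D[OF assms, of "e / 2"] e by auto
  define B where "B = (\<Sum>k<N. norm (d k))"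
  have "eventually (\<lambda>n. B / real n < e / 2) sequentially" using e by real_asymp
  then obtain N' where N': "\<And>n. n \<ge> N' \<Longrightarrow> B / real n < e / 2" by (auto simp: eventually_sequentially)
  have "norm ((1 / real n) *\<^sub>R (\<Sum>k<n. d k)) < e" if n: "n \<ge> max (max N N') 1" for n
  proof -
    have "{..<n} = {..<N} \<union> {N..<n}" using n by auto
    then have "norm (\<Sum>k<n. d k) \<le> (\<Sum>k\<in>{..<N} \<union> {N..<n}. norm (d k))" by (simp add: norm_sum)
    also have "\<dots> = B + (\<Sum>k=N..<n. norm (d k))" unfolding B_def by (rule sum.union_disjoint) auto
    also have "(\<Sum>k=N..<n. norm (d k)) \<le> (\<Sum>k=N..<n. e / 2)" by (intro sum_mono) (use N in \<open>auto intro: less_imp_le\<close>)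
    also have "\<dots> \<le> real n * (e / 2)" using e by (simp add: mult_right_mono)
    finally have "norm (\<Sum>k<n. d k) \<le> B + real n * (e / 2)" by simp
    then have "norm (\<Sum>k<n. d k) / real n \<le> (B + real n * (e / 2)) / real n" by (intro divide_right_mono) auto
    also have "\<dots> = B / real n + e / 2" using n by (simp add: add_divide_distrib)
    also have "B / real n < e / 2" by (rule N') (use n in simp)
    finally show ?thesis using n by simp
  qed
  then show "\<exists>no. \<forall>n\<ge>no. norm ((1 / real n) *\<^sub>R (\<Sum>k<n. d k) - 0) < e"
    unfolding diff_zero by blast
qed

text \<open>Interface between complex analysis and dynamics: visits, returns and excursions are
  treated from these properties. The sign of \<open>\<kappa>\<close> is left open; it follows from
  the invariance of Lebesgue measure.\<close>

locale parabolic_map =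
  fixes h :: "complex \<Rightarrow> complex" and T T' :: "real \<Rightarrow> real" and \<kappa> C R :: real
  assumes T_borel [measurable]: "T \<in> borel_measurable borel"
    and h_upper: "\<And>w. Im w > 0 \<Longrightarrow> Im (h w) > 0"
    and h_holomorphic: "h holomorphic_on {w. Im w > 0}"
    and distr_cauchy: "\<And>w. Im w > 0 \<Longrightarrow> distr (cauchy w) borel T = cauchy (h w)"
    and h_iterates: "\<And>w. Im w > 0 \<Longrightarrow> filterlim (\<lambda>n. (h ^^ n) w) at_infinity sequentially"
    and C_pos: "C > 0" and R_pos: "R > 0" and \<kappa>_nonzero: "\<kappa> \<noteq> 0"
    and h_asymp: "\<And>w. Im w > 0 \<Longrightarrow> norm w > R \<Longrightarrow> norm (h w - w + of_real \<kappa> / w) \<le> C / (norm w)\<^sup>2"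
    and T_asymp: "\<And>x. \<bar>x\<bar> > R \<Longrightarrow> \<bar>T x - x + \<kappa> / x\<bar> \<le> C / x\<^sup>2"
    and T_deriv: "\<And>x. \<bar>x\<bar> > R \<Longrightarrow> (T has_real_derivative T' x) (at x)"
    and T'_cont: "continuous_on {x. \<bar>x\<bar> > R} T'"
    and T'_asymp: "\<And>x. \<bar>x\<bar> > R \<Longrightarrow> \<bar>T' x - 1 - \<kappa> / x\<^sup>2\<bar> \<le> C / \<bar>x\<bar> ^ 3"
begin

lemma h_asymp_imaginary: "(\<lambda>n. h (\<i> * of_real (real n)) / of_real (real n) ) \<longlonglongrightarrow> \<i>"
proof -
  have "(\<lambda>n. h (\<i> * of_real (real n)) / of_real (real n) - \<i>) \<longlonglongrightarrow> 0"
  proof (rule Lim_null_comparison)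
    show "eventually (\<lambda>n. norm (h (\<i> * of_real (real n)) / of_real (real n) - \<i>) \<le> (\<bar>\<kappa>\<bar> / real n + C / (real n)\<^sup>2) / real n) sequentially"
      using eventually_gt_at_top[of "nat \<lceil>R\<rceil>"]
    proof eventually_elim
      case (elim n)
      then have n: "real n > R" "n > 0" by linarith+
      let ?w = "\<i> * of_real (real n)"
      have "norm (h ?w - ?w + of_real \<kappa> / ?w) \<le> C / (real n)\<^sup>2"
        using h_asymp[of ?w] n R_pos by (simp add: norm_mult)
      moreover have "norm (of_real \<kappa> / ?w) = \<bar>\<kappa>\<bar> / real n" by (simp add: norm_divide norm_mult)
      moreover have "norm (h ?w - ?w) \<le> norm (h ?w - ?w + of_real \<kappa> / ?w) + norm (of_real \<kappa> / ?w)"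
        using norm_triangle_ineq4[of "h ?w - ?w + of_real \<kappa> / ?w" "of_real \<kappa> / ?w"] by simp
      ultimately have "norm (h ?w - ?w) \<le> \<bar>\<kappa>\<bar> / real n + C / (real n)\<^sup>2" by simp
      then have "norm (h ?w - ?w) / real n \<le> (\<bar>\<kappa>\<bar> / real n + C / (real n)\<^sup>2) / real n"
        by (intro divide_right_mono) auto
      moreover have "h ?w / of_real (real n) - \<i> = (h ?w - ?w) / of_real (real n)"
        using n by (simp add: field_simps)
      ultimately show ?case by (simp add: norm_divide)
    qed
    show "(\<lambda>n. (\<bar>\<kappa>\<bar> / real n + C / (real n)\<^sup>2) / real n) \<longlonglongrightarrow> 0" by real_asymp
  qed
  then show ?thesis by (rule LIM_zero_cancel)
qed

lemma measure_cauchy_vimage: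
  assumes "Im w > 0" "S \<in> sets borel"
  shows "emeasure (cauchy w) (T -` S) = emeasure (cauchy (h w)) S"
  using arg_cong[OF distr_cauchy[OF assms(1)], of "\<lambda>M. emeasure M S"] assms by (simp add: emeasure_distr)

text \<open>Multiplied by \<open>pi * n\<close>, the harmonic measure seen from
  \<open>\<i> * n\<close> increases to Lebesgue measure. Its image under \<open>T\<close> is the one
  seen from \<open>h (\<i> * n)\<close>, which has the same limit on bounded sets since
  \<open>h (\<i> * n) / n\<close> tends to \<open>\<i>\<close>.\<close>

lemma emeasure_vimage_Ioo:
  assumes "l \<le> u"
  shows "emeasure lborel (T -` {l<..<u}) = ennreal (u - l)"
proof -
  define S where "S = {l<..<u}"
  have S [measurable]: "S \<in> sets borel" "T -` S \<in> sets borel"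
    using measurable_sets[OF T_borel, of S] by (auto simp: S_def)
  define f where "f n x = ennreal ((real n)\<^sup>2 / (x\<^sup>2 + (real n)\<^sup>2)) * indicator (T -` S) x" for n x
  have f_n: "(\<integral>\<^sup>+x. f n x \<partial>lborel) = ennreal (pi * real n) * emeasure (cauchy (\<i> * of_real (real n))) (T -` S)" for n
  proof -
    have "ennreal (pi * real n) * emeasure (cauchy (\<i> * of_real (real n))) (T -` S)
       = (\<integral>\<^sup>+x. ennreal (pi * real n) * (ennreal (poisson (\<i> * of_real (real n)) x) * indicator (T -` S) x) \<partial>lborel)"
      by (simp add: emeasure_cauchy nn_integral_cmult)
    also have "\<dots> = (\<integral>\<^sup>+x. f n x \<partial>lborel)"
      unfolding f_def mult.assoc[symmetric]
      by (intro nn_integral_cong arg_cong2[where f = "(*)"] refl)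
        (simp add: poisson_def ennreal_mult'[symmetric] power2_eq_square mult_ac)
    finally show ?thesis by simp
  qed
  have mono: "incseq f"
  proof (intro incseq_SucI le_funI)
    fix n x
    have "(real n)\<^sup>2 / (x\<^sup>2 + (real n)\<^sup>2) \<le> (real (Suc n))\<^sup>2 / (x\<^sup>2 + (real (Suc n))\<^sup>2)"
    proof (cases "n = 0")
      case False
      have "(real n)\<^sup>2 \<le> (real (Suc n))\<^sup>2" by (intro power_mono) auto
      then have "(real n)\<^sup>2 * x\<^sup>2 \<le> (real (Suc n))\<^sup>2 * x\<^sup>2" by (intro mult_right_mono) auto
      then show ?thesis using False by (simp add: divide_simps add_nonneg_pos add_pos_nonneg algebra_simps)
    qed simp
    then show "f n x \<le> f (Suc n) x" unfolding f_def by (intro mult_right_mono ennreal_leI) auto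
  qed
  have lim1: "(\<lambda>n. \<integral>\<^sup>+x. f n x \<partial>lborel) \<longlonglongrightarrow> emeasure lborel (T -` S)"
  proof -
    have "(\<lambda>n. \<integral>\<^sup>+x. f n x \<partial>lborel) \<longlonglongrightarrow> (\<integral>\<^sup>+x. indicator (T -` S) x \<partial>lborel)"
    proof (rule nn_integral_LIMSEQ[OF mono])
      show "f n \<in> borel_measurable lborel" for n unfolding f_def by measurable
      fix x
      have "(\<lambda>n. (real n)\<^sup>2 / (x\<^sup>2 + (real n)\<^sup>2)) \<longlonglongrightarrow> 1" by real_asymp
      then have "(\<lambda>n. ennreal ((real n)\<^sup>2 / (x\<^sup>2 + (real n)\<^sup>2))) \<longlonglongrightarrow> 1"
        using tendsto_ennrealI by fastforce
      then show "(\<lambda>n. f n x) \<longlonglongrightarrow> indicator (T -` S) x"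
        unfolding f_def by (cases "x \<in> T -` S") auto
    qed
    then show ?thesis by simp
  qed
  define w where "w n = h (\<i> * of_real (real n))" for n
  define \<rho> where "\<rho> = \<bar>l\<bar> + \<bar>u\<bar>"
  have S\<rho>: "S \<subseteq> {- \<rho>..\<rho>}" by (auto simp: S_def \<rho>_def)
  have mS: "measure lborel S = u - l" using assms by (simp add: S_def)
  have re: "(\<lambda>n. Re (w n) / real n) \<longlonglongrightarrow> 0" and im: "(\<lambda>n. Im (w n) / real n) \<longlonglongrightarrow> 1"
    using tendsto_Re[OF h_asymp_imaginary] tendsto_Im[OF h_asymp_imaginary] by (auto simp: w_def)
  have lim2: "(\<lambda>n. pi * real n * measure (cauchy (w n)) S) \<longlonglongrightarrow> u - l"
  proof (rule tendsto_sandwich)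
    have w_pos: "Im (w n) > 0" if "n > 0" for n unfolding w_def using that by (intro h_upper) auto
    show "eventually (\<lambda>n. (Im (w n) / real n) / ((\<rho> / real n + \<bar>Re (w n) / real n\<bar>)\<^sup>2 + (Im (w n) / real n)\<^sup>2) * (u - l) \<le> pi * real n * measure (cauchy (w n)) S) sequentially"
      using eventually_gt_at_top[of 0]
    proof eventually_elim
      case (elim n)
      have "pi * real n * (Im (w n) / (pi * ((\<rho> + \<bar>Re (w n)\<bar>)\<^sup>2 + (Im (w n))\<^sup>2)) * (u - l)) \<le> pi * real n * measure (cauchy (w n)) S"
        using measure_cauchy_bounds(2)[OF w_pos[OF elim] S(1) S\<rho>] by (intro mult_left_mono) (auto simp: mS)
      moreover have "(\<rho> / real n + \<bar>Re (w n) / real n\<bar>)\<^sup>2 + (Im (w n) / real n)\<^sup>2 = ((\<rho> + \<bar>Re (w n)\<bar>)\<^sup>2 + (Im (w n))\<^sup>2) / (real n)\<^sup>2"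
        using elim by (simp add: power_divide add_divide_distrib flip: add_divide_distrib)
      ultimately show ?case using elim by (simp add: power2_eq_square mult_ac)
    qed
    show "eventually (\<lambda>n. pi * real n * measure (cauchy (w n)) S \<le> 1 / (Im (w n) / real n) * (u - l)) sequentially"
      using eventually_gt_at_top[of 0]
    proof eventually_elim
      case (elim n)
      have "pi * real n * measure (cauchy (w n)) S \<le> pi * real n * (1 / (pi * Im (w n)) * (u - l))"
        using measure_cauchy_bounds(1)[OF w_pos[OF elim] S(1) S\<rho>] by (intro mult_left_mono) (auto simp: mS)
      then show ?case by simp
    qed
    have "(\<lambda>n. (Im (w n) / real n) / ((\<rho> / real n + \<bar>Re (w n) / real n\<bar>)\<^sup>2 + (Im (w n) / real n)\<^sup>2) * (u - l)) \<longlonglongrightarrow> 1 / ((0 + \<bar>0\<bar>)\<^sup>2 + 1\<^sup>2) * (u - l)"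
      by (intro tendsto_intros re im) (simp | real_asymp)+
    then show "(\<lambda>n. (Im (w n) / real n) / ((\<rho> / real n + \<bar>Re (w n) / real n\<bar>)\<^sup>2 + (Im (w n) / real n)\<^sup>2) * (u - l)) \<longlonglongrightarrow> u - l"
      by simp
    have "(\<lambda>n. 1 / (Im (w n) / real n) * (u - l)) \<longlonglongrightarrow> 1 / 1 * (u - l)"
      by (intro tendsto_intros im) simp
    then show "(\<lambda>n. 1 / (Im (w n) / real n) * (u - l)) \<longlonglongrightarrow> u - l" by simp
  qed
  have "(\<lambda>n. \<integral>\<^sup>+x. f n x \<partial>lborel) \<longlonglongrightarrow> ennreal (u - l)"
  proof (rule Lim_transform_eventually[OF tendsto_ennrealI[OF lim2]])
    show "eventually (\<lambda>n. ennreal (pi * real n * measure (cauchy (w n)) S) = (\<integral>\<^sup>+x. f n x \<partial>lborel)) sequentially"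
      using eventually_gt_at_top[of 0]
    proof eventually_elim
      case (elim n)
      then have i: "Im (\<i> * of_real (real n)) > 0" by simp
      interpret prob_space "cauchy (w n)" unfolding w_def by (intro prob_space_cauchy h_upper i)
      show ?case
        unfolding f_n measure_cauchy_vimage[OF i S(1)] w_def[symmetric] emeasure_eq_measure by (simp add: ennreal_mult')
    qed
  qed
  then show ?thesis using LIMSEQ_unique[OF lim1] by (simp add: S_def)
qed

sublocale lebesgue_preserving T
proof
  have "lborel = distr lborel borel T"
  proof (rule lborel_eqI)
    fix l u :: real
    assume "\<And>b. b \<in> Basis \<Longrightarrow> l \<bullet> b \<le> u \<bullet> b"
    then show "emeasure (distr lborel borel T) (box l u) = ennreal (\<Prod>b\<in>Basis. (u - l) \<bullet> b)"
      using emeasure_vimage_Ioo[of l u] by (simp add: emeasure_distr box_real)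
  qed simp
  then show "distr lborel borel T = lborel" by simp
qed (rule T_borel)

text \<open>For \<open>\<kappa> < 0\<close> points near infinity would move outwards. The preimages
  of \<open>{- \<rho>..\<rho>}\<close> and of the gap between \<open>\<rho>\<close> and
  \<open>T \<rho>\<close> would then both lie in \<open>{- \<rho>..\<rho>}\<close>, whose measure is
  too small for that.\<close>

lemma \<kappa>_pos: "\<kappa> > 0"
proof (rule ccontr)
  assume "\<not> \<kappa> > 0"
  then have \<kappa>: "\<kappa> < 0" using \<kappa>_nonzero by simp
  \<comment> \<open>The summand \<open>C / (- \<kappa>)\<close> makes the error in
    \<open>T_asymp\<close> smaller than the drift, and \<open>- \<kappa> + C\<close> makes
    \<open>T'\<close> positive.\<close>
  define \<rho> where "\<rho> = R + 1 + C / (- \<kappa>) + (- \<kappa>) + C"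
  have \<rho>: "\<rho> > R" "\<rho> > C / (- \<kappa>)" "\<rho> > 1" "\<rho> > - \<kappa> + C"
    using \<kappa> C_pos R_pos divide_pos_pos[of C "- \<kappa>"] by (auto simp: \<rho>_def)
  have out: "sgn x * (T x - x) > 0" if "\<bar>x\<bar> \<ge> \<rho>" for x
  proof -
    have x: "\<bar>x\<bar> > R" "\<bar>x\<bar> > C / (- \<kappa>)" "x \<noteq> 0" using that \<rho> by auto
    have "\<bar>sgn x * (T x - x + \<kappa> / x)\<bar> \<le> C / x\<^sup>2"
      using T_asymp[OF x(1)] x(3) by (simp add: abs_mult abs_sgn_eq)
    moreover have "sgn x * (\<kappa> / x) = \<kappa> / \<bar>x\<bar>" using x by (simp add: sgn_if abs_if)
    moreover have "C / x\<^sup>2 < - \<kappa> / \<bar>x\<bar>"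
    proof -
      have "C < - \<kappa> * \<bar>x\<bar>" using x \<kappa> by (simp add: field_simps)
      moreover have "0 < \<bar>x\<bar> * \<bar>x\<bar>" using x by (intro mult_pos_pos) auto
      ultimately have "C / (\<bar>x\<bar> * \<bar>x\<bar>) < - \<kappa> * \<bar>x\<bar> / (\<bar>x\<bar> * \<bar>x\<bar>)" by (rule divide_strict_right_mono)
      also have "- \<kappa> * \<bar>x\<bar> / (\<bar>x\<bar> * \<bar>x\<bar>) = - \<kappa> / \<bar>x\<bar>" using x by (simp add: field_simps)
      also have "\<bar>x\<bar> * \<bar>x\<bar> = x\<^sup>2" by (simp add: power2_eq_square)
      finally show ?thesis .
    qed
    ultimately show ?thesis unfolding abs_le_iff by (simp add: ring_distribs)
  qed
  have T'_pos: "T' x > 0" if "x \<ge> \<rho>" for x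
  proof -
    have x: "x > R" "x > 1" "x > - \<kappa> + C" using that \<rho> by auto
    have "\<bar>T' x - 1 - \<kappa> / x\<^sup>2\<bar> \<le> C / x ^ 3" using T'_asymp[of x] x by simp
    moreover have "x \<le> x ^ 3" "x \<le> x ^ 2" using x power_increasing[of 1 3 x] power_increasing[of 1 2 x] by auto
    moreover from this have "C / x ^ 3 \<le> C / x" "- \<kappa> / x\<^sup>2 \<le> - \<kappa> / x"
      using x C_pos \<kappa> by (auto intro!: divide_left_mono mult_pos_pos simp del: minus_divide_left[symmetric])
    moreover have "(- \<kappa> + C) / x < 1" using x by simp
    then have "- \<kappa> / x + C / x < 1" by (simp only: add_divide_distrib)
    ultimately show ?thesis by linarith
  qed
  have mono: "T \<rho> \<le> T x" if "\<rho> \<le> x" for x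
  proof (rule DERIV_nonneg_imp_nondecreasing[OF that])
    fix y assume "\<rho> \<le> y" "y \<le> x"
    then show "\<exists>d. (T has_real_derivative d) (at y) \<and> 0 \<le> d"
      using T_deriv[of y] T'_pos[of y] \<rho> by (intro exI[of _ "T' y"]) auto
  qed
  define S where "S = {\<rho><..<T \<rho>}"
  have T\<rho>: "T \<rho> > \<rho>" using out[of \<rho>] \<rho> by (simp add: sgn_if)
  have S: "S \<in> sets borel" "measure lborel S = T \<rho> - \<rho>" using T\<rho> by (auto simp: S_def)
  have 1: "T -` S \<union> T -` {-\<rho>..\<rho>} \<subseteq> {-\<rho>..\<rho>}"
  proof
    fix x assume x: "x \<in> T -` S \<union> T -` {-\<rho>..\<rho>}"
    show "x \<in> {-\<rho>..\<rho>}"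
    proof (rule ccontr)
      assume "x \<notin> {-\<rho>..\<rho>}"
      then consider "x > \<rho>" | "x < - \<rho>" by force
      then show False
      proof cases
        case 1
        then show ?thesis using x mono[of x] out[of x] \<rho> by (auto simp: S_def sgn_if)
      next
        case 2
        then show ?thesis using x out[of x] \<rho> by (auto simp: S_def sgn_if)
      qed
    qed
  qed
  have sets: "T -` S \<in> sets lborel" "T -` {-\<rho>..\<rho>} \<in> sets lborel"
    using sets_vimage_funpow[of _ 1] S by auto
  have "measure lborel (T -` S) + measure lborel (T -` {-\<rho>..\<rho>}) = measure lborel (T -` S \<union> T -` {-\<rho>..\<rho>})"
  proof (rule measure_Union[symmetric])
    show "emeasure lborel (T -` S) \<noteq> \<infinity>" "emeasure lborel (T -` {-\<rho>..\<rho>}) \<noteq> \<infinity>"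
      using T\<rho> \<rho> by (auto simp: emeasure_vimage S_def)
  qed (use sets in \<open>auto simp: S_def\<close>)
  also have "\<dots> \<le> measure lborel {-\<rho>..\<rho>}"
    by (rule measure_mono_fmeasurable[OF 1]) (use sets in auto)
  finally show False using S T\<rho> by (simp add: measure_vimage)
qed

end

section \<open>Visits, return times and excursions\<close>

text \<open>\<open>A\<close> and \<open>R1\<close> depend on \<open>\<kappa>\<close>,
  \<open>C\<close> and \<open>R\<close> only, so the same values serve both tails and every end
  point \<open>b \<ge> R1\<close>.\<close>

lemma right_tail_exists:
  assumes "\<kappa> > 0" "C > 0" "R > 0"
  obtains A R1 where "R1 > R" "A \<ge> 0"
    "\<And>f f' b. lebesgue_preserving f \<Longrightarrow> R1 \<le> b \<Longrightarrow>
      (\<And>x. x > R \<Longrightarrow> \<bar>f x - x + \<kappa> / x\<bar> \<le> C / x\<^sup>2) \<Longrightarrow>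
      (\<And>x. x > R \<Longrightarrow> (f has_real_derivative f' x) (at x)) \<Longrightarrow>
      continuous_on {R<..} f' \<Longrightarrow>
      (\<And>x. x > R \<Longrightarrow> \<bar>f' x - 1 - \<kappa> / x\<^sup>2\<bar> \<le> C / x ^ 3) \<Longrightarrow> right_tail f f' \<kappa> A b"
proof -
  \<comment> \<open>With \<open>u = 1 / x\<close> the inequality for \<open>x + A\<close> requires
    \<open>\<kappa> * A \<ge> 2 * C\<close> at order \<open>u^2\<close>. The surplus 1 pays for the
    cubic term, whose coefficient is \<open>D\<close>, as soon as
    \<open>D * u \<le> 1\<close>.\<close>
  define A where "A = (2 * C + 1) / \<kappa>"
  have A: "A > 0" "\<kappa> * A = 2 * C + 1" using assms by (auto simp: A_def)
  define D where "D = C * A + 2 * \<kappa>\<^sup>2"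
  define R1 where "R1 = R + 1 + D + A + 2 * C / \<kappa> + 8 * \<kappa> + 4 * A"
  have D: "D > 0" using assms A by (simp add: D_def add_pos_nonneg)
  have q: "2 * C / \<kappa> > 0" using assms by simp
  have R1: "R1 > R" "R1 > 1" "R1 > D" "R1 > A" "R1 > 2 * C / \<kappa>" "R1 > 8 * \<kappa>" "R1 > 4 * A" "R1 > 4 * A + 8 * \<kappa>"
    using assms A D q unfolding R1_def by linarith+
  show ?thesis
  proof
    show "R1 > R" by fact
    show "A \<ge> 0" using A by simp
    fix f f' b
    assume leb: "lebesgue_preserving f" and b: "R1 \<le> b"
      and f: "\<And>x. x > R \<Longrightarrow> \<bar>f x - x + \<kappa> / x\<bar> \<le> C / x\<^sup>2"
      and deriv: "\<And>x. x > R \<Longrightarrow> (f has_real_derivative f' x) (at x)"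
      and cont: "continuous_on {R<..} f'"
      and f': "\<And>x. x > R \<Longrightarrow> \<bar>f' x - 1 - \<kappa> / x\<^sup>2\<bar> \<le> C / x ^ 3"
    interpret lebesgue_preserving f by (rule leb)
    show "right_tail f f' \<kappa> A b"
    proof
      fix x assume xb: "x \<ge> b"
      have x: "x > R" "x > 1" "x > D" "x > A" "x > 2 * C / \<kappa>" "x > 8 * \<kappa>" "x > 4 * A" "x > 4 * A + 8 * \<kappa>" using xb b R1 by auto
      define u where "u = 1 / x"
      have u: "u > 0" "u * x = 1" "u < 1" using x by (auto simp: u_def)
      have fx: "x - f x \<le> \<kappa> * u + C * u\<^sup>2" "\<kappa> * u - C * u\<^sup>2 \<le> x - f x"
        using f[OF x(1)] by (auto simp: u_def power_divide abs_le_iff)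
      have f'x: "f' x \<le> 1 + \<kappa> * u\<^sup>2 + C * u ^ 3" "1 + \<kappa> * u\<^sup>2 - C * u ^ 3 \<le> f' x"
        using f'[OF x(1)] by (auto simp: u_def power_divide abs_le_iff)
      have "2 * C < \<kappa> * x" using x(5) assms by (simp add: field_simps)
      then have "2 * C * u < \<kappa> * x * u" using u by (intro mult_strict_right_mono) auto
      then have Cu: "2 * (C * u) \<le> \<kappa>" using u by (simp add: mult_ac)
      then have Cu2: "2 * (C * u) * u \<le> \<kappa> * u" using u by (intro mult_right_mono) auto
      have ge: "\<kappa> * u / 2 \<le> x - f x" and le: "x - f x \<le> 2 * (\<kappa> * u)"
      proof -
        have "C * u\<^sup>2 = (C * u) * u" by (simp add: power2_eq_square)
        with Cu2 have "C * u\<^sup>2 \<le> \<kappa> * u / 2" by linarith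
        moreover have "\<kappa> * u > 0" using assms u by simp
        ultimately show "\<kappa> * u / 2 \<le> x - f x" "x - f x \<le> 2 * (\<kappa> * u)" using fx by linarith+
      qed
      have \<kappa>u: "\<kappa> * u \<le> \<kappa>" "\<kappa> * u > 0" using u assms by auto
      show "(f has_real_derivative f' x) (at x)" by (rule deriv[OF x(1)])
      show f_ge: "x / 2 + A \<le> f x" using le \<kappa>u x(8) A(1) assms(1) by linarith
      show "\<kappa> / (2 * x) \<le> x - f x" using ge by (simp add: u_def)
      show "x - f x \<le> 2 * \<kappa> / x" using le by (simp add: u_def)
      have fA: "f x + A > 0" "f x - A > 0" using f_ge x A by linarith+
      show "(x + A) / (f x + A) \<le> f' x"
      proof -
        have Du: "D * u \<le> 1" using x(3) u by (simp add: u_def)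
        have "(\<kappa> * u\<^sup>2 - C * u ^ 3) * (x + A - 2 * (\<kappa> * u)) - (\<kappa> * u + C * u\<^sup>2)
            = u\<^sup>2 * (1 - D * u) + 2 * \<kappa> * C * u ^ 4"
        proof -
          have 1: "u\<^sup>2 * x = u" "u ^ 3 * x = u\<^sup>2" using u(2) by (simp_all add: power2_eq_square power3_eq_cube)
          have "(\<kappa> * u\<^sup>2 - C * u ^ 3) * (x + A - 2 * (\<kappa> * u)) = \<kappa> * (u\<^sup>2 * x) - C * (u ^ 3 * x) + (\<kappa> * A) * u\<^sup>2 - C * A * u ^ 3 - 2 * \<kappa>\<^sup>2 * u ^ 3 + 2 * \<kappa> * C * u ^ 4"
            by (simp add: algebra_simps power2_eq_square power3_eq_cube power4_eq_xxxx)
          also have "\<dots> = \<kappa> * u - C * u\<^sup>2 + (2 * C + 1) * u\<^sup>2 - D * u ^ 3 + 2 * \<kappa> * C * u ^ 4"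
            unfolding 1 A(2) D_def by (simp add: algebra_simps)
          finally show ?thesis by (simp add: algebra_simps power2_eq_square power3_eq_cube)
        qed
        moreover have "u\<^sup>2 * (1 - D * u) + 2 * \<kappa> * C * u ^ 4 \<ge> 0"
          using Du assms u by (intro add_nonneg_nonneg mult_nonneg_nonneg) auto
        moreover have "0 \<le> \<kappa> * u\<^sup>2 - C * u ^ 3"
        proof -
          have "C * u \<le> \<kappa>" using Cu assms u by (smt (verit) mult_pos_pos)
          then have "C * u * u\<^sup>2 \<le> \<kappa> * u\<^sup>2" by (intro mult_right_mono) auto
          then show ?thesis by (simp add: power2_eq_square power3_eq_cube mult_ac)
        qed
        then have "(\<kappa> * u\<^sup>2 - C * u ^ 3) * (x + A - 2 * (\<kappa> * u)) \<le> (\<kappa> * u\<^sup>2 - C * u ^ 3) * (f x + A)"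
          using le by (intro mult_left_mono) auto
        moreover have "(\<kappa> * u\<^sup>2 - C * u ^ 3) * (f x + A) \<le> (f' x - 1) * (f x + A)"
          using f'x fA by (intro mult_right_mono) auto
        ultimately have "x - f x \<le> (f' x - 1) * (f x + A)" using fx(1) by linarith
        then show ?thesis using fA by (simp add: field_simps)
      qed
      show "f' x \<le> (x - A) / (f x - A)"
      proof -
        have "f x \<le> x" using ge \<kappa>u by linarith
        have "(f' x - 1) * (f x - A) \<le> (\<kappa> * u\<^sup>2 + C * u ^ 3) * (f x - A)"
          using f'x fA by (intro mult_right_mono) auto
        also have "\<dots> \<le> (\<kappa> * u\<^sup>2 + C * u ^ 3) * (x - A)"
          using \<open>f x \<le> x\<close> assms u by (intro mult_left_mono add_nonneg_nonneg) auto
        also have "\<dots> = \<kappa> * u + C * u\<^sup>2 - (2 * C + 1) * u\<^sup>2 - C * A * u ^ 3"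
        proof -
          have 1: "u\<^sup>2 * x = u" "u ^ 3 * x = u\<^sup>2" using u(2) by (simp_all add: power2_eq_square power3_eq_cube)
          have "(\<kappa> * u\<^sup>2 + C * u ^ 3) * (x - A) = \<kappa> * (u\<^sup>2 * x) + C * (u ^ 3 * x) - (\<kappa> * A) * u\<^sup>2 - C * A * u ^ 3"
            by (simp add: algebra_simps)
          then show ?thesis unfolding 1 A(2) .
        qed
        also have "\<dots> \<le> \<kappa> * u - C * u\<^sup>2"
        proof -
          have "C * A * u ^ 3 \<ge> 0" "u\<^sup>2 \<ge> 0" using assms A u by auto
          then show ?thesis by (simp add: algebra_simps)
        qed
        also have "\<dots> \<le> x - f x" by (rule fx)
        finally show ?thesis using fA by (simp add: field_simps)
      qed
    next
      show "continuous_on {b..} f'" by (rule continuous_on_subset[OF cont]) (use b R1 in auto)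
    qed (use assms A b R1 in auto)
  qed
qed

lemma (in lebesgue_preserving) lebesgue_preserving_mirror: "lebesgue_preserving (\<lambda>x. - T (- x))"
proof
  show m: "(\<lambda>x. - T (- x)) \<in> borel_measurable borel" by measurable
  have "distr lborel borel (\<lambda>x. - T (- x)) = distr (distr (distr lborel borel uminus) borel T) borel uminus"
    by (simp add: distr_distr comp_def)
  also have "\<dots> = lborel" by (simp add: lborel_distr_uminus distr_T)
  finally show "distr lborel borel (\<lambda>x. - T (- x)) = lborel" .
qed

context parabolic_map
begin

lemma two_tails_exists:
  obtains A R1 where "R1 > R" "A \<ge> 0" "\<And>b c. R1 \<le> b \<Longrightarrow> R1 \<le> c \<Longrightarrow> two_tails T T' \<kappa> A b c"
proof -
  obtain A R1 where AR: "R1 > R" "A \<ge> 0"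
    "\<And>f f' b. lebesgue_preserving f \<Longrightarrow> R1 \<le> b \<Longrightarrow>
      (\<And>x. x > R \<Longrightarrow> \<bar>f x - x + \<kappa> / x\<bar> \<le> C / x\<^sup>2) \<Longrightarrow>
      (\<And>x. x > R \<Longrightarrow> (f has_real_derivative f' x) (at x)) \<Longrightarrow>
      continuous_on {R<..} f' \<Longrightarrow>
      (\<And>x. x > R \<Longrightarrow> \<bar>f' x - 1 - \<kappa> / x\<^sup>2\<bar> \<le> C / x ^ 3) \<Longrightarrow> right_tail f f' \<kappa> A b"
    using right_tail_exists[OF \<kappa>_pos C_pos R_pos] by metis
  show ?thesis
  proof
    show "R1 > R" "A \<ge> 0" by fact+
    fix b c assume bc: "R1 \<le> b" "R1 \<le> c"
    have "right_tail T T' \<kappa> A b"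
    proof (rule AR(3)[OF lebesgue_preserving_axioms bc(1)])
      show "continuous_on {R<..} T'" by (rule continuous_on_subset[OF T'_cont]) auto
      fix x assume x: "x > R"
      then have "\<bar>x\<bar> > R" "x > 0" using R_pos by auto
      then show "\<bar>T x - x + \<kappa> / x\<bar> \<le> C / x\<^sup>2" "(T has_real_derivative T' x) (at x)" "\<bar>T' x - 1 - \<kappa> / x\<^sup>2\<bar> \<le> C / x ^ 3"
        using T_asymp[of x] T_deriv[of x] T'_asymp[of x] by auto
    qed
    moreover have "right_tail (\<lambda>x. - T (- x)) (\<lambda>x. T' (- x)) \<kappa> A c"
    proof (rule AR(3)[OF lebesgue_preserving_mirror bc(2)])
      show "continuous_on {R<..} (\<lambda>x. T' (- x))"
        by (rule continuous_on_compose2[OF T'_cont]) (auto intro!: continuous_intros)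
      fix x assume x: "x > R"
      then have x': "\<bar>- x\<bar> > R" "x > 0" using R_pos by auto
      have "\<bar>- (T (- x) - (- x) + \<kappa> / (- x))\<bar> \<le> C / x\<^sup>2" using T_asymp[OF x'(1)] by simp
      then show "\<bar>- T (- x) - x + \<kappa> / x\<bar> \<le> C / x\<^sup>2" by (simp add: algebra_simps)
      have "((\<lambda>x. T (uminus x)) has_real_derivative T' (- x) * (- 1)) (at x)"
        by (rule DERIV_chain2[where f = T and g = uminus])
          (use T_deriv[OF x'(1)] in \<open>auto intro!: derivative_eq_intros\<close>)
      from DERIV_minus[OF this] show "((\<lambda>x. - T (- x)) has_real_derivative T' (- x)) (at x)" by simp
      show "\<bar>T' (- x) - 1 - \<kappa> / x\<^sup>2\<bar> \<le> C / x ^ 3" using T'_asymp[OF x'(1)] x' by simp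
    qed
    ultimately show "two_tails T T' \<kappa> A b c" by (rule two_tails.intro)
  qed
qed

section \<open>Asymptotics of the iterates and mixing\<close>

lemma h_upper_funpow: "Im w > 0 \<Longrightarrow> Im ((h ^^ n) w) > 0"
  by (induction n) (auto intro: h_upper)

lemma distr_cauchy_funpow: "Im w > 0 \<Longrightarrow> distr (cauchy w) borel (T ^^ n) = cauchy ((h ^^ n) w)"
proof (induction n)
  case 0
  have "distr (cauchy w) borel (\<lambda>x. x) = cauchy w" by (rule distr_id2) simp
  then show ?case by (simp add: id_def)
next
  case (Suc n)
  have "distr (cauchy w) borel (T ^^ Suc n) = distr (distr (cauchy w) borel (T ^^ n)) borel T"
    by (simp add: distr_distr comp_def)
  also have "\<dots> = cauchy (h ((h ^^ n) w))" using Suc by (simp add: distr_cauchy h_upper_funpow)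
  also have "h ((h ^^ n) w) = (h ^^ Suc n) w" by simp
  finally show ?case .
qed

lemma measure_cauchy_funpow:
  assumes "Im w > 0" "S \<in> sets borel"
  shows "measure (cauchy w) ((T ^^ n) -` S) = measure (cauchy ((h ^^ n) w)) S"
  using arg_cong[OF distr_cauchy_funpow[OF assms(1), of n], of "\<lambda>M. measure M S"] assms by (simp add: measure_distr)

text \<open>The increments of the squares tend to \<open>- 2 * \<kappa>\<close>, so Cesaro means
  give the limit of the squares divided by \<open>n\<close>. The correct square root is selected by
  factoring: with \<open>v n\<close> in the upper half-plane, \<open>v n + \<i> * \<beta>\<close>
  has norm at least \<open>\<beta>\<close>.\<close>

lemma iterates_asymptotic:
  assumes w: "Im w > 0"
  shows "(\<lambda>n. (h ^^ n) w / of_real (sqrt (real n))) \<longlonglongrightarrow> \<i> * of_real (sqrt (2 * \<kappa>))"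
proof -
  define z where "z n = (h ^^ n) w" for n
  have z: "Im (z n) > 0" for n by (simp add: z_def h_upper_funpow w)
  have zinf: "filterlim z at_infinity sequentially" unfolding z_def by (rule h_iterates[OF w])
  have norm_z: "filterlim (\<lambda>n. norm (z n)) at_top sequentially"
    using zinf by (simp add: filterlim_at_infinity_conv_norm_at_top)
  define d where "d n = (z (Suc n))\<^sup>2 - (z n)\<^sup>2 + of_real (2 * \<kappa>)" for n
  have "d \<longlonglongrightarrow> 0"
  proof (rule Lim_null_comparison)
    show "eventually (\<lambda>n. norm (d n) \<le> 2 * C / norm (z n) + (\<kappa> / norm (z n) + C / (norm (z n))\<^sup>2)\<^sup>2) sequentially"
      using filterlim_at_top_dense[THEN iffD1, OF norm_z, rule_format, of R]
    proof eventually_elim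
      case (elim n)
      then have nz: "norm (z n) > 0" "z n \<noteq> 0" using R_pos by auto
      define r where "r = h (z n) - z n + of_real \<kappa> / z n"
      have r: "norm r \<le> C / (norm (z n))\<^sup>2" unfolding r_def by (rule h_asymp[OF z elim])
      have zS: "z (Suc n) = z n - of_real \<kappa> / z n + r" by (simp add: z_def r_def)
      have "d n = 2 * z n * r + (r - of_real \<kappa> / z n)\<^sup>2"
        unfolding d_def zS using nz by (simp add: power2_eq_square field_simps)
      then have "norm (d n) \<le> norm (2 * z n * r) + norm ((r - of_real \<kappa> / z n)\<^sup>2)"
        by (simp only: norm_triangle_ineq)
      moreover have "norm (2 * z n * r) \<le> 2 * C / norm (z n)"
      proof -
        have "norm (2 * z n * r) = (2 * norm (z n)) * norm r" by (simp add: norm_mult)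
        also have "\<dots> \<le> (2 * norm (z n)) * (C / (norm (z n))\<^sup>2)" by (intro mult_left_mono r) auto
        finally show ?thesis using nz by (simp add: power2_eq_square)
      qed
      moreover have "norm ((r - of_real \<kappa> / z n)\<^sup>2) \<le> (\<kappa> / norm (z n) + C / (norm (z n))\<^sup>2)\<^sup>2"
      proof -
        have "norm (r - of_real \<kappa> / z n) \<le> norm r + norm (of_real \<kappa> / z n)" by (rule norm_triangle_ineq4)
        also have "\<dots> \<le> \<kappa> / norm (z n) + C / (norm (z n))\<^sup>2" using r \<kappa>_pos by (simp add: norm_divide)
        finally show ?thesis unfolding norm_power by (intro power_mono) auto
      qed
      ultimately show ?case by linarith
    qed
    have "((\<lambda>t. 2 * C / t + (\<kappa> / t + C / t\<^sup>2)\<^sup>2) \<longlongrightarrow> 0) at_top"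
      using C_pos \<kappa>_pos by real_asymp
    then show "(\<lambda>n. 2 * C / norm (z n) + (\<kappa> / norm (z n) + C / (norm (z n))\<^sup>2)\<^sup>2) \<longlonglongrightarrow> 0"
      by (rule filterlim_compose[OF _ norm_z])
  qed
  then have "(\<lambda>n. (1 / real n) *\<^sub>R (\<Sum>k<n. d k)) \<longlonglongrightarrow> 0" by (rule cesaro_zero)
  moreover have sum_d: "(\<Sum>k<n. d k) = (z n)\<^sup>2 - w\<^sup>2 + of_real (2 * \<kappa> * real n)" for n
    by (induction n) (auto simp: d_def z_def algebra_simps)
  moreover have "(\<lambda>n. (1 / real n) *\<^sub>R w\<^sup>2) \<longlonglongrightarrow> 0 *\<^sub>R w\<^sup>2"
    by (intro tendsto_scaleR tendsto_const) real_asymp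
  ultimately have "(\<lambda>n. (1 / real n) *\<^sub>R ((z n)\<^sup>2 - w\<^sup>2 + of_real (2 * \<kappa> * real n)) + (1 / real n) *\<^sub>R w\<^sup>2) \<longlonglongrightarrow> 0 + 0"
    by (intro tendsto_add) auto
  then have lim: "(\<lambda>n. (1 / real n) *\<^sub>R ((z n)\<^sup>2 + of_real (2 * \<kappa> * real n))) \<longlonglongrightarrow> 0"
    by (simp add: algebra_simps)
  define \<beta> where "\<beta> = sqrt (2 * \<kappa>)"
  have \<beta>: "\<beta> > 0" "\<beta>\<^sup>2 = 2 * \<kappa>" using \<kappa>_pos by (auto simp: \<beta>_def)
  define v where "v n = z n / of_real (sqrt (real n))" for n
  have "(\<lambda>n. v n - \<i> * of_real \<beta>) \<longlonglongrightarrow> 0"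
  proof (rule Lim_null_comparison)
    show "eventually (\<lambda>n. norm (v n - \<i> * of_real \<beta>) \<le> norm ((1 / real n) *\<^sub>R ((z n)\<^sup>2 + of_real (2 * \<kappa> * real n))) / \<beta>) sequentially"
      using eventually_gt_at_top[of 0]
    proof eventually_elim
      case (elim n)
      have "(v n - \<i> * of_real \<beta>) * (v n + \<i> * of_real \<beta>) = (v n)\<^sup>2 + of_real (\<beta>\<^sup>2)"
        by (simp add: power2_eq_square algebra_simps)
      also have "\<dots> = (1 / real n) *\<^sub>R ((z n)\<^sup>2 + of_real (2 * \<kappa> * real n))"
      proof -
        have "(of_real (sqrt (real n)))\<^sup>2 = (of_real (real n) :: complex)" by (simp flip: of_real_power)
        then show ?thesis unfolding \<beta>(2) v_def power_divide using elim by (simp add: scaleR_conv_of_real field_simps)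
      qed
      finally have eq: "norm (v n - \<i> * of_real \<beta>) * norm (v n + \<i> * of_real \<beta>) = norm ((1 / real n) *\<^sub>R ((z n)\<^sup>2 + of_real (2 * \<kappa> * real n)))"
        by (metis norm_mult)
      have "Im (v n) \<ge> 0" using z[of n] by (simp add: v_def)
      then have "\<beta> \<le> Im (v n + \<i> * of_real \<beta>)" by simp
      also have "\<dots> \<le> norm (v n + \<i> * of_real \<beta>)" using abs_Im_le_cmod[of "v n + \<i> * of_real \<beta>"] by linarith
      finally have "norm (v n - \<i> * of_real \<beta>) * \<beta> \<le> norm (v n - \<i> * of_real \<beta>) * norm (v n + \<i> * of_real \<beta>)"
        by (intro mult_left_mono) auto
      then show ?case using \<beta>(1) unfolding eq by (simp only: pos_le_divide_eq)
    qed
    have "(\<lambda>n. norm ((1 / real n) *\<^sub>R ((z n)\<^sup>2 + of_real (2 * \<kappa> * real n))) / \<beta>) \<longlonglongrightarrow> 0 / \<beta>"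
      by (intro tendsto_divide tendsto_const tendsto_norm_zero lim) (use \<beta> in auto)
    then show "(\<lambda>n. norm ((1 / real n) *\<^sub>R ((z n)\<^sup>2 + of_real (2 * \<kappa> * real n))) / \<beta>) \<longlonglongrightarrow> 0" by simp
  qed
  then show ?thesis unfolding v_def z_def \<beta>_def by (rule LIM_zero_cancel)
qed

text \<open>A difference of two Poisson kernels with positive integral that is negative outside of
  the interval of radius \<open>e\<close> around \<open>t\<close>.\<close>

lemma poisson_difference_le:
  assumes "e > 0"
  shows "poisson (Complex t (e / 4)) x - poisson (Complex t e) x / 2 \<le> 4 / e * indicator {t - e..t + e} x"
proof -
  define s where "s = (x - t)\<^sup>2"
  have s: "s \<ge> 0" by (simp add: s_def)
  have p: "poisson (Complex t (e / 4)) x = (e / 4) / (pi * (s + (e / 4)\<^sup>2))" "poisson (Complex t e) x = e / (pi * (s + e\<^sup>2))"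
    by (simp_all add: poisson_def s_def)
  show ?thesis
  proof (cases "x \<in> {t - e..t + e}")
    case True
    have "poisson (Complex t (e / 4)) x \<le> (e / 4) / (1 * (0 + (e / 4)\<^sup>2))"
      unfolding p using s assms pi_gt3 by (intro divide_left_mono mult_mono mult_pos_pos add_nonneg_pos) auto
    also have "\<dots> = 4 / e" using assms by (simp add: power2_eq_square)
    finally show ?thesis using True assms poisson_pos[of "Complex t e" x] by simp
  next
    case False
    then have "e < \<bar>x - t\<bar>" by (auto simp: abs_if)
    then have "\<bar>e\<bar> \<le> \<bar>x - t\<bar>" using assms by simp
    then have se: "e\<^sup>2 \<le> s" unfolding s_def by (simp only: abs_le_square_iff)
    have "(e / 4) * (pi * (s + e\<^sup>2)) \<le> (e / 2) * (pi * (s + (e / 4)\<^sup>2))"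
    proof -
      have "(s + e\<^sup>2) / 4 \<le> (s + (e / 4)\<^sup>2) / 2"
      proof -
        have "(e / 4)\<^sup>2 = e\<^sup>2 / 16" "0 \<le> e\<^sup>2" by (simp_all add: power_divide)
        moreover have "7 * e\<^sup>2 \<le> 8 * s" using se zero_le_power2[of e] by linarith
        ultimately show ?thesis by (simp only:) (simp add: field_simps)
      qed
      then have "e * pi * ((s + e\<^sup>2) / 4) \<le> e * pi * ((s + (e / 4)\<^sup>2) / 2)" using assms by (intro mult_left_mono) auto
      then show ?thesis by (simp add: algebra_simps)
    qed
    then have "(e / 4) / (pi * (s + (e / 4)\<^sup>2)) \<le> (e / 2) / (pi * (s + e\<^sup>2))"
    proof -
      have cross: "u / p1 \<le> v / p2" if "u * p2 \<le> v * p1" "p1 > 0" "p2 > 0" for u v p1 p2 :: real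
        using that by (simp add: field_simps)
      assume "(e / 4) * (pi * (s + e\<^sup>2)) \<le> (e / 2) * (pi * (s + (e / 4)\<^sup>2))"
      then show ?thesis by (rule cross) (use s assms in \<open>auto intro!: mult_pos_pos add_nonneg_pos\<close>)
    qed
    then show ?thesis using False unfolding p by (simp add: mult_ac)
  qed
qed

text \<open>The kernel difference of \<open>poisson_difference_le\<close> is integrated over the
  preimage of \<open>S\<close>. On the image side it becomes a difference of harmonic measures seen
  from points near \<open>\<i> * \<beta> * sqrt i\<close>. On a bounded set these agree to leading
  order, so about half of one of them survives.\<close>

lemma mixing:
  assumes ab: "a < b" and \<rho>: "\<rho> > 0"
  shows "eventually (\<lambda>i. \<exists>\<delta>>0. \<forall>S. S \<in> sets borel \<longrightarrow> S \<subseteq> {- \<rho>..\<rho>} \<longrightarrow>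
    \<delta> * measure lborel S \<le> measure lborel ({a..b} \<inter> (T ^^ i) -` S)) sequentially"
proof -
  define t e where "t = (a + b) / 2" and "e = (b - a) / 2"
  have e: "e > 0" "{t - e..t + e} = {a..b}" using ab by (auto simp: t_def e_def field_simps)
  define w1 w2 where "w1 = Complex t (e / 4)" and "w2 = Complex t e"
  have w: "Im w1 > 0" "Im w2 > 0" using e by (auto simp: w1_def w2_def)
  define \<beta> where "\<beta> = sqrt (2 * \<kappa>)"
  have \<beta>: "\<beta> > 0" using \<kappa>_pos by (simp add: \<beta>_def)
  have lims: "(\<lambda>i. Re ((h ^^ i) w) / sqrt (real i)) \<longlonglongrightarrow> 0" "(\<lambda>i. Im ((h ^^ i) w) / sqrt (real i)) \<longlonglongrightarrow> \<beta>" if "Im w > 0" for w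
    using tendsto_Re[OF iterates_asymptotic[OF that]] tendsto_Im[OF iterates_asymptotic[OF that]]
    by (auto simp: \<beta>_def)
  \<comment> \<open>\<open>L i\<close> and \<open>U i\<close> are the two constants of
    \<open>measure_cauchy_bounds\<close> multiplied by \<open>pi * sqrt i\<close>; both tend to
    \<open>1 / \<beta>\<close>.\<close>
  define L where "L i = (Im ((h ^^ i) w1) / sqrt (real i)) / ((\<rho> / sqrt (real i) + \<bar>Re ((h ^^ i) w1) / sqrt (real i)\<bar>)\<^sup>2 + (Im ((h ^^ i) w1) / sqrt (real i))\<^sup>2)" for i
  define U where "U i = 1 / (Im ((h ^^ i) w2) / sqrt (real i))" for i
  have "(\<lambda>i. \<rho> / sqrt (real i)) \<longlonglongrightarrow> 0" by real_asymp
  then have "L \<longlonglongrightarrow> \<beta> / ((0 + \<bar>0\<bar>)\<^sup>2 + \<beta>\<^sup>2)"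
    unfolding L_def by (intro tendsto_intros lims w) (use \<beta> in auto)
  then have "L \<longlonglongrightarrow> 1 / \<beta>" using \<beta> by (simp add: power2_eq_square)
  moreover have "U \<longlonglongrightarrow> 1 / \<beta>" unfolding U_def by (intro tendsto_intros lims w) (use \<beta> in auto)
  ultimately have "(\<lambda>i. L i - U i / 2) \<longlonglongrightarrow> 1 / \<beta> - 1 / \<beta> / 2" by (intro tendsto_intros) auto
  moreover have "1 / \<beta> - 1 / \<beta> / 2 > 0" using \<beta> by (simp add: field_simps)
  ultimately have "eventually (\<lambda>i. L i - U i / 2 > 0) sequentially" by (rule order_tendstoD)
  then show ?thesis using eventually_gt_at_top[of 0]
  proof eventually_elim
    case (elim i)
    define v1 v2 where "v1 = (h ^^ i) w1" and "v2 = (h ^^ i) w2"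
    have v: "Im v1 > 0" "Im v2 > 0" using h_upper_funpow w by (auto simp: v1_def v2_def)
    define l u where "l = Im v1 / (pi * ((\<rho> + \<bar>Re v1\<bar>)\<^sup>2 + (Im v1)\<^sup>2))" and "u = 1 / (pi * Im v2)"
    have "l = L i / (pi * sqrt (real i))"
    proof -
      have "(\<rho> / sqrt (real i) + \<bar>Re v1 / sqrt (real i)\<bar>)\<^sup>2 + (Im v1 / sqrt (real i))\<^sup>2 = ((\<rho> + \<bar>Re v1\<bar>)\<^sup>2 + (Im v1)\<^sup>2) / real i"
        using elim(2) by (simp add: power_divide flip: add_divide_distrib)
      then have "L i = (Im v1 / sqrt (real i)) * real i / ((\<rho> + \<bar>Re v1\<bar>)\<^sup>2 + (Im v1)\<^sup>2)"
        by (simp add: L_def v1_def)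
      also have "(Im v1 / sqrt (real i)) * real i = Im v1 * sqrt (real i)"
        using elim(2) by (simp add: field_simps)
      finally show ?thesis using elim(2) by (simp add: l_def)
    qed
    moreover have "u = U i / (pi * sqrt (real i))" using elim(2) by (simp add: u_def U_def v2_def)
    ultimately have "l - u / 2 = (L i - U i / 2) / (pi * sqrt (real i))" by (simp add: diff_divide_distrib)
    then have lu: "l - u / 2 > 0" using elim by simp
    show ?case
    proof (intro exI[of _ "e / 4 * (l - u / 2)"] conjI allI impI)
      show "e / 4 * (l - u / 2) > 0" using e lu by simp
      fix S :: "real set" assume S: "S \<in> sets borel" "S \<subseteq> {- \<rho>..\<rho>}"
      have Ti: "(T ^^ i) -` S \<in> sets borel" by (rule sets_vimage_funpow[OF S(1)])
      have fm: "{a..b} \<inter> (T ^^ i) -` S \<in> fmeasurable lborel"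
        by (rule fmeasurableI2[of "{a..b}"]) (use Ti in auto)
      have "l * measure lborel S - u * measure lborel S / 2 \<le> measure (cauchy v1) S - measure (cauchy v2) S / 2"
        using measure_cauchy_bounds(2)[OF v(1) S] measure_cauchy_bounds(1)[OF v(2) S] by (simp add: l_def u_def)
      also have "\<dots> = measure (cauchy w1) ((T ^^ i) -` S) - measure (cauchy w2) ((T ^^ i) -` S) / 2"
        by (simp add: v1_def v2_def measure_cauchy_funpow w S)
      also have "\<dots> = (\<integral>x. poisson w1 x * indicator ((T ^^ i) -` S) x - poisson w2 x * indicator ((T ^^ i) -` S) x / 2 \<partial>lborel)"
        by (simp add: measure_cauchy w Ti integrable_poisson_indicator)
      also have "\<dots> \<le> (\<integral>x. 4 / e * indicator ({a..b} \<inter> (T ^^ i) -` S) x \<partial>lborel)"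
      proof (rule integral_mono)
        show "integrable lborel (\<lambda>x. poisson w1 x * indicator ((T ^^ i) -` S) x - poisson w2 x * indicator ((T ^^ i) -` S) x / 2)"
          by (intro Bochner_Integration.integrable_diff integrable_divide integrable_poisson_indicator w Ti)
        show "integrable lborel (\<lambda>x. 4 / e * indicator ({a..b} \<inter> (T ^^ i) -` S) x)"
          using fm by (auto simp: fmeasurable_def)
        show "poisson w1 x * indicator ((T ^^ i) -` S) x - poisson w2 x * indicator ((T ^^ i) -` S) x / 2
            \<le> 4 / e * indicator ({a..b} \<inter> (T ^^ i) -` S) x" for x
          using poisson_difference_le[OF e(1), of t x] unfolding e(2) w1_def w2_def
          by (auto split: split_indicator)
      qed
      also have "\<dots> = 4 / e * measure lborel ({a..b} \<inter> (T ^^ i) -` S)"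
        using fm by (simp add: fmeasurable_def)
      finally show "e / 4 * (l - u / 2) * measure lborel S \<le> measure lborel ({a..b} \<inter> (T ^^ i) -` S)"
        using e by (simp add: field_simps)
    qed
  qed
qed

section \<open>Consequences for visits, return times and excursions\<close>

lemma return_estimates_exists:
  obtains \<rho>0 where "\<And>\<rho> a b. \<rho> \<ge> \<rho>0 \<Longrightarrow> a < b \<Longrightarrow> {a..b} \<subseteq> {- \<rho>..\<rho>} \<Longrightarrow> \<exists>C' \<delta> i0. return_estimates T {- \<rho>..\<rho>} {a..b} C' \<delta> i0"
proof -
  obtain A R1 where AR: "R1 > R" "A \<ge> 0" "\<And>b c. R1 \<le> b \<Longrightarrow> R1 \<le> c \<Longrightarrow> two_tails T T' \<kappa> A b c"
    using two_tails_exists by metis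
  show ?thesis
  proof
    fix \<rho> a b :: real assume \<rho>: "\<rho> \<ge> R1" and ab: "a < b" "{a..b} \<subseteq> {- \<rho>..\<rho>}"
    interpret tt: two_tails T T' \<kappa> A \<rho> \<rho> by (rule AR(3)[OF \<rho> \<rho>])
    have core: "tt.core = {- \<rho>..\<rho>}" by (simp add: tt.core_def)
    obtain C1 where C1: "C1 > 0" "\<And>S m. S \<in> sets borel \<Longrightarrow> S \<subseteq> {- \<rho>..\<rho>} \<Longrightarrow>
      measure lborel {x. (\<forall>l<m. (T ^^ l) x \<notin> {- \<rho>..\<rho>}) \<and> (T ^^ m) x \<in> S} \<le> C1 / sqrt (real m + 1) * measure lborel S"
      by (rule tt.entrance_estimate[unfolded core], rule that)
    obtain C2 where C2: "C2 > 0" "\<And>S m. S \<in> sets borel \<Longrightarrow> S \<subseteq> {- \<rho>..\<rho>} \<Longrightarrow> m \<ge> 1 \<Longrightarrow>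
      measure lborel {x\<in>{- \<rho>..\<rho>}. (\<forall>l. 1 \<le> l \<and> l < m \<longrightarrow> (T ^^ l) x \<notin> {- \<rho>..\<rho>}) \<and> (T ^^ m) x \<in> S}
        \<le> C2 / (real m * sqrt m) * measure lborel S"
      by (rule tt.excursion_estimate[unfolded core], rule that)
    have "\<rho> > 0" using \<rho> AR R_pos by simp
    then obtain i0 \<delta> where mix: "\<delta> > 0" "\<And>S. S \<in> sets borel \<Longrightarrow> S \<subseteq> {- \<rho>..\<rho>} \<Longrightarrow>
        \<delta> * measure lborel S \<le> measure lborel ({a..b} \<inter> (T ^^ i0) -` S)"
      using eventually_happens[OF mixing[OF ab(1), of \<rho>]] by force
    have "return_estimates T {- \<rho>..\<rho>} {a..b} (C1 + C2) \<delta> i0"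
    proof
      fix S :: "real set" and m :: nat assume S: "S \<in> sets borel" "S \<subseteq> {- \<rho>..\<rho>}"
      have "C1 / sqrt (real m + 1) * measure lborel S \<le> (C1 + C2) / sqrt (real m + 1) * measure lborel S"
        using C2(1) by (intro mult_right_mono divide_right_mono) auto
      then show "measure lborel {x. (\<forall>l<m. (T ^^ l) x \<notin> {- \<rho>..\<rho>}) \<and> (T ^^ m) x \<in> S} \<le> (C1 + C2) / sqrt (real m + 1) * measure lborel S"
        using C1(2)[OF S, of m] by linarith
      assume m: "1 \<le> m"
      have "C2 / (real m * sqrt m) * measure lborel S \<le> (C1 + C2) / (real m * sqrt m) * measure lborel S"
        using C1(1) by (intro mult_right_mono divide_right_mono) auto
      then show "measure lborel {x\<in>{- \<rho>..\<rho>}. (\<forall>l. 1 \<le> l \<and> l < m \<longrightarrow> (T ^^ l) x \<notin> {- \<rho>..\<rho>}) \<and> (T ^^ m) x \<in> S}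
        \<le> (C1 + C2) / (real m * sqrt m) * measure lborel S"
        using C2(2)[OF S m] by linarith
    qed (use C1(1) C2(1) mix ab in auto)
    then show "\<exists>C' \<delta> i0. return_estimates T {- \<rho>..\<rho>} {a..b} C' \<delta> i0" by blast
  qed
qed

text \<open>Recurrence of \<open>{- \<rho>..\<rho>}\<close> to itself is the case
  \<open>E = K\<close> of \<open>return_estimates\<close>. A second instance, with the given
  interval as \<open>E\<close>, shows that almost every point of \<open>{- \<rho>..\<rho>}\<close>
  hits it; countably many \<open>\<rho>\<close> exhaust the line.\<close>

theorem AE_visits_lborel:
  assumes ab: "a < b" and \<epsilon>: "0 < \<epsilon>" "\<epsilon> < 1 / 2"
  shows "AE x in lborel. filterlim (\<lambda>n. real (visits T {a..b} n x) / real n powr (1 / 2 - \<epsilon>)) at_top sequentially"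
proof -
  obtain \<rho>0 where \<rho>0: "\<And>\<rho> a b. \<rho> \<ge> \<rho>0 \<Longrightarrow> a < b \<Longrightarrow> {a..b} \<subseteq> {- \<rho>..\<rho>} \<Longrightarrow> \<exists>C' \<delta> i0. return_estimates T {- \<rho>..\<rho>} {a..b} C' \<delta> i0"
    using return_estimates_exists by metis
  define r where "r = max 1 (max \<rho>0 (\<bar>a\<bar> + \<bar>b\<bar>))"
  have "AE x in lborel. x \<in> {- (r + real n)..r + real n} \<longrightarrow> (\<exists>l. (T ^^ l) x \<in> {a..b})" for n
  proof -
    define \<rho> where "\<rho> = r + real n"
    have "r \<ge> 1" by (simp add: r_def)
    then have "\<rho> \<ge> 1" by (simp add: \<rho>_def)
    then have \<rho>: "\<rho> \<ge> \<rho>0" "- \<rho> < \<rho>" "{a..b} \<subseteq> {- \<rho>..\<rho>}" by (auto simp: \<rho>_def r_def)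
    obtain C1 \<delta>1 i1 where "return_estimates T {- \<rho>..\<rho>} {a..b} C1 \<delta>1 i1" using \<rho>0[OF \<rho>(1) ab \<rho>(3)] by blast
    then interpret r1: return_estimates T "{- \<rho>..\<rho>}" "{a..b}" C1 \<delta>1 i1 .
    obtain C2 \<delta>2 i2 where "return_estimates T {- \<rho>..\<rho>} {- \<rho>..\<rho>} C2 \<delta>2 i2" using \<rho>0[OF \<rho>(1,2)] by blast
    then interpret r2: return_estimates T "{- \<rho>..\<rho>}" "{- \<rho>..\<rho>}" C2 \<delta>2 i2 .
    show ?thesis
      using r1.AE_K_hits_E[OF returning.AE_returns[OF r2.returning_E]] unfolding \<rho>_def by blast
  qed
  then have "AE x in lborel. \<forall>n. x \<in> {- (r + real n)..r + real n} \<longrightarrow> (\<exists>l. (T ^^ l) x \<in> {a..b})"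
    unfolding AE_all_countable by blast
  then have hit: "AE x in lborel. \<exists>l. (T ^^ l) x \<in> {a..b}"
  proof eventually_elim
    case (elim x)
    obtain n :: nat where "\<bar>x\<bar> \<le> real n" using real_arch_simple by blast
    then have "x \<in> {- (r + real n)..r + real n}" by (auto simp: r_def)
    then show ?case using elim by blast
  qed
  have "\<exists>C' \<delta> i0. return_estimates T {- r..r} {a..b} C' \<delta> i0" by (rule \<rho>0) (auto simp: r_def ab)
  then obtain C1 \<delta>1 i1 where "return_estimates T {- r..r} {a..b} C1 \<delta>1 i1" by blast
  then interpret r1: return_estimates T "{- r..r}" "{a..b}" C1 \<delta>1 i1 .
  show ?thesis by (rule returning.AE_visits[OF r1.returning_E \<epsilon> hit])
qed

lemma return_set_eq: "n \<ge> 1 \<Longrightarrow> return_set T E n = first_returns E n E"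
proof -
  assume n: "n \<ge> 1"
  have "first_return_time T E x = enat n \<longleftrightarrow> (\<forall>l. 1 \<le> l \<and> l < n \<longrightarrow> (T ^^ l) x \<notin> E) \<and> (T ^^ n) x \<in> E" for x
  proof
    assume eq: "first_return_time T E x = enat n"
    let ?A = "{enat k | k. k \<ge> 1 \<and> (T ^^ k) x \<in> E}"
    have ne: "?A \<noteq> {}"
    proof
      assume "?A = {}"
      then have "first_return_time T E x = \<infinity>" unfolding first_return_time_def by (simp only: Inf_empty top_enat_def)
      with eq show False by simp
    qed
    then have "Inf ?A \<in> ?A" unfolding Inf_enat_def by (auto intro: LeastI)
    then have "(T ^^ n) x \<in> E" using eq by (auto simp: first_return_time_def)
    moreover have "(T ^^ l) x \<notin> E" if "1 \<le> l \<and> l < n" for l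
    proof
      assume "(T ^^ l) x \<in> E"
      then have "Inf ?A \<le> enat l" using that by (intro Inf_lower) auto
      then show False using that eq by (simp add: first_return_time_def)
    qed
    ultimately show "(\<forall>l. 1 \<le> l \<and> l < n \<longrightarrow> (T ^^ l) x \<notin> E) \<and> (T ^^ n) x \<in> E" by blast
  next
    assume *: "(\<forall>l. 1 \<le> l \<and> l < n \<longrightarrow> (T ^^ l) x \<notin> E) \<and> (T ^^ n) x \<in> E"
    show "first_return_time T E x = enat n"
      unfolding first_return_time_def
    proof (rule antisym)
      show "Inf {enat k | k. k \<ge> 1 \<and> (T ^^ k) x \<in> E} \<le> enat n" using * n by (intro Inf_lower) auto
      show "enat n \<le> Inf {enat k | k. k \<ge> 1 \<and> (T ^^ k) x \<in> E}"
        using * by (intro Inf_greatest) (auto simp: not_less[symmetric])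
    qed
  qed
  then show ?thesis by (auto simp: return_set_def first_returns_def)
qed

theorem return_set_upper:
  assumes ab: "a < b"
  obtains A where "A > 0" "\<And>n. n \<ge> 1 \<Longrightarrow> measure lborel (return_set T {a..b} n) \<le> A / (real n * sqrt n)"
proof -
  obtain \<rho>0 where \<rho>0: "\<And>\<rho> a b. \<rho> \<ge> \<rho>0 \<Longrightarrow> a < b \<Longrightarrow> {a..b} \<subseteq> {- \<rho>..\<rho>} \<Longrightarrow> \<exists>C' \<delta> i0. return_estimates T {- \<rho>..\<rho>} {a..b} C' \<delta> i0"
    using return_estimates_exists by metis
  define r where "r = max \<rho>0 (\<bar>a\<bar> + \<bar>b\<bar>)"
  have "\<exists>C' \<delta> i0. return_estimates T {- r..r} {a..b} C' \<delta> i0" by (rule \<rho>0) (auto simp: r_def ab)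
  then obtain C1 \<delta>1 i1 where "return_estimates T {- r..r} {a..b} C1 \<delta>1 i1" by blast
  then interpret r1: return_estimates T "{- r..r}" "{a..b}" C1 \<delta>1 i1 .
  show ?thesis by (rule r1.first_return_bound) (use that in \<open>auto simp: return_set_eq r1.from_E_eq\<close>)
qed

theorem excursion_set_large:
  obtains r where "r > 0"
    "\<And>a b. {- r..r} \<subseteq> {a..b} \<Longrightarrow>
      (\<lambda>n. measure lborel (excursion_set T (UNIV - {a..b}) n)) \<lesssim> (\<lambda>n. 1 / sqrt (real n)) \<and>
      (\<lambda>n. 1 / sqrt (real n)) \<lesssim> (\<lambda>n. measure lborel (excursion_set T (UNIV - {a..b}) n))"
proof -
  obtain A R1 where AR: "R1 > R" "A \<ge> 0" "\<And>b c. R1 \<le> b \<Longrightarrow> R1 \<le> c \<Longrightarrow> two_tails T T' \<kappa> A b c"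
    using two_tails_exists by metis
  show ?thesis
  proof
    show R1: "R1 > 0" using AR R_pos by simp
    fix a b assume "{- R1..R1} \<subseteq> {a..b}"
    then have ab: "R1 \<le> b" "R1 \<le> - a" using R1 by auto
    interpret tt: two_tails T T' \<kappa> A b "- a" by (rule AR(3)[OF ab])
    show "(\<lambda>n. measure lborel (excursion_set T (UNIV - {a..b}) n)) \<lesssim> (\<lambda>n. 1 / sqrt (real n)) \<and>
      (\<lambda>n. 1 / sqrt (real n)) \<lesssim> (\<lambda>n. measure lborel (excursion_set T (UNIV - {a..b}) n))"
      using tt.excursion_set_asymptotics by (simp add: tt.core_def)
  qed
qed

end

section \<open>Lower bound for the return times\<close>

lemma poisson_mirror: "poisson (- cnj w) x = poisson w (- x)"
proof -
  have "(x + Re w)\<^sup>2 = (- x - Re w)\<^sup>2" by (simp add: power2_eq_square algebra_simps)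
  then show ?thesis by (simp add: poisson_def)
qed

lemma distr_cauchy_uminus: "distr (cauchy w) borel uminus = cauchy (- cnj w)"
proof (rule measure_eqI)
  fix S assume "S \<in> sets (distr (cauchy w) borel uminus)"
  then have S [measurable]: "S \<in> sets borel" by simp
  have S' [measurable]: "uminus -` S \<in> sets borel"
    using measurable_sets[of uminus borel borel S] by simp
  have "emeasure (distr (cauchy w) borel uminus) S = (\<integral>\<^sup>+x. ennreal (poisson w x) * indicator S (- x) \<partial>lborel)"
    by (simp add: emeasure_distr emeasure_cauchy indicator_def)
  also have "\<dots> = (\<integral>\<^sup>+x. ennreal (poisson w (- x)) * indicator S x \<partial>distr lborel borel uminus)"
    by (subst nn_integral_distr) auto
  also have "\<dots> = emeasure (cauchy (- cnj w)) S"
    by (simp add: lborel_distr_uminus emeasure_cauchy poisson_mirror)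
  finally show "emeasure (distr (cauchy w) borel uminus) S = emeasure (cauchy (- cnj w)) S" .
qed simp

context parabolic_map
begin

lemma mirror_funpow: "((\<lambda>w. - cnj (h (- cnj w))) ^^ n) w = - cnj ((h ^^ n) (- cnj w))"
  by (induction n) auto

text \<open>Exchanges the two end points of an interval and the two sides of infinity, so that a
  distinguished end point can be taken to be the right one.\<close>

lemma mirror: "parabolic_map (\<lambda>w. - cnj (h (- cnj w))) (\<lambda>x. - T (- x)) (\<lambda>x. T' (- x)) \<kappa> C R"
proof
  show "(\<lambda>x. - T (- x)) \<in> borel_measurable borel" by measurable
  show "Im (- cnj (h (- cnj w))) > 0" if "Im w > 0" for w using h_upper[of "- cnj w"] that by simp
  have "(cnj \<circ> (h \<circ> uminus) \<circ> cnj) holomorphic_on {w. Im w > 0}"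
  proof (rule holomorphic_on_compose_cnj_cnj)
    show "(h \<circ> uminus) holomorphic_on cnj ` {w. Im w > 0}"
      by (rule holomorphic_on_compose_gen[OF _ h_holomorphic]) (auto intro!: holomorphic_intros)
    show "open {w. Im w > 0}" by (rule open_halfspace_Im_gt)
  qed
  then have "(\<lambda>w. - (cnj \<circ> (h \<circ> uminus) \<circ> cnj) w) holomorphic_on {w. Im w > 0}"
    by (rule holomorphic_on_minus)
  then show "(\<lambda>w. - cnj (h (- cnj w))) holomorphic_on {w. Im w > 0}" by (simp add: comp_def)
  show "distr (cauchy w) borel (\<lambda>x. - T (- x)) = cauchy (- cnj (h (- cnj w)))" if w: "Im w > 0" for w
  proof -
    have w': "Im (- cnj w) > 0" using w by simp
    have "cauchy w = distr (cauchy (- cnj w)) borel uminus" by (simp add: distr_cauchy_uminus)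
    then have "distr (cauchy w) borel (\<lambda>x. - T (- x)) = distr (distr (cauchy (- cnj w)) borel uminus) borel (\<lambda>x. - T (- x))"
      by simp
    also have "\<dots> = distr (cauchy (- cnj w)) borel (\<lambda>x. - T x)" by (simp add: distr_distr comp_def)
    also have "\<dots> = distr (distr (cauchy (- cnj w)) borel T) borel uminus" by (simp add: distr_distr comp_def)
    also have "\<dots> = cauchy (- cnj (h (- cnj w)))" unfolding distr_cauchy[OF w'] by (rule distr_cauchy_uminus)
    finally show ?thesis .
  qed
  show "filterlim (\<lambda>n. ((\<lambda>w. - cnj (h (- cnj w))) ^^ n) w) at_infinity sequentially" if w: "Im w > 0" for w
    using h_iterates[of "- cnj w"] w unfolding mirror_funpow by (simp add: filterlim_at_infinity_conv_norm_at_top)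
  show "C > 0" "R > 0" "\<kappa> \<noteq> 0" by (fact C_pos R_pos \<kappa>_nonzero)+
  show "norm (- cnj (h (- cnj w)) - w + of_real \<kappa> / w) \<le> C / (norm w)\<^sup>2" if w: "Im w > 0" "norm w > R" for w
  proof -
    have "norm (- cnj (h (- cnj w)) - w + of_real \<kappa> / w) = norm (- cnj (h (- cnj w) - (- cnj w) + of_real \<kappa> / (- cnj w)))"
      by (intro arg_cong[where f = norm]) simp
    also have "\<dots> \<le> C / (norm w)\<^sup>2" unfolding norm_minus_cancel complex_mod_cnj using h_asymp[of "- cnj w"] w by simp
    finally show ?thesis .
  qed
  fix x :: real
  assume x: "\<bar>x\<bar> > R"
  then have x': "\<bar>- x\<bar> > R" by simp
  have "\<bar>- (T (- x) - (- x) + \<kappa> / (- x))\<bar> \<le> C / x\<^sup>2" using T_asymp[OF x'] by simp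
  then show "\<bar>- T (- x) - x + \<kappa> / x\<bar> \<le> C / x\<^sup>2" by (simp add: algebra_simps)
  have "((\<lambda>x. T (uminus x)) has_real_derivative T' (- x) * (- 1)) (at x)"
    by (rule DERIV_chain2[where f = T and g = uminus])
      (use T_deriv[OF x'] in \<open>auto intro!: derivative_eq_intros\<close>)
  from DERIV_minus[OF this] show "((\<lambda>x. - T (- x)) has_real_derivative T' (- x)) (at x)" by simp
  show "\<bar>T' (- x) - 1 - \<kappa> / x\<^sup>2\<bar> \<le> C / \<bar>x\<bar> ^ 3" using T'_asymp[OF x'] by simp
next
  show "continuous_on {x. \<bar>x\<bar> > R} (\<lambda>x. T' (- x))"
    by (rule continuous_on_compose2[OF T'_cont]) (auto intro!: continuous_intros)
qed

text \<open>The measure \<open>cauchy \<i>\<close> serves as a reference measure near infinity: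
  the density of \<open>cauchy w\<close> with respect to it tends to \<open>Im w\<close>.\<close>

abbreviation ref :: "real set \<Rightarrow> real" where "ref J \<equiv> measure (cauchy \<i>) J"

lemma cauchy_far:
  assumes w: "Im w > 0" and \<eta>: "\<eta> > 0"
  obtains Y where "\<And>J. J \<in> sets borel \<Longrightarrow> J \<subseteq> {y. Y \<le> \<bar>y\<bar>} \<Longrightarrow> (Im w - \<eta>) * ref J \<le> measure (cauchy w) J"
    "\<And>J. J \<in> sets borel \<Longrightarrow> J \<subseteq> {y. Y \<le> \<bar>y\<bar>} \<Longrightarrow> measure (cauchy w) J \<le> (Im w + \<eta>) * ref J"
proof -
  define q where "q y = Im w * (y\<^sup>2 + 1) / ((y - Re w)\<^sup>2 + (Im w)\<^sup>2)" for y
  have q: "poisson w y = q y * poisson \<i> y" for y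
  proof -
    have "y\<^sup>2 + 1 \<noteq> 0" by (smt (verit) zero_le_power2)
    then show ?thesis by (simp add: q_def poisson_def)
  qed
  obtain a c where ac: "a = Re w" "c = Im w" by blast
  have "((\<lambda>y. c * (y\<^sup>2 + 1) / ((y - a)\<^sup>2 + c\<^sup>2)) \<longlongrightarrow> c) at_top" "((\<lambda>y. c * (y\<^sup>2 + 1) / ((y - a)\<^sup>2 + c\<^sup>2)) \<longlongrightarrow> c) at_bot"
    using w unfolding ac(2)[symmetric] by real_asymp+
  then have "(q \<longlongrightarrow> Im w) at_top" "(q \<longlongrightarrow> Im w) at_bot" unfolding q_def ac by auto
  then have "eventually (\<lambda>y. dist (q y) (Im w) < \<eta>) at_top" "eventually (\<lambda>y. dist (q y) (Im w) < \<eta>) at_bot"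
    using \<eta> by (auto dest: tendstoD)
  then obtain Y1 Y2 where Y12: "\<And>y. Y1 \<le> y \<Longrightarrow> dist (q y) (Im w) < \<eta>" "\<And>y. y \<le> Y2 \<Longrightarrow> dist (q y) (Im w) < \<eta>"
    by (auto simp: eventually_at_top_linorder eventually_at_bot_linorder)
  define Y where "Y = max (max Y1 (- Y2)) 0"
  have dist: "\<bar>q y - Im w\<bar> < \<eta>" if "Y \<le> \<bar>y\<bar>" for y
    using that Y12[of y] by (auto simp: Y_def dist_real_def abs_if split: if_splits)
  have i: "Im \<i> > 0" by simp
  show ?thesis
  proof
    fix J :: "real set" assume J: "J \<in> sets borel" "J \<subseteq> {y. Y \<le> \<bar>y\<bar>}"
    have "(\<integral>x. (Im w - \<eta>) * (poisson \<i> x * indicator J x) \<partial>lborel) \<le> measure (cauchy w) J"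
      unfolding measure_cauchy[OF w J(1)]
    proof (intro integral_mono integrable_mult_right integrable_poisson_indicator i w J)
      fix x
      have "Im w - \<eta> \<le> q x" if "x \<in> J" using dist[of x] that J by auto
      then show "(Im w - \<eta>) * (poisson \<i> x * indicator J x) \<le> poisson w x * indicator J x"
        unfolding q[of x] using poisson_nonneg[OF i, of x] by (auto simp: indicator_def mult_right_mono)
    qed
    then show "(Im w - \<eta>) * ref J \<le> measure (cauchy w) J" by (simp add: measure_cauchy[OF i J(1)])
    have "measure (cauchy w) J \<le> (\<integral>x. (Im w + \<eta>) * (poisson \<i> x * indicator J x) \<partial>lborel)"
      unfolding measure_cauchy[OF w J(1)]
    proof (intro integral_mono integrable_mult_right integrable_poisson_indicator i w J)
      fix x
      have "q x \<le> Im w + \<eta>" if "x \<in> J" using dist[of x] that J by auto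
      then show "poisson w x * indicator J x \<le> (Im w + \<eta>) * (poisson \<i> x * indicator J x)"
        unfolding q[of x] using poisson_nonneg[OF i, of x] by (auto simp: indicator_def mult_right_mono)
    qed
    then show "measure (cauchy w) J \<le> (Im w + \<eta>) * ref J" by (simp add: measure_cauchy[OF i J(1)])
  qed
qed

lemma ref_Icc_pos: "ref {y..y + 1} > 0"
proof -
  have "{y..y + 1} \<subseteq> {- (\<bar>y\<bar> + 1)..\<bar>y\<bar> + 1}" by auto
  then have "Im \<i> / (pi * ((\<bar>y\<bar> + 1 + \<bar>Re \<i>\<bar>)\<^sup>2 + (Im \<i>)\<^sup>2)) * measure lborel {y..y + 1} \<le> ref {y..y + 1}"
    by (intro measure_cauchy_bounds) auto
  moreover have "0 < Im \<i> / (pi * ((\<bar>y\<bar> + 1 + \<bar>Re \<i>\<bar>)\<^sup>2 + (Im \<i>)\<^sup>2)) * measure lborel {y..y + 1}"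
    by (auto intro!: divide_pos_pos mult_pos_pos add_nonneg_pos)
  ultimately show ?thesis by linarith
qed

lemma cauchy_mono_combination:
  assumes w: "Im w1 > 0" "Im w2 > 0" and le: "\<And>x. c1 * poisson w1 x \<le> c2 * poisson w2 x" and S: "S \<in> sets borel"
  shows "c1 * measure (cauchy w1) S \<le> c2 * measure (cauchy w2) S"
proof -
  have "(\<integral>x. c1 * (poisson w1 x * indicator S x) \<partial>lborel) \<le> (\<integral>x. c2 * (poisson w2 x * indicator S x) \<partial>lborel)"
    using le by (intro integral_mono integrable_mult_right integrable_poisson_indicator w S) (auto simp: indicator_def)
  then show ?thesis by (simp add: measure_cauchy w S)
qed

text \<open>Pointwise inequalities between Poisson kernels transfer to \<open>Im (h\<^sup>N)\<close>, by testing
  them on \<open>T\<^sup>-\<^sup>N J\<close> for sets \<open>J\<close> far out.\<close>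

lemma Im_comparison:
  assumes w: "Im w1 > 0" "Im w2 > 0" and c: "c1 \<ge> 0" "c2 \<ge> 0"
    and le: "\<And>x. c1 * poisson w1 x \<le> c2 * poisson w2 x"
  shows "c1 * Im ((h ^^ N) w1) \<le> c2 * Im ((h ^^ N) w2)"
proof (rule ccontr)
  define I1 I2 where "I1 = Im ((h ^^ N) w1)" and "I2 = Im ((h ^^ N) w2)"
  assume "\<not> c1 * Im ((h ^^ N) w1) \<le> c2 * Im ((h ^^ N) w2)"
  then have d: "c1 * I1 - c2 * I2 > 0" by (simp add: I1_def I2_def)
  define \<eta> where "\<eta> = (c1 * I1 - c2 * I2) / (2 * (c1 + c2 + 1))"
  have \<eta>: "\<eta> > 0" using d c by (auto simp: \<eta>_def intro!: divide_pos_pos)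
  have \<eta>': "(c1 + c2) * \<eta> < c1 * I1 - c2 * I2"
  proof -
    have "(c1 + c2) * \<eta> = ((c1 + c2) / (2 * (c1 + c2 + 1))) * (c1 * I1 - c2 * I2)" by (simp add: \<eta>_def)
    also have "\<dots> < 1 * (c1 * I1 - c2 * I2)" using c d by (intro mult_strict_right_mono) (auto simp: divide_simps)
    finally show ?thesis by simp
  qed
  obtain Y1 where Y1: "\<And>J. J \<in> sets borel \<Longrightarrow> J \<subseteq> {y. Y1 \<le> \<bar>y\<bar>} \<Longrightarrow> (I1 - \<eta>) * ref J \<le> measure (cauchy ((h ^^ N) w1)) J"
    using cauchy_far[OF h_upper_funpow[OF w(1)] \<eta>] unfolding I1_def by metis
  obtain Y2 where Y2: "\<And>J. J \<in> sets borel \<Longrightarrow> J \<subseteq> {y. Y2 \<le> \<bar>y\<bar>} \<Longrightarrow> measure (cauchy ((h ^^ N) w2)) J \<le> (I2 + \<eta>) * ref J"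
    using cauchy_far[OF h_upper_funpow[OF w(2)] \<eta>] unfolding I2_def by metis
  define y where "y = max 0 (max Y1 Y2)"
  define J where "J = {y..y + 1}"
  have J: "J \<in> sets borel" "J \<subseteq> {y. Y1 \<le> \<bar>y\<bar>}" "J \<subseteq> {y. Y2 \<le> \<bar>y\<bar>}" "ref J > 0"
    using ref_Icc_pos by (auto simp: J_def y_def)
  have "c1 * ((I1 - \<eta>) * ref J) \<le> c1 * measure (cauchy ((h ^^ N) w1)) J"
    using Y1[OF J(1,2)] c by (intro mult_left_mono)
  also have "\<dots> = c1 * measure (cauchy w1) ((T ^^ N) -` J)" by (simp add: measure_cauchy_funpow w J)
  also have "\<dots> \<le> c2 * measure (cauchy w2) ((T ^^ N) -` J)"
    by (rule cauchy_mono_combination[OF w le]) (rule sets_vimage_funpow[OF J(1)])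
  also have "\<dots> = c2 * measure (cauchy ((h ^^ N) w2)) J" by (simp add: measure_cauchy_funpow w J)
  also have "\<dots> \<le> c2 * ((I2 + \<eta>) * ref J)"
    using Y2[OF J(1,3)] c by (intro mult_left_mono)
  finally have "(c1 * (I1 - \<eta>)) * ref J \<le> (c2 * (I2 + \<eta>)) * ref J" by (simp add: mult.assoc)
  then have "c1 * (I1 - \<eta>) \<le> c2 * (I2 + \<eta>)" using J(4) by simp
  then show False using \<eta>' by (simp add: algebra_simps)
qed

text \<open>Sets near infinity are reached from the interval at time \<open>N\<close> only in a
  vanishing proportion, measured by \<open>ref\<close>.\<close>

definition small :: "real \<Rightarrow> real \<Rightarrow> nat \<Rightarrow> bool" where
  "small a b N \<longleftrightarrow> (\<forall>\<eta>>0. \<exists>Y. \<forall>J. J \<in> sets borel \<longrightarrow> J \<subseteq> {y. Y \<le> \<bar>y\<bar>} \<longrightarrow>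
     measure lborel ({a..b} \<inter> (T ^^ N) -` J) \<le> \<eta> * ref J)"

text \<open>If the measure in the Herglotz representation of \<open>h ^^ N\<close> does not charge
  the open interval, this inequality follows by comparing kernels; it is used in place of that
  condition. The factor 2 comes from \<open>s + e^2 \<le> 2 * (s + \<epsilon>^2)\<close> for
  \<open>s \<ge> e^2\<close>.\<close>

definition flat :: "real \<Rightarrow> real \<Rightarrow> nat \<Rightarrow> bool" where
  "flat a b N \<longleftrightarrow> (\<forall>t e \<epsilon>. 0 < \<epsilon> \<longrightarrow> \<epsilon> \<le> e \<longrightarrow> a \<le> t - e \<longrightarrow> t + e \<le> b \<longrightarrow>
     Im ((h ^^ N) (Complex t \<epsilon>)) \<le> 2 * \<epsilon> / e * Im ((h ^^ N) (Complex t e)))"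

lemma fmeasurable_Icc_vimage: "J \<in> sets borel \<Longrightarrow> {a..b} \<inter> (T ^^ N) -` J \<in> fmeasurable lborel"
  by (rule fmeasurableI2[of "{a..b}"]) (auto intro: sets_vimage_funpow)

text \<open>Outside of \<open>{a..b}\<close> the Poisson kernel at height \<open>\<epsilon>\<close>
  is at most \<open>q\<close> times the one at height \<open>e\<close>. Where the imaginary parts
  violate this relation, testing the difference of the kernels on preimages of far sets leaves a
  positive proportion, which only the interval can supply.\<close>

lemma not_flat_lower:
  assumes "\<not> flat a b N"
  obtains c Y where "c > 0"
    "\<And>J. J \<in> sets borel \<Longrightarrow> J \<subseteq> {y. Y \<le> \<bar>y\<bar>} \<Longrightarrow> c * ref J \<le> measure lborel ({a..b} \<inter> (T ^^ N) -` J)"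
proof -
  obtain t e \<epsilon> where te: "0 < \<epsilon>" "\<epsilon> \<le> e" "a \<le> t - e" "t + e \<le> b"
    "Im ((h ^^ N) (Complex t \<epsilon>)) > 2 * \<epsilon> / e * Im ((h ^^ N) (Complex t e))"
    using assms unfolding flat_def by (force simp: not_le)
  have e: "e > 0" using te by simp
  define w1 w2 where "w1 = Complex t \<epsilon>" and "w2 = Complex t e"
  define q where "q = 2 * \<epsilon> / e"
  have q: "q > 0" using te e by (simp add: q_def)
  have w: "Im w1 > 0" "Im w2 > 0" using te e by (auto simp: w1_def w2_def)
  define d where "d = Im ((h ^^ N) w1) - q * Im ((h ^^ N) w2)"
  have d: "d > 0" using te(5) by (simp add: d_def w1_def w2_def q_def)
  \<comment> \<open>The errors of the two uses of \<open>cauchy_far\<close> together amount to half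
    of \<open>d\<close>.\<close>
  define \<eta> where "\<eta> = d / (2 * (1 + q))"
  have \<eta>: "\<eta> > 0" using d q by (simp add: \<eta>_def)
  obtain Y1 where Y1: "\<And>J. J \<in> sets borel \<Longrightarrow> J \<subseteq> {y. Y1 \<le> \<bar>y\<bar>} \<Longrightarrow> (Im ((h ^^ N) w1) - \<eta>) * ref J \<le> measure (cauchy ((h ^^ N) w1)) J"
    using cauchy_far[OF h_upper_funpow[OF w(1)] \<eta>] by metis
  obtain Y2 where Y2: "\<And>J. J \<in> sets borel \<Longrightarrow> J \<subseteq> {y. Y2 \<le> \<bar>y\<bar>} \<Longrightarrow> measure (cauchy ((h ^^ N) w2)) J \<le> (Im ((h ^^ N) w2) + \<eta>) * ref J"
    using cauchy_far[OF h_upper_funpow[OF w(2)] \<eta>] by metis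
  have kernel: "poisson w1 x - q * poisson w2 x \<le> 1 / \<epsilon> * indicator {a..b} x" for x
  proof -
    define s where "s = (x - t)\<^sup>2"
    have s: "s \<ge> 0" by (simp add: s_def)
    have p: "poisson w1 x = \<epsilon> / pi * (1 / (s + \<epsilon>\<^sup>2))" "q * poisson w2 x = \<epsilon> / pi * (2 / (s + e\<^sup>2))"
      using e by (simp_all add: poisson_def s_def w1_def w2_def q_def)
    show ?thesis
    proof (cases "x \<in> {a..b}")
      case True
      have "poisson w1 x = \<epsilon> / (pi * ((x - t)\<^sup>2 + \<epsilon>\<^sup>2))" by (simp add: poisson_def w1_def)
      also have "\<dots> \<le> \<epsilon> / (1 * (0 + \<epsilon>\<^sup>2))"
        using te pi_gt3 by (intro divide_left_mono mult_mono mult_pos_pos add_nonneg_pos) auto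
      also have "\<dots> = 1 / \<epsilon>" by (simp add: power2_eq_square)
      finally show ?thesis using True mult_pos_pos[OF q poisson_pos[OF w(2), of x]] by simp
    next
      case False
      then have "\<bar>e\<bar> \<le> \<bar>x - t\<bar>" using te e by (auto simp: abs_if)
      then have es: "e\<^sup>2 \<le> s" unfolding s_def by (simp only: abs_le_square_iff)
      have aux: "1 * (s + u) \<le> 2 * (s + v)" if "u \<le> s" "0 \<le> v" for u v :: real
        using that by (simp add: algebra_simps)
      have "1 * (s + e\<^sup>2) \<le> 2 * (s + \<epsilon>\<^sup>2)" by (rule aux[OF es]) simp
      then have "1 / (s + \<epsilon>\<^sup>2) \<le> 2 / (s + e\<^sup>2)"
        using s te e by (subst frac_le_eq) (auto simp: add_nonneg_pos add_nonneg_eq_0_iff intro!: divide_nonpos_pos mult_pos_pos add_nonneg_pos)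
      then have "poisson w1 x \<le> q * poisson w2 x" unfolding p using te by (intro mult_left_mono) auto
      then show ?thesis using False by simp
    qed
  qed
  show ?thesis
  proof
    show "\<epsilon> * (d / 2) > 0" using te d by simp
    fix J assume J: "J \<in> sets borel" "J \<subseteq> {y. max Y1 Y2 \<le> \<bar>y\<bar>}"
    then have J': "J \<subseteq> {y. Y1 \<le> \<bar>y\<bar>}" "J \<subseteq> {y. Y2 \<le> \<bar>y\<bar>}" by auto
    define A where "A = (T ^^ N) -` J"
    have A: "A \<in> sets borel" unfolding A_def by (rule sets_vimage_funpow[OF J(1)])
    have fm: "{a..b} \<inter> A \<in> fmeasurable lborel" unfolding A_def by (rule fmeasurable_Icc_vimage[OF J(1)])
    have "d / 2 * ref J \<le> (Im ((h ^^ N) w1) - \<eta>) * ref J - q * ((Im ((h ^^ N) w2) + \<eta>) * ref J)"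
    proof -
      have gen: "x * (d / (2 * x)) = d / 2" if "x \<noteq> 0" for x using that by simp
      have "(1 + q) * \<eta> = d / 2" unfolding \<eta>_def by (rule gen) (use q in simp)
      then have "(Im ((h ^^ N) w1) - \<eta>) - q * (Im ((h ^^ N) w2) + \<eta>) = d / 2" by (simp add: d_def algebra_simps)
      then have "((Im ((h ^^ N) w1) - \<eta>) - q * (Im ((h ^^ N) w2) + \<eta>)) * ref J = d / 2 * ref J" by simp
      then show ?thesis by (simp add: algebra_simps)
    qed
    also have "\<dots> \<le> measure (cauchy ((h ^^ N) w1)) J - q * measure (cauchy ((h ^^ N) w2)) J"
      using Y1[OF J(1) J'(1)] Y2[OF J(1) J'(2)] q by (intro diff_mono mult_left_mono) auto
    also have "\<dots> = measure (cauchy w1) A - q * measure (cauchy w2) A"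
      by (simp add: A_def measure_cauchy_funpow w J)
    also have "\<dots> = (\<integral>x. poisson w1 x * indicator A x - q * (poisson w2 x * indicator A x) \<partial>lborel)"
      by (simp add: measure_cauchy w A integrable_poisson_indicator)
    also have "\<dots> \<le> (\<integral>x. 1 / \<epsilon> * indicator ({a..b} \<inter> A) x \<partial>lborel)"
    proof (rule integral_mono)
      show "integrable lborel (\<lambda>x. poisson w1 x * indicator A x - q * (poisson w2 x * indicator A x))"
        by (intro Bochner_Integration.integrable_diff integrable_mult_right integrable_poisson_indicator w A)
      show "integrable lborel (\<lambda>x. 1 / \<epsilon> * indicator ({a..b} \<inter> A) x)" using fm by (auto simp: fmeasurable_def)
      show "poisson w1 x * indicator A x - q * (poisson w2 x * indicator A x) \<le> 1 / \<epsilon> * indicator ({a..b} \<inter> A) x" for x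
        using kernel[of x] by (auto split: split_indicator)
    qed
    also have "\<dots> = 1 / \<epsilon> * measure lborel ({a..b} \<inter> A)" using fm by (simp add: fmeasurable_def)
    finally show "\<epsilon> * (d / 2) * ref J \<le> measure lborel ({a..b} \<inter> (T ^^ N) -` J)"
      using te(1) by (simp add: A_def field_simps)
  qed
qed

text \<open>The Poisson kernel at height \<open>\<epsilon>\<close> is at least
  \<open>1 / (8 * \<epsilon>)\<close> on the interval of radius \<open>\<epsilon>\<close>, because
  \<open>pi < 4\<close>.\<close>

lemma measure_Icc_vimage_le:
  assumes \<epsilon>: "\<epsilon> > 0" and \<theta>: "\<theta> > 0"
  obtains Y where "\<And>J. J \<in> sets borel \<Longrightarrow> J \<subseteq> {y. Y \<le> \<bar>y\<bar>} \<Longrightarrow>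
    measure lborel ({p - \<epsilon>..p + \<epsilon>} \<inter> (T ^^ N) -` J) \<le> 8 * \<epsilon> * (Im ((h ^^ N) (Complex p \<epsilon>)) + \<theta>) * ref J"
proof -
  define w where "w = Complex p \<epsilon>"
  have w: "Im w > 0" using \<epsilon> by (simp add: w_def)
  obtain Y where Y: "\<And>J. J \<in> sets borel \<Longrightarrow> J \<subseteq> {y. Y \<le> \<bar>y\<bar>} \<Longrightarrow> measure (cauchy ((h ^^ N) w)) J \<le> (Im ((h ^^ N) w) + \<theta>) * ref J"
    using cauchy_far[OF h_upper_funpow[OF w] \<theta>] by metis
  show ?thesis
  proof
    fix J assume J: "J \<in> sets borel" "J \<subseteq> {y. Y \<le> \<bar>y\<bar>}"
    define A where "A = (T ^^ N) -` J"
    have A: "A \<in> sets borel" unfolding A_def by (rule sets_vimage_funpow[OF J(1)])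
    have fm: "{p - \<epsilon>..p + \<epsilon>} \<inter> A \<in> fmeasurable lborel" unfolding A_def by (rule fmeasurable_Icc_vimage[OF J(1)])
    have "1 / (8 * \<epsilon>) * measure lborel ({p - \<epsilon>..p + \<epsilon>} \<inter> A) = (\<integral>x. 1 / (8 * \<epsilon>) * indicator ({p - \<epsilon>..p + \<epsilon>} \<inter> A) x \<partial>lborel)"
      using fm by (simp add: fmeasurable_def)
    also have "\<dots> \<le> (\<integral>x. poisson w x * indicator A x \<partial>lborel)"
    proof (rule integral_mono)
      show "integrable lborel (\<lambda>x. 1 / (8 * \<epsilon>) * indicator ({p - \<epsilon>..p + \<epsilon>} \<inter> A) x)" using fm by (auto simp: fmeasurable_def)
      show "integrable lborel (\<lambda>x. poisson w x * indicator A x)" by (rule integrable_poisson_indicator[OF w A])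
      fix x
      show "1 / (8 * \<epsilon>) * indicator ({p - \<epsilon>..p + \<epsilon>} \<inter> A) x \<le> poisson w x * indicator A x"
      proof (cases "x \<in> {p - \<epsilon>..p + \<epsilon>}")
        case True
        then have "\<bar>x - p\<bar> \<le> \<bar>\<epsilon>\<bar>" using \<epsilon> by (auto simp: abs_if)
        then have "(x - p)\<^sup>2 \<le> \<epsilon>\<^sup>2" by (simp only: abs_le_square_iff)
        then have "pi * ((x - p)\<^sup>2 + \<epsilon>\<^sup>2) \<le> 4 * (\<epsilon>\<^sup>2 + \<epsilon>\<^sup>2)" using pi_less_4 by (intro mult_mono) auto
        then have "\<epsilon> / (4 * (\<epsilon>\<^sup>2 + \<epsilon>\<^sup>2)) \<le> poisson w x"
          unfolding poisson_def w_def using \<epsilon> by (auto intro!: divide_left_mono mult_pos_pos add_nonneg_pos)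
        moreover have "\<epsilon> / (4 * (\<epsilon>\<^sup>2 + \<epsilon>\<^sup>2)) = 1 / (8 * \<epsilon>)" using \<epsilon> by (simp add: power2_eq_square field_simps)
        ultimately show ?thesis using True by (auto simp: indicator_def)
      qed (use poisson_nonneg[OF w, of x] in auto)
    qed
    also have "\<dots> = measure (cauchy ((h ^^ N) w)) J"
      unfolding measure_cauchy[OF w A, symmetric] unfolding A_def by (rule measure_cauchy_funpow[OF w J(1)])
    also have "\<dots> \<le> (Im ((h ^^ N) w) + \<theta>) * ref J" by (rule Y[OF J])
    finally show "measure lborel ({p - \<epsilon>..p + \<epsilon>} \<inter> (T ^^ N) -` J) \<le> 8 * \<epsilon> * (Im ((h ^^ N) (Complex p \<epsilon>)) + \<theta>) * ref J"
      using \<epsilon> by (simp add: A_def w_def field_simps)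
  qed
qed

lemma funpow_holomorphic: "(h ^^ N) holomorphic_on {w. Im w > 0}"
proof (induction N)
  case (Suc N)
  then show ?case unfolding funpow.simps
    by (rule holomorphic_on_compose_gen[OF _ h_holomorphic]) (auto intro: h_upper_funpow)
qed simp

text \<open>If \<open>Im (h\<^sup>N)\<close> vanishes linearly on the open interval and has no mass at the end points,
  the interval is covered by short intervals on which \<open>measure_Icc_vimage_le\<close> is good enough.\<close>

lemma flat_imp_small:
  assumes ab: "a < b" and flat: "flat a b N"
    and ends: "\<And>p \<eta>. p = a \<or> p = b \<Longrightarrow> \<eta> > 0 \<Longrightarrow> \<exists>\<epsilon>>0. \<epsilon> * Im ((h ^^ N) (Complex p \<epsilon>)) < \<eta>"
  shows "small a b N"
  unfolding small_def
proof (intro allI impI)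
  fix \<eta> :: real assume \<eta>: "\<eta> > 0"
  have ends': "\<exists>\<epsilon> Y. \<epsilon> > 0 \<and> (\<forall>J. J \<in> sets borel \<longrightarrow> J \<subseteq> {y. Y \<le> \<bar>y\<bar>} \<longrightarrow>
      measure lborel ({p - \<epsilon>..p + \<epsilon>} \<inter> (T ^^ N) -` J) \<le> \<eta> / 4 * ref J)" if p: "p = a \<or> p = b" for p
  proof -
    obtain \<epsilon> where \<epsilon>: "\<epsilon> > 0" "\<epsilon> * Im ((h ^^ N) (Complex p \<epsilon>)) < \<eta> / 64" using ends[OF p, of "\<eta> / 64"] \<eta> by auto
    have "\<eta> / (64 * \<epsilon>) > 0" using \<eta> \<epsilon> by simp
    then obtain Y where Y: "\<And>J. J \<in> sets borel \<Longrightarrow> J \<subseteq> {y. Y \<le> \<bar>y\<bar>} \<Longrightarrow>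
      measure lborel ({p - \<epsilon>..p + \<epsilon>} \<inter> (T ^^ N) -` J) \<le> 8 * \<epsilon> * (Im ((h ^^ N) (Complex p \<epsilon>)) + \<eta> / (64 * \<epsilon>)) * ref J"
      using measure_Icc_vimage_le[OF \<epsilon>(1)] by metis
    have "8 * \<epsilon> * (Im ((h ^^ N) (Complex p \<epsilon>)) + \<eta> / (64 * \<epsilon>)) = 8 * (\<epsilon> * Im ((h ^^ N) (Complex p \<epsilon>))) + \<eta> / 8"
      using \<epsilon> by (simp add: field_simps)
    also have "\<dots> \<le> \<eta> / 4" using \<epsilon> by simp
    finally have "8 * \<epsilon> * (Im ((h ^^ N) (Complex p \<epsilon>)) + \<eta> / (64 * \<epsilon>)) * ref J \<le> \<eta> / 4 * ref J" for J
      by (intro mult_right_mono) auto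
    then show ?thesis using Y \<epsilon>(1) by (intro exI[of _ \<epsilon>] exI[of _ Y]) (meson order_trans)
  qed
  obtain \<epsilon>a Ya where A: "\<epsilon>a > 0" "\<And>J. J \<in> sets borel \<Longrightarrow> J \<subseteq> {y. Ya \<le> \<bar>y\<bar>} \<Longrightarrow>
      measure lborel ({a - \<epsilon>a..a + \<epsilon>a} \<inter> (T ^^ N) -` J) \<le> \<eta> / 4 * ref J" using ends'[of a] by blast
  obtain \<epsilon>b Yb where B: "\<epsilon>b > 0" "\<And>J. J \<in> sets borel \<Longrightarrow> J \<subseteq> {y. Yb \<le> \<bar>y\<bar>} \<Longrightarrow>
      measure lborel ({b - \<epsilon>b..b + \<epsilon>b} \<inter> (T ^^ N) -` J) \<le> \<eta> / 4 * ref J" using ends'[of b] by blast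
  define e where "e = min (min \<epsilon>a \<epsilon>b) ((b - a) / 4)"
  have e4: "e \<le> (b - a) / 4" unfolding e_def by (rule min.cobounded2)
  then have e: "e > 0" "e \<le> \<epsilon>a" "e \<le> \<epsilon>b" "e \<le> (b - a) / 4" using A(1) B(1) ab by (auto simp: e_def)
  have "continuous_on {a + e..b - e} (\<lambda>t. Complex t e)"
    unfolding Complex_eq by (intro continuous_intros)
  then have "continuous_on {a + e..b - e} (\<lambda>t. (h ^^ N) (Complex t e))"
    by (rule continuous_on_compose2[OF holomorphic_on_imp_continuous_on[OF funpow_holomorphic]]) (use e in auto)
  then have "continuous_on {a + e..b - e} (\<lambda>t. Im ((h ^^ N) (Complex t e)))"
    by (rule continuous_on_Im)
  then have "\<exists>t0\<in>{a + e..b - e}. \<forall>t\<in>{a + e..b - e}. Im ((h ^^ N) (Complex t e)) \<le> Im ((h ^^ N) (Complex t0 e))"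
    using e ab by (intro continuous_attains_sup) auto
  then obtain t0 where t0: "\<And>t. t \<in> {a + e..b - e} \<Longrightarrow> Im ((h ^^ N) (Complex t e)) \<le> Im ((h ^^ N) (Complex t0 e))"
    by blast
  define M where "M = max 1 (Im ((h ^^ N) (Complex t0 e)))"
  have M: "M > 0" "\<And>t. t \<in> {a + e..b - e} \<Longrightarrow> Im ((h ^^ N) (Complex t e)) \<le> M"
    using t0 by (auto simp: M_def le_max_iff_disj)
  \<comment> \<open>Budget for \<open>\<eta>\<close>: a quarter for each end point and one half for
    the \<open>k0 + 1\<close> short intervals. Each of these contributes at most
    \<open>16 * \<epsilon> * \<theta>\<close> times \<open>ref J\<close>, and
    \<open>(k0 + 1) * \<epsilon> \<le> b - a + 1\<close>.\<close>
  define L where "L = 8 * (b - a + 1)"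
  have L: "L > 0" using ab by (simp add: L_def)
  define \<theta> where "\<theta> = \<eta> / (4 * L)"
  have \<theta>: "\<theta> > 0" using \<eta> L by (simp add: \<theta>_def)
  define \<epsilon> where "\<epsilon> = min (min e 1) (\<theta> * e / (2 * M))"
  have \<epsilon>': "\<epsilon> \<le> \<theta> * e / (2 * M)" unfolding \<epsilon>_def by (rule min.cobounded2)
  have \<epsilon>: "\<epsilon> > 0" "\<epsilon> \<le> e" "\<epsilon> \<le> 1"
    using e \<theta> M by (auto simp: \<epsilon>_def)
  have \<epsilon>4: "2 * \<epsilon> / e * M \<le> \<theta>" using \<epsilon>' e(1) M(1) by (simp add: field_simps)
  have small_Im: "Im ((h ^^ N) (Complex t \<epsilon>)) \<le> \<theta>" if "t \<in> {a + e..b - e}" for t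
  proof -
    have "Im ((h ^^ N) (Complex t \<epsilon>)) \<le> 2 * \<epsilon> / e * Im ((h ^^ N) (Complex t e))"
      using flat that \<epsilon> unfolding flat_def by auto
    also have "\<dots> \<le> 2 * \<epsilon> / e * M" using M(2)[OF that] \<epsilon> e by (intro mult_left_mono) auto
    finally show ?thesis using \<epsilon>4 by linarith
  qed
  define k0 where "k0 = nat \<lfloor>(b - a - 2 * e) / \<epsilon>\<rfloor>"
  define t where "t k = a + e + real k * \<epsilon>" for k
  have k0: "real k0 \<le> (b - a - 2 * e) / \<epsilon>" "(b - a - 2 * e) / \<epsilon> < real k0 + 1"
    using e \<epsilon> ab by (auto simp: k0_def)
  have t_in: "t k \<in> {a + e..b - e}" if "k \<le> k0" for k
  proof -
    have "real k * \<epsilon> \<le> (b - a - 2 * e) / \<epsilon> * \<epsilon>" using that k0 \<epsilon> by (intro mult_right_mono) auto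
    then show ?thesis using \<epsilon> by (auto simp: t_def)
  qed
  have cover: "{a + e..b - e} \<subseteq> (\<Union>k\<in>{..k0}. {t k - \<epsilon>..t k + \<epsilon>})"
  proof
    fix x assume x: "x \<in> {a + e..b - e}"
    define k where "k = nat \<lfloor>(x - a - e) / \<epsilon>\<rfloor>"
    have k: "real k \<le> (x - a - e) / \<epsilon>" "(x - a - e) / \<epsilon> < real k + 1" using x \<epsilon> by (auto simp: k_def)
    have "(x - a - e) / \<epsilon> \<le> (b - a - 2 * e) / \<epsilon>" using x \<epsilon> by (intro divide_right_mono) auto
    then have "k \<le> k0" unfolding k_def k0_def by (intro nat_mono floor_mono)
    moreover have "real k * \<epsilon> \<le> x - a - e" "x - a - e < (real k + 1) * \<epsilon>"
      using k \<epsilon> by (auto simp: pos_le_divide_eq pos_divide_less_eq)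
    then have "x \<in> {t k - \<epsilon>..t k + \<epsilon>}" using \<epsilon> by (auto simp: t_def algebra_simps)
    ultimately show "x \<in> (\<Union>k\<in>{..k0}. {t k - \<epsilon>..t k + \<epsilon>})" by blast
  qed
  have "\<exists>Y. \<forall>k. \<forall>J. J \<in> sets borel \<longrightarrow> J \<subseteq> {y. Y k \<le> \<bar>y\<bar>} \<longrightarrow>
      measure lborel ({t k - \<epsilon>..t k + \<epsilon>} \<inter> (T ^^ N) -` J) \<le> 8 * \<epsilon> * (Im ((h ^^ N) (Complex (t k) \<epsilon>)) + \<theta>) * ref J"
  proof (intro choice allI)
    fix k
    show "\<exists>Y. \<forall>J. J \<in> sets borel \<longrightarrow> J \<subseteq> {y. Y \<le> \<bar>y\<bar>} \<longrightarrow>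
      measure lborel ({t k - \<epsilon>..t k + \<epsilon>} \<inter> (T ^^ N) -` J) \<le> 8 * \<epsilon> * (Im ((h ^^ N) (Complex (t k) \<epsilon>)) + \<theta>) * ref J"
      by (rule measure_Icc_vimage_le[OF \<epsilon>(1) \<theta>, of "t k" N]) blast
  qed
  then obtain Y where Y: "\<And>k J. J \<in> sets borel \<Longrightarrow> J \<subseteq> {y. Y k \<le> \<bar>y\<bar>} \<Longrightarrow>
      measure lborel ({t k - \<epsilon>..t k + \<epsilon>} \<inter> (T ^^ N) -` J) \<le> 8 * \<epsilon> * (Im ((h ^^ N) (Complex (t k) \<epsilon>)) + \<theta>) * ref J"
    by blast
  define Y0 where "Y0 = Max (insert Ya (insert Yb (Y ` {..k0})))"
  have Y0: "Ya \<le> Y0" "Yb \<le> Y0" "\<And>k. k \<le> k0 \<Longrightarrow> Y k \<le> Y0" unfolding Y0_def by (rule Max_ge; simp)+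
  show "\<exists>Y. \<forall>J. J \<in> sets borel \<longrightarrow> J \<subseteq> {y. Y \<le> \<bar>y\<bar>} \<longrightarrow> measure lborel ({a..b} \<inter> (T ^^ N) -` J) \<le> \<eta> * ref J"
  proof (intro exI[of _ Y0] allI impI)
    fix J assume J: "J \<in> sets borel" "J \<subseteq> {y. Y0 \<le> \<bar>y\<bar>}"
    define G where "G = (T ^^ N) -` J"
    have fm: "{u..v} \<inter> G \<in> fmeasurable lborel" for u v unfolding G_def by (rule fmeasurable_Icc_vimage[OF J(1)])
    have J': "J \<subseteq> {y. Ya \<le> \<bar>y\<bar>}" "J \<subseteq> {y. Yb \<le> \<bar>y\<bar>}" using J(2) Y0 by auto
    have Jk: "J \<subseteq> {y. Y k \<le> \<bar>y\<bar>}" if "k \<le> k0" for k using J(2) Y0(3)[OF that] by auto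
    let ?A = "{a - \<epsilon>a..a + \<epsilon>a} \<inter> G" let ?B = "{b - \<epsilon>b..b + \<epsilon>b} \<inter> G"
    let ?M = "\<Union>k\<in>{..k0}. {t k - \<epsilon>..t k + \<epsilon>} \<inter> G"
    have M_fm: "?M \<in> fmeasurable lborel" by (intro fmeasurable.finite_UN fm) auto
    have "{a..b} \<inter> G \<subseteq> (?A \<union> ?B) \<union> ?M"
    proof
      fix x assume x: "x \<in> {a..b} \<inter> G"
      then consider "x \<le> a + e" | "x \<ge> b - e" | "x \<in> {a + e..b - e}" by force
      then show "x \<in> (?A \<union> ?B) \<union> ?M"
      proof cases
        case 1 then show ?thesis using x e A(1) by auto
      next
        case 2 then show ?thesis using x e B(1) by auto
      next
        case 3 then show ?thesis using x cover by blast
      qed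
    qed
    then have "measure lborel ({a..b} \<inter> G) \<le> measure lborel ((?A \<union> ?B) \<union> ?M)"
      by (intro measure_mono_fmeasurable fmeasurable.Un fm M_fm fmeasurableD)
    also have "\<dots> \<le> measure lborel (?A \<union> ?B) + measure lborel ?M"
      by (intro measure_Un_le fmeasurableD fmeasurable.Un fm M_fm)
    also have "measure lborel (?A \<union> ?B) \<le> measure lborel ?A + measure lborel ?B"
      by (intro measure_Un_le fmeasurableD fm)
    also have "measure lborel ?A \<le> \<eta> / 4 * ref J" unfolding G_def by (rule A(2)[OF J(1) J'(1)])
    also have "measure lborel ?B \<le> \<eta> / 4 * ref J" unfolding G_def by (rule B(2)[OF J(1) J'(2)])
    also have "measure lborel ?M \<le> (\<Sum>k\<le>k0. measure lborel ({t k - \<epsilon>..t k + \<epsilon>} \<inter> G))"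
      by (intro measure_UNION_le fmeasurableD fm) simp
    also have "\<dots> \<le> (\<Sum>k\<le>k0. 8 * \<epsilon> * (\<theta> + \<theta>) * ref J)"
    proof (rule sum_mono)
      fix k assume k: "k \<in> {..k0}"
      have "measure lborel ({t k - \<epsilon>..t k + \<epsilon>} \<inter> G) \<le> 8 * \<epsilon> * (Im ((h ^^ N) (Complex (t k) \<epsilon>)) + \<theta>) * ref J"
        unfolding G_def by (rule Y[OF J(1) Jk]) (use k in simp)
      also have "\<dots> \<le> 8 * \<epsilon> * (\<theta> + \<theta>) * ref J"
        using small_Im[OF t_in[of k]] k \<epsilon> by (intro mult_right_mono mult_left_mono) auto
      finally show "measure lborel ({t k - \<epsilon>..t k + \<epsilon>} \<inter> G) \<le> 8 * \<epsilon> * (\<theta> + \<theta>) * ref J" .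
    qed
    also have "\<dots> = 16 * \<theta> * ((real k0 + 1) * \<epsilon>) * ref J" by (simp add: algebra_simps)
    also have "\<dots> \<le> 16 * \<theta> * (b - a + 1) * ref J"
    proof -
      have "real k0 * \<epsilon> \<le> b - a - 2 * e" using k0(1) \<epsilon>(1) by (simp only: pos_le_divide_eq)
      moreover have "(real k0 + 1) * \<epsilon> = real k0 * \<epsilon> + \<epsilon>" by (simp add: algebra_simps)
      ultimately have "(real k0 + 1) * \<epsilon> \<le> b - a + 1" using \<epsilon>(3) e(1) by linarith
      then show ?thesis using \<theta> by (intro mult_right_mono mult_left_mono) auto
    qed
    also have "16 * \<theta> * (b - a + 1) = 2 * (\<theta> * L)" by (simp add: L_def)
    also have "\<theta> * L = \<eta> / 4" using L by (simp add: \<theta>_def)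
    finally show "measure lborel ({a..b} \<inter> (T ^^ N) -` J) \<le> \<eta> * ref J"
      unfolding G_def by (simp add: algebra_simps)
  qed
qed

text \<open>The preimage of \<open>{y..y + 1}\<close> has measure 1, and the expanding tail branch
  supplies less by an amount of order \<open>1 / y^2\<close>, the size of \<open>ref\<close> on this
  interval. The rest lies in the core and is reached from \<open>{a..b}\<close> in \<open>i\<close>
  steps by \<open>mixing\<close>; hence the witness \<open>Suc i\<close>.\<close>

lemma not_small_exists:
  assumes ab: "a < b"
  obtains N where "\<not> small a b N"
proof -
  obtain A R1 where AR: "R1 > R" "A \<ge> 0" "\<And>b c. R1 \<le> b \<Longrightarrow> R1 \<le> c \<Longrightarrow> two_tails T T' \<kappa> A b c"
    using two_tails_exists by metis
  interpret tt: two_tails T T' \<kappa> A R1 R1 by (rule AR(3)) auto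
  have R1: "R1 > 0" using AR R_pos by simp
  obtain i where "\<exists>\<delta>>0. \<forall>S. S \<in> sets borel \<longrightarrow> S \<subseteq> {- R1..R1} \<longrightarrow>
      \<delta> * measure lborel S \<le> measure lborel ({a..b} \<inter> (T ^^ i) -` S)"
    using eventually_happens[OF mixing[OF ab R1]] by auto
  then obtain \<delta> where \<delta>: "\<delta> > 0" "\<And>S. S \<in> sets borel \<Longrightarrow> S \<subseteq> {- R1..R1} \<Longrightarrow>
      \<delta> * measure lborel S \<le> measure lborel ({a..b} \<inter> (T ^^ i) -` S)" by auto
  define c where "c = \<delta> * (\<kappa> / (16 * (1 + 4 * \<kappa> / R1\<^sup>2)))"
  have c: "c > 0" using \<delta> \<kappa>_pos R1 by (auto simp: c_def intro!: mult_pos_pos divide_pos_pos add_pos_nonneg)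
  have lower: "c / (y + 1)\<^sup>2 \<le> measure lborel ({a..b} \<inter> (T ^^ Suc i) -` {y..y + 1})" if y: "y > R1" for y
  proof -
    define J where "J = {y..y + 1}"
    have TR1: "T R1 < R1" by (rule tt.T_less) simp
    obtain v where v: "v \<ge> R1" "T v = y + 1" using tt.T_surj[of "y + 1"] y TR1 by auto
    have vR: "R1 < v" using v y TR1 by (cases "v = R1") auto
    define J' where "J' = {x. R1 < x \<and> T x \<in> J}"
    have J: "J \<in> sets borel" "J \<subseteq> {T R1<..T v}" "{x. R1 < x \<and> T x \<in> J} \<subseteq> {R1..}"
      using v y TR1 by (auto simp: J_def)
    note m = tt.measure_pull_Suc[OF J(1,2) vR order_refl J(3), folded J'_def]
    define S where "S = {- R1..R1} \<inter> T -` J"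
    have TJ: "T -` J \<in> sets borel" "measure lborel (T -` J) = 1" "T -` J \<in> fmeasurable lborel"
      using sets_vimage_funpow[OF J(1), of 1] measure_vimage[OF J(1)] fmeasurable_vimage[OF m(1)] by (auto simp: J_def)
    have S: "S \<in> sets borel" "S \<subseteq> {- R1..R1}" using TJ by (auto simp: S_def)
    have "T -` J \<subseteq> S \<union> J'"
    proof
      fix x assume x: "x \<in> T -` J"
      have "\<not> x < - R1"
      proof
        assume "x < - R1"
        then have "0 < - T (- (- x))" by (intro tt.L.T_pos) simp
        then show False using x y R1 by (auto simp: J_def)
      qed
      then show "x \<in> S \<union> J'" using x by (auto simp: S_def J'_def)
    qed
    then have "measure lborel (T -` J) \<le> measure lborel (S \<union> J')"
      using m(2) fmeasurableI2[OF TJ(3), of S] S(1) TJ(1)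
      by (intro measure_mono_fmeasurable fmeasurable.Un) (auto simp: S_def)
    also have "\<dots> \<le> measure lborel S + measure lborel J'" using S(1) m(2) by (intro measure_Un_le) auto
    finally have S_ge: "1 - measure lborel J' \<le> measure lborel S" using TJ(2) by simp
    have J1: "measure lborel J = 1" by (simp add: J_def)
    have "v / 2 \<le> y + 1" using tt.T_ge[OF v(1)] v(2) AR(2) by simp
    then have v2: "v \<le> 2 * (y + 1)" by simp
    have J'_ge: "1 / (1 + 4 * \<kappa> / R1\<^sup>2) \<le> measure lborel J'"
      using m(3) \<kappa>_pos unfolding J1 by (simp add: divide_le_eq mult.commute add_pos_nonneg)
    have "\<kappa> / (16 * (1 + 4 * \<kappa> / R1\<^sup>2)) / (y + 1)\<^sup>2 = \<kappa> / (4 * (2 * (y + 1))\<^sup>2) * (1 / (1 + 4 * \<kappa> / R1\<^sup>2))"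
    proof -
      have "\<kappa> / (16 * X) / z\<^sup>2 = \<kappa> / (4 * (2 * z)\<^sup>2) * (1 / X)" for X z
        by (simp add: power_mult_distrib)
      then show ?thesis .
    qed
    also have "\<dots> \<le> \<kappa> / (4 * v\<^sup>2) * measure lborel J'"
      using v2 v R1 \<kappa>_pos J'_ge by (intro mult_mono divide_left_mono mult_left_mono power_mono) (auto intro!: mult_pos_pos divide_nonneg_pos add_pos_nonneg)
    also have "\<dots> \<le> measure lborel S" using m(4) S_ge J1 by (simp add: algebra_simps)
    finally have "\<delta> * (\<kappa> / (16 * (1 + 4 * \<kappa> / R1\<^sup>2)) / (y + 1)\<^sup>2) \<le> \<delta> * measure lborel S"
      using \<delta>(1) by (intro mult_left_mono) auto
    also have "\<dots> \<le> measure lborel ({a..b} \<inter> (T ^^ i) -` S)" by (rule \<delta>(2)[OF S])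
    also have "\<dots> \<le> measure lborel ({a..b} \<inter> (T ^^ Suc i) -` J)"
      by (rule measure_mono_fmeasurable)
        (use S(1) J(1) in \<open>auto simp: S_def intro: fmeasurable_Icc_vimage sets_vimage_funpow simp del: funpow.simps\<close>, auto)
    finally show ?thesis by (simp add: c_def J_def del: funpow.simps)
  qed
  have "\<not> small a b (Suc i)"
  proof
    assume "small a b (Suc i)"
    moreover have "c > 0" by fact
    ultimately obtain Y where Y: "\<And>J. J \<in> sets borel \<Longrightarrow> J \<subseteq> {y. Y \<le> \<bar>y\<bar>} \<Longrightarrow>
       measure lborel ({a..b} \<inter> (T ^^ Suc i) -` J) \<le> c * ref J" unfolding small_def by blast
    \<comment> \<open>The bound \<open>y \<ge> 3\<close> yields
      \<open>(y + 1)^2 \<le> 16 / 9 * y^2 < pi * y^2\<close>.\<close>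
    define y where "y = max (R1 + 1) (max Y 3)"
    have y: "y > R1" "y \<ge> Y" "y \<ge> 3" by (auto simp: y_def)
    have "ref {y..y + 1} < 1 / (y + 1)\<^sup>2"
    proof -
      have "ref {y..y + 1} = (\<integral>x. poisson \<i> x * indicator {y..y + 1} x \<partial>lborel)" by (rule measure_cauchy) auto
      also have "\<dots> \<le> (\<integral>x. 1 / (pi * y\<^sup>2) * indicator {y..y + 1} x \<partial>lborel)"
      proof (rule integral_mono)
        show "integrable lborel (\<lambda>x. poisson \<i> x * indicator {y..y + 1} x)" by (rule integrable_poisson_indicator) auto
        fix x
        have "poisson \<i> x \<le> 1 / (pi * y\<^sup>2)" if "y \<le> x"
        proof -
          have "y\<^sup>2 \<le> x\<^sup>2 + 1" using power_mono[OF that, of 2] y by simp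
          then show ?thesis using y by (auto simp: poisson_def intro!: divide_left_mono mult_left_mono mult_pos_pos add_nonneg_pos)
        qed
        then show "poisson \<i> x * indicator {y..y + 1} x \<le> 1 / (pi * y\<^sup>2) * indicator {y..y + 1} x"
          by (auto simp: indicator_def)
      qed simp
      also have "\<dots> = 1 / (pi * y\<^sup>2)" by simp
      also have "\<dots> < 1 / (y + 1)\<^sup>2"
      proof -
        have "(y + 1)\<^sup>2 \<le> (4 / 3 * y)\<^sup>2" using y by (intro power_mono) auto
        also have "\<dots> = 16 / 9 * y\<^sup>2" by (simp add: power2_eq_square)
        also have "\<dots> < pi * y\<^sup>2" using pi_gt3 y by (intro mult_strict_right_mono) auto
        finally show ?thesis using y by (intro divide_strict_left_mono) (auto intro!: mult_pos_pos)
      qed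
      finally show ?thesis .
    qed
    then have "c * ref {y..y + 1} < c / (y + 1)\<^sup>2" using c mult_strict_left_mono[of "ref {y..y + 1}" "1 / (y + 1)\<^sup>2" c] by simp
    moreover have "{y..y + 1} \<subseteq> {z. Y \<le> \<bar>z\<bar>}" using y by auto
    ultimately show False using Y[of "{y..y + 1}"] lower[OF y(1)] by (simp del: funpow.simps)
  qed
  then show ?thesis by (rule that)
qed

end

text \<open>The Schwarz lemma on the disc of radius \<open>Im z\<close> around \<open>z\<close>,
  followed by a Moebius map that sends \<open>f z\<close> to 0. Using this disc instead of the
  half-plane accounts for the factor 2.\<close>

lemma half_plane_deriv_bound:
  assumes hol: "f holomorphic_on {w. Im w > 0}" and up: "\<And>w. Im w > 0 \<Longrightarrow> Im (f w) > 0" and z: "Im z > 0"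
  shows "norm (deriv f z) \<le> 2 * Im (f z) / Im z"
proof -
  define r where "r = Im z"
  define w0 where "w0 = f z"
  have w0: "Im w0 > 0" unfolding w0_def by (rule up[OF z])
  have in_H: "Im (z + of_real r * \<xi>) > 0" if "norm \<xi> < 1" for \<xi>
  proof -
    have "\<bar>Im \<xi>\<bar> < 1" using that abs_Im_le_cmod[of \<xi>] by simp
    then have "- 1 < Im \<xi>" by linarith
    then have "r * (- 1) < r * Im \<xi>" using z by (intro mult_strict_left_mono) (auto simp: r_def)
    then show ?thesis by (simp add: r_def)
  qed
  define g where "g \<xi> = f (z + of_real r * \<xi>)" for \<xi>
  have g_hol: "g holomorphic_on ball 0 1"
    unfolding g_def by (rule holomorphic_on_compose_gen[OF _ hol, unfolded comp_def])
      (use in_H in \<open>auto intro!: holomorphic_intros\<close>)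
  have g_up: "Im (g \<xi>) > 0" if "norm \<xi> < 1" for \<xi> unfolding g_def by (rule up[OF in_H[OF that]])
  have ne: "g \<xi> - cnj w0 \<noteq> 0" if "norm \<xi> < 1" for \<xi>
    using g_up[OF that] w0 by (auto simp: complex_eq_iff)
  define \<phi> where "\<phi> \<xi> = (g \<xi> - w0) / (g \<xi> - cnj w0)" for \<xi>
  have "\<phi> holomorphic_on ball 0 1"
    unfolding \<phi>_def by (intro holomorphic_intros g_hol) (use ne in auto)
  moreover have "\<phi> 0 = 0" by (simp add: \<phi>_def g_def w0_def)
  moreover have "norm (\<phi> \<xi>) < 1" if "norm \<xi> < 1" for \<xi>
  proof -
    have "(norm (g \<xi> - w0))\<^sup>2 < (norm (g \<xi> - cnj w0))\<^sup>2"
    proof -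
      have "(Im (g \<xi>) + Im w0)\<^sup>2 - (Im (g \<xi>) - Im w0)\<^sup>2 = 4 * (Im (g \<xi>) * Im w0)"
        by (simp add: power2_eq_square algebra_simps)
      moreover have "Im (g \<xi>) * Im w0 > 0" using g_up[OF that] w0 by simp
      ultimately show ?thesis by (simp add: cmod_power2)
    qed
    then have "norm (g \<xi> - w0) < norm (g \<xi> - cnj w0)" by (rule power2_less_imp_less) simp
    then show ?thesis using ne[OF that] by (simp add: \<phi>_def norm_divide)
  qed
  ultimately have "norm (deriv \<phi> 0) \<le> 1"
    by (intro Schwarz_Lemma(2)[of \<phi> 0]) auto
  moreover have "deriv \<phi> 0 = of_real r * deriv f z / (w0 - cnj w0)"
  proof (rule DERIV_imp_deriv)
    have "(f has_field_derivative deriv f z) (at z)"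
      by (rule holomorphic_derivI[OF hol open_halfspace_Im_gt]) (use z in simp)
    then have "(f has_field_derivative deriv f z) (at (z + of_real r * 0))" by simp
    then have "(g has_field_derivative deriv f z * of_real r) (at 0)"
      unfolding g_def by (rule DERIV_chain2) (auto intro!: derivative_eq_intros)
    then have "(\<phi> has_field_derivative ((deriv f z * of_real r) * (g 0 - cnj w0) - (g 0 - w0) * (deriv f z * of_real r)) / ((g 0 - cnj w0) * (g 0 - cnj w0))) (at 0)"
      unfolding \<phi>_def using ne[of 0] by (auto intro!: derivative_eq_intros)
    moreover have "g 0 = w0" by (simp add: g_def w0_def)
    ultimately show "(\<phi> has_field_derivative of_real r * deriv f z / (w0 - cnj w0)) (at 0)"
      using ne[of 0] by (simp add: mult.commute)
  qed
  moreover have "w0 - cnj w0 = of_real (2 * Im w0) * \<i>" by (simp add: complex_eq_iff)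
  ultimately have "r * norm (deriv f z) / (2 * Im w0) \<le> 1"
    using z w0 by (simp add: norm_divide norm_mult r_def)
  then show ?thesis using z w0 by (simp add: r_def w0_def field_simps)
qed

section \<open>Boundary values of the iterates near an end point\<close>

lemma poisson_eq_norm: "poisson w y = Im w / (pi * (norm (w - of_real y))\<^sup>2)"
  by (simp add: poisson_def cmod_power2 power2_commute)

context parabolic_map
begin

lemma continuous_horizontal: "\<eta> > 0 \<Longrightarrow> continuous_on UNIV (\<lambda>t. (h ^^ N) (Complex t \<eta>))"
proof -
  assume \<eta>: "\<eta> > 0"
  have "continuous_on UNIV (\<lambda>t. Complex t \<eta>)" unfolding Complex_eq by (intro continuous_intros)
  then show ?thesis
    by (rule continuous_on_compose2[OF holomorphic_on_imp_continuous_on[OF funpow_holomorphic]]) (use \<eta> in auto)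
qed

text \<open>Averaging the harmonic measures \<open>cauchy (t + \<i> \<eta>)\<close> over \<open>t\<close> in \<open>[a, b]\<close> and letting
  \<open>\<eta> \<rightarrow> 0\<close> recovers Lebesgue measure on \<open>[a, b]\<close>; on the image side the averages are controlled
  from below with Fatou's lemma.\<close>

lemma boundary_lower_bound:
  assumes J: "J \<in> fmeasurable lborel" and ab: "a \<le> b" and \<phi>: "\<phi> \<in> borel_measurable borel"
    and ev: "\<And>y. y \<in> J \<Longrightarrow> eventually (\<lambda>n. ennreal (\<phi> y) \<le>
      (\<integral>\<^sup>+t. ennreal (poisson ((h ^^ N) (Complex t (1 / real (Suc n)))) y) * indicator {a..b} t \<partial>lborel)) sequentially"
  shows "(\<integral>\<^sup>+y. ennreal (\<phi> y) * indicator J y \<partial>lborel) \<le> emeasure lborel ({a..b} \<inter> (T ^^ N) -` J)"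
proof -
  define A where "A = (T ^^ N) -` J"
  have J_sets [measurable]: "J \<in> sets borel" using J by (simp add: fmeasurable_def)
  have A_fm: "A \<in> fmeasurable lborel" unfolding A_def by (rule fmeasurable_vimage_funpow[OF J])
  then have A_sets [measurable]: "A \<in> sets borel" by (simp add: fmeasurable_def)
  define \<eta> where "\<eta> n = 1 / real (Suc n)" for n
  have \<eta>: "\<eta> n > 0" for n by (simp add: \<eta>_def)
  have \<eta>_lim: "\<eta> \<longlonglongrightarrow> 0" unfolding \<eta>_def by real_asymp
  define u where "u n y = (\<integral>\<^sup>+t. ennreal (poisson ((h ^^ N) (Complex t (\<eta> n))) y) * indicator {a..b} t \<partial>lborel) * indicator J y" for n y
  define g where "g n x = (\<integral>\<^sup>+t. ennreal (poisson (Complex t (\<eta> n)) x) * indicator {a..b} t \<partial>lborel)" for n x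
  have measH [measurable]: "(\<lambda>t. (h ^^ N) (Complex t (\<eta> n))) \<in> borel_measurable borel" for n
    by (rule borel_measurable_continuous_onI[OF continuous_horizontal[OF \<eta>]])
  have section1 [measurable]: "(\<lambda>t. poisson ((h ^^ N) (Complex t (\<eta> n))) y) \<in> borel_measurable borel" for n y
    unfolding poisson_def by measurable
  have section2 [measurable]: "(\<lambda>t. poisson (Complex t (\<eta> n)) x) \<in> borel_measurable borel" for n x
    unfolding poisson_def complex.sel by measurable
  have meas1 [measurable]: "(\<lambda>p. ennreal (poisson ((h ^^ N) (Complex (snd p) (\<eta> n))) (fst p)) * indicator {a..b} (snd p)) \<in> borel_measurable (borel \<Otimes>\<^sub>M borel)" for n
    unfolding poisson_def by measurable
  have meas2 [measurable]: "(\<lambda>p. ennreal (poisson (Complex (snd p) (\<eta> n)) (fst p)) * indicator {a..b} (snd p)) \<in> borel_measurable (borel \<Otimes>\<^sub>M borel)" for n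
    unfolding poisson_def complex.sel by measurable
  have u_meas [measurable]: "u n \<in> borel_measurable lborel" for n unfolding u_def by measurable
  have g_meas [measurable]: "g n \<in> borel_measurable lborel" for n unfolding g_def by measurable
  have inner_int: "(\<integral>\<^sup>+y. (ennreal (poisson w y) * indicator {a..b} t) * indicator B y \<partial>lborel) = emeasure (cauchy w) B * indicator {a..b} t"
    if [measurable]: "B \<in> sets borel" for w t B
  proof -
    have "(\<integral>\<^sup>+y. (ennreal (poisson w y) * indicator {a..b} t) * indicator B y \<partial>lborel)
        = (\<integral>\<^sup>+y. (ennreal (poisson w y) * indicator B y) * indicator {a..b} t \<partial>lborel)"
      by (simp add: mult_ac)
    also have "\<dots> = (\<integral>\<^sup>+y. ennreal (poisson w y) * indicator B y \<partial>lborel) * indicator {a..b} t"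
      by (rule nn_integral_multc) measurable
    finally show ?thesis by (simp add: emeasure_cauchy that)
  qed
  have int_u: "(\<integral>\<^sup>+y. u n y \<partial>lborel) = (\<integral>\<^sup>+x. g n x * indicator A x \<partial>lborel)" for n
  proof -
    have "(\<integral>\<^sup>+y. u n y \<partial>lborel) = (\<integral>\<^sup>+y. \<integral>\<^sup>+t. (ennreal (poisson ((h ^^ N) (Complex t (\<eta> n))) y) * indicator {a..b} t) * indicator J y \<partial>lborel \<partial>lborel)"
      unfolding u_def by (intro nn_integral_cong nn_integral_multc[symmetric]) auto
    also have "\<dots> = (\<integral>\<^sup>+t. \<integral>\<^sup>+y. (ennreal (poisson ((h ^^ N) (Complex t (\<eta> n))) y) * indicator {a..b} t) * indicator J y \<partial>lborel \<partial>lborel)"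
      by (rule lborel_pair.Fubini'[symmetric]) measurable
    also have "\<dots> = (\<integral>\<^sup>+t. emeasure (cauchy ((h ^^ N) (Complex t (\<eta> n)))) J * indicator {a..b} t \<partial>lborel)"
      by (intro nn_integral_cong) (simp add: inner_int)
    also have "\<dots> = (\<integral>\<^sup>+t. emeasure (cauchy (Complex t (\<eta> n))) A * indicator {a..b} t \<partial>lborel)"
    proof -
      have "emeasure (cauchy ((h ^^ N) (Complex t (\<eta> n)))) J = emeasure (cauchy (Complex t (\<eta> n))) A" for t
        using arg_cong[OF distr_cauchy_funpow[of "Complex t (\<eta> n)" N], of "\<lambda>M. emeasure M J"] \<eta>[of n]
        by (simp add: emeasure_distr A_def)
      then show ?thesis by simp
    qed
    also have "\<dots> = (\<integral>\<^sup>+t. \<integral>\<^sup>+x. (ennreal (poisson (Complex t (\<eta> n)) x) * indicator {a..b} t) * indicator A x \<partial>lborel \<partial>lborel)"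
      by (intro nn_integral_cong) (simp add: inner_int)
    also have "\<dots> = (\<integral>\<^sup>+x. \<integral>\<^sup>+t. (ennreal (poisson (Complex t (\<eta> n)) x) * indicator {a..b} t) * indicator A x \<partial>lborel \<partial>lborel)"
      by (rule lborel_pair.Fubini') measurable
    also have "\<dots> = (\<integral>\<^sup>+x. g n x * indicator A x \<partial>lborel)"
      unfolding g_def by (intro nn_integral_cong nn_integral_multc) auto
    finally show ?thesis .
  qed
  \<comment> \<open>By symmetry of the kernel, \<open>g n x\<close> is the harmonic measure of
    \<open>{a..b}\<close> seen from \<open>x + \<i> * \<eta> n\<close>: it is at most 1 and tends to
    0 off the interval.\<close>
  have swap: "poisson (Complex t s) x = poisson (Complex x s) t" for t s x
    by (simp add: poisson_def power2_commute)
  have g_eq: "g n x = emeasure (cauchy (Complex x (\<eta> n))) {a..b}" for n x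
    unfolding g_def by (simp add: emeasure_cauchy swap[of _ _ x])
  have g_le: "g n x \<le> 1" for n x
  proof -
    interpret prob_space "cauchy (Complex x (\<eta> n))" by (rule prob_space_cauchy) (simp add: \<eta>)
    show ?thesis unfolding g_eq by (rule measure_le_1)
  qed
  have g_lim: "(\<lambda>n. g n x * indicator (A - {a..b}) x) \<longlonglongrightarrow> 0" for x
  proof (cases "x \<in> A - {a..b}")
    case True
    define d where "d = (if x < a then a - x else x - b)"
    have d: "d > 0" using True by (auto simp: d_def)
    have "g n x \<le> ennreal (\<eta> n / d\<^sup>2 * (b - a))" for n
    proof -
      have "g n x \<le> (\<integral>\<^sup>+t. ennreal (\<eta> n / d\<^sup>2) * indicator {a..b} t \<partial>lborel)"
        unfolding g_def
      proof (intro nn_integral_mono)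
        fix t
        have "poisson (Complex t (\<eta> n)) x \<le> \<eta> n / d\<^sup>2" if "t \<in> {a..b}"
        proof -
          have "\<bar>d\<bar> \<le> \<bar>x - t\<bar>" using that True by (auto simp: d_def abs_if)
          then have "d\<^sup>2 \<le> (x - t)\<^sup>2" by (simp only: abs_le_square_iff)
          then have "d\<^sup>2 \<le> (x - t)\<^sup>2 + (\<eta> n)\<^sup>2" by (rule add_increasing2[rotated]) simp
          then have "1 * d\<^sup>2 \<le> pi * ((x - t)\<^sup>2 + (\<eta> n)\<^sup>2)" using pi_gt3 by (intro mult_mono) auto
          then show ?thesis unfolding poisson_def using \<eta>[of n] d by (auto intro!: divide_left_mono mult_pos_pos add_nonneg_pos)
        qed
        then show "ennreal (poisson (Complex t (\<eta> n)) x) * indicator {a..b} t \<le> ennreal (\<eta> n / d\<^sup>2) * indicator {a..b} t"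
          by (auto simp: indicator_def intro!: ennreal_leI)
      qed
      also have "\<dots> = ennreal (\<eta> n / d\<^sup>2) * emeasure lborel {a..b}" by (rule nn_integral_cmult_indicator) simp
      also have "\<dots> = ennreal (\<eta> n / d\<^sup>2 * (b - a))"
        unfolding emeasure_lborel_Icc[OF ab] by (rule ennreal_mult''[symmetric]) (use ab in simp)
      finally show ?thesis .
    qed
    moreover have "(\<lambda>n. ennreal (\<eta> n / d\<^sup>2 * (b - a))) \<longlonglongrightarrow> ennreal (0 / d\<^sup>2 * (b - a))"
      by (intro tendsto_ennrealI tendsto_intros \<eta>_lim) (use d in auto)
    ultimately have "(\<lambda>n. g n x) \<longlonglongrightarrow> 0"
      by (intro tendsto_sandwich[of "\<lambda>_. 0" "\<lambda>n. g n x" sequentially "\<lambda>n. ennreal (\<eta> n / d\<^sup>2 * (b - a))" 0]) auto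
    then show ?thesis using True by simp
  qed simp
  have lim0: "(\<lambda>n. \<integral>\<^sup>+x. g n x * indicator (A - {a..b}) x \<partial>lborel) \<longlonglongrightarrow> (\<integral>\<^sup>+x. 0 \<partial>(lborel::real measure))"
  proof (rule nn_integral_dominated_convergence[where w = "indicator A"])
    show "(\<integral>\<^sup>+x. indicator A x \<partial>lborel) < \<infinity>" using A_fm by (simp add: fmeasurable_def)
    show "AE x in lborel. g n x * indicator (A - {a..b}) x \<le> indicator A x" for n
      using g_le[of n] by (auto simp: indicator_def)
    show "AE x in lborel. (\<lambda>n. g n x * indicator (A - {a..b}) x) \<longlonglongrightarrow> 0" using g_lim by simp
  qed auto
  have "(\<integral>\<^sup>+y. ennreal (\<phi> y) * indicator J y \<partial>lborel) \<le> (\<integral>\<^sup>+y. liminf (\<lambda>n. u n y) \<partial>lborel)"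
  proof (rule nn_integral_mono)
    fix y
    show "ennreal (\<phi> y) * indicator J y \<le> liminf (\<lambda>n. u n y)"
    proof (cases "y \<in> J")
      case True
      have "eventually (\<lambda>n. ennreal (\<phi> y) * indicator J y \<le> u n y) sequentially"
        using ev[OF True] by eventually_elim (simp add: u_def \<eta>_def True)
      then show ?thesis by (rule Liminf_bounded)
    qed simp
  qed
  also have "\<dots> \<le> liminf (\<lambda>n. \<integral>\<^sup>+y. u n y \<partial>lborel)" by (rule nn_integral_liminf) measurable
  also have "\<dots> \<le> liminf (\<lambda>n. emeasure lborel ({a..b} \<inter> A) + (\<integral>\<^sup>+x. g n x * indicator (A - {a..b}) x \<partial>lborel))"
  proof (intro Liminf_mono always_eventually allI)
    fix n
    have "(\<integral>\<^sup>+y. u n y \<partial>lborel) \<le> (\<integral>\<^sup>+x. indicator ({a..b} \<inter> A) x + g n x * indicator (A - {a..b}) x \<partial>lborel)"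
      unfolding int_u using g_le[of n] by (intro nn_integral_mono) (auto simp: indicator_def)
    also have "\<dots> = emeasure lborel ({a..b} \<inter> A) + (\<integral>\<^sup>+x. g n x * indicator (A - {a..b}) x \<partial>lborel)"
      by (subst nn_integral_add) auto
    finally show "(\<integral>\<^sup>+y. u n y \<partial>lborel) \<le> \<dots>" .
  qed
  also have "\<dots> = emeasure lborel ({a..b} \<inter> A)"
  proof (rule lim_imp_Liminf)
    have "(\<lambda>n. emeasure lborel ({a..b} \<inter> A) + (\<integral>\<^sup>+x. g n x * indicator (A - {a..b}) x \<partial>lborel)) \<longlonglongrightarrow> emeasure lborel ({a..b} \<inter> A) + 0"
      using lim0 by (intro tendsto_add tendsto_const) simp
    then show "(\<lambda>n. emeasure lborel ({a..b} \<inter> A) + (\<integral>\<^sup>+x. g n x * indicator (A - {a..b}) x \<partial>lborel)) \<longlonglongrightarrow> emeasure lborel ({a..b} \<inter> A)"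
      by simp
  qed simp
  finally show ?thesis by (simp add: A_def)
qed

end

text \<open>A boundary version of the Schwarz reflection principle on the triangle with vertex \<open>b\<close>.\<close>

lemma boundary_extension_triangle:
  fixes H :: "complex \<Rightarrow> complex"
  assumes hol: "H holomorphic_on {w. Im w > 0}" and up: "\<And>w. Im w > 0 \<Longrightarrow> Im (H w) > 0"
    and c2: "c2 > 0"
    and upper: "\<And>x \<eta>. b - d < x \<Longrightarrow> x < b \<Longrightarrow> 0 < \<eta> \<Longrightarrow> \<eta> \<le> b - x \<Longrightarrow> Im (H (Complex x \<eta>)) \<le> c2 * \<eta> / (b - x)\<^sup>2"
    and lower: "\<And>x \<eta>. b - d < x \<Longrightarrow> x < b \<Longrightarrow> 0 < \<eta> \<Longrightarrow> \<eta> \<le> b - x \<Longrightarrow> c1 * \<eta> / (b - x)\<^sup>2 \<le> Im (H (Complex x \<eta>))"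
  obtains f where
    "\<And>x. b - d < x \<Longrightarrow> x < b \<Longrightarrow> \<exists>f'. (f has_real_derivative f') (at x) \<and> c1 / (b - x)\<^sup>2 \<le> f'"
    "\<And>x t \<eta> \<delta>. \<delta> > 0 \<Longrightarrow> b - d < x \<Longrightarrow> x \<le> b - \<delta> \<Longrightarrow> b - d < t \<Longrightarrow> t \<le> b - \<delta> \<Longrightarrow> 0 < \<eta> \<Longrightarrow> \<eta> < b - t \<Longrightarrow>
      norm (H (Complex t \<eta>) - of_real (f x)) \<le> 2 * c2 / \<delta>\<^sup>2 * norm (Complex t \<eta> - of_real x)"
proof -
  define D where "D = {z. b - d < Re z \<and> Re z < b \<and> \<bar>Im z\<bar> < b - Re z}"
  define P where "P = {z. 0 < Im z}"
  have lip: "norm (H z - H w) \<le> 2 * c2 / \<delta>\<^sup>2 * norm (z - w)"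
    if "z \<in> D \<inter> P" "w \<in> D \<inter> P" "Re z \<le> b - \<delta>" "Re w \<le> b - \<delta>" "\<delta> > 0" for z w \<delta>
  proof -
    \<comment> \<open>The upper half of the triangle, cut off before its vertex, is convex, so that
      a bound on the derivative is a Lipschitz bound.\<close>
    define S where "S = {z. b - d < Re z} \<inter> {z. Re z \<le> b - \<delta>} \<inter> {z. 0 < Im z} \<inter> {z. (1 + \<i>) \<bullet> z < b} \<inter> {z. (1 - \<i>) \<bullet> z < b}"
    have S: "convex S"
      unfolding S_def by (intro convex_Int convex_halfspace_Re_gt convex_halfspace_Re_le convex_halfspace_Im_gt convex_halfspace_lt)
    have S_iff: "z \<in> S \<longleftrightarrow> z \<in> D \<inter> P \<and> Re z \<le> b - \<delta>" for z
      using \<open>\<delta> > 0\<close> by (auto simp: S_def D_def P_def inner_complex_def abs_if)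
    show ?thesis
    proof (rule field_differentiable_bound[OF S])
      fix z assume z: "z \<in> S"
      then have z': "b - d < Re z" "Re z < b" "0 < Im z" "Im z < b - Re z" "Re z \<le> b - \<delta>"
        unfolding S_iff by (auto simp: D_def P_def)
      show "(H has_field_derivative deriv H z) (at z within S)"
        using holomorphic_derivI[OF hol open_halfspace_Im_gt] z' by (blast intro: has_field_derivative_at_within)
      have "norm (deriv H z) \<le> 2 * Im (H z) / Im z"
        by (rule half_plane_deriv_bound[OF hol up z'(3)])
      also have "Im (H z) \<le> c2 * Im z / (b - Re z)\<^sup>2" using upper[of "Re z" "Im z"] z' by simp
      then have "2 * Im (H z) / Im z \<le> 2 * (c2 * Im z / (b - Re z)\<^sup>2) / Im z"
        using z' by (intro divide_right_mono mult_left_mono) auto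
      also have "\<dots> = 2 * c2 / (b - Re z)\<^sup>2" using z' by simp
      also have "\<dots> \<le> 2 * c2 / \<delta>\<^sup>2"
        using z' c2 \<open>\<delta> > 0\<close> by (intro divide_left_mono power_mono mult_pos_pos) auto
      finally show "norm (deriv H z) \<le> 2 * c2 / \<delta>\<^sup>2" .
    qed (use that S_iff in auto)
  qed
  \<comment> \<open>Vertical approach to \<open>z\<close> from above; the shift is a fraction of the
    distance to the slanted side, which keeps the points in the triangle.\<close>
  define zs where "zs n z = z + \<i> * of_real ((b - Re z - Im z) / (real n + 2))" for n z
  have zs_in: "zs n z \<in> D \<inter> P" and zs_Re: "Re (zs n z) = Re z" if "z \<in> D" "Im z \<ge> 0" for n z
  proof -
    show "Re (zs n z) = Re z" by (simp add: zs_def)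
    define e where "e = b - Re z - Im z"
    have e: "e > 0" using that by (auto simp: e_def D_def)
    have "e / (real n + 2) < e / 1" using e by (intro divide_strict_left_mono) auto
    moreover have "e / (real n + 2) > 0" using e by simp
    ultimately show "zs n z \<in> D \<inter> P" using that by (auto simp: zs_def D_def P_def e_def)
  qed
  have zs_lim: "(\<lambda>n. zs n z) \<longlonglongrightarrow> z" for z
  proof -
    have "(\<lambda>n. (b - Re z - Im z) / (real n + 2)) \<longlonglongrightarrow> 0" by real_asymp
    then have "(\<lambda>n. z + \<i> * of_real ((b - Re z - Im z) / (real n + 2))) \<longlonglongrightarrow> z + \<i> * of_real 0"
      by (intro tendsto_intros)
    then show ?thesis by (simp add: zs_def)
  qed
  define G where "G z = lim (\<lambda>n. H (zs n z))" for z
  have G_lim: "(\<lambda>n. H (zs n z)) \<longlonglongrightarrow> G z" if z: "z \<in> D" "Im z \<ge> 0" for z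
  proof -
    define \<delta> where "\<delta> = b - Re z"
    have \<delta>: "\<delta> > 0" using z by (auto simp: D_def \<delta>_def)
    define B where "B = 2 * c2 / \<delta>\<^sup>2"
    have B: "B > 0" using c2 \<delta> by (simp add: B_def)
    have "Cauchy (\<lambda>n. H (zs n z))"
    proof (rule CauchyI)
      fix e :: real assume e: "e > 0"
      have "Cauchy (\<lambda>n. zs n z)" by (rule LIMSEQ_imp_Cauchy[OF zs_lim])
      then obtain M where M: "\<And>m n. m \<ge> M \<Longrightarrow> n \<ge> M \<Longrightarrow> norm (zs m z - zs n z) < e / B"
        using CauchyD[of "\<lambda>n. zs n z" "e / B"] e B by auto
      show "\<exists>M. \<forall>m\<ge>M. \<forall>n\<ge>M. norm (H (zs m z) - H (zs n z)) < e"
      proof (intro exI[of _ M] allI impI)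
        fix m n assume "M \<le> m" "M \<le> n"
        have "norm (H (zs m z) - H (zs n z)) \<le> B * norm (zs m z - zs n z)"
          unfolding B_def by (rule lip) (use zs_in[OF z] zs_Re[OF z] \<delta> in \<open>auto simp: \<delta>_def\<close>)
        also have "\<dots> < B * (e / B)" using M[OF \<open>M \<le> m\<close> \<open>M \<le> n\<close>] B by (intro mult_strict_left_mono)
        finally show "norm (H (zs m z) - H (zs n z)) < e" using B by simp
      qed
    qed
    then show ?thesis unfolding G_def by (simp add: Cauchy_convergent_iff convergent_LIMSEQ_iff)
  qed
  have G_lip: "norm (G z - G w) \<le> 2 * c2 / \<delta>\<^sup>2 * norm (z - w)"
    if "z \<in> D" "Im z \<ge> 0" "w \<in> D" "Im w \<ge> 0" "Re z \<le> b - \<delta>" "Re w \<le> b - \<delta>" "\<delta> > 0" for z w \<delta>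
  proof (rule LIMSEQ_le)
    show "(\<lambda>n. norm (H (zs n z) - H (zs n w))) \<longlonglongrightarrow> norm (G z - G w)"
      by (intro tendsto_norm tendsto_diff G_lim that)
    show "(\<lambda>n. 2 * c2 / \<delta>\<^sup>2 * norm (zs n z - zs n w)) \<longlonglongrightarrow> 2 * c2 / \<delta>\<^sup>2 * norm (z - w)"
      by (intro tendsto_mult tendsto_const tendsto_norm tendsto_diff zs_lim)
    show "\<exists>N. \<forall>n\<ge>N. norm (H (zs n z) - H (zs n w)) \<le> 2 * c2 / \<delta>\<^sup>2 * norm (zs n z - zs n w)"
      using lip zs_in zs_Re that by (intro exI[of _ 0] allI impI lip) auto
  qed
  have G_eq: "G z = H z" if "z \<in> D \<inter> P" for z
  proof -
    have z: "z \<in> D" "Im z \<ge> 0" "z \<in> P" using that by (auto simp: P_def)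
    have "isCont H z"
      using holomorphic_on_imp_continuous_on[OF hol] z(3) open_halfspace_Im_gt[of 0]
      by (auto simp: continuous_on_eq_continuous_at P_def)
    then have "(\<lambda>n. H (zs n z)) \<longlonglongrightarrow> H z" by (rule isCont_tendsto_compose[OF _ zs_lim])
    then show ?thesis using G_lim[OF z(1,2)] LIMSEQ_unique by blast
  qed
  have G_cont: "continuous_on (D \<inter> {z. 0 \<le> Im z}) G"
    unfolding continuous_on_iff
  proof (intro ballI allI impI)
    fix z and e :: real assume z: "z \<in> D \<inter> {z. 0 \<le> Im z}" and e: "e > 0"
    define \<delta> where "\<delta> = (b - Re z) / 2"
    have \<delta>: "\<delta> > 0" "Re z + \<delta> = b - \<delta>" using z by (auto simp: D_def \<delta>_def field_simps)
    define B where "B = 2 * c2 / \<delta>\<^sup>2"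
    have B: "B > 0" using c2 \<delta> by (simp add: B_def)
    show "\<exists>s>0. \<forall>x'\<in>D \<inter> {z. 0 \<le> Im z}. dist x' z < s \<longrightarrow> dist (G x') (G z) < e"
    proof (intro exI[of _ "min \<delta> (e / B)"] conjI ballI impI)
      show "min \<delta> (e / B) > 0" using \<delta> e B by simp
      fix w assume w: "w \<in> D \<inter> {z. 0 \<le> Im z}" and dw: "dist w z < min \<delta> (e / B)"
      have "Re (w - z) \<le> norm (w - z)" by (rule complex_Re_le_cmod)
      then have "Re w \<le> b - \<delta>" using dw \<delta> by (simp add: dist_norm)
      then have "norm (G w - G z) \<le> B * norm (w - z)"
        unfolding B_def using w z \<delta> by (intro G_lip) auto
      also have "\<dots> < B * (e / B)" using dw B by (intro mult_strict_left_mono) (auto simp: dist_norm)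
      finally show "dist (G w) (G z) < e" using B by (simp add: dist_norm)
    qed
  qed
  have G_real: "Im (G (of_real x)) = 0" if x: "b - d < x" "x < b" for x
  proof -
    have z: "of_real x \<in> D" "Im (of_real x :: complex) \<ge> 0" using x by (auto simp: D_def)
    have "(\<lambda>n. Im (H (zs n (of_real x)))) \<longlonglongrightarrow> Im (G (of_real x))" by (intro tendsto_Im G_lim z)
    moreover have "(\<lambda>n. Im (H (zs n (of_real x)))) \<longlonglongrightarrow> 0"
    proof (rule tendsto_sandwich)
      have zn: "zs n (of_real x) = Complex x ((b - x) / (real n + 2))" for n by (simp add: zs_def complex_eq_iff)
      have pos: "0 < (b - x) / (real n + 2)" "(b - x) / (real n + 2) \<le> b - x" for n
        using x by (auto simp: divide_le_eq intro!: mult_left_mono[of 1 "real n + 2" "b - x", simplified])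
      show "eventually (\<lambda>n. 0 \<le> Im (H (zs n (of_real x)))) sequentially"
        using zs_in[OF z] by (intro always_eventually allI less_imp_le up) (auto simp: P_def)
      show "eventually (\<lambda>n. Im (H (zs n (of_real x))) \<le> c2 * ((b - x) / (real n + 2)) / (b - x)\<^sup>2) sequentially"
        unfolding zn by (intro always_eventually allI upper x pos)
      show "(\<lambda>n. c2 * ((b - x) / (real n + 2)) / (b - x)\<^sup>2) \<longlonglongrightarrow> 0"
      proof -
        have "(\<lambda>n. c2 * (b - x) / (b - x)\<^sup>2 * (1 / (real n + 2))) \<longlonglongrightarrow> c2 * (b - x) / (b - x)\<^sup>2 * 0"
          by (intro tendsto_mult tendsto_const) real_asymp
        then show ?thesis by (simp add: mult.commute)
      qed
    qed simp
    ultimately show ?thesis using LIMSEQ_unique by blast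
  qed
  define F where "F = (\<lambda>z. if 0 \<le> Im z then G z else cnj (G (cnj z)))"
  have D_open: "open D"
  proof -
    have "D = {z. b - d < Re z} \<inter> {z. Re z < b} \<inter> {z. (1 + \<i>) \<bullet> z < b} \<inter> {z. (1 - \<i>) \<bullet> z < b}"
      by (auto simp: D_def inner_complex_def abs_if)
    then show ?thesis by (simp add: open_Int open_halfspace_Re_gt open_halfspace_Re_lt open_halfspace_lt)
  qed
  have F_hol: "F holomorphic_on D"
    unfolding F_def
  proof (rule Schwarz_reflection[OF D_open _ _ G_cont])
    show "cnj ` D \<subseteq> D" by (auto simp: D_def)
    show "G holomorphic_on D \<inter> {z. 0 < Im z}"
      by (rule holomorphic_transform[OF holomorphic_on_subset[OF hol]]) (use G_eq in \<open>auto simp: P_def\<close>)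
    show "G z \<in> \<real>" if "z \<in> D" "z \<in> \<real>" for z
      using that G_real[of "Re z"] by (auto simp: D_def complex_is_Real_iff elim!: Reals_cases)
  qed
  define f where "f x = Re (G (of_real x))" for x
  have f_G: "G (of_real x) = of_real (f x)" if "b - d < x" "x < b" for x
    using G_real[OF that] by (simp add: f_def complex_eq_iff)
  show ?thesis
  proof (rule that[of f])
    fix x t \<eta> \<delta>
    assume a: "\<delta> > 0" "b - d < x" "x \<le> b - \<delta>" "b - d < t" "t \<le> b - \<delta>" "0 < \<eta>" "\<eta> < b - t"
    have "Complex t \<eta> \<in> D \<inter> P" "of_real x \<in> D" using a by (auto simp: D_def P_def)
    then have "norm (G (Complex t \<eta>) - G (of_real x)) \<le> 2 * c2 / \<delta>\<^sup>2 * norm (Complex t \<eta> - of_real x)"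
      using a by (intro G_lip) auto
    then show "norm (H (Complex t \<eta>) - of_real (f x)) \<le> 2 * c2 / \<delta>\<^sup>2 * norm (Complex t \<eta> - of_real x)"
      using G_eq[OF \<open>Complex t \<eta> \<in> D \<inter> P\<close>] f_G[of x] a by simp
  next
    fix x assume x: "b - d < x" "x < b"
    have xD: "of_real x \<in> D" "Im (of_real x :: complex) \<ge> 0" using x by (auto simp: D_def)
    define q where "q = deriv F (of_real x)"
    have q: "(F has_field_derivative q) (at (of_real x))"
      unfolding q_def by (rule holomorphic_derivI[OF F_hol D_open xD(1)])
    have "((\<lambda>t. F (of_real t)) has_vector_derivative q) (at x)"
      by (rule has_vector_derivative_real_field[OF q])
    then have "((\<lambda>t. Re (F (of_real t))) has_vector_derivative Re q) (at x)"
      by (rule bounded_linear.has_vector_derivative[OF bounded_linear_Re])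
    then have "((\<lambda>t. Re (F (of_real t))) has_real_derivative Re q) (at x)"
      by (simp add: has_real_derivative_iff_has_vector_derivative)
    then have f_deriv: "(f has_real_derivative Re q) (at x)" by (simp add: f_def[abs_def] F_def)
    define \<tau> where "\<tau> n = (b - x) / (real n + 2)" for n
    have \<tau>: "0 < \<tau> n" "\<tau> n \<le> b - x" for n
      using x by (auto simp: \<tau>_def divide_le_eq intro!: mult_left_mono[of 1 "real n + 2" "b - x", simplified])
    have "filterlim (\<lambda>n. \<i> * of_real (\<tau> n)) (at 0) sequentially"
    proof (rule filterlim_atI)
      have "(\<lambda>n. (b - x) * (1 / (real n + 2))) \<longlonglongrightarrow> (b - x) * 0"
        by (intro tendsto_mult tendsto_const) real_asymp
      then have "\<tau> \<longlonglongrightarrow> 0" by (simp add: \<tau>_def[abs_def])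
      then have "(\<lambda>n. \<i> * of_real (\<tau> n)) \<longlonglongrightarrow> \<i> * of_real 0" by (intro tendsto_intros)
      then show "(\<lambda>n. \<i> * of_real (\<tau> n)) \<longlonglongrightarrow> 0" by simp
      show "eventually (\<lambda>n. \<i> * of_real (\<tau> n) \<noteq> 0) sequentially"
        using \<tau>(1) by (intro always_eventually allI) (auto simp: less_imp_neq[symmetric])
    qed
    then have "(\<lambda>n. (F (of_real x + \<i> * of_real (\<tau> n)) - F (of_real x)) / (\<i> * of_real (\<tau> n))) \<longlonglongrightarrow> q"
      by (rule filterlim_compose[OF DERIV_D[OF q]])
    then have "(\<lambda>n. Re ((F (of_real x + \<i> * of_real (\<tau> n)) - F (of_real x)) / (\<i> * of_real (\<tau> n)))) \<longlonglongrightarrow> Re q"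
      by (rule tendsto_Re)
    \<comment> \<open>Since \<open>F\<close> is real at \<open>x\<close>, the difference quotient in
      the imaginary direction has real part \<open>Im (H (Complex x (\<tau> n))) / \<tau> n\<close>,
      to which \<open>lower\<close> applies.\<close>
    moreover have "c1 / (b - x)\<^sup>2 \<le> Re ((F (of_real x + \<i> * of_real (\<tau> n)) - F (of_real x)) / (\<i> * of_real (\<tau> n)))" for n
    proof -
      have z: "of_real x + \<i> * of_real (\<tau> n) = zs n (of_real x)" by (simp add: zs_def \<tau>_def)
      then have "F (of_real x + \<i> * of_real (\<tau> n)) = H (Complex x (\<tau> n))"
        using zs_in[OF xD, of n] G_eq[of "zs n (of_real x)"] \<tau>(1)[of n]
        by (simp add: F_def complex_eq_iff) (simp add: z[symmetric] Complex_eq)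
      moreover have "F (of_real x) = of_real (f x)" using f_G[OF x] by (simp add: F_def)
      moreover have "Re (v / (\<i> * of_real s)) = Im v / s" if "s > 0" for v s
        using that by (simp add: Re_divide power2_eq_square)
      ultimately have "Re ((F (of_real x + \<i> * of_real (\<tau> n)) - F (of_real x)) / (\<i> * of_real (\<tau> n))) = Im (H (Complex x (\<tau> n))) / \<tau> n"
        using \<tau>(1)[of n] by simp
      moreover have "c1 * \<tau> n / (b - x)\<^sup>2 \<le> Im (H (Complex x (\<tau> n)))" by (rule lower[OF x \<tau>])
      then have "c1 * \<tau> n / (b - x)\<^sup>2 / \<tau> n \<le> Im (H (Complex x (\<tau> n))) / \<tau> n"
        using \<tau>(1)[of n] by (intro divide_right_mono) auto
      moreover have "c1 * \<tau> n / (b - x)\<^sup>2 / \<tau> n = c1 / (b - x)\<^sup>2" using \<tau>(1)[of n] by simp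
      ultimately show ?thesis by simp
    qed
    ultimately have "c1 / (b - x)\<^sup>2 \<le> Re q" by (intro LIMSEQ_le_const) auto
    with f_deriv show "\<exists>f'. (f has_real_derivative f') (at x) \<and> c1 / (b - x)\<^sup>2 \<le> f'" by blast
  qed
qed

context parabolic_map
begin

text \<open>Combined with \<open>flat\<close>, this bounds the imaginary part of the iterate at
  height \<open>\<eta>\<close> above \<open>b - e\<close> by a multiple of
  \<open>\<eta> / e^2\<close>; \<open>endpoint_kernel_lower\<close> and the mass at \<open>b\<close>
  give the matching lower bound. Both kernel inequalities rest on the parallelogram
  identity.\<close>

lemma endpoint_kernel_upper:
  assumes e: "0 < e" "e \<le> 1"
  shows "1 * poisson (Complex (b - e) e) s \<le> 3 / e * poisson (Complex b 1) s"
proof -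
  define q where "q = (s - (b - e))\<^sup>2"
  have q: "q \<ge> 0" by (simp add: q_def)
  have e2: "e\<^sup>2 \<le> 1" "e\<^sup>2 \<ge> 0" using e by (auto simp: power_le_one)
  have "(s - b)\<^sup>2 + (s - b + 2 * e)\<^sup>2 = 2 * q + 2 * e\<^sup>2" by (simp add: q_def power2_eq_square algebra_simps)
  then have sb: "(s - b)\<^sup>2 \<le> 2 * q + 2 * e\<^sup>2" using zero_le_power2[of "s - b + 2 * e"] by argo
  have "e\<^sup>2 * ((s - b)\<^sup>2 + 1) \<le> e\<^sup>2 * (2 * q + 2 * e\<^sup>2 + 1)" using sb e2 by (intro mult_left_mono) auto
  also have "\<dots> = 2 * (e\<^sup>2 * q) + 2 * (e\<^sup>2 * e\<^sup>2) + e\<^sup>2" by (simp add: algebra_simps)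
  also have "\<dots> \<le> 2 * (1 * q) + 2 * (1 * e\<^sup>2) + e\<^sup>2"
    using e2 q by (intro add_mono mult_left_mono mult_right_mono) auto
  also have "\<dots> \<le> 3 * (q + e\<^sup>2)" using q by (simp add: algebra_simps)
  finally have *: "e\<^sup>2 * ((s - b)\<^sup>2 + 1) \<le> 3 * (q + e\<^sup>2)" .
  have pos: "q + e\<^sup>2 > 0" "(s - b)\<^sup>2 + 1 > 0" using e q by (auto simp: add_nonneg_pos)
  have cross: "e / (pi * u) \<le> 3 / e * (1 / (pi * v))" if "e\<^sup>2 * v \<le> 3 * u" "u > 0" "v > 0" for u v
    using that e by (simp add: field_simps power2_eq_square)
  show ?thesis using cross[OF * pos] by (simp add: poisson_def q_def)
qed

lemma endpoint_kernel_lower: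
  assumes e: "0 < \<eta>" "\<eta> \<le> e"
  shows "\<eta> / (3 * e) * poisson (Complex b e) s \<le> 1 * poisson (Complex (b - e) \<eta>) s"
proof -
  define q where "q = (s - b)\<^sup>2"
  have q: "q \<ge> 0" by (simp add: q_def)
  have "(s - (b - e))\<^sup>2 + (s - b - e)\<^sup>2 = 2 * q + 2 * e\<^sup>2" by (simp add: q_def power2_eq_square algebra_simps)
  then have sb: "(s - (b - e))\<^sup>2 \<le> 2 * q + 2 * e\<^sup>2" using zero_le_power2[of "s - b - e"] by argo
  have "\<eta>\<^sup>2 \<le> e\<^sup>2" using e by (intro power_mono) auto
  then have *: "(s - (b - e))\<^sup>2 + \<eta>\<^sup>2 \<le> 3 * (q + e\<^sup>2)" using sb q by (simp add: algebra_simps)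
  have pos: "q + e\<^sup>2 > 0" "(s - (b - e))\<^sup>2 + \<eta>\<^sup>2 > 0" using e q by (auto simp: add_nonneg_pos)
  have cross: "\<eta> / (3 * e) * (e / (pi * u)) \<le> \<eta> / (pi * v)" if "v \<le> 3 * u" "u > 0" "v > 0" for u v
  proof -
    have "\<eta> / (3 * e) * (e / (pi * u)) = \<eta> / (pi * (3 * u))" using e by simp
    also have "\<dots> \<le> \<eta> / (pi * v)" using that e by (intro divide_left_mono mult_left_mono mult_pos_pos) auto
    finally show ?thesis .
  qed
  show ?thesis using cross[OF * pos] by (simp add: poisson_def q_def)
qed

text \<open>\<open>mass\<close> expresses a point mass of the Herglotz measure at \<open>b\<close>.
  Left of \<open>b\<close> the iterate extends to a real function \<open>f\<close> with derivative
  at least \<open>c1 / (b - x)^2\<close>. Hence \<open>f\<close> rises to plus infinity and takes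
  each large \<open>y\<close> at distance at least \<open>c1 / (2 * y)\<close> from
  \<open>b\<close>. The averages in \<open>boundary_lower_bound\<close> are then at least of order
  \<open>1 / y^2\<close>, like the density of \<open>ref\<close>.\<close>

lemma endpoint_lower:
  assumes ab: "a < b" and flat: "flat a b N" and \<epsilon>0: "\<epsilon>0 > 0"
    and mass: "\<And>e. e > 0 \<Longrightarrow> \<epsilon>0 \<le> e * Im ((h ^^ N) (Complex b e))"
  obtains c Y where "c > 0"
    "\<And>J. J \<in> fmeasurable lborel \<Longrightarrow> J \<subseteq> {Y..} \<Longrightarrow> c * ref J \<le> measure lborel ({a..b} \<inter> (T ^^ N) -` J)"
proof -
  define d where "d = min 1 ((b - a) / 2)"
  have d: "d > 0" "d \<le> 1" using ab by (auto simp: d_def)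
  have d2: "2 * d \<le> b - a" unfolding d_def by (simp add: min_def)
  define H where "H = h ^^ N"
  define I1 where "I1 = Im (H (Complex b 1))"
  have I1: "I1 > 0" unfolding I1_def H_def by (rule h_upper_funpow) simp
  define c1 c2 where "c1 = \<epsilon>0 / 3" and "c2 = 6 * I1"
  have c: "c1 > 0" "c2 > 0" using \<epsilon>0 I1 by (auto simp: c1_def c2_def)
  have upper: "Im (H (Complex x \<eta>)) \<le> c2 * \<eta> / (b - x)\<^sup>2"
    if x: "b - d < x" "x < b" "0 < \<eta>" "\<eta> \<le> b - x" for x \<eta>
  proof -
    define e where "e = b - x"
    have e: "0 < e" "e \<le> 1" "\<eta> \<le> e" "x = b - e" using x d by (auto simp: e_def)
    have "a \<le> x - e" "x + e \<le> b" using x d2 by (auto simp: e_def)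
    then have "Im (H (Complex x \<eta>)) \<le> 2 * \<eta> / e * Im (H (Complex x e))"
      using flat x(3) e(3) unfolding flat_def H_def by blast
    also have "1 * Im (H (Complex x e)) \<le> 3 / e * Im (H (Complex b 1))"
      unfolding H_def e(4) by (rule Im_comparison[OF _ _ _ _ endpoint_kernel_upper]) (use e in auto)
    then have "2 * \<eta> / e * Im (H (Complex x e)) \<le> 2 * \<eta> / e * (3 / e * Im (H (Complex b 1)))"
      using e x by (intro mult_left_mono) auto
    also have "\<dots> = c2 * \<eta> / e\<^sup>2" by (simp add: c2_def I1_def power2_eq_square)
    finally show ?thesis by (simp add: e_def)
  qed
  have lower: "c1 * \<eta> / (b - x)\<^sup>2 \<le> Im (H (Complex x \<eta>))"
    if x: "b - d < x" "x < b" "0 < \<eta>" "\<eta> \<le> b - x" for x \<eta>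
  proof -
    define e where "e = b - x"
    have e: "0 < e" "\<eta> \<le> e" "x = b - e" using x by (auto simp: e_def)
    have "c1 * \<eta> / e\<^sup>2 = \<eta> / (3 * e) * (\<epsilon>0 / e)" by (simp add: c1_def power2_eq_square ac_simps)
    also have "\<dots> \<le> \<eta> / (3 * e) * Im (H (Complex b e))"
      using mass[OF e(1)] e x by (intro mult_left_mono) (auto simp: H_def field_simps)
    also have "\<dots> \<le> 1 * Im (H (Complex x \<eta>))"
      unfolding H_def e(3) by (rule Im_comparison[OF _ _ _ _ endpoint_kernel_lower]) (use e x in auto)
    finally show ?thesis by (simp add: e_def)
  qed
  have H_hol: "H holomorphic_on {w. Im w > 0}" unfolding H_def by (rule funpow_holomorphic)
  have H_up: "\<And>w. Im w > 0 \<Longrightarrow> Im (H w) > 0" unfolding H_def by (rule h_upper_funpow)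
  obtain f where f: "\<And>x. b - d < x \<Longrightarrow> x < b \<Longrightarrow> \<exists>f'. (f has_real_derivative f') (at x) \<and> c1 / (b - x)\<^sup>2 \<le> f'"
    "\<And>x t \<eta> \<delta>. \<delta> > 0 \<Longrightarrow> b - d < x \<Longrightarrow> x \<le> b - \<delta> \<Longrightarrow> b - d < t \<Longrightarrow> t \<le> b - \<delta> \<Longrightarrow> 0 < \<eta> \<Longrightarrow> \<eta> < b - t \<Longrightarrow>
      norm (H (Complex t \<eta>) - of_real (f x)) \<le> 2 * c2 / \<delta>\<^sup>2 * norm (Complex t \<eta> - of_real x)"
    by (rule boundary_extension_triangle[OF H_hol H_up c(2) upper lower]) blast+
  define x1 where "x1 = b - d / 2"
  define k where "k = f x1 - c1 / (b - x1)"
  have growth: "c1 / (b - x) + k \<le> f x" if "x1 \<le> x" "x < b" for x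
  proof -
    have "f x1 - c1 / (b - x1) \<le> f x - c1 / (b - x)"
    proof (rule DERIV_nonneg_imp_nondecreasing[OF that(1)])
      fix y assume y: "x1 \<le> y" "y \<le> x"
      then have y': "b - d < y" "y < b" using that d by (auto simp: x1_def)
      obtain f' where f': "(f has_real_derivative f') (at y)" "c1 / (b - y)\<^sup>2 \<le> f'" using f(1)[OF y'] by blast
      have "((\<lambda>x. f x - c1 / (b - x)) has_real_derivative f' - c1 / (b - y)\<^sup>2) (at y)"
        using y' f'(1) by (auto intro!: derivative_eq_intros simp: power2_eq_square)
      then show "\<exists>d. ((\<lambda>x. f x - c1 / (b - x)) has_real_derivative d) (at y) \<and> 0 \<le> d"
        using f'(2) by (intro exI[of _ "f' - c1 / (b - y)\<^sup>2"]) auto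
    qed
    then show ?thesis by (simp add: k_def)
  qed
  define Y where "Y = max (f x1 + 1) (\<bar>k\<bar> + 1)"
  have preimage: "\<exists>x. x1 \<le> x \<and> x < b \<and> f x = y \<and> c1 / (2 * y) \<le> b - x" if y: "Y \<le> y" for y
  proof -
    have y': "f x1 < y" "\<bar>k\<bar> + 1 \<le> y" using y by (auto simp: Y_def)
    then have yk: "0 < y - k" "y - k \<le> 2 * y" by auto
    \<comment> \<open>At a distance \<open>r \<le> c1 / (y - k)\<close> from \<open>b\<close> the
      growth bound is already at least \<open>y\<close>.\<close>
    define r where "r = min (d / 2) (c1 / (y - k))"
    have r: "r > 0" "r \<le> d / 2" using d c yk unfolding r_def by (simp, intro min.cobounded1)
    have "r \<le> c1 / (y - k)" by (simp add: r_def)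
    then have "y - k \<le> c1 / r" using r yk by (simp add: field_simps)
    moreover have "c1 / (b - (b - r)) + k \<le> f (b - r)" using r by (intro growth) (auto simp: x1_def)
    ultimately have "y \<le> f (b - r)" by simp
    moreover have "continuous_on {x1..b - r} f"
    proof (rule continuous_at_imp_continuous_on, rule ballI)
      fix z assume "z \<in> {x1..b - r}"
      then have "b - d < z" "z < b" using r d by (auto simp: x1_def)
      then show "isCont f z" using f(1)[of z] DERIV_isCont by blast
    qed
    ultimately obtain x where x: "x1 \<le> x" "x \<le> b - r" "f x = y"
      using IVT'[of f x1 y "b - r"] y' r by (auto simp: x1_def)
    have "c1 / (b - x) + k \<le> y" using growth[of x] x r by simp
    then have "c1 / (b - x) \<le> 2 * y" using yk by linarith
    then have "c1 / (2 * y) \<le> b - x" using x r y' by (simp add: field_simps)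
    then show ?thesis using x r by (intro exI[of _ x]) auto
  qed
  define c3 where "c3 = c1 / (256 * pi * c2\<^sup>2)"
  define c4 where "c4 = c3 * (c1\<^sup>2 / 4)"
  have c34: "c3 > 0" "c4 > 0" using c by (auto simp: c3_def c4_def)
  have local: "eventually (\<lambda>n. ennreal (c4 * poisson \<i> y) \<le>
      (\<integral>\<^sup>+t. ennreal (poisson ((h ^^ N) (Complex t (1 / real (Suc n)))) y) * indicator {a..b} t \<partial>lborel)) sequentially"
    if y: "Y \<le> y" for y
  proof -
    obtain x where x: "x1 \<le> x" "x < b" "f x = y" "c1 / (2 * y) \<le> b - x" using preimage[OF y] by blast
    have y1: "y \<ge> 1" using y by (auto simp: Y_def)
    define e where "e = b - x"
    have e: "e > 0" "e \<le> d / 2" using x by (auto simp: e_def x1_def)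
    have "eventually (\<lambda>n. 1 / real (Suc n) < e / 4) sequentially" using e by real_asymp
    then show ?thesis
    proof eventually_elim
      case (elim n)
      define \<eta> where "\<eta> = 1 / real (Suc n)"
      have \<eta>: "0 < \<eta>" "\<eta> \<le> e / 4" using elim by (auto simp: \<eta>_def)
      \<comment> \<open>The lower bound for the imaginary part, divided by \<open>pi\<close> times
        the squared upper bound for the distance to \<open>y\<close>. Integrated over an interval of
        length \<open>2 * \<eta>\<close> it no longer depends on \<open>\<eta>\<close>.\<close>
      define p where "p = c1 * e\<^sup>2 / (512 * pi * c2\<^sup>2 * \<eta>)"
      have p0: "p > 0" using c e \<eta> by (simp add: p_def)
      have kernel: "p \<le> poisson (H (Complex t \<eta>)) y" if t: "t \<in> {x - \<eta>..x + \<eta>}" for t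
      proof -
        define z where "z = Complex t \<eta>"
        have bt: "b - t \<le> 5 / 4 * e" "3 / 4 * e \<le> b - t" using t \<eta> by (auto simp: e_def)
        have t': "b - d < t" "t < b" "t \<le> b - e / 2" using bt e by auto
        have "x = b - e" by (simp add: e_def)
        then have xe: "x \<le> b - e / 2" using e by linarith
        have "norm (z - of_real x) \<le> \<bar>t - x\<bar> + \<bar>\<eta>\<bar>" using cmod_le[of "z - of_real x"] by (simp add: z_def)
        also have "\<dots> \<le> 2 * \<eta>" using t \<eta> by auto
        finally have n1: "norm (z - of_real x) \<le> 2 * \<eta>" .
        have "norm (H z - of_real (f x)) \<le> 2 * c2 / (e / 2)\<^sup>2 * norm (z - of_real x)"
          unfolding z_def by (rule f(2)) (use e x t' \<eta> bt d xe in \<open>auto simp: e_def x1_def\<close>)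
        also have "\<dots> \<le> 2 * c2 / (e / 2)\<^sup>2 * (2 * \<eta>)" using n1 c by (intro mult_left_mono) auto
        finally have *: "norm (H z - of_real y) \<le> 2 * c2 / (e / 2)\<^sup>2 * (2 * \<eta>)"
          using x by simp
        then have nrm: "norm (H z - of_real y) \<le> 16 * c2 * \<eta> / e\<^sup>2" by (simp add: power_divide)
        have "c1 * \<eta> / (b - t)\<^sup>2 \<le> Im (H z)" unfolding z_def by (rule lower) (use t' \<eta> bt in auto)
        moreover have "c1 * \<eta> / (2 * e\<^sup>2) \<le> c1 * \<eta> / (b - t)\<^sup>2"
        proof -
          have "(b - t)\<^sup>2 \<le> (5 / 4 * e)\<^sup>2" using bt e by (intro power_mono) auto
          also have "\<dots> \<le> 2 * e\<^sup>2" by (simp add: power_mult_distrib power_divide)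
          finally show ?thesis using c \<eta> t' e by (intro divide_left_mono) auto
        qed
        ultimately have im: "c1 * \<eta> / (2 * e\<^sup>2) \<le> Im (H z)" by simp
        have Hpos: "Im (H z) > 0" unfolding z_def by (rule H_up) (use \<eta> in simp)
        have nz: "norm (H z - of_real y) > 0" using Hpos by (auto simp: complex_eq_iff)
        have "p = (c1 * \<eta> / (2 * e\<^sup>2)) / (pi * (16 * c2 * \<eta> / e\<^sup>2)\<^sup>2)"
          using c e \<eta> by (simp add: p_def power2_eq_square field_simps)
        also have "\<dots> \<le> Im (H z) / (pi * (norm (H z - of_real y))\<^sup>2)"
          using im nrm nz Hpos by (intro frac_le mult_left_mono power_mono) auto
        finally show ?thesis by (simp add: poisson_eq_norm z_def)
      qed
      have sub: "{x - \<eta>..x + \<eta>} \<subseteq> {a..b}" using \<eta> e d2 by (auto simp: e_def)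
      have "c4 * poisson \<i> y \<le> p * (2 * \<eta>)"
      proof -
        have "p * (2 * \<eta>) = c3 * e\<^sup>2" using \<eta> c by (simp add: p_def c3_def)
        moreover have "c3 * (c1 / (2 * y))\<^sup>2 \<le> c3 * e\<^sup>2"
          using x(4) c34 c y1 by (intro mult_left_mono power_mono) (auto simp: e_def)
        moreover have "c3 * (c1 / (2 * y))\<^sup>2 = c4 * (1 / y\<^sup>2)" by (simp add: c4_def power_divide power_mult_distrib)
        moreover have "poisson \<i> y \<le> 1 / y\<^sup>2"
        proof -
          have "1 * y\<^sup>2 \<le> pi * (y\<^sup>2 + 1)" using pi_gt3 by (intro mult_mono) auto
          then show ?thesis unfolding poisson_def using y1 by (auto intro!: divide_left_mono mult_pos_pos add_nonneg_pos)
        qed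
        then have "c4 * poisson \<i> y \<le> c4 * (1 / y\<^sup>2)" using c34 by (intro mult_left_mono) auto
        ultimately show ?thesis by simp
      qed
      then have "ennreal (c4 * poisson \<i> y) \<le> ennreal (p * (2 * \<eta>))" by (rule ennreal_leI)
      also have "\<dots> = (\<integral>\<^sup>+t. ennreal p * indicator {x - \<eta>..x + \<eta>} t \<partial>lborel)"
        using p0 \<eta> by (subst nn_integral_cmult_indicator) (auto simp: ennreal_mult'')
      also have "\<dots> \<le> (\<integral>\<^sup>+t. ennreal (poisson (H (Complex t \<eta>)) y) * indicator {a..b} t \<partial>lborel)"
        using sub kernel by (intro nn_integral_mono) (auto simp: indicator_def intro!: ennreal_leI)
      finally show ?case by (simp add: H_def \<eta>_def)
    qed
  qed
  show ?thesis
  proof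
    show "c4 > 0" by fact
    fix J assume J: "J \<in> fmeasurable lborel" "J \<subseteq> {Y..}"
    have J_sets: "J \<in> sets borel" using J by (simp add: fmeasurable_def)
    have "(\<integral>\<^sup>+y. ennreal (c4 * poisson \<i> y) * indicator J y \<partial>lborel) \<le> emeasure lborel ({a..b} \<inter> (T ^^ N) -` J)"
    proof (rule boundary_lower_bound[OF J(1) less_imp_le[OF ab]])
      show "(\<lambda>y. c4 * poisson \<i> y) \<in> borel_measurable borel" by measurable
      fix y assume "y \<in> J"
      then have "Y \<le> y" using J(2) by auto
      then show "eventually (\<lambda>n. ennreal (c4 * poisson \<i> y) \<le>
        (\<integral>\<^sup>+t. ennreal (poisson ((h ^^ N) (Complex t (1 / real (Suc n)))) y) * indicator {a..b} t \<partial>lborel)) sequentially"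
        by (rule local)
    qed
    also have "\<dots> = ennreal (measure lborel ({a..b} \<inter> (T ^^ N) -` J))"
      by (rule emeasure_eq_measure2[OF fmeasurable_Icc_vimage[OF J_sets]])
    also have "(\<integral>\<^sup>+y. ennreal (c4 * poisson \<i> y) * indicator J y \<partial>lborel) = ennreal c4 * emeasure (cauchy \<i>) J"
      unfolding emeasure_cauchy[OF J_sets] using c34 J_sets
      by (subst nn_integral_cmult[symmetric]) (auto intro!: nn_integral_cong simp: ennreal_mult' poisson_nonneg mult.assoc)
    also have "emeasure (cauchy \<i>) J = ennreal (ref J)"
    proof -
      interpret prob_space "cauchy \<i>" by (rule prob_space_cauchy) simp
      show ?thesis by (rule emeasure_eq_measure)
    qed
    finally show "c4 * ref J \<le> measure lborel ({a..b} \<inter> (T ^^ N) -` J)"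
      using c34 by (simp add: ennreal_mult'[symmetric] ennreal_mult''[symmetric])
  qed
qed

end

section \<open>Lower bound for the measure of the return sets\<close>

context parabolic_map
begin

text \<open>\<open>S l\<close> collects the points of the fundamental interval that need exactly
  \<open>l\<close> further steps to hit \<open>E\<close>; by \<open>mixing\<close> one of these sets
  has positive measure. An orbit from \<open>E\<close> that is in the pull-back \<open>J m\<close>
  at time \<open>N\<close> without an earlier return comes back exactly at time
  \<open>N + m + l\<close>. The measure of \<open>J m\<close> has at least the order
  \<open>m powr (- 1 / 2)\<close>, and the density of \<open>ref\<close> on it at least the order
  \<open>1 / m\<close>.\<close>

lemma return_set_lower_aux:
  assumes ab: "a < b" and small: "\<And>i. i < N \<Longrightarrow> small a b i" and c: "c > 0"
    and far: "\<And>J. J \<in> fmeasurable lborel \<Longrightarrow> J \<subseteq> {Y..} \<Longrightarrow> c * ref J \<le> measure lborel ({a..b} \<inter> (T ^^ N) -` J)"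
  obtains c' n0 where "c' > 0" "\<And>n. n \<ge> n0 \<Longrightarrow> c' / (real n * sqrt n) \<le> measure lborel (return_set T {a..b} n)"
proof -
  define E where "E = {a..b}"
  have E [measurable]: "E \<in> sets borel" by (simp add: E_def)
  obtain A R1 where AR: "R1 > R" "A \<ge> 0" "\<And>b c. R1 \<le> b \<Longrightarrow> R1 \<le> c \<Longrightarrow> two_tails T T' \<kappa> A b c"
    using two_tails_exists by metis
  \<comment> \<open>The second bound ensures \<open>T \<rho> \<ge> \<rho> / 2 > b\<close>, so that
    the fundamental interval lies to the right of \<open>E\<close>.\<close>
  define \<rho> where "\<rho> = max R1 (2 * (\<bar>a\<bar> + \<bar>b\<bar>) + 2)"
  have \<rho>: "\<rho> \<ge> R1" "\<rho> \<ge> 2 * (\<bar>a\<bar> + \<bar>b\<bar>) + 2" by (auto simp: \<rho>_def)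
  interpret tt: two_tails T T' \<kappa> A \<rho> \<rho> by (rule AR(3)) (use \<rho> in auto)
  have T\<rho>: "T \<rho> > b" "T \<rho> < \<rho>" "\<rho> > 0"
    using tt.T_ge[of \<rho>] tt.T_less[of \<rho>] \<rho> AR(2) tt.R_pos by auto
  \<comment> \<open>\<open>mixing\<close> takes a closed interval, which has to lie inside the
    half-open fundamental interval.\<close>
  define z1 where "z1 = (T \<rho> + \<rho>) / 2"
  have z1: "T \<rho> < z1" "z1 < \<rho>" using T\<rho> by (auto simp: z1_def)
  have E_\<rho>: "E \<subseteq> {- \<rho>..\<rho>}" using \<rho> by (auto simp: E_def)
  obtain j where "\<exists>\<delta>>0. \<forall>S. S \<in> sets borel \<longrightarrow> S \<subseteq> {- \<rho>..\<rho>} \<longrightarrow>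
      \<delta> * measure lborel S \<le> measure lborel ({z1..\<rho>} \<inter> (T ^^ j) -` S)"
    using eventually_happens[OF mixing[OF z1(2) T\<rho>(3)]] by auto
  then obtain \<delta> where \<delta>: "\<delta> > 0" "\<delta> * measure lborel E \<le> measure lborel ({z1..\<rho>} \<inter> (T ^^ j) -` E)"
    using E E_\<rho> by blast
  define S where "S l = {z\<in>{T \<rho><..\<rho>}. (\<forall>k<l. (T ^^ k) z \<notin> E) \<and> (T ^^ l) z \<in> E}" for l
  have S_sets: "S l \<in> sets borel" for l
  proof -
    have "{z\<in>space borel. z \<in> {T \<rho><..\<rho>} \<and> (\<forall>k<l. (T ^^ k) z \<notin> E) \<and> (T ^^ l) z \<in> E} \<in> sets borel" by measurable
    then show ?thesis by (simp add: S_def)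
  qed
  have S_sub: "S l \<subseteq> {T \<rho><..\<rho>}" for l by (auto simp: S_def)
  have S_fm: "S l \<in> fmeasurable lborel" for l
    by (rule fmeasurableI2[of "{T \<rho>..\<rho>}"]) (use S_sets S_sub[of l] in auto)
  have "\<exists>l\<le>j. measure lborel (S l) > 0"
  proof (rule ccontr)
    assume "\<not> (\<exists>l\<le>j. measure lborel (S l) > 0)"
    then have S0: "measure lborel (S l) = 0" if "l \<le> j" for l
      using that measure_nonneg[of lborel "S l"] by (metis le_less)
    have "{z1..\<rho>} \<inter> (T ^^ j) -` E \<subseteq> (\<Union>l\<in>{..j}. S l)"
    proof
      fix z assume z: "z \<in> {z1..\<rho>} \<inter> (T ^^ j) -` E"
      define l where "l = (LEAST l. (T ^^ l) z \<in> E)"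
      have j: "(T ^^ j) z \<in> E" using z by simp
      have "(T ^^ l) z \<in> E" "l \<le> j" unfolding l_def by (rule LeastI, rule j) (rule Least_le, rule j)
      moreover have "(T ^^ k) z \<notin> E" if "k < l" for k using that not_less_Least unfolding l_def by blast
      ultimately show "z \<in> (\<Union>l\<in>{..j}. S l)" using z z1 by (auto simp: S_def)
    qed
    then have "measure lborel ({z1..\<rho>} \<inter> (T ^^ j) -` E) \<le> measure lborel (\<Union>l\<in>{..j}. S l)"
      using E by (intro measure_mono_fmeasurable fmeasurable.finite_UN S_fm) (auto intro: sets_vimage_funpow)
    also have "\<dots> \<le> (\<Sum>l\<le>j. measure lborel (S l))" by (rule measure_UNION_le) (use S_sets in auto)
    also have "\<dots> = 0" using S0 by simp
    finally have "\<delta> * measure lborel E \<le> 0" using \<delta>(2) by linarith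
    moreover have "measure lborel E = b - a" using ab by (simp add: E_def)
    ultimately show False using \<delta>(1) ab by (simp add: mult_le_0_iff)
  qed
  then obtain l where l: "measure lborel (S l) > 0" by blast
  define J where "J m = tt.pull m (S l)" for m
  have J_fm: "J m \<in> fmeasurable lborel" and J_sets: "J m \<in> sets borel" for m
    using tt.fmeasurable_pull[OF S_sets S_sub] tt.sets_pull[OF S_sets] by (auto simp: J_def)
  obtain q where q: "q > 0" "\<And>m. q / sqrt (real m + 1) * measure lborel (S l) \<le> measure lborel (J m)"
    unfolding J_def using tt.measure_pull_lower S_sets S_sub by metis
  obtain C1 where C1: "C1 > 0" "\<And>n. tt.level n \<le> C1 * sqrt (real n + 1)"
    by (rule tt.level_bounds) metis
  \<comment> \<open>A return at an early time \<open>k\<close> leads from \<open>E\<close> to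
    \<open>J m\<close> in \<open>N - k < N\<close> steps, where \<open>small\<close> is available.
    All these contributions together are at most half of the main term.\<close>
  define \<eta> where "\<eta> = c / (2 * (real N + 1))"
  have \<eta>: "\<eta> > 0" "real N * \<eta> \<le> c / 2" using c by (auto simp: \<eta>_def field_simps)
  have "\<forall>k\<in>{1..<N}. \<exists>Y. \<forall>J. J \<in> sets borel \<longrightarrow> J \<subseteq> {y. Y \<le> \<bar>y\<bar>} \<longrightarrow>
      measure lborel ({a..b} \<inter> (T ^^ (N - k)) -` J) \<le> \<eta> * ref J"
    using small \<eta>(1) unfolding small_def by force
  then obtain Yk where Yk: "\<And>k J. k \<in> {1..<N} \<Longrightarrow> J \<in> sets borel \<Longrightarrow> J \<subseteq> {y. Yk k \<le> \<bar>y\<bar>} \<Longrightarrow>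
      measure lborel (E \<inter> (T ^^ (N - k)) -` J) \<le> \<eta> * ref J"
    unfolding E_def by metis
  define Y0 where "Y0 = Max (insert Y (Yk ` {1..<N}))"
  have Y0: "Y \<le> Y0" "\<And>k. k \<in> {1..<N} \<Longrightarrow> Yk k \<le> Y0" unfolding Y0_def by (rule Max_ge; simp)+
  obtain M where M: "\<And>m. m \<ge> M \<Longrightarrow> Y0 \<le> tt.level m"
    using filterlim_at_top[THEN iffD1, OF tt.level_tendsto] by (auto simp: eventually_sequentially)
  define c5 where "c5 = c / 2 * (q * measure lborel (S l) / (pi * (C1\<^sup>2 + 1)))"
  have c5: "c5 > 0" using c q(1) l C1(1) unfolding c5_def
    by (intro mult_pos_pos divide_pos_pos add_nonneg_pos) auto
  have main: "c5 / ((real m + 1) * sqrt (real m + 1)) \<le> measure lborel (return_set T {a..b} (N + m + l))"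
    if m: "m \<ge> Suc M" for m
  proof -
    have J_sub: "J m \<subseteq> {tt.level (m - 1)<..tt.level m}"
      using tt.pull_subset(2)[OF S_sub, of "m - 1" l] m by (simp add: J_def del: tt.level.simps)
    have lev: "Y0 \<le> tt.level (m - 1)" "tt.level (m - 1) > 0" "tt.level m > 0"
      using M[of "m - 1"] m tt.level_ge[of "m - 1"] tt.level_ge[of m] T\<rho>(3) by auto
    have J_Y: "J m \<subseteq> {Y..}" "\<And>k. k \<in> {1..<N} \<Longrightarrow> J m \<subseteq> {y. Yk k \<le> \<bar>y\<bar>}"
      using J_sub lev Y0 by force+
    define X where "X = {x\<in>E. (\<forall>k. 0 < k \<and> k < N \<longrightarrow> (T ^^ k) x \<notin> E) \<and> (T ^^ N) x \<in> J m}"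
    have X_sets: "X \<in> sets borel"
    proof -
      have [measurable]: "J m \<in> sets borel" by (rule J_sets)
      have "{x\<in>space borel. x \<in> E \<and> (\<forall>k. 0 < k \<and> k < N \<longrightarrow> (T ^^ k) x \<notin> E) \<and> (T ^^ N) x \<in> J m} \<in> sets borel" by measurable
      then show ?thesis by (simp add: X_def)
    qed
    have X_fm: "X \<in> fmeasurable lborel"
    proof (rule fmeasurableI2[of "{a..b}"])
      show "X \<subseteq> {a..b}" by (auto simp: X_def E_def)
      show "X \<in> sets lborel" using X_sets by simp
    qed simp
    let ?V = "\<lambda>k. (T ^^ k) -` (E \<inter> (T ^^ (N - k)) -` J m)"
    have V_fm: "?V k \<in> fmeasurable lborel" for k
      unfolding E_def by (intro fmeasurable_vimage_funpow fmeasurable_Icc_vimage J_sets)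
    have "E \<inter> (T ^^ N) -` J m \<subseteq> X \<union> (\<Union>k\<in>{1..<N}. ?V k)"
    proof
      fix x assume x: "x \<in> E \<inter> (T ^^ N) -` J m"
      show "x \<in> X \<union> (\<Union>k\<in>{1..<N}. ?V k)"
      proof (cases "x \<in> X")
        case False
        then obtain k where k: "0 < k" "k < N" "(T ^^ k) x \<in> E" using x by (auto simp: X_def)
        have "N = (N - k) + k" using k by simp
        then have "(T ^^ (N - k)) ((T ^^ k) x) = (T ^^ N) x" by (metis funpow_add comp_apply)
        then have "x \<in> ?V k" using x k by simp
        then show ?thesis using k by (intro UnI2 UN_I[of k]) auto
      qed simp
    qed
    then have "measure lborel (E \<inter> (T ^^ N) -` J m) \<le> measure lborel (X \<union> (\<Union>k\<in>{1..<N}. ?V k))"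
      using E J_sets by (intro measure_mono_fmeasurable fmeasurable.Un fmeasurable.finite_UN V_fm X_fm) (auto intro: sets_vimage_funpow)
    also have "\<dots> \<le> measure lborel X + measure lborel (\<Union>k\<in>{1..<N}. ?V k)"
      by (intro measure_Un_le fmeasurableD fmeasurable.finite_UN V_fm X_fm) auto
    also have "measure lborel (\<Union>k\<in>{1..<N}. ?V k) \<le> (\<Sum>k\<in>{1..<N}. measure lborel (?V k))"
      by (intro measure_UNION_le fmeasurableD V_fm) auto
    also have "\<dots> \<le> (\<Sum>k\<in>{1..<N}. \<eta> * ref (J m))"
    proof (rule sum_mono)
      fix k assume k: "k \<in> {1..<N}"
      have "measure lborel (?V k) = measure lborel (E \<inter> (T ^^ (N - k)) -` J m)"
        using E J_sets by (intro measure_vimage_funpow sets.Int sets_vimage_funpow)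
      also have "\<dots> \<le> \<eta> * ref (J m)" by (rule Yk[OF k J_sets J_Y(2)[OF k]])
      finally show "measure lborel (?V k) \<le> \<eta> * ref (J m)" .
    qed
    also have "\<dots> \<le> real N * \<eta> * ref (J m)"
      using \<eta>(1) by (simp add: mult.assoc) (intro mult_right_mono, auto)
    also have "\<dots> \<le> c / 2 * ref (J m)" using \<eta>(2) by (intro mult_right_mono) auto
    finally have "measure lborel (E \<inter> (T ^^ N) -` J m) \<le> measure lborel X + c / 2 * ref (J m)" by simp
    moreover have "c * ref (J m) \<le> measure lborel (E \<inter> (T ^^ N) -` J m)"
      unfolding E_def by (rule far[OF J_fm J_Y(1)])
    ultimately have X_ge: "c / 2 * ref (J m) \<le> measure lborel X" by argo
    have "c5 / ((real m + 1) * sqrt (real m + 1)) = c / 2 * (1 / (pi * ((C1\<^sup>2 + 1) * (real m + 1))) * (q / sqrt (real m + 1) * measure lborel (S l)))"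
      by (simp add: c5_def mult_ac)
    also have "\<dots> \<le> c / 2 * (1 / (pi * ((tt.level m)\<^sup>2 + 1)) * measure lborel (J m))"
    proof -
      have "(tt.level m)\<^sup>2 \<le> (C1 * sqrt (real m + 1))\<^sup>2" using lev C1(2)[of m] by (intro power_mono) auto
      then have "(tt.level m)\<^sup>2 + 1 \<le> (C1\<^sup>2 + 1) * (real m + 1)" by (simp add: power_mult_distrib algebra_simps)
      then have "1 / (pi * ((C1\<^sup>2 + 1) * (real m + 1))) \<le> 1 / (pi * ((tt.level m)\<^sup>2 + 1))"
        by (intro divide_left_mono mult_left_mono mult_pos_pos) (auto simp: add_nonneg_pos)
      then show ?thesis using q c l by (intro mult_left_mono mult_mono) auto
    qed
    also have "\<dots> \<le> c / 2 * ref (J m)"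
    proof -
      have "J m \<subseteq> {- tt.level m..tt.level m}" using J_sub lev by auto
      then have "Im \<i> / (pi * ((tt.level m + \<bar>Re \<i>\<bar>)\<^sup>2 + (Im \<i>)\<^sup>2)) * measure lborel (J m) \<le> ref (J m)"
        by (intro measure_cauchy_bounds J_sets) auto
      then show ?thesis using c by (intro mult_left_mono) auto
    qed
    also have "\<dots> \<le> measure lborel X" by (rule X_ge)
    also have "\<dots> \<le> measure lborel (return_set T {a..b} (N + m + l))"
    proof -
      have n: "N + m + l \<ge> 1" using m by simp
      have eq: "return_set T {a..b} (N + m + l) = first_returns E (N + m + l) E"
        unfolding E_def by (rule return_set_eq[OF n])
      have "X \<subseteq> first_returns E (N + m + l) E"
      proof
        fix x assume x: "x \<in> X"
        define y where "y = (T ^^ N) x"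
        define z where "z = (T ^^ m) y"
        have y: "\<And>k. k < m \<Longrightarrow> \<rho> < (T ^^ k) y" "z \<in> S l" using x by (auto simp: X_def J_def tt.pull_def y_def z_def)
        have yk: "(T ^^ k) y = (T ^^ (k + N)) x" for k by (simp add: y_def funpow_add)
        have zk: "(T ^^ k) z = (T ^^ (k + m + N)) x" for k by (simp add: z_def y_def funpow_add)
        show "x \<in> first_returns E (N + m + l) E"
          unfolding first_returns_def
        proof (intro CollectI conjI allI impI)
          show "x \<in> E" using x by (simp add: X_def)
          have "(T ^^ l) z \<in> E" using y(2) by (simp add: S_def)
          then show "(T ^^ (N + m + l)) x \<in> E" unfolding zk by (simp add: add_ac)
          fix k assume k: "1 \<le> k \<and> k < N + m + l"
          consider "k < N" | "N \<le> k" "k < N + m" | "N + m \<le> k" by linarith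
          then show "(T ^^ k) x \<notin> E"
          proof cases
            case 1 then show ?thesis using x k by (auto simp: X_def)
          next
            case 2
            then have "\<rho> < (T ^^ (k - N)) y" by (intro y) auto
            then have "\<rho> < (T ^^ k) x" unfolding yk using 2 by simp
            then show ?thesis using E_\<rho> by auto
          next
            case 3
            then have "k - (N + m) < l" using k by auto
            then have "(T ^^ (k - (N + m))) z \<notin> E" using y(2) by (simp add: S_def)
            moreover have "k - (N + m) + m + N = k" using 3 by simp
            ultimately show ?thesis unfolding zk by simp
          qed
        qed
      qed
      moreover have "first_returns E (N + m + l) E \<in> fmeasurable lborel"
      proof (rule fmeasurableI2[of "{a..b}"])
        have "{x\<in>space borel. x \<in> E \<and> (\<forall>k. 1 \<le> k \<and> k < N + m + l \<longrightarrow> (T ^^ k) x \<notin> E) \<and> (T ^^ (N + m + l)) x \<in> E} \<in> sets borel"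
          by measurable
        then show "first_returns E (N + m + l) E \<in> sets lborel" by (simp add: first_returns_def)
      qed (auto simp: first_returns_def E_def)
      ultimately show ?thesis unfolding eq using X_sets by (intro measure_mono_fmeasurable) auto
    qed
    finally show ?thesis .
  qed
  show ?thesis
  proof
    show "c5 / 4 > 0" using c5 by simp
    fix n assume n: "n \<ge> N + Suc M + l"
    define m where "m = n - N - l"
    have m: "m \<ge> Suc M" "n = N + m + l" using n by (auto simp: m_def)
    have m2: "real m + 1 \<le> 2 * real n" using m by auto
    have "(real m + 1) * sqrt (real m + 1) \<le> 2 * real n * sqrt (2 * real n)"
      using m2 by (intro mult_mono) auto
    also have "sqrt (2 * real n) \<le> 2 * sqrt n"
    proof -
      have "sqrt (2 * real n) \<le> sqrt (4 * real n)" by simp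
      then show ?thesis by (simp add: real_sqrt_mult)
    qed
    finally have "(real m + 1) * sqrt (real m + 1) \<le> 4 * (real n * sqrt n)" by (simp add: mult_left_mono)
    then have "c5 / (4 * (real n * sqrt n)) \<le> c5 / ((real m + 1) * sqrt (real m + 1))"
      using c5 m by (intro divide_left_mono) (auto intro!: mult_pos_pos)
    also have "\<dots> \<le> measure lborel (return_set T {a..b} n)" unfolding m(2) by (rule main[OF m(1)])
    finally show "c5 / 4 / (real n * sqrt n) \<le> measure lborel (return_set T {a..b} n)" by simp
  qed
qed

text \<open>If \<open>flat\<close> fails for the minimal \<open>N\<close>, the required proportion
  of far sets comes from \<open>not_flat_lower\<close>. If it holds, \<open>flat_imp_small\<close>
  leaves only the possibility of a point mass at an end point; the left one is turned into a right
  one by \<open>mirror\<close>.\<close>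

theorem return_set_lower:
  assumes ab: "a < b"
  obtains c n0 where "c > 0" "\<And>n. n \<ge> n0 \<Longrightarrow> c / (real n * sqrt n) \<le> measure lborel (return_set T {a..b} n)"
proof -
  obtain N' where "\<not> small a b N'" using not_small_exists[OF ab] by blast
  define N where "N = (LEAST N. \<not> small a b N)"
  have N: "\<not> small a b N" "\<And>i. i < N \<Longrightarrow> small a b i"
    unfolding N_def using LeastI[of "\<lambda>N. \<not> small a b N", OF \<open>\<not> small a b N'\<close>] not_less_Least by blast+
  show ?thesis
  proof (cases "flat a b N")
    case False
    obtain c Y where c: "c > 0" "\<And>J. J \<in> sets borel \<Longrightarrow> J \<subseteq> {y. Y \<le> \<bar>y\<bar>} \<Longrightarrow> c * ref J \<le> measure lborel ({a..b} \<inter> (T ^^ N) -` J)"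
      using not_flat_lower[OF False] by metis
    show ?thesis
    proof (rule return_set_lower_aux[where Y = "max Y 0", OF ab N(2) c(1)])
      fix J assume "J \<in> fmeasurable lborel" "J \<subseteq> {max Y 0..}"
      then have "J \<in> sets borel" "J \<subseteq> {y. Y \<le> \<bar>y\<bar>}" by (auto simp: fmeasurable_def)
      then show "c * ref J \<le> measure lborel ({a..b} \<inter> (T ^^ N) -` J)" by (rule c(2))
    qed (use that in auto)
  next
    case flat: True
    obtain p \<eta> where p: "p = a \<or> p = b" "\<eta> > 0" "\<And>\<epsilon>. \<epsilon> > 0 \<Longrightarrow> \<eta> \<le> \<epsilon> * Im ((h ^^ N) (Complex p \<epsilon>))"
      using flat_imp_small[OF ab flat] N(1) by (meson not_less)
    show ?thesis
    proof (cases "p = b")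
      case True
      obtain c Y where c: "c > 0" "\<And>J. J \<in> fmeasurable lborel \<Longrightarrow> J \<subseteq> {Y..} \<Longrightarrow> c * ref J \<le> measure lborel ({a..b} \<inter> (T ^^ N) -` J)"
        using endpoint_lower[OF ab flat p(2)] p(3) unfolding True by metis
      show ?thesis by (rule return_set_lower_aux[OF ab N(2) c]) (use that in auto)
    next
      case False
      then have pa: "p = a" using p(1) by simp
      define h' where "h' w = - cnj (h (- cnj w))" for w
      define T'' where "T'' x = - T (- x)" for x
      interpret m: parabolic_map h' T'' "\<lambda>x. T' (- x)" \<kappa> C R
        unfolding h'_def T''_def by (rule mirror)
      have Im_h': "Im ((h' ^^ n) (Complex t \<epsilon>)) = Im ((h ^^ n) (Complex (- t) \<epsilon>))" for n t \<epsilon>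
      proof -
        have "- cnj (Complex t \<epsilon>) = Complex (- t) \<epsilon>" by (simp add: complex_eq_iff)
        then show ?thesis unfolding h'_def[abs_def] mirror_funpow by simp
      qed
      have T''_funpow: "(T'' ^^ n) x = - (T ^^ n) (- x)" for n x
        by (induction n) (auto simp: T''_def)
      have ref_uminus: "ref (uminus -` J) = ref J" if "J \<in> sets borel" for J
        using that arg_cong[OF distr_cauchy_uminus[of \<i>], of "\<lambda>M. measure M J"] by (simp add: measure_distr)
      have ab': "- b < - a" using ab by simp
      have m_flat: "m.flat (- b) (- a) N"
        unfolding m.flat_def Im_h'
      proof (intro allI impI)
        fix t e \<epsilon> :: real assume "0 < \<epsilon>" "\<epsilon> \<le> e" "- b \<le> t - e" "t + e \<le> - a"
        then show "Im ((h ^^ N) (Complex (- t) \<epsilon>)) \<le> 2 * \<epsilon> / e * Im ((h ^^ N) (Complex (- t) e))"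
          using flat[unfolded flat_def, rule_format, of \<epsilon> e "- t"] by auto
      qed
      have m_small: "m.small (- b) (- a) i" if iN: "i < N" for i
        unfolding m.small_def
      proof (intro allI impI)
        fix \<eta> :: real assume "\<eta> > 0"
        then obtain Y where Y: "\<And>J. J \<in> sets borel \<Longrightarrow> J \<subseteq> {y. Y \<le> \<bar>y\<bar>} \<Longrightarrow> measure lborel ({a..b} \<inter> (T ^^ i) -` J) \<le> \<eta> * ref J"
          using N(2)[OF iN] unfolding small_def by blast
        show "\<exists>Y. \<forall>J. J \<in> sets borel \<longrightarrow> J \<subseteq> {y. Y \<le> \<bar>y\<bar>} \<longrightarrow> measure lborel ({- b..- a} \<inter> (T'' ^^ i) -` J) \<le> \<eta> * ref J"
        proof (intro exI[of _ Y] allI impI)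
          fix J :: "real set" assume J: "J \<in> sets borel" "J \<subseteq> {y. Y \<le> \<bar>y\<bar>}"
          have J': "uminus -` J \<in> sets borel" "uminus -` J \<subseteq> {y. Y \<le> \<bar>y\<bar>}"
            using measurable_sets[of uminus borel borel J] J by auto
          have eq: "{- b..- a} \<inter> (T'' ^^ i) -` J = uminus -` ({a..b} \<inter> (T ^^ i) -` (uminus -` J))"
            by (auto simp: T''_funpow)
          have "{a..b} \<inter> (T ^^ i) -` (uminus -` J) \<in> sets borel" by (intro sets.Int sets_vimage_funpow J') auto
          then have "measure lborel ({- b..- a} \<inter> (T'' ^^ i) -` J) = measure lborel ({a..b} \<inter> (T ^^ i) -` (uminus -` J))"
            unfolding eq by (rule measure_uminus_vimage)
          also have "\<dots> \<le> \<eta> * ref (uminus -` J)" by (rule Y[OF J'])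
          finally show "measure lborel ({- b..- a} \<inter> (T'' ^^ i) -` J) \<le> \<eta> * ref J" by (simp add: ref_uminus J)
        qed
      qed
      have mass: "\<eta> \<le> e * Im ((h' ^^ N) (Complex (- a) e))" if "e > 0" for e
        using p(3)[OF that] pa by (simp add: Im_h')
      obtain c Y where c: "c > 0" "\<And>J. J \<in> fmeasurable lborel \<Longrightarrow> J \<subseteq> {Y..} \<Longrightarrow> c * ref J \<le> measure lborel ({- b..- a} \<inter> (T'' ^^ N) -` J)"
        using m.endpoint_lower[OF ab' m_flat p(2) mass] by metis
      obtain c' n0 where c': "c' > 0" "\<And>n. n \<ge> n0 \<Longrightarrow> c' / (real n * sqrt n) \<le> measure lborel (return_set T'' {- b..- a} n)"
        using m.return_set_lower_aux[OF ab' m_small c] by metis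
      have eq: "measure lborel (return_set T'' {- b..- a} n) = measure lborel (return_set T {a..b} n)" if n: "n \<ge> 1" for n
      proof -
        have "return_set T'' {- b..- a} n = uminus -` return_set T {a..b} n"
          unfolding return_set_eq[OF n] m.return_set_eq[OF n] first_returns_def m.first_returns_def
          by (auto simp: T''_funpow)
        moreover have "return_set T {a..b} n \<in> sets borel"
        proof -
          have "{x\<in>space borel. x \<in> {a..b} \<and> (\<forall>k. 1 \<le> k \<and> k < n \<longrightarrow> (T ^^ k) x \<notin> {a..b}) \<and> (T ^^ n) x \<in> {a..b}} \<in> sets borel"
            by measurable
          then show ?thesis unfolding return_set_eq[OF n] by (simp add: first_returns_def)
        qed
        ultimately show ?thesis by (simp add: measure_uminus_vimage)
      qed
      show ?thesis
      proof (rule that[of c' "max 1 n0"])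
        fix n assume "max 1 n0 \<le> n"
        then have n: "n \<ge> 1" "n \<ge> n0" by auto
        show "c' / (real n * sqrt n) \<le> measure lborel (return_set T {a..b} n)" using c'(2)[OF n(2)] eq[OF n(1)] by simp
      qed (rule c'(1))
    qed
  qed
qed

end

section \<open>Boundary values of holomorphic maps\<close>

definition angle_measure :: "real measure" where
  "angle_measure = uniform_measure lborel {0..<2 * pi}"

lemma sets_angle [simp, measurable_cong]: "sets angle_measure = sets borel"
  and space_angle [simp]: "space angle_measure = UNIV"
  by (simp_all add: angle_measure_def)

lemma angle_measure_density:
  "angle_measure = density lborel (\<lambda>t. ennreal (indicator {0..<2 * pi} t / (2 * pi)))"
proof -
  have "indicator {0..<2 * pi} t / emeasure lborel {0..<2 * pi} = ennreal (indicator {0..<2 * pi} t / (2 * pi))" for t :: real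
    using divide_ennreal[of 1 "2 * pi"] by (simp add: indicator_def)
  then show ?thesis unfolding angle_measure_def uniform_measure_def by simp
qed

interpretation angle: prob_space angle_measure
  unfolding angle_measure_def by (rule prob_space_uniform_measure) simp_all

lemma cis_measurable [measurable]: "cis \<in> borel_measurable borel"
  by (intro borel_measurable_continuous_onI continuous_intros)

lemma integral_angle_continuous:
  fixes k :: "real \<Rightarrow> complex"
  assumes k: "continuous_on UNIV k"
  shows "(\<integral>t. k t \<partial>angle_measure) = integral {0..2 * pi} k / (2 * pi)"
proof -
  have [measurable]: "k \<in> borel_measurable borel" by (rule borel_measurable_continuous_onI[OF k])
  have int: "set_integrable lborel {0..2 * pi} k"
    by (rule borel_integrable_atLeastAtMost'[OF continuous_on_subset[OF k]]) simp
  have "(\<integral>t. k t \<partial>angle_measure) = (\<integral>t. (indicator {0..<2 * pi} t / (2 * pi)) *\<^sub>R k t \<partial>lborel)"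
    unfolding angle_measure_density by (rule integral_density) auto
  also have "\<dots> = (\<integral>t. (indicator {0..2 * pi} t *\<^sub>R k t) / (2 * pi) \<partial>lborel)"
  proof (rule integral_cong_AE)
    show "AE t in lborel. (indicator {0..<2 * pi} t / (2 * pi)) *\<^sub>R k t = (indicator {0..2 * pi} t *\<^sub>R k t) / (2 * pi)"
      using AE_lborel_singleton[of "2 * pi"]
      by eventually_elim (auto simp: indicator_def scaleR_conv_of_real)
  qed auto
  also have "\<dots> = (LINT t:{0..2 * pi}|lborel. k t) / (2 * pi)"
    unfolding set_lebesgue_integral_def by (rule integral_divide_zero)
  also have "\<dots> = integral {0..2 * pi} k / (2 * pi)"
    by (simp add: set_borel_integral_eq_integral(2)[OF int])
  finally show ?thesis .
qed

text \<open>The Poisson kernel of the unit disc, normalised to have mean 1 with respect to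
  \<open>angle_measure\<close>.\<close>

definition disc_kernel :: "complex \<Rightarrow> complex \<Rightarrow> real" where
  "disc_kernel z \<zeta> = (1 - (norm z)\<^sup>2) / (norm (\<zeta> - z))\<^sup>2"

lemma disc_kernel_0 [simp]: "norm \<zeta> = 1 \<Longrightarrow> disc_kernel 0 \<zeta> = 1"
  by (simp add: disc_kernel_def)

lemma continuous_disc_kernel: "norm z < 1 \<Longrightarrow> continuous_on UNIV (\<lambda>t. disc_kernel z (cis t))"
  unfolding disc_kernel_def by (intro continuous_intros) auto

lemma disc_kernel_bounds:
  assumes "norm z < 1" "norm \<zeta> = 1"
  shows "0 \<le> disc_kernel z \<zeta>" "disc_kernel z \<zeta> \<le> (1 - (norm z)\<^sup>2) / (1 - norm z)\<^sup>2"
proof -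
  have "(norm z)\<^sup>2 \<le> 1" using assms by (simp add: power_le_one)
  moreover have "1 - norm z \<le> norm (\<zeta> - z)" using norm_triangle_ineq2[of \<zeta> z] assms by simp
  then have "(1 - norm z)\<^sup>2 \<le> (norm (\<zeta> - z))\<^sup>2" using assms by (intro power_mono) auto
  ultimately show "0 \<le> disc_kernel z \<zeta>" "disc_kernel z \<zeta> \<le> (1 - (norm z)\<^sup>2) / (1 - norm z)\<^sup>2"
    using assms unfolding disc_kernel_def by (auto intro!: divide_left_mono mult_pos_pos zero_less_power)
qed

text \<open>The Poisson formula is the Cauchy formula for \<open>f u * (1 - \<bar>z\<bar>\<^sup>2) / (1 - cnj z * u)\<close>.\<close>

lemma poisson_disc_smooth:
  assumes f: "f holomorphic_on ball 0 R" "R > 1" and z: "norm z < 1"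
  shows "(\<integral>t. of_real (disc_kernel z (cis t)) * f (cis t) \<partial>angle_measure) = f z"
proof -
  define Q where "Q u = f u * of_real (1 - (norm z)\<^sup>2) / (1 - cnj z * u)" for u
  have ne: "1 - cnj z * u \<noteq> 0" if "norm u \<le> 1" for u
  proof
    assume "1 - cnj z * u = 0"
    then have "cnj z * u = 1" by simp
    then have "norm z * norm u = 1" by (metis norm_mult complex_mod_cnj norm_one)
    moreover have "norm z * norm u \<le> norm z * 1" using that by (intro mult_left_mono) auto
    ultimately show False using z by simp
  qed
  have Q: "Q holomorphic_on cball 0 1"
    unfolding Q_def by (intro holomorphic_intros holomorphic_on_subset[OF f(1)]) (use ne f(2) in auto)
  have "((\<lambda>u. Q u / (u - z)) has_contour_integral (2 * of_real pi * \<i> * Q z)) (circlepath 0 1)"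
    by (rule Cauchy_integral_circlepath_simple[OF Q]) (use z in simp)
  then have "((\<lambda>t. Q (cis t) / (cis t - z) * \<i> * cis t) has_integral 2 * of_real pi * \<i> * Q z) {0..2 * pi}"
    unfolding circlepath_def by (subst (asm) has_contour_integral_part_circlepath_iff) simp_all
  also have "(\<lambda>t. Q (cis t) / (cis t - z) * \<i> * cis t) = (\<lambda>t. \<i> * (of_real (disc_kernel z (cis t)) * f (cis t)))"
  proof
    fix t
    define D where "D = cis t - z"
    have D: "D \<noteq> 0" using z by (auto simp: D_def)
    have "1 - cnj z * cis t = cis t * cnj D" by (simp add: D_def algebra_simps cis_cnj cis_mult)
    moreover have "of_real (disc_kernel z (cis t)) = of_real (1 - (norm z)\<^sup>2) / (D * cnj D)"
      by (simp add: disc_kernel_def D_def[symmetric] complex_norm_square[symmetric])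
    ultimately show "Q (cis t) / (cis t - z) * \<i> * cis t = \<i> * (of_real (disc_kernel z (cis t)) * f (cis t))"
      using D by (simp add: Q_def D_def[symmetric] mult_ac)
  qed
  also have "Q z = f z"
  proof -
    have "1 - cnj z * z = of_real (1 - (norm z)\<^sup>2)" using complex_norm_square[of z] by (simp add: mult.commute)
    then show ?thesis using ne[of z] z unfolding Q_def by simp
  qed
  finally have I: "((\<lambda>t. - \<i> * (\<i> * (of_real (disc_kernel z (cis t)) * f (cis t)))) has_integral - \<i> * (2 * of_real pi * \<i> * f z)) {0..2 * pi}"
    by (rule has_integral_mult_right)
  have e1: "- \<i> * (\<i> * v) = v" for v :: complex by (simp add: mult.assoc[symmetric])
  have e2: "- \<i> * (2 * of_real pi * \<i> * f z) = 2 * of_real pi * f z" by (simp add: algebra_simps)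
  have "((\<lambda>t. of_real (disc_kernel z (cis t)) * f (cis t)) has_integral 2 * of_real pi * f z) {0..2 * pi}"
    using I unfolding e1 e2 .
  moreover have "continuous_on UNIV (\<lambda>t. of_real (disc_kernel z (cis t)) * f (cis t))"
  proof (intro continuous_intros continuous_disc_kernel z)
    show "continuous_on UNIV (\<lambda>t. f (cis t))"
      by (rule continuous_on_compose2[OF holomorphic_on_imp_continuous_on[OF f(1)]]) (use f(2) in \<open>auto intro!: continuous_intros\<close>)
  qed
  ultimately show ?thesis by (simp add: integral_angle_continuous integral_unique)
qed

text \<open>A sequence replaces the limit along \<open>at_left 1\<close> wherever measurability or
  dominated convergence is required; the summand 2 keeps all radii positive.\<close>

definition radii :: "nat \<Rightarrow> real" where
  "radii n = 1 - 1 / (real n + 2)"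

lemma radii: "0 < radii n" "radii n < 1" "radii \<longlonglongrightarrow> 1"
proof -
  show "0 < radii n" "radii n < 1" by (simp_all add: radii_def)
  show "radii \<longlonglongrightarrow> 1" unfolding radii_def by real_asymp
qed

lemma radii_at_left: "filterlim radii (at_left 1) sequentially"
  using radii by (auto simp: filterlim_at intro!: always_eventually) (metis less_irrefl)

lemma norm_radii [simp]: "norm (of_real (radii n) * u :: complex) = radii n * norm u"
  using radii(1)[of n] by (simp add: norm_mult)

text \<open>The dilations of \<open>F\<close> by \<open>radii n\<close> are holomorphic on larger
  discs, where the smooth formula applies; the bound \<open>B\<close> permits the passage to the
  limit.\<close>

theorem poisson_disc:
  fixes Fs :: "real \<Rightarrow> complex"
  assumes F: "F holomorphic_on ball 0 1" "\<And>z. norm z < 1 \<Longrightarrow> norm (F z) \<le> B"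
    and Fs [measurable]: "Fs \<in> borel_measurable borel"
    and lim: "AE t in angle_measure. (\<lambda>n. F (of_real (radii n) * cis t)) \<longlonglongrightarrow> Fs t"
    and z: "norm z < 1"
  shows "(\<integral>t. of_real (disc_kernel z (cis t)) * Fs t \<partial>angle_measure) = F z"
proof -
  define K where "K = (1 - (norm z)\<^sup>2) / (1 - norm z)\<^sup>2"
  have k_meas [measurable]: "(\<lambda>t. disc_kernel z (cis t)) \<in> borel_measurable borel"
    by (rule borel_measurable_continuous_onI[OF continuous_disc_kernel[OF z]])
  have F_cont: "continuous_on UNIV (\<lambda>t. F (of_real (radii n) * cis t))" for n
    by (rule continuous_on_compose2[OF holomorphic_on_imp_continuous_on[OF F(1)]])
      (use radii in \<open>auto intro!: continuous_intros\<close>)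
  have F_meas [measurable]: "(\<lambda>t. F (of_real (radii n) * cis t)) \<in> borel_measurable borel" for n
    by (rule borel_measurable_continuous_onI[OF F_cont])
  have eq: "(\<integral>t. of_real (disc_kernel z (cis t)) * F (of_real (radii n) * cis t) \<partial>angle_measure) = F (of_real (radii n) * z)" for n
  proof (rule poisson_disc_smooth[where R = "1 / radii n"])
    have "(F \<circ> (\<lambda>u. of_real (radii n) * u)) holomorphic_on ball 0 (1 / radii n)"
      by (rule holomorphic_on_compose_gen[OF _ F(1)])
        (use radii(1,2)[of n] in \<open>auto intro!: holomorphic_intros simp: norm_mult field_simps\<close>)
    then show "(\<lambda>u. F (of_real (radii n) * u)) holomorphic_on ball 0 (1 / radii n)" by (simp add: o_def)
    show "1 < 1 / radii n" using radii(1,2)[of n] by simp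
  qed fact
  have "(\<lambda>n. \<integral>t. of_real (disc_kernel z (cis t)) * F (of_real (radii n) * cis t) \<partial>angle_measure)
    \<longlonglongrightarrow> (\<integral>t. of_real (disc_kernel z (cis t)) * Fs t \<partial>angle_measure)"
  proof (rule integral_dominated_convergence[where w = "\<lambda>_. K * B"])
    show "AE t in angle_measure. (\<lambda>n. of_real (disc_kernel z (cis t)) * F (of_real (radii n) * cis t))
      \<longlonglongrightarrow> of_real (disc_kernel z (cis t)) * Fs t"
      using lim by eventually_elim (rule tendsto_mult_left)
    show "AE t in angle_measure. norm (of_real (disc_kernel z (cis t)) * F (of_real (radii n) * cis t)) \<le> K * B" for n
    proof (intro always_eventually allI)
      fix t
      have "norm (F (of_real (radii n) * cis t)) \<le> B" by (rule F(2)) (simp add: radii)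
      then have "disc_kernel z (cis t) * norm (F (of_real (radii n) * cis t)) \<le> K * B"
        unfolding K_def using disc_kernel_bounds[OF z norm_cis[of t]] by (intro mult_mono) auto
      then show "norm (of_real (disc_kernel z (cis t)) * F (of_real (radii n) * cis t)) \<le> K * B"
        using disc_kernel_bounds(1)[OF z norm_cis[of t]] by (simp add: norm_mult)
    qed
  qed simp_all
  then have "(\<lambda>n. F (of_real (radii n) * z)) \<longlonglongrightarrow> (\<integral>t. of_real (disc_kernel z (cis t)) * Fs t \<partial>angle_measure)"
    by (simp only: eq)
  moreover have "(\<lambda>n. F (of_real (radii n) * z)) \<longlonglongrightarrow> F z"
  proof (rule isCont_tendsto_compose[where g = F])
    show "isCont F z" using F(1) z by (intro holomorphic_on_imp_continuous_on[THEN continuous_on_interior]) auto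
    have "(\<lambda>n. of_real (radii n) * z) \<longlonglongrightarrow> of_real 1 * z" by (intro tendsto_intros radii)
    then show "(\<lambda>n. of_real (radii n) * z) \<longlonglongrightarrow> z" by simp
  qed
  ultimately show ?thesis by (rule LIMSEQ_unique)
qed

text \<open>Integrate \<open>((1 + cnj p * F) / 2) ^ k\<close>: its boundary values tend to the indicator of
  \<open>Fs t = p\<close>, while its value at the origin tends to \<open>0\<close>.\<close>

lemma AE_boundary_value_ne:
  assumes F: "F holomorphic_on ball 0 1" "\<And>z. norm z < 1 \<Longrightarrow> norm (F z) < 1"
    and Fs [measurable]: "Fs \<in> borel_measurable borel"
    and lim: "AE t in angle_measure. (\<lambda>n. F (of_real (radii n) * cis t)) \<longlonglongrightarrow> Fs t"
    and p: "norm p = 1"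
  shows "AE t in angle_measure. Fs t \<noteq> p"
proof -
  define u where "u w = (1 + cnj p * w) / 2" for w :: complex
  have u_le: "norm (u w) \<le> (1 + norm w) / 2" for w
  proof -
    have "norm (1 + cnj p * w) \<le> norm (1 :: complex) + norm (cnj p * w)" by (rule norm_triangle_ineq)
    then show ?thesis by (simp add: u_def norm_mult norm_divide p)
  qed
  \<comment> \<open>Strict convexity of the disc: the midpoint of 1 and \<open>cnj p * w\<close> has
    norm 1 only if the two points coincide.\<close>
  have u_less: "norm (u w) < 1" if w: "norm w \<le> 1" "w \<noteq> p" for w
  proof (rule ccontr)
    assume "\<not> norm (u w) < 1"
    define v where "v = cnj p * w"
    have v: "norm v \<le> 1" using w p by (simp add: v_def norm_mult)
    have "2 \<le> norm (1 + v)" using \<open>\<not> norm (u w) < 1\<close> by (simp add: u_def v_def norm_divide)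
    then have "2\<^sup>2 \<le> (norm (1 + v))\<^sup>2" by (intro power_mono) auto
    moreover have "(norm (1 + v))\<^sup>2 = 1 + 2 * Re v + (norm v)\<^sup>2"
      unfolding cmod_power2 by (simp add: power2_eq_square algebra_simps)
    moreover have "(norm v)\<^sup>2 \<le> 1" using v by (simp add: power_le_one)
    ultimately have Re: "Re v \<ge> 1" by simp
    then have "1\<^sup>2 \<le> (Re v)\<^sup>2" by (intro power_mono) auto
    moreover have "(Re v)\<^sup>2 + (Im v)\<^sup>2 \<le> 1" using \<open>(norm v)\<^sup>2 \<le> 1\<close> by (simp only: cmod_power2)
    ultimately have "(Im v)\<^sup>2 \<le> 0" unfolding one_power2 by linarith
    then have "Im v = 0" by simp
    moreover have "Re v \<le> 1" using complex_Re_le_cmod[of v] v by linarith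
    ultimately have "cnj p * w = 1" using Re by (simp add: v_def[symmetric] complex_eq_iff)
    then have "p * cnj p * w = p" by (simp add: mult.assoc)
    then show False using w p by (simp add: complex_norm_square[symmetric])
  qed
  have u0: "norm (u (F 0)) < 1" using u_le[of "F 0"] F(2)[of 0] by simp
  have eq: "(\<integral>t. u (Fs t) ^ k \<partial>angle_measure) = u (F 0) ^ k" for k
  proof -
    have "(\<integral>t. of_real (disc_kernel 0 (cis t)) * u (Fs t) ^ k \<partial>angle_measure) = u (F 0) ^ k"
    proof (rule poisson_disc[where F = "\<lambda>z. u (F z) ^ k"])
      show "(\<lambda>z. u (F z) ^ k) holomorphic_on ball 0 1" unfolding u_def by (intro holomorphic_intros F(1)) auto
      show "norm (u (F z) ^ k) \<le> 1" if "norm z < 1" for z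
        using u_le[of "F z"] F(2)[OF that] by (simp add: norm_power power_le_one)
      show "(\<lambda>t. u (Fs t) ^ k) \<in> borel_measurable borel" unfolding u_def by measurable
      show "AE t in angle_measure. (\<lambda>n. u (F (of_real (radii n) * cis t)) ^ k) \<longlonglongrightarrow> u (Fs t) ^ k"
        using lim unfolding u_def by eventually_elim (intro tendsto_intros, auto)
    qed simp
    then show ?thesis by simp
  qed
  have Fs_le: "AE t in angle_measure. norm (Fs t) \<le> 1"
    using lim
  proof eventually_elim
    case (elim t)
    have "norm (F (of_real (radii n) * cis t)) \<le> 1" for n by (intro less_imp_le F(2)) (simp add: radii)
    then show ?case using tendsto_norm[OF elim] by (intro LIMSEQ_le_const2) auto
  qed
  have "(\<lambda>k. \<integral>t. u (Fs t) ^ k \<partial>angle_measure) \<longlonglongrightarrow> (\<integral>t. indicator {t. Fs t = p} t \<partial>angle_measure)"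
  proof (rule integral_dominated_convergence[where w = "\<lambda>_. 1"])
    show "AE t in angle_measure. (\<lambda>k. u (Fs t) ^ k) \<longlonglongrightarrow> indicator {t. Fs t = p} t"
      using Fs_le
    proof eventually_elim
      case (elim t)
      show ?case
      proof (cases "Fs t = p")
        case True
        have "u p = 1" using p by (simp add: u_def complex_norm_square[symmetric] mult.commute)
        then show ?thesis using True by simp
      next
        case False
        then show ?thesis using LIMSEQ_power_zero[OF u_less[OF elim False]] by simp
      qed
    qed
    show "AE t in angle_measure. norm (u (Fs t) ^ k) \<le> 1" for k
      using Fs_le
    proof eventually_elim
      case (elim t)
      then have "(1 + norm (Fs t)) / 2 \<le> 1" by simp
      with u_le[of "Fs t"] have "norm (u (Fs t)) \<le> 1" by (rule order_trans)
      then show ?case by (simp add: norm_power power_le_one)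
    qed
    show "(\<lambda>t. indicator {t. Fs t = p} t :: complex) \<in> borel_measurable angle_measure" by measurable
    show "(\<lambda>t. u (Fs t) ^ k) \<in> borel_measurable angle_measure" for k unfolding u_def by measurable
  qed simp
  then have "(\<lambda>k. u (F 0) ^ k) \<longlonglongrightarrow> (\<integral>t. indicator {t. Fs t = p} t \<partial>angle_measure)" by (simp only: eq)
  then have "(\<integral>t. indicator {t. Fs t = p} t \<partial>angle_measure) = (0 :: complex)"
    using LIMSEQ_unique LIMSEQ_power_zero[OF u0] by blast
  moreover have [measurable]: "{t. Fs t = p} \<in> sets borel" by measurable
  moreover have "(\<integral>t. indicator {t. Fs t = p} t \<partial>angle_measure) = complex_of_real (measure angle_measure {t. Fs t = p})"
  proof -
    have "(\<integral>t. indicator {t. Fs t = p} t \<partial>angle_measure) = (\<integral>t. complex_of_real (indicator {t. Fs t = p} t) \<partial>angle_measure)"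
      by (intro Bochner_Integration.integral_cong refl) (simp add: indicator_def)
    also have "\<dots> = of_real (\<integral>t. indicator {t. Fs t = p} t \<partial>angle_measure)" by (rule integral_complex_of_real)
    finally show ?thesis by simp
  qed
  ultimately have "measure angle_measure {t. Fs t = p} = 0" by simp
  then have "emeasure angle_measure {t. Fs t = p} = 0" by (simp add: angle.emeasure_eq_measure)
  then show ?thesis by (intro AE_I[of _ _ "{t. Fs t = p}"]) auto
qed

lemma AE_cis_ne:
  assumes "norm p = 1"
  shows "AE t in angle_measure. cis t \<noteq> p"
proof (rule AE_boundary_value_ne[where F = "\<lambda>z. z", OF _ _ _ _ assms])
  have "(\<lambda>n. of_real (radii n) * cis t) \<longlonglongrightarrow> of_real 1 * cis t" for t by (intro tendsto_intros radii)
  then show "AE t in angle_measure. (\<lambda>n. of_real (radii n) * cis t) \<longlonglongrightarrow> cis t" by simp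
qed (auto intro: holomorphic_intros)

text \<open>Normal form of a Moebius map of the disc onto the half-plane with pole \<open>p\<close>.
  The parameters are the coordinates of the image of the centre:
  \<open>M 0 = Complex t\<^sub>0 s\<close>, and the constant \<open>\<alpha>\<close> below is its
  conjugate.\<close>

locale half_plane_chart =
  fixes M :: "complex \<Rightarrow> complex" and p :: complex and s t\<^sub>0 :: real
  assumes norm_p: "norm p = 1" and s_pos: "s > 0"
    and M_eq': "\<And>z. z \<noteq> p \<Longrightarrow> M z = Complex t\<^sub>0 (- s) - 2 * of_real s * \<i> * p / (z - p)"
begin

definition \<alpha> :: complex where "\<alpha> = Complex t\<^sub>0 (- s)"

definition \<beta> :: complex where "\<beta> = - (2 * of_real s * \<i> * p)"

definition N :: "complex \<Rightarrow> complex" where "N w = p + \<beta> / (w - \<alpha>)"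

lemma M_eq: "z \<noteq> p \<Longrightarrow> M z = \<alpha> + \<beta> / (z - p)"
  using M_eq' by (simp add: \<alpha>_def \<beta>_def)

lemma \<beta>: "norm \<beta> = 2 * s" "\<beta> \<noteq> 0"
  using s_pos norm_p by (auto simp: \<beta>_def norm_mult)

lemma ne_\<alpha>: "Im w \<ge> 0 \<Longrightarrow> w \<noteq> \<alpha>"
  using s_pos by (auto simp: \<alpha>_def)

lemma N_ne: "w \<noteq> \<alpha> \<Longrightarrow> N w \<noteq> p"
  using \<beta> by (simp add: N_def)

lemma M_N: "w \<noteq> \<alpha> \<Longrightarrow> M (N w) = w"
  using N_ne[of w] \<beta> by (simp add: M_eq N_def)

lemma N_M: "z \<noteq> p \<Longrightarrow> N (M z) = z"
  using \<beta> by (simp add: M_eq N_def)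

lemma Im_M:
  assumes "z \<noteq> p"
  shows "Im (M z) = s * (1 - (norm z)\<^sup>2) / (norm (z - p))\<^sup>2"
proof -
  define u where "u = z - p"
  have u: "(norm u)\<^sup>2 > 0" using assms by (simp add: u_def)
  have p2: "(Re p)\<^sup>2 + (Im p)\<^sup>2 = 1" using norm_p by (simp add: cmod_power2[symmetric])
  have z: "z = p + u" by (simp add: u_def)
  have norm_z: "1 - (norm z)\<^sup>2 = - 2 * (Re p * Re u + Im p * Im u) - (norm u)\<^sup>2"
    unfolding z cmod_power2 using p2 by (simp add: power2_eq_square algebra_simps)
  have Im: "Im (\<beta> / u) = - 2 * s * (Re p * Re u + Im p * Im u) / (norm u)\<^sup>2"
    unfolding Im_divide cmod_power2 by (simp add: \<beta>_def algebra_simps)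
  have "Im (M z) = - s + Im (\<beta> / u)" using assms by (simp add: M_eq u_def \<alpha>_def)
  then show ?thesis unfolding Im norm_z u_def[symmetric] using u by (simp add: field_simps)
qed

lemma M_upper:
  assumes "norm z < 1"
  shows "Im (M z) > 0"
proof -
  have "z \<noteq> p" using assms norm_p by auto
  moreover have "(norm z)\<^sup>2 < 1" using assms by (simp add: power_less_one_iff)
  ultimately show ?thesis using Im_M[of z] s_pos by simp
qed

lemma M_real: "norm \<zeta> = 1 \<Longrightarrow> \<zeta> \<noteq> p \<Longrightarrow> of_real (Re (M \<zeta>)) = M \<zeta>"
  using Im_M[of \<zeta>] by (simp add: complex_eq_iff)

lemma N_disc:
  assumes "Im w > 0"
  shows "norm (N w) < 1"
proof -
  have w: "w \<noteq> \<alpha>" using assms by (intro ne_\<alpha>) simp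
  have "0 < s * (1 - (norm (N w))\<^sup>2) / (norm (N w - p))\<^sup>2"
    using Im_M[OF N_ne[OF w]] assms by (simp add: M_N[OF w])
  then have "(norm (N w))\<^sup>2 < 1" using s_pos by (auto simp: zero_less_divide_iff zero_less_mult_iff)
  then show ?thesis by (simp add: power_less_one_iff)
qed

lemma N_circle: "norm (N (of_real x)) = 1"
proof -
  have w: "of_real x \<noteq> \<alpha>" by (intro ne_\<alpha>) simp
  have "0 = s * (1 - (norm (N (of_real x)))\<^sup>2) / (norm (N (of_real x) - p))\<^sup>2"
    using Im_M[OF N_ne[OF w]] by (simp add: M_N[OF w])
  then have "(norm (N (of_real x)))\<^sup>2 = 1" using s_pos N_ne[OF w] by simp
  then show ?thesis using norm_ge_zero[of "N (of_real x)"] by (simp add: power2_eq_1_iff)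
qed

text \<open>The second factor depends on \<open>\<zeta>\<close> only. Kernels for two different
  points therefore have the same ratio in the disc and in the half-plane, which transfers the
  Poisson formula to the line.\<close>

lemma poisson_chart:
  assumes z: "norm z < 1" and \<zeta>: "norm \<zeta> = 1" "\<zeta> \<noteq> p"
  shows "poisson (M z) (Re (M \<zeta>)) = disc_kernel z \<zeta> * ((norm (\<zeta> - p))\<^sup>2 / (4 * pi * s))"
proof -
  have zp: "z \<noteq> p" "z \<noteq> \<zeta>" using z norm_p \<zeta> by auto
  define A B D where "A = norm (z - p)" and "B = norm (\<zeta> - p)" and "D = norm (\<zeta> - z)"
  have pos: "A > 0" "B > 0" "D > 0" using zp \<zeta> by (auto simp: A_def B_def D_def)
  have "M z - of_real (Re (M \<zeta>)) = \<beta> * (\<zeta> - z) / ((z - p) * (\<zeta> - p))"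
    unfolding M_real[OF \<zeta>] using zp \<zeta> by (simp add: M_eq field_simps)
  then have "norm (M z - of_real (Re (M \<zeta>))) = 2 * s * D / (A * B)"
    by (simp add: norm_divide norm_mult \<beta> A_def B_def D_def)
  moreover have "Im (M z) = s * (1 - (norm z)\<^sup>2) / A\<^sup>2" using Im_M[OF zp(1)] by (simp add: A_def)
  ultimately have "poisson (M z) (Re (M \<zeta>)) = (s * (1 - (norm z)\<^sup>2) / A\<^sup>2) / (pi * (2 * s * D / (A * B))\<^sup>2)"
    by (simp add: poisson_eq_norm)
  also have "\<dots> = (1 - (norm z)\<^sup>2) / D\<^sup>2 * (B\<^sup>2 / (4 * pi * s))"
    using pos s_pos by (simp add: power2_eq_square field_simps)
  finally show ?thesis by (simp add: disc_kernel_def B_def D_def)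
qed

definition X :: "real \<Rightarrow> real" where "X t = Re (M (cis t))"

lemma M_measurable [measurable]: "M \<in> borel_measurable borel"
proof -
  have "M = (\<lambda>z. if z = p then M p else \<alpha> + \<beta> / (z - p))" using M_eq by auto
  moreover have "(\<lambda>z. if z = p then M p else \<alpha> + \<beta> / (z - p)) \<in> borel_measurable borel" by measurable
  ultimately show ?thesis by simp
qed

lemma X_measurable [measurable]: "X \<in> borel_measurable borel"
  unfolding X_def by measurable

lemma pushforward_measure_eq: "pushforward_measure M = distr angle_measure borel X"
proof -
  have "pushforward_measure M = distr angle_measure borel ((\<lambda>\<zeta>. Re (M \<zeta>)) \<circ> cis)"
    unfolding pushforward_measure_def circle_measure_def angle_measure_def[symmetric]
    by (rule distr_distr) measurable
  then show ?thesis by (simp add: o_def X_def[abs_def])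
qed

lemma M_holomorphic: "M holomorphic_on ball 0 1"
proof (rule holomorphic_transform)
  show "(\<lambda>z. \<alpha> + \<beta> / (z - p)) holomorphic_on ball 0 1"
    using norm_p by (intro holomorphic_intros) auto
  show "\<alpha> + \<beta> / (z - p) = M z" if "z \<in> ball 0 1" for z
    using that norm_p by (subst M_eq) auto
qed

lemma M_radial_limit:
  assumes "cis t \<noteq> p"
  shows "(\<lambda>n. M (of_real (radii n) * cis t)) \<longlonglongrightarrow> M (cis t)"
proof -
  have "norm (of_real (radii n) * cis t) < 1" for n by (simp add: radii)
  then have ne: "of_real (radii n) * cis t \<noteq> p" for n using norm_p by (metis less_irrefl)
  have "(\<lambda>n. \<alpha> + \<beta> / (of_real (radii n) * cis t - p)) \<longlonglongrightarrow> \<alpha> + \<beta> / (of_real 1 * cis t - p)"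
    using assms by (intro tendsto_intros radii) simp
  then show ?thesis using assms by (simp add: M_eq ne)
qed

text \<open>The assumption \<open>push\<close> breaks a circle. For general charts it is proved with
  characteristic functions, whose values for Cauchy distributions rest on this lemma. For the single
  chart \<open>std\<close> it is verified by comparing distribution functions, which starts the
  argument.\<close>

lemma poisson_line_aux:
  fixes Fs :: "real \<Rightarrow> complex"
  assumes push: "distr angle_measure borel X = cauchy (M 0)"
    and F: "F holomorphic_on ball 0 1" "\<And>z. norm z < 1 \<Longrightarrow> norm (F z) \<le> B"
    and Fs [measurable]: "Fs \<in> borel_measurable borel"
    and lim: "AE t in angle_measure. (\<lambda>n. F (of_real (radii n) * cis t)) \<longlonglongrightarrow> Fs (X t)"
    and w: "Im w > 0"
  shows "(\<integral>x. poisson w x *\<^sub>R Fs x \<partial>lborel) = F (N w)"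
proof -
  define w0 where "w0 = M 0"
  have w0: "Im w0 > 0" unfolding w0_def by (rule M_upper) simp
  define z where "z = N w"
  have z: "norm z < 1" "M z = w" using N_disc[OF w] M_N[of w] ne_\<alpha>[of w] w by (auto simp: z_def)
  have k_meas [measurable]: "(\<lambda>t. disc_kernel z (cis t)) \<in> borel_measurable borel"
    by (rule borel_measurable_continuous_onI[OF continuous_disc_kernel[OF z(1)]])
  have "(\<integral>x. poisson w x *\<^sub>R Fs x \<partial>lborel) = (\<integral>x. poisson w0 x *\<^sub>R ((poisson w x / poisson w0 x) *\<^sub>R Fs x) \<partial>lborel)"
    using poisson_pos[OF w0] by (intro Bochner_Integration.integral_cong refl) (simp add: less_imp_neq[symmetric])
  also have "\<dots> = (\<integral>x. (poisson w x / poisson w0 x) *\<^sub>R Fs x \<partial>cauchy w0)"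
    unfolding cauchy_def by (rule integral_density[symmetric]) (auto intro: poisson_nonneg w0)
  also have "\<dots> = (\<integral>t. (poisson w (X t) / poisson w0 (X t)) *\<^sub>R Fs (X t) \<partial>angle_measure)"
    unfolding w0_def push[symmetric] by (rule integral_distr) measurable
  also have "\<dots> = (\<integral>t. of_real (disc_kernel z (cis t)) * Fs (X t) \<partial>angle_measure)"
  proof (rule integral_cong_AE)
    show "AE t in angle_measure. (poisson w (X t) / poisson w0 (X t)) *\<^sub>R Fs (X t) = of_real (disc_kernel z (cis t)) * Fs (X t)"
      using AE_cis_ne[OF norm_p]
    proof eventually_elim
      case (elim t)
      define q where "q = (norm (cis t - p))\<^sup>2 / (4 * pi * s)"
      have "q > 0" using elim s_pos by (simp add: q_def)
      moreover have "poisson w (X t) = disc_kernel z (cis t) * q" "poisson w0 (X t) = q"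
        using poisson_chart[OF z(1) norm_cis elim] poisson_chart[OF _ norm_cis elim, of 0]
        by (simp_all add: X_def q_def z(2) w0_def)
      ultimately show ?case by (simp add: scaleR_conv_of_real)
    qed
  qed measurable
  also have "\<dots> = F z" by (rule poisson_disc[OF F _ lim z(1)]) measurable
  finally show ?thesis by (simp add: z_def)
qed

lemma exp_M:
  assumes "\<theta> \<ge> 0"
  shows "(\<lambda>z. exp (\<i> * of_real \<theta> * M z)) holomorphic_on ball 0 1"
    and "\<And>z. norm z < 1 \<Longrightarrow> norm (exp (\<i> * of_real \<theta> * M z)) \<le> 1"
    and "AE t in angle_measure. (\<lambda>n. exp (\<i> * of_real \<theta> * M (of_real (radii n) * cis t))) \<longlonglongrightarrow> iexp (\<theta> * X t)"
proof -
  show "(\<lambda>z. exp (\<i> * of_real \<theta> * M z)) holomorphic_on ball 0 1"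
    by (intro holomorphic_intros M_holomorphic)
  show "norm (exp (\<i> * of_real \<theta> * M z)) \<le> 1" if "norm z < 1" for z
    using M_upper[OF that] assms by (simp add: norm_exp_eq_Re)
  show "AE t in angle_measure. (\<lambda>n. exp (\<i> * of_real \<theta> * M (of_real (radii n) * cis t))) \<longlonglongrightarrow> iexp (\<theta> * X t)"
    using AE_cis_ne[OF norm_p]
  proof eventually_elim
    case (elim t)
    have "(\<lambda>n. exp (\<i> * of_real \<theta> * M (of_real (radii n) * cis t))) \<longlonglongrightarrow> exp (\<i> * of_real \<theta> * M (cis t))"
      by (intro tendsto_intros M_radial_limit elim)
    also have "M (cis t) = of_real (X t)" using M_real[OF norm_cis elim] by (simp add: X_def)
    finally show ?case by (simp add: mult.assoc)
  qed
qed

lemma char_cauchy_aux: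
  assumes push: "distr angle_measure borel X = cauchy (M 0)" and w: "Im w > 0" and \<theta>: "\<theta> \<ge> 0"
  shows "char (cauchy w) \<theta> = exp (\<i> * of_real \<theta> * w)"
proof -
  have "char (cauchy w) \<theta> = (\<integral>x. poisson w x *\<^sub>R iexp (\<theta> * x) \<partial>lborel)"
    unfolding char_def cauchy_def by (rule integral_density) (auto intro: poisson_nonneg w)
  also have "\<dots> = exp (\<i> * of_real \<theta> * M (N w))"
    by (rule poisson_line_aux[OF push exp_M(1,2)[OF \<theta>] _ exp_M(3)[OF \<theta>] w]) measurable
  finally show ?thesis using ne_\<alpha>[of w] w by (simp add: M_N)
qed

end

section \<open>The Cayley transform and the push-forward of arc length\<close>

interpretation std: half_plane_chart "\<lambda>z. - \<i> - 2 * \<i> / (z - 1)" 1 1 0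
  by unfold_locales (simp_all add: complex_eq_iff)

lemma std_X: "std.X t = - sin t / (1 - cos t)"
proof -
  have "(cos t - 1)\<^sup>2 + (sin t)\<^sup>2 = 2 * (1 - cos t)"
    using sin_cos_squared_add[of t] by (simp add: power2_eq_square algebra_simps)
  moreover have "std.X t = - (2 * sin t / ((cos t - 1)\<^sup>2 + (sin t)\<^sup>2))" by (simp add: std.X_def Re_divide)
  moreover have "2 * sin t / (2 * (1 - cos t)) = sin t / (1 - cos t)" by (rule mult_divide_mult_cancel_left) simp
  ultimately show ?thesis by simp
qed

lemma std_X_le_iff:
  assumes "0 < t" "t < 2 * pi"
  shows "std.X t \<le> x \<longleftrightarrow> t \<le> pi + 2 * arctan x"
proof -
  define v where "v = (t - pi) / 2"
  have v: "- (pi / 2) < v" "v < pi / 2" "t = 2 * v + pi" using assms by (auto simp: v_def field_simps)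
  have "cos v > 0" using v by (intro cos_gt_zero_pi) auto
  have "std.X t = 2 * sin v * cos v / (2 * (cos v)\<^sup>2)"
    unfolding std_X v(3) by (simp add: sin_double cos_double_cos)
  also have "\<dots> = tan v" using \<open>cos v > 0\<close> by (simp add: tan_def power2_eq_square)
  finally have "std.X t \<le> x \<longleftrightarrow> arctan (tan v) \<le> arctan x" by (simp add: arctan_le_iff)
  also have "\<dots> \<longleftrightarrow> v \<le> arctan x" using arctan_tan v by simp
  finally show ?thesis using v by auto
qed

lemma std_pushforward: "distr angle_measure borel std.X = cauchy \<i>"
proof (rule cdf_unique)
  show "real_distribution (distr angle_measure borel std.X)" by (rule angle.real_distribution_distr) measurable
  show rd: "real_distribution (cauchy \<i>)" by (rule real_distribution_cauchy) simp
  interpret c: real_distribution "cauchy \<i>" by fact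
  show "cdf (distr angle_measure borel std.X) = cdf (cauchy \<i>)"
  proof
    fix x
    have a: "- (pi / 2) < arctan x" "arctan x < pi / 2" using arctan_bounded[of x] by auto
    have "measure (cauchy \<i>) {x..} = 1 / 2 - arctan x / pi"
    proof -
      have "arctan x / pi \<le> 1 / 2" using a by (simp add: field_simps)
      then show ?thesis using emeasure_cauchy_atLeast[of \<i> x] by (simp add: measure_def)
    qed
    moreover have "measure (cauchy \<i>) {x..} = measure (cauchy \<i>) {x<..}"
    proof (rule c.finite_measure_eq_AE)
      have "AE y in cauchy \<i>. y \<noteq> x"
        unfolding cauchy_def by (subst AE_density) (use AE_lborel_singleton[of x] in auto)
      then show "AE y in cauchy \<i>. (y \<in> {x..}) = (y \<in> {x<..})" by eventually_elim auto
    qed auto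
    moreover have "measure (cauchy \<i>) {..x} = 1 - measure (cauchy \<i>) {x<..}"
    proof -
      have "{..x} = space (cauchy \<i>) - {x<..}" by auto
      then show ?thesis using c.prob_compl[of "{x<..}"] by simp
    qed
    ultimately have 1: "cdf (cauchy \<i>) x = 1 / 2 + arctan x / pi" by (simp add: cdf_def)
    have "cdf (distr angle_measure borel std.X) x = measure angle_measure {t. std.X t \<le> x}"
      unfolding cdf_def by (subst measure_distr) (auto intro!: arg_cong[of _ _ "measure angle_measure"])
    also have "\<dots> = measure angle_measure {0..pi + 2 * arctan x}"
    proof (rule angle.finite_measure_eq_AE)
      have "AE t in angle_measure. 0 \<le> t \<and> t < 2 * pi"
        unfolding angle_measure_def by (rule AE_uniform_measureI) auto
      moreover have "AE t in angle_measure. t \<noteq> 0"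
        unfolding angle_measure_density by (subst AE_density) (use AE_lborel_singleton[of 0] in auto)
      ultimately show "AE t in angle_measure. (t \<in> {t. std.X t \<le> x}) = (t \<in> {0..pi + 2 * arctan x})"
        by eventually_elim (auto simp: std_X_le_iff)
    qed auto
    also have "\<dots> = measure lborel ({0..<2 * pi} \<inter> {0..pi + 2 * arctan x}) / measure lborel {0..<2 * pi}"
      unfolding angle_measure_def by (rule measure_uniform_measure) auto
    also have "{0..<2 * pi} \<inter> {0..pi + 2 * arctan x} = {0..pi + 2 * arctan x}" using a by auto
    also have "measure lborel {0..pi + 2 * arctan x} / measure lborel {0..<2 * pi} = 1 / 2 + arctan x / pi"
      using a by (simp add: field_simps)
    finally show "cdf (distr angle_measure borel std.X) x = cdf (cauchy \<i>) x" using 1 by simp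
  qed
qed

lemma char_cauchy: "Im w > 0 \<Longrightarrow> \<theta> \<ge> 0 \<Longrightarrow> char (cauchy w) \<theta> = exp (\<i> * of_real \<theta> * w)"
  by (rule std.char_cauchy_aux) (simp_all add: std_pushforward)

text \<open>The exponentials \<open>exp (\<i> * \<theta> * w)\<close> are bounded on the upper
  half-plane for \<open>\<theta> \<ge> 0\<close>, where the Poisson formula computes characteristic
  functions. Negative arguments follow by conjugation.\<close>

lemma real_distribution_eqI:
  assumes "real_distribution P" "real_distribution Q" and eq: "\<And>\<theta>. \<theta> \<ge> 0 \<Longrightarrow> char P \<theta> = char Q \<theta>"
  shows "P = Q"
proof (rule Levy_uniqueness[OF assms(1,2)], rule ext)
  fix \<theta> :: real
  have minus: "char R (- \<theta>) = cnj (char R \<theta>)" for R \<theta>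
  proof -
    have "char R (- \<theta>) = (CLINT x|R. cnj (iexp (\<theta> * x)))"
      unfolding char_def by (intro Bochner_Integration.integral_cong refl) (simp add: exp_cnj)
    also have "\<dots> = cnj (char R \<theta>)" unfolding char_def by (rule Bochner_Integration.integral_cnj)
    finally show ?thesis .
  qed
  show "char P \<theta> = char Q \<theta>"
  proof (cases "\<theta> \<ge> 0")
    case False
    then show ?thesis using eq[of "- \<theta>"] minus[of _ "- \<theta>"] by simp
  qed (rule eq)
qed

context half_plane_chart
begin

text \<open>By the mean value property the characteristic function of the image measure is the value
  at the centre, \<open>exp (\<i> * \<theta> * M 0)\<close>, which is also that of the Cauchy
  distribution.\<close>

lemma pushforward: "distr angle_measure borel X = cauchy (M 0)"
proof (rule real_distribution_eqI)
  have M0: "Im (M 0) > 0" by (rule M_upper) simp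
  show "real_distribution (distr angle_measure borel X)" by (rule angle.real_distribution_distr) measurable
  show "real_distribution (cauchy (M 0))" by (rule real_distribution_cauchy[OF M0])
  fix \<theta> :: real assume \<theta>: "\<theta> \<ge> 0"
  have "char (distr angle_measure borel X) \<theta> = (\<integral>t. iexp (\<theta> * X t) \<partial>angle_measure)"
    unfolding char_def by (rule integral_distr) measurable
  also have "\<dots> = (\<integral>t. of_real (disc_kernel 0 (cis t)) * iexp (\<theta> * X t) \<partial>angle_measure)" by simp
  also have "\<dots> = exp (\<i> * of_real \<theta> * M 0)"
    by (rule poisson_disc[OF exp_M(1,2)[OF \<theta>] _ exp_M(3)[OF \<theta>]]) measurable
  finally show "char (distr angle_measure borel X) \<theta> = char (cauchy (M 0)) \<theta>"
    by (simp add: char_cauchy[OF M0 \<theta>])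
qed

lemmas poisson_line = poisson_line_aux[OF pushforward]

end

section \<open>Doubly parabolic inner functions\<close>

text \<open>Two Moebius maps with the same pole differ by an affine map \<open>A * w + B\<close> of
  the image. It sends the upper half-plane into itself, so \<open>A\<close> is real and positive and
  \<open>Im B \<ge> 0\<close>; that \<open>M\<close> is onto excludes
  \<open>Im B > 0\<close>.\<close>

lemma moebius_chart:
  assumes M: "moebius_to_UHP M p" and p: "norm p = 1"
  obtains s t where "half_plane_chart M p s t"
proof -
  obtain a b c d where det: "a * d - b * c \<noteq> 0" and pole: "c * p + d = 0"
    and M_frac: "\<And>z. M z = (a * z + b) / (c * z + d)" and im: "M ` ball 0 1 = upper_half_plane"
    using M unfolding moebius_to_UHP_def by blast
  have p0: "p \<noteq> 0" using p by auto
  have d: "d = - (c * p)" using pole by (simp add: add_eq_0_iff)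
  have c: "c \<noteq> 0" using det d by auto
  have ap: "a * p + b \<noteq> 0"
  proof
    assume "a * p + b = 0"
    then have "b = - (a * p)" by (simp add: add_eq_0_iff)
    then show False using det d by simp
  qed
  define C where "C z = Complex 0 (- 1) - 2 * of_real 1 * \<i> * p / (z - p)" for z
  interpret C: half_plane_chart C p 1 0 using p by unfold_locales (simp_all add: C_def)
  define K where "K = (a * p + b) / (2 * c * p)"
  define A where "A = \<i> * K"
  define B where "B = a / c - K"
  have M_aff: "M z = A * C z + B" if z: "z \<noteq> p" for z
  proof -
    define u where "u = z - p"
    have u: "u \<noteq> 0" "z = p + u" using z by (auto simp: u_def)
    have "M z = (a * u + (a * p + b)) / (c * u)" unfolding M_frac d u(2) by (simp add: algebra_simps)
    also have "\<dots> = a / c + 2 * K * p / u" using u c p0 by (simp add: K_def field_simps)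
    also have "2 * K * p / u = - (2 * (\<i> * \<i>) * K * p / u)" by simp
    also have "a / c + - (2 * (\<i> * \<i>) * K * p / u) = A * C z + B"
    proof -
      have "Complex 0 (- 1) = - \<i>" by (simp add: complex_eq_iff)
      then have "C z = - \<i> - 2 * \<i> * p / u" by (simp add: C_def u_def)
      moreover have "A * (- \<i>) = K" by (simp add: A_def algebra_simps)
      ultimately have "A * C z = K - A * (2 * \<i> * p / u)" by (metis right_diff_distrib)
      then show ?thesis by (simp add: A_def B_def mult_ac)
    qed
    finally show ?thesis .
  qed
  have pos: "Im (A * w + B) > 0" if w: "Im w > 0" for w
  proof -
    have "w \<noteq> C.\<alpha>" using w by (intro C.ne_\<alpha>) simp
    then have "M (C.N w) = A * w + B" using M_aff[OF C.N_ne] by (simp add: C.M_N)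
    moreover have "M (C.N w) \<in> upper_half_plane" unfolding im[symmetric] using C.N_disc[OF w] by simp
    ultimately show ?thesis by (simp add: upper_half_plane_def)
  qed
  have pos': "Im A * x + Re A * y + Im B > 0" if "y > 0" for x y
    using pos[of "Complex x y"] that by (simp add: algebra_simps)
  have ImA: "Im A = 0"
  proof (rule ccontr)
    assume "Im A \<noteq> 0"
    then show False using pos'[of 1 "- (Re A + Im B) / Im A"] by simp
  qed
  have "A \<noteq> 0" using ap c p0 by (simp add: A_def K_def)
  then have "Re A \<noteq> 0" using ImA by (simp add: complex_eq_iff)
  have ReA: "Re A > 0"
  proof (rule ccontr)
    assume "\<not> Re A > 0"
    then have neg: "Re A < 0" using \<open>Re A \<noteq> 0\<close> by simp
    then have "(\<bar>Im B\<bar> + 1) / (- Re A) > 0" by (intro divide_pos_pos) auto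
    from pos'[OF this, of 0] neg show False by simp
  qed
  have "Im B \<ge> 0"
  proof (rule ccontr)
    assume "\<not> Im B \<ge> 0"
    then have "- Im B / Re A > 0" using ReA by (intro divide_pos_pos) auto
    from pos'[OF this, of 0] ReA show False by simp
  qed
  moreover have "Im B \<le> 0"
  proof (rule ccontr)
    assume B: "\<not> Im B \<le> 0"
    then have "\<i> * of_real (Im B / 2) \<in> M ` ball 0 1" unfolding im by (simp add: upper_half_plane_def)
    then obtain z where z: "norm z < 1" "M z = \<i> * of_real (Im B / 2)" by auto
    have "z \<noteq> p" using z p by auto
    then have "Im (M z) = Re A * Im (C z) + Im B" using ImA by (simp add: M_aff)
    moreover have "Re A * Im (C z) > 0" using ReA C.M_upper[OF z(1)] by simp
    ultimately show False using B z(2) by simp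
  qed
  ultimately have "A = of_real (Re A)" "B = of_real (Re B)" using ImA by (auto simp: complex_eq_iff)
  then have "M z = Complex (Re B) (- Re A) - 2 * of_real (Re A) * \<i> * p / (z - p)" if "z \<noteq> p" for z
  proof -
    have "A * C z = of_real (Re A) * Complex 0 (- 1) - of_real (Re A) * (2 * of_real 1 * \<i> * p / (z - p))"
      unfolding C_def using \<open>A = of_real (Re A)\<close> by (metis right_diff_distrib)
    moreover have "of_real (Re A) * Complex 0 (- 1) + B = Complex (Re B) (- Re A)"
      using \<open>B = of_real (Re B)\<close> by (simp add: complex_eq_iff)
    ultimately show ?thesis unfolding M_aff[OF that] by (simp add: algebra_simps)
  qed
  then have "half_plane_chart M p (Re A) (Re B)" using ReA p by unfold_locales
  then show ?thesis by (rule that)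
qed

context half_plane_chart
begin

lemma UHP_inverse_eq:
  assumes "Im w \<ge> 0"
  shows "UHP_inverse M p w = N w"
  unfolding UHP_inverse_def
proof (rule the_inv_into_f_eq)
  show "inj_on M (cball 0 1 - {p})" by (rule inj_on_inverseI[of _ N]) (simp add: N_M)
  show "M (N w) = w" using M_N ne_\<alpha>[OF assms] by simp
  have "norm (N w) \<le> 1"
  proof (cases "Im w = 0")
    case True
    then have "w = of_real (Re w)" by (simp add: complex_eq_iff)
    then show ?thesis using N_circle[of "Re w"] by simp
  next
    case False
    then show ?thesis using N_disc[of w] assms by simp
  qed
  then show "N w \<in> cball 0 1 - {p}" using N_ne ne_\<alpha>[OF assms] by simp
qed

lemma isCont_M:
  assumes "z \<noteq> p"
  shows "isCont M z"
proof -
  have "eventually (\<lambda>u. M u = \<alpha> + \<beta> / (u - p)) (nhds z)"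
    using t1_space_nhds[OF assms] by eventually_elim (simp add: M_eq)
  moreover have "isCont (\<lambda>u. \<alpha> + \<beta> / (u - p)) z" using assms by (intro continuous_intros) auto
  ultimately show ?thesis by (simp add: isCont_cong)
qed

lemma M_at_infinity:
  assumes "f \<longlonglongrightarrow> p" "\<And>n. f n \<noteq> p"
  shows "filterlim (\<lambda>n. M (f n)) at_infinity sequentially"
proof -
  have "(\<lambda>n. f n - p) \<longlonglongrightarrow> p - p" by (intro tendsto_intros assms(1))
  then have "filterlim (\<lambda>n. f n - p) (at 0) sequentially" using assms(2) by (simp add: filterlim_at)
  then have "filterlim (\<lambda>n. inverse (f n - p)) at_infinity sequentially"
    by (rule filterlim_compose[OF filterlim_inverse_at_infinity])
  then have "filterlim (\<lambda>n. \<beta> * inverse (f n - p)) at_infinity sequentially"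
    by (rule tendsto_mult_filterlim_at_infinity[OF tendsto_const \<beta>(2)])
  then have "filterlim (\<lambda>n. \<alpha> + \<beta> * inverse (f n - p)) at_infinity sequentially"
    by (rule tendsto_add_filterlim_at_infinity[OF tendsto_const])
  then show ?thesis using assms(2) by (simp add: M_eq divide_inverse)
qed

end

section \<open>The boundary map of a doubly parabolic inner function\<close>

locale doubly_parabolic_chart = half_plane_chart +
  fixes h g :: "complex \<Rightarrow> complex" and T :: "real \<Rightarrow> real"
  assumes parabolic: "doubly_parabolic g p"
    and h_eq: "\<And>w. Im w > 0 \<Longrightarrow> h w = M (g (N w))"
    and T_eq: "\<And>x. T x = Re (Lim (at_left 1) (\<lambda>r. h (M (of_real r * N (of_real x)))))"
begin

lemma g_holomorphic: "g holomorphic_on ball 0 1"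
  and g_disc: "norm z < 1 \<Longrightarrow> norm (g z) < 1"
  and g_radial: "AE \<zeta> in circle_measure. \<exists>l\<in>sphere 0 1. ((\<lambda>r. g (of_real r * \<zeta>)) \<longlongrightarrow> l) (at_left 1)"
  and g_iterates: "norm z < 1 \<Longrightarrow> (\<lambda>n. (g ^^ n) z) \<longlonglongrightarrow> p"
  using parabolic unfolding doubly_parabolic_def inner_function_def Denjoy_Wolff_point_def
  by (auto simp: image_subset_iff)

lemma disc_ne: "norm z < 1 \<Longrightarrow> z \<noteq> p"
  using norm_p by auto

lemma h_M: "norm z < 1 \<Longrightarrow> h (M z) = M (g z)"
  using h_eq[OF M_upper] N_M[OF disc_ne] by simp

lemma h_upper: "Im w > 0 \<Longrightarrow> Im (h w) > 0"
  unfolding h_eq by (intro M_upper g_disc N_disc)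

lemma N_holomorphic: "N holomorphic_on {w. Im w > 0}"
  unfolding N_def by (intro holomorphic_intros) (use ne_\<alpha> in auto)

lemma Mg_holomorphic: "(\<lambda>z. M (g z)) holomorphic_on ball 0 1"
proof -
  have "g ` ball 0 1 \<subseteq> ball 0 1" using g_disc by auto
  from holomorphic_on_compose_gen[OF g_holomorphic M_holomorphic this] show ?thesis by (simp add: o_def)
qed

lemma h_holomorphic: "h holomorphic_on {w. Im w > 0}"
proof (rule holomorphic_transform)
  show "((\<lambda>z. M (g z)) \<circ> N) holomorphic_on {w. Im w > 0}"
    by (rule holomorphic_on_compose_gen[OF N_holomorphic Mg_holomorphic]) (auto intro: N_disc)
qed (simp add: h_eq)

lemma g_funpow_disc: "norm z < 1 \<Longrightarrow> norm ((g ^^ n) z) < 1"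
  by (induction n) (auto intro: g_disc)

lemma h_funpow:
  assumes "Im w > 0"
  shows "(h ^^ n) w = M ((g ^^ n) (N w))"
proof (induction n)
  case 0
  then show ?case using M_N ne_\<alpha>[of w] assms by simp
next
  case (Suc n)
  then show ?case using h_M[OF g_funpow_disc[OF N_disc[OF assms]]] by simp
qed

lemma h_iterates:
  assumes "Im w > 0"
  shows "filterlim (\<lambda>n. (h ^^ n) w) at_infinity sequentially"
  unfolding h_funpow[OF assms]
  by (intro M_at_infinity g_iterates disc_ne g_funpow_disc N_disc assms)

lemma at_left_pos: "eventually (\<lambda>r::real. 0 < r \<and> r < 1) (at_left 1)"
  by (rule eventually_at_leftI[of 0]) auto

lemma norm_mult_radius: "0 < r \<Longrightarrow> r < 1 \<Longrightarrow> norm \<zeta> = 1 \<Longrightarrow> norm (of_real r * \<zeta> :: complex) < 1"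
  by (simp add: norm_mult)

definition \<phi> :: "real \<Rightarrow> real \<Rightarrow> complex" where
  "\<phi> r x = M (g (of_real r * N (of_real x)))"

lemma T_\<phi>: "T x = Re (Lim (at_left 1) (\<lambda>r. \<phi> r x))"
proof -
  have "eventually (\<lambda>r. h (M (of_real r * N (of_real x))) = \<phi> r x) (at_left 1)"
    using at_left_pos by eventually_elim (simp add: \<phi>_def h_M norm_mult_radius N_circle)
  then show ?thesis unfolding T_eq by (intro arg_cong[of _ _ Re] Lim_cong[OF _ refl])
qed

lemma T_limit: "((\<lambda>r. \<phi> r x) \<longlongrightarrow> l) (at_left 1) \<Longrightarrow> T x = Re l"
  unfolding T_\<phi> by (subst tendsto_Lim) auto

lemma \<phi>_continuous:
  assumes "0 < r" "r < 1"
  shows "continuous_on UNIV (\<phi> r)"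
  unfolding \<phi>_def
proof (rule continuous_on_compose2[OF holomorphic_on_imp_continuous_on[OF Mg_holomorphic]])
  have "(of_real x :: complex) \<noteq> \<alpha>" for x by (rule ne_\<alpha>) simp
  then show "continuous_on UNIV (\<lambda>x. of_real r * N (of_real x))"
    unfolding N_def by (intro continuous_intros) auto
qed (use assms in \<open>auto simp: norm_mult N_circle\<close>)

text \<open>For each pair of radii the set where the values differ by at most \<open>\<epsilon>\<close> is closed. The Cauchy
  criterion thus describes the set of convergence by countably many closed sets.\<close>

lemma T_borel: "T \<in> borel_measurable borel"
proof -
  define E where "E = {x. \<exists>l. ((\<lambda>r. \<phi> r x) \<longlongrightarrow> l) (at_left 1)}"
  define Q where "Q n = {1 - 1 / (real n + 2)<..<1}" for n
  define D where "D k n = (\<Inter>r\<in>Q n. \<Inter>s\<in>Q n. {x. dist (\<phi> r x) (\<phi> s x) \<le> 1 / (real k + 1)})" for k n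
  have Q: "0 < r \<and> r < 1" if "r \<in> Q n" for r n
  proof -
    have "1 - 1 / (real n + 2) < r" "r < 1" using that by (auto simp: Q_def)
    moreover have "1 / (real n + 2) \<le> 1" by simp
    ultimately show ?thesis by linarith
  qed
  have radii_Q: "radii m \<in> Q n" if "n < m" for n m
  proof -
    have "1 / (real m + 2) < 1 / (real n + 2)" using that by (intro divide_strict_left_mono) auto
    then show ?thesis using radii(2)[of m] by (simp add: Q_def radii_def)
  qed
  have "closed (D k n)" for k n
    unfolding D_def
    by (intro closed_INT ballI closed_Collect_le continuous_intros) (use Q in \<open>auto intro!: \<phi>_continuous\<close>)
  then have [measurable]: "D k n \<in> sets borel" for k n by (rule borel_closed)
  have "E = (\<Inter>k. \<Union>n. D k n)"
  proof (intro set_eqI iffI)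
    fix x assume "x \<in> E"
    then obtain l where l: "((\<lambda>r. \<phi> r x) \<longlongrightarrow> l) (at_left 1)" by (auto simp: E_def)
    show "x \<in> (\<Inter>k. \<Union>n. D k n)"
    proof
      fix k
      have "eventually (\<lambda>r. dist (\<phi> r x) l < 1 / (2 * (real k + 1))) (at_left 1)"
        using l by (rule tendstoD) simp
      then have "\<exists>b<1. \<forall>r>b. r < 1 \<longrightarrow> dist (\<phi> r x) l < 1 / (2 * (real k + 1))"
        unfolding eventually_at_left[OF zero_less_one] .
      then obtain b where b: "b < 1" "\<And>r. b < r \<Longrightarrow> r < 1 \<Longrightarrow> dist (\<phi> r x) l < 1 / (2 * (real k + 1))"
        by blast
      obtain n where "1 / real (Suc n) < 1 - b" using b(1) reals_Archimedean[of "1 - b"] by (auto simp: inverse_eq_divide)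
      moreover have "1 / (real n + 2) \<le> 1 / real (Suc n)" by (intro divide_left_mono) auto
      ultimately have n: "b < 1 - 1 / (real n + 2)" by linarith
      have "dist (\<phi> r x) (\<phi> s x) \<le> 1 / (real k + 1)" if "r \<in> Q n" "s \<in> Q n" for r s
      proof -
        have rs: "b < r" "r < 1" "b < s" "s < 1" using that n by (auto simp: Q_def)
        have "dist (\<phi> r x) (\<phi> s x) \<le> 1 / (2 * (real k + 1)) + 1 / (2 * (real k + 1))"
          using dist_triangle2[of "\<phi> r x" "\<phi> s x" l] b(2)[OF rs(1,2)] b(2)[OF rs(3,4)] by linarith
        then show ?thesis by (simp add: field_simps)
      qed
      then show "x \<in> (\<Union>n. D k n)" by (auto simp: D_def)
    qed
  next
    fix x assume x: "x \<in> (\<Inter>k. \<Union>n. D k n)"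
    have close: "\<exists>n. \<forall>r\<in>Q n. \<forall>s\<in>Q n. dist (\<phi> r x) (\<phi> s x) < e" if "e > 0" for e
    proof -
      obtain k where k: "1 / real (Suc k) < e" using reals_Archimedean[OF \<open>e > 0\<close>] by (auto simp: inverse_eq_divide)
      obtain n where "x \<in> D k n" using x by auto
      then have "\<forall>r\<in>Q n. \<forall>s\<in>Q n. dist (\<phi> r x) (\<phi> s x) \<le> 1 / (real k + 1)" by (auto simp: D_def)
      moreover have "1 / (real k + 1) < e" using k by (simp add: add.commute)
      ultimately show ?thesis by (meson le_less_trans)
    qed
    have "Cauchy (\<lambda>m. \<phi> (radii m) x)"
    proof (rule metric_CauchyI)
      fix e :: real assume "e > 0"
      then obtain n where "\<forall>r\<in>Q n. \<forall>s\<in>Q n. dist (\<phi> r x) (\<phi> s x) < e" using close by blast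
      then show "\<exists>M. \<forall>m\<ge>M. \<forall>m'\<ge>M. dist (\<phi> (radii m) x) (\<phi> (radii m') x) < e"
        using radii_Q by (intro exI[of _ "Suc n"]) auto
    qed
    then obtain l where l: "(\<lambda>m. \<phi> (radii m) x) \<longlonglongrightarrow> l" using Cauchy_convergent by (auto simp: convergent_def)
    have "((\<lambda>r. \<phi> r x) \<longlongrightarrow> l) (at_left 1)"
    proof (rule tendstoI)
      fix e :: real assume "e > 0"
      then have "e / 2 > 0" by simp
      then obtain n where n: "\<forall>r\<in>Q n. \<forall>s\<in>Q n. dist (\<phi> r x) (\<phi> s x) < e / 2" using close by blast
      have "dist (\<phi> r x) l < e" if r: "1 - 1 / (real n + 2) < r" "r < 1" for r
      proof -
        have "(\<lambda>m. dist (\<phi> r x) (\<phi> (radii m) x)) \<longlonglongrightarrow> dist (\<phi> r x) l" by (intro tendsto_intros l)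
        moreover have "dist (\<phi> r x) (\<phi> (radii m) x) \<le> e / 2" if "m \<ge> Suc n" for m
          using n r radii_Q[of n m] that by (auto simp: Q_def intro: less_imp_le)
        ultimately have "dist (\<phi> r x) l \<le> e / 2" by (intro LIMSEQ_le_const2) auto
        then show ?thesis using \<open>e > 0\<close> by simp
      qed
      then show "eventually (\<lambda>r. dist (\<phi> r x) l < e) (at_left 1)"
        by (intro eventually_at_leftI[of "1 - 1 / (real n + 2)"]) auto
    qed
    then show "x \<in> E" by (auto simp: E_def)
  qed
  then have [measurable]: "E \<in> sets borel" by simp
  have [measurable]: "\<phi> (radii n) \<in> borel_measurable borel" for n
    by (rule borel_measurable_continuous_onI[OF \<phi>_continuous[OF radii(1,2)]])
  \<comment> \<open>Where the limit does not exist, \<open>Lim\<close> is the description operator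
    applied to an empty predicate, hence a constant.\<close>
  have "T = (\<lambda>x. if x \<in> E then Re (lim (\<lambda>n. \<phi> (radii n) x)) else Re (THE l::complex. False))"
  proof
    fix x
    show "T x = (if x \<in> E then Re (lim (\<lambda>n. \<phi> (radii n) x)) else Re (THE l::complex. False))"
    proof (cases "x \<in> E")
      case True
      then obtain l where l: "((\<lambda>r. \<phi> r x) \<longlongrightarrow> l) (at_left 1)" by (auto simp: E_def)
      then have "(\<lambda>n. \<phi> (radii n) x) \<longlonglongrightarrow> l" by (rule filterlim_compose[OF _ radii_at_left])
      then show ?thesis using T_limit[OF l] True by (simp add: limI)
    next
      case False
      then have "(\<lambda>l. ((\<lambda>r. \<phi> r x) \<longlongrightarrow> l) (at_left 1)) = (\<lambda>_. False)" by (auto simp: E_def)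
      then show ?thesis using False by (simp add: T_\<phi> t2_space_class.Lim_def)
    qed
  qed
  also have "\<dots> \<in> borel_measurable borel" by measurable
  finally show ?thesis .
qed

text \<open>\<open>M\<close> is continuous away from \<open>p\<close>, so radial limits of
  \<open>g\<close> pass through \<open>M\<close> once the value \<open>p\<close> is excluded;
  \<open>AE_boundary_value_ne\<close> excludes it almost everywhere.\<close>

lemma AE_radial_limit:
  "AE t in angle_measure. cis t \<noteq> p \<and> (\<exists>l. norm l = 1 \<and> l \<noteq> p \<and> ((\<lambda>r. g (of_real r * cis t)) \<longlongrightarrow> l) (at_left 1))"
proof -
  have "AE t in angle_measure. \<exists>l\<in>sphere 0 1. ((\<lambda>r. g (of_real r * cis t)) \<longlongrightarrow> l) (at_left 1)"
    using g_radial unfolding circle_measure_def angle_measure_def[symmetric] by (rule AE_distrD[rotated]) measurable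
  then have lim: "AE t in angle_measure. \<exists>l. norm l = 1 \<and> ((\<lambda>r. g (of_real r * cis t)) \<longlongrightarrow> l) (at_left 1)"
    by eventually_elim auto
  define gs where "gs t = lim (\<lambda>n. g (of_real (radii n) * cis t))" for t
  have gs: "gs t = l" "(\<lambda>n. g (of_real (radii n) * cis t)) \<longlonglongrightarrow> l"
    if "((\<lambda>r. g (of_real r * cis t)) \<longlongrightarrow> l) (at_left 1)" for t l
  proof -
    show "(\<lambda>n. g (of_real (radii n) * cis t)) \<longlonglongrightarrow> l" by (rule filterlim_compose[OF that radii_at_left])
    then show "gs t = l" by (simp add: gs_def limI)
  qed
  have "continuous_on UNIV (\<lambda>t. g (of_real (radii n) * cis t))" for n
    by (rule continuous_on_compose2[OF holomorphic_on_imp_continuous_on[OF g_holomorphic]])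
      (use radii in \<open>auto intro!: continuous_intros\<close>)
  then have [measurable]: "(\<lambda>t. g (of_real (radii n) * cis t)) \<in> borel_measurable borel" for n
    by (rule borel_measurable_continuous_onI)
  have "AE t in angle_measure. gs t \<noteq> p"
  proof (rule AE_boundary_value_ne[OF g_holomorphic g_disc _ _ norm_p])
    show "gs \<in> borel_measurable borel" unfolding gs_def by measurable
    show "AE t in angle_measure. (\<lambda>n. g (of_real (radii n) * cis t)) \<longlonglongrightarrow> gs t"
      using lim by eventually_elim (use gs in blast)
  qed
  with lim AE_cis_ne[OF norm_p] show ?thesis by eventually_elim (use gs in blast)
qed

lemma T_boundary:
  assumes t: "cis t \<noteq> p" and l: "norm l = 1" "l \<noteq> p" "((\<lambda>r. g (of_real r * cis t)) \<longlongrightarrow> l) (at_left 1)"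
  shows "of_real (T (X t)) = M l" "N (of_real (X t)) = cis t"
    "((\<lambda>r. M (g (of_real r * cis t))) \<longlongrightarrow> M l) (at_left 1)"
proof -
  show N_X: "N (of_real (X t)) = cis t" using M_real[OF norm_cis t] N_M[OF t] by (simp add: X_def)
  show lim: "((\<lambda>r. M (g (of_real r * cis t))) \<longlongrightarrow> M l) (at_left 1)"
    by (rule isCont_tendsto_compose[OF isCont_M[OF l(2)] l(3)])
  then have "T (X t) = Re (M l)" by (intro T_limit) (simp add: \<phi>_def N_X)
  then show "of_real (T (X t)) = M l" using M_real[OF l(1,2)] by simp
qed

text \<open>The function \<open>exp (\<i> * \<theta> * M (g z))\<close> is bounded and holomorphic
  in the disc, with boundary values \<open>iexp (\<theta> * T (X t))\<close>. Its Poisson formula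
  computes the characteristic function of the image measure.\<close>

lemma distr_cauchy:
  assumes w: "Im w > 0"
  shows "distr (cauchy w) borel T = cauchy (h w)"
proof (rule real_distribution_eqI)
  note [measurable] = T_borel
  interpret c: real_distribution "cauchy w" by (rule real_distribution_cauchy[OF w])
  show "real_distribution (distr (cauchy w) borel T)" by (rule c.real_distribution_distr) measurable
  show "real_distribution (cauchy (h w))" by (rule real_distribution_cauchy[OF h_upper[OF w]])
  fix \<theta> :: real assume \<theta>: "\<theta> \<ge> 0"
  define F where "F z = exp (\<i> * of_real \<theta> * M (g z))" for z
  have "char (distr (cauchy w) borel T) \<theta> = (\<integral>x. iexp (\<theta> * T x) \<partial>cauchy w)"
    unfolding char_def by (rule integral_distr) measurable
  also have "\<dots> = (\<integral>x. poisson w x *\<^sub>R iexp (\<theta> * T x) \<partial>lborel)"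
    unfolding cauchy_def by (rule integral_density) (auto intro: poisson_nonneg w)
  also have "\<dots> = F (N w)"
  proof (rule poisson_line[where B = 1])
    show "F holomorphic_on ball 0 1" unfolding F_def by (intro holomorphic_intros Mg_holomorphic)
    show "norm (F z) \<le> 1" if "norm z < 1" for z
      using exp_M(2)[OF \<theta> g_disc[OF that]] by (simp add: F_def)
    show "AE t in angle_measure. (\<lambda>n. F (of_real (radii n) * cis t)) \<longlonglongrightarrow> iexp (\<theta> * T (X t))"
      using AE_radial_limit
    proof eventually_elim
      case (elim t)
      then obtain l where l: "norm l = 1" "l \<noteq> p" "((\<lambda>r. g (of_real r * cis t)) \<longlongrightarrow> l) (at_left 1)" and t: "cis t \<noteq> p" by blast
      have "(\<lambda>n. M (g (of_real (radii n) * cis t))) \<longlonglongrightarrow> M l"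
        by (rule filterlim_compose[OF T_boundary(3)[OF t l] radii_at_left])
      then have "(\<lambda>n. F (of_real (radii n) * cis t)) \<longlonglongrightarrow> exp (\<i> * of_real \<theta> * M l)"
        unfolding F_def by (intro tendsto_intros)
      then show ?case by (simp add: T_boundary(1)[OF t l, symmetric] mult.assoc)
    qed
  qed (use w in measurable)
  also have "\<dots> = char (cauchy (h w)) \<theta>"
    unfolding char_cauchy[OF h_upper[OF w] \<theta>] unfolding F_def h_eq[OF w] ..
  finally show "char (distr (cauchy w) borel T) \<theta> = char (cauchy (h w)) \<theta>" .
qed

end

text \<open>Taking reciprocals moves the fixed point to infinity: the cubic term becomes a term of
  order \<open>\<delta>\<close>, that is of order \<open>1 / w\<close> in the half-plane. In the
  numerator \<open>P\<close> all terms below order 4 in \<open>\<delta>\<close> have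
  cancelled.\<close>

lemma cubic_perturbation:
  fixes c :: complex
  assumes K: "K > 0"
  obtains \<rho> L where "\<rho> > 0" "L > 0"
    "\<And>\<delta> D. \<delta> \<noteq> 0 \<Longrightarrow> norm \<delta> < \<rho> \<Longrightarrow> norm (D - (\<delta> + c * \<delta> ^ 3)) \<le> K * norm \<delta> ^ 4 \<Longrightarrow>
      D \<noteq> 0 \<and> norm (1 / D - 1 / \<delta> + c * \<delta>) \<le> L * (norm \<delta>)\<^sup>2"
proof -
  define A where "A = norm c + K"
  have A: "A > 0" using K by (simp add: A_def add_nonneg_pos)
  define \<rho> where "\<rho> = min 1 (1 / (2 * A))"
  define L where "L = 2 * (K + (norm c)\<^sup>2 + norm c * K)"
  have "\<rho> > 0" using A by (simp add: \<rho>_def)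
  moreover have "L > 0" using K by (simp add: L_def add_pos_nonneg)
  moreover have "D \<noteq> 0 \<and> norm (1 / D - 1 / \<delta> + c * \<delta>) \<le> L * (norm \<delta>)\<^sup>2"
    if \<delta>: "\<delta> \<noteq> 0" "norm \<delta> < \<rho>" and D: "norm (D - (\<delta> + c * \<delta> ^ 3)) \<le> K * norm \<delta> ^ 4" for \<delta> D
  proof -
    define n where "n = norm \<delta>"
    have n: "0 < n" "n \<le> 1" "n < 1 / (2 * A)" using \<delta> by (auto simp: n_def \<rho>_def)
    have n_pow: "n ^ Suc k \<le> n ^ k" for k using n by (intro power_decreasing) auto
    have n32: "n ^ 3 \<le> n\<^sup>2" "n ^ 4 \<le> n\<^sup>2" "n ^ 5 \<le> n ^ 4" "n\<^sup>2 \<le> 1"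
      using n by (auto intro!: power_decreasing simp: power_le_one)
    define E where "E = D - (\<delta> + c * \<delta> ^ 3)"
    have E: "norm E \<le> K * n ^ 4" using D by (simp add: E_def n_def)
    have "norm (D - \<delta>) = norm (c * \<delta> ^ 3 + E)" by (simp add: E_def)
    also have "\<dots> \<le> norm (c * \<delta> ^ 3) + norm E" by (rule norm_triangle_ineq)
    also have "\<dots> \<le> norm c * n ^ 3 + K * n ^ 4" using E by (simp add: norm_mult norm_power n_def)
    also have "\<dots> \<le> norm c * n\<^sup>2 + K * n\<^sup>2" using n32 K by (intro add_mono mult_left_mono) auto
    also have "\<dots> = (A * n) * n" by (simp add: A_def power2_eq_square algebra_simps)
    also have "\<dots> \<le> (1 / 2) * n" using n A by (intro mult_right_mono) (auto simp: field_simps)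
    finally have "norm (D - \<delta>) \<le> n / 2" by simp
    moreover have "n \<le> norm D + norm (D - \<delta>)" using norm_triangle_sub[of \<delta> D] by (simp add: n_def norm_minus_commute)
    ultimately have D_low: "n / 2 \<le> norm D" by linarith
    have D0: "D \<noteq> 0" using D_low n by auto
    have D_eq: "D = \<delta> + c * \<delta> ^ 3 + E" by (simp add: E_def)
    define P where "P = - E + c\<^sup>2 * \<delta> ^ 5 + c * \<delta>\<^sup>2 * E"
    have "\<delta> - D + c * \<delta>\<^sup>2 * D = P" unfolding D_eq P_def by (simp add: algebra_simps power2_eq_square power3_eq_cube eval_nat_numeral)
    moreover have "1 / D - 1 / \<delta> + c * \<delta> = (\<delta> - D + c * \<delta>\<^sup>2 * D) / (\<delta> * D)"
      using D0 \<delta> by (simp add: field_simps power2_eq_square)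
    ultimately have eq: "norm (1 / D - 1 / \<delta> + c * \<delta>) = norm P / (n * norm D)" by (simp add: norm_divide norm_mult n_def)
    have "norm P \<le> norm (- E + c\<^sup>2 * \<delta> ^ 5) + norm (c * \<delta>\<^sup>2 * E)" unfolding P_def by (rule norm_triangle_ineq)
    also have "\<dots> \<le> norm E + norm (c\<^sup>2 * \<delta> ^ 5) + norm (c * \<delta>\<^sup>2 * E)"
      using norm_triangle_ineq[of "- E" "c\<^sup>2 * \<delta> ^ 5"] by simp
    also have "\<dots> = norm E + (norm c)\<^sup>2 * n ^ 5 + norm c * (n\<^sup>2 * norm E)" by (simp add: norm_mult norm_power n_def)
    also have "\<dots> \<le> K * n ^ 4 + (norm c)\<^sup>2 * n ^ 4 + norm c * (1 * (K * n ^ 4))"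
      using E n32 by (intro add_mono mult_left_mono mult_mono) auto
    also have "\<dots> = L / 2 * n ^ 4" by (simp add: L_def algebra_simps)
    finally have P: "norm P \<le> L / 2 * n ^ 4" .
    have "norm P / (n * norm D) \<le> (L / 2 * n ^ 4) / (n * (n / 2))"
      using P D_low n \<open>L > 0\<close> by (intro frac_le mult_left_mono mult_pos_pos) auto
    also have "\<dots> = L * n\<^sup>2" using n by (simp add: power2_eq_square eval_nat_numeral)
    finally show ?thesis using D0 eq by (simp add: n_def)
  qed
  ultimately show ?thesis by (rule that) blast+
qed

section \<open>Expansion of the map at infinity\<close>

context doubly_parabolic_chart
begin

text \<open>\<open>H\<close> is \<open>G\<close> in the coordinate of the half-plane, hence
  holomorphic on both sides of the real line near infinity. Radial limits give
  \<open>T x = Re (H x)\<close>. To see that \<open>H\<close> is real there, note that the set where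
  its imaginary part does not vanish is open; since \<open>g\<close> is inner it is also a null set,
  so it is empty.\<close>

lemma expansion_at_infinity:
  obtains k :: complex and R C :: real and H where
    "k \<noteq> 0" "R > 0" "C > 0" "H holomorphic_on {w. R < norm w}"
    "\<And>w. R < norm w \<Longrightarrow> norm (H w - w + k / w) \<le> C / (norm w)\<^sup>2"
    "\<And>w. R < norm w \<Longrightarrow> Im w > 0 \<Longrightarrow> h w = H w"
    "\<And>x. R < \<bar>x\<bar> \<Longrightarrow> of_real (T x) = H (of_real x)"
proof -
  obtain G r c where G: "r > 0" "G holomorphic_on ball p r"
      "\<And>z. z \<in> ball p r \<Longrightarrow> norm z < 1 \<Longrightarrow> G z = g z" "c \<noteq> 0"
    and big: "(\<lambda>z. G z - (p + (z - p) + c * (z - p) ^ 3)) \<in> O[at p](\<lambda>z. (z - p) ^ 4)"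
    using parabolic unfolding doubly_parabolic_def by (auto simp: Ball_def)
  obtain K where K: "K > 0" "eventually (\<lambda>z. norm (G z - (p + (z - p) + c * (z - p) ^ 3)) \<le> K * norm ((z - p) ^ 4)) (at p)"
    by (rule landau_o.bigE[OF big]) (rule that)
  obtain d where d: "d > 0" "\<And>z. z \<noteq> p \<Longrightarrow> dist z p < d \<Longrightarrow> norm (G z - (p + (z - p) + c * (z - p) ^ 3)) \<le> K * norm ((z - p) ^ 4)"
    using K(2) unfolding eventually_at by auto
  obtain \<rho> L where \<rho>: "\<rho> > 0" "L > 0"
    "\<And>\<delta> D. \<delta> \<noteq> 0 \<Longrightarrow> norm \<delta> < \<rho> \<Longrightarrow> norm (D - (\<delta> + c * \<delta> ^ 3)) \<le> K * norm \<delta> ^ 4 \<Longrightarrow>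
      D \<noteq> 0 \<and> norm (1 / D - 1 / \<delta> + c * \<delta>) \<le> L * (norm \<delta>)\<^sup>2"
    by (rule cubic_perturbation[OF K(1), of c]) blast
  define \<rho>' where "\<rho>' = min r (min d \<rho>)"
  have \<rho>': "\<rho>' > 0" "\<rho>' \<le> r" "\<rho>' \<le> d" "\<rho>' \<le> \<rho>" using G d \<rho> by (auto simp: \<rho>'_def)
  have G_near: "G (p + \<delta>) - p \<noteq> 0 \<and> norm (1 / (G (p + \<delta>) - p) - 1 / \<delta> + c * \<delta>) \<le> L * (norm \<delta>)\<^sup>2"
    if "\<delta> \<noteq> 0" "norm \<delta> < \<rho>'" for \<delta>
  proof (rule \<rho>(3))
    show "norm (G (p + \<delta>) - p - (\<delta> + c * \<delta> ^ 3)) \<le> K * norm \<delta> ^ 4"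
      using d(2)[of "p + \<delta>"] that \<rho>' by (simp add: dist_norm norm_power algebra_simps)
  qed (use that \<rho>' in auto)
  \<comment> \<open>Outside of this radius \<open>w\<close> is far from \<open>\<alpha>\<close>, and
    \<open>\<delta> w\<close>, the displacement of \<open>N w\<close> from \<open>p\<close>, is
    smaller than \<open>\<rho>'\<close>.\<close>
  define R where "R = 2 * norm \<alpha> + 2 * norm \<beta> / \<rho>' + 1"
  have R: "R > 0" "R \<ge> 1" using \<rho>' by (auto simp: R_def add_nonneg_pos)
  define \<delta> where "\<delta> w = \<beta> / (w - \<alpha>)" for w
  have far: "w - \<alpha> \<noteq> 0" "norm w / 2 \<le> norm (w - \<alpha>)" "\<delta> w \<noteq> 0" "norm (\<delta> w) \<le> 2 * norm \<beta> / norm w"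
    "norm (\<delta> w) < \<rho>'" if w: "R < norm w" for w
  proof -
    have "2 * norm \<beta> / \<rho>' \<ge> 0" using \<rho>' by simp
    then have "2 * norm \<alpha> \<le> norm w" "2 * norm \<beta> / \<rho>' < norm w"
      using w unfolding R_def using norm_ge_zero[of \<alpha>] by linarith+
    moreover have w0: "norm w > 0" using w R by linarith
    ultimately show le: "norm w / 2 \<le> norm (w - \<alpha>)" using norm_triangle_ineq2[of w \<alpha>] by linarith
    then show ne: "w - \<alpha> \<noteq> 0" using w0 by auto
    show "\<delta> w \<noteq> 0" using ne \<beta> by (simp add: \<delta>_def)
    have "norm (\<delta> w) = norm \<beta> / norm (w - \<alpha>)" by (simp add: \<delta>_def norm_divide)
    also have "\<dots> \<le> norm \<beta> / (norm w / 2)" using le w0 ne by (intro divide_left_mono mult_pos_pos) auto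
    finally show le2: "norm (\<delta> w) \<le> 2 * norm \<beta> / norm w" by (simp add: mult.commute)
    also have "2 * norm \<beta> / norm w < \<rho>'"
      using \<open>2 * norm \<beta> / \<rho>' < norm w\<close> w0 \<rho>'(1) by (simp add: field_simps)
    finally show "norm (\<delta> w) < \<rho>'" .
  qed
  define H where "H w = \<alpha> + \<beta> / (G (p + \<delta> w) - p)" for w
  have G_ne: "G (p + \<delta> w) \<noteq> p" if "R < norm w" for w
    using G_near[OF far(3)[OF that] far(5)[OF that]] by auto
  have N_\<delta>: "N w = p + \<delta> w" for w by (simp add: N_def \<delta>_def)
  have in_ball: "p + \<delta> w \<in> ball p r" if "R < norm w" for w
    using far(5)[OF that] \<rho>' by (simp add: dist_norm)
  have H_hol: "H holomorphic_on {w. R < norm w}"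
  proof -
    have "(\<lambda>w. p + \<delta> w) holomorphic_on {w. R < norm w}"
      unfolding \<delta>_def using far(1) by (intro holomorphic_intros) auto
    then have "(G \<circ> (\<lambda>w. p + \<delta> w)) holomorphic_on {w. R < norm w}"
      by (rule holomorphic_on_compose_gen[OF _ G(2)]) (use in_ball in auto)
    then show ?thesis unfolding H_def using G_ne by (intro holomorphic_intros) (auto simp: o_def)
  qed
  define k where "k = \<beta>\<^sup>2 * c"
  define C where "C = 4 * norm \<beta> ^ 3 * L + 2 * norm k * norm \<alpha>"
  have C: "C > 0" using \<rho>(2) \<beta>(2) by (simp add: C_def add_pos_nonneg)
  have H_asymp: "norm (H w - w + k / w) \<le> C / (norm w)\<^sup>2" if w: "R < norm w" for w
  proof -
    define n where "n = norm w"
    have n: "n > 0" using w R unfolding n_def by linarith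
    have w0: "w \<noteq> 0" using n by (auto simp: n_def)
    have "w = \<alpha> + \<beta> / \<delta> w" using far(1,3)[OF w] \<beta>(2) by (simp add: \<delta>_def)
    then have "H w - w = \<beta> * (1 / (G (p + \<delta> w) - p) - 1 / \<delta> w)" by (simp add: H_def algebra_simps)
    moreover have "k / (w - \<alpha>) = \<beta> * (c * \<delta> w)" by (simp add: k_def \<delta>_def power2_eq_square)
    ultimately have 1: "H w - w + k / (w - \<alpha>) = \<beta> * (1 / (G (p + \<delta> w) - p) - 1 / \<delta> w + c * \<delta> w)"
      by (simp add: algebra_simps)
    have "norm (H w - w + k / (w - \<alpha>)) \<le> norm \<beta> * (L * (norm (\<delta> w))\<^sup>2)"
      unfolding 1 norm_mult using G_near[OF far(3)[OF w] far(5)[OF w]] by (intro mult_left_mono) auto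
    also have "\<dots> \<le> norm \<beta> * (L * (2 * norm \<beta> / n)\<^sup>2)"
      using far(4)[OF w] \<rho>(2) by (intro mult_left_mono power_mono) (auto simp: n_def)
    also have "\<dots> = 4 * norm \<beta> ^ 3 * L / n\<^sup>2" by (simp add: power2_eq_square power3_eq_cube)
    finally have a: "norm (H w - w + k / (w - \<alpha>)) \<le> 4 * norm \<beta> ^ 3 * L / n\<^sup>2" .
    have "k / w - k / (w - \<alpha>) = - (k * \<alpha>) / (w * (w - \<alpha>))" using w0 far(1)[OF w] by (simp add: field_simps)
    then have "norm (k / w - k / (w - \<alpha>)) = norm k * norm \<alpha> / (n * norm (w - \<alpha>))"
      by (simp add: norm_mult norm_divide n_def)
    also have "\<dots> \<le> norm k * norm \<alpha> / (n * (n / 2))"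
      using far(2)[OF w] n by (intro divide_left_mono mult_left_mono mult_pos_pos) (auto simp: n_def)
    also have "\<dots> = 2 * norm k * norm \<alpha> / n\<^sup>2" by (simp add: power2_eq_square)
    finally have b: "norm (k / w - k / (w - \<alpha>)) \<le> 2 * norm k * norm \<alpha> / n\<^sup>2" .
    have split: "H w - w + k / w = (H w - w + k / (w - \<alpha>)) + (k / w - k / (w - \<alpha>))" by simp
    have "norm (H w - w + k / w) \<le> norm (H w - w + k / (w - \<alpha>)) + norm (k / w - k / (w - \<alpha>))"
      unfolding split by (rule norm_triangle_ineq)
    also have "\<dots> \<le> 4 * norm \<beta> ^ 3 * L / n\<^sup>2 + 2 * norm k * norm \<alpha> / n\<^sup>2" using a b by (rule add_mono)
    also have "\<dots> = C / n\<^sup>2" by (simp add: C_def add_divide_distrib)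
    finally show ?thesis by (simp add: n_def)
  qed
  have h_H: "h w = H w" if "R < norm w" "Im w > 0" for w
  proof -
    have "G (p + \<delta> w) = g (N w)" using G(3)[OF in_ball[OF that(1)]] N_disc[OF that(2)] by (simp add: N_\<delta>)
    then show ?thesis using h_eq[OF that(2)] M_eq[OF disc_ne[OF g_disc[OF N_disc[OF that(2)]]]] by (simp add: H_def)
  qed
  have radial: "((\<lambda>r. g (of_real r * N (of_real x))) \<longlongrightarrow> G (N (of_real x))) (at_left 1)" if x: "R < \<bar>x\<bar>" for x
  proof -
    define \<zeta> where "\<zeta> = N (of_real x)"
    have \<zeta>: "\<zeta> \<in> ball p r" "norm \<zeta> = 1" using in_ball[of "of_real x"] x N_circle by (auto simp: \<zeta>_def N_\<delta>)
    have "((\<lambda>r. of_real r * \<zeta>) \<longlongrightarrow> of_real 1 * \<zeta>) (at_left 1)" by (intro tendsto_intros)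
    then have lim: "((\<lambda>r. of_real r * \<zeta>) \<longlongrightarrow> \<zeta>) (at_left 1)" by simp
    have "isCont G \<zeta>" using G(2) \<zeta>(1) by (intro holomorphic_on_imp_continuous_on[THEN continuous_on_interior]) auto
    then have "((\<lambda>r. G (of_real r * \<zeta>)) \<longlongrightarrow> G \<zeta>) (at_left 1)" using lim by (rule isCont_tendsto_compose)
    moreover have "eventually (\<lambda>r'. of_real r' * \<zeta> \<in> ball p r) (at_left 1)"
      by (rule topological_tendstoD[OF lim open_ball \<zeta>(1)])
    then have "eventually (\<lambda>r. G (of_real r * \<zeta>) = g (of_real r * \<zeta>)) (at_left 1)"
      using at_left_pos by eventually_elim (simp add: G(3) norm_mult_radius \<zeta>(2))
    ultimately show ?thesis unfolding \<zeta>_def[symmetric] by (rule Lim_transform_eventually)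
  qed
  have T_H: "T x = Re (H (of_real x))" if x: "R < \<bar>x\<bar>" for x
  proof (rule T_limit)
    have "G (N (of_real x)) \<noteq> p" using G_ne[of "of_real x"] x by (simp add: N_\<delta>)
    then have "((\<lambda>r. M (g (of_real r * N (of_real x)))) \<longlongrightarrow> M (G (N (of_real x)))) (at_left 1)"
      by (rule isCont_tendsto_compose[OF isCont_M radial[OF x]])
    then show "((\<lambda>r. \<phi> r x) \<longlongrightarrow> H (of_real x)) (at_left 1)"
      using \<open>G (N (of_real x)) \<noteq> p\<close> by (simp add: \<phi>_def H_def M_eq N_\<delta>)
  qed
  define U where "U = {x :: real. R < \<bar>x\<bar>} \<inter> (\<lambda>x. Im (H (of_real x))) -` (- {0})"
  have "open U"
    unfolding U_def
  proof (rule continuous_open_preimage)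
    show "open {x :: real. R < \<bar>x\<bar>}" by (intro open_Collect_less continuous_intros)
    show "continuous_on {x. R < \<bar>x\<bar>} (\<lambda>x. Im (H (of_real x)))"
      by (intro continuous_on_Im continuous_on_compose2[OF holomorphic_on_imp_continuous_on[OF H_hol]] continuous_intros) auto
  qed auto
  then have U_sets [measurable]: "U \<in> sets borel" by simp
  have X_U: "AE t in angle_measure. X t \<notin> U"
    using AE_radial_limit
  proof eventually_elim
    case (elim t)
    then obtain l where t: "cis t \<noteq> p" and l: "norm l = 1" "l \<noteq> p" "((\<lambda>r. g (of_real r * cis t)) \<longlongrightarrow> l) (at_left 1)" by blast
    show ?case
    proof
      assume "X t \<in> U"
      then have x: "R < \<bar>X t\<bar>" "Im (H (of_real (X t))) \<noteq> 0" by (auto simp: U_def)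
      have "((\<lambda>r. g (of_real r * cis t)) \<longlongrightarrow> G (cis t)) (at_left 1)"
        using radial[OF x(1)] by (simp add: T_boundary(2)[OF t l])
      then have "l = G (cis t)" using tendsto_unique[OF _ l(3)] by simp
      moreover have "cis t = p + \<delta> (of_real (X t))" using T_boundary(2)[OF t l] by (simp add: N_\<delta>)
      ultimately have "H (of_real (X t)) = M l" using l(2) by (simp add: H_def M_eq)
      then have "H (of_real (X t)) = of_real (T (X t))" using T_boundary(1)[OF t l] by simp
      then show False using x(2) by simp
    qed
  qed
  have "{x \<in> space borel. x \<notin> U} = - U" by auto
  then have compl: "{x \<in> space borel. x \<notin> U} \<in> sets borel" using U_sets by (simp add: borel_comp)
  have "AE x in distr angle_measure borel X. x \<notin> U"
  proof (subst AE_distr_iff[OF _ compl])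
    show "X \<in> borel_measurable angle_measure" by measurable
  qed (rule X_U)
  then have "AE x in lborel. x \<notin> U"
    unfolding pushforward cauchy_def using poisson_pos[OF M_upper[of 0]] by (subst (asm) AE_density) auto
  then have "U \<in> null_sets lborel" using U_sets by (subst AE_iff_null_sets) auto
  then have "negligible U" by (auto simp: negligible_iff_null_sets intro: null_sets_completionI)
  then have "U = {}" using open_not_negligible[OF \<open>open U\<close>] by blast
  then have "Im (H (of_real x)) = 0" if "R < \<bar>x\<bar>" for x using that by (auto simp: U_def)
  then have T_H': "of_real (T x) = H (of_real x)" if "R < \<bar>x\<bar>" for x
    using T_H[OF that] that by (simp add: complex_eq_iff)
  have "k \<noteq> 0" using \<beta>(2) G(4) by (simp add: k_def)
  then show ?thesis by (rule that[OF _ R(1) C H_hol H_asymp h_H T_H'])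
qed

text \<open>The coefficient \<open>k\<close> is real because \<open>H\<close> maps real numbers near
  infinity to real numbers. The estimate of \<open>T'\<close> is the Cauchy inequality on the disc
  of radius \<open>\<bar>x\<bar> / 2\<close> around \<open>x\<close>; this is the origin of
  \<open>8 * C\<close> and \<open>2 * R\<close>.\<close>

theorem parabolic_map_exists: "\<exists>T' \<kappa> C R. parabolic_map h T T' \<kappa> C R"
proof -
  obtain k :: complex and R C :: real and H where k: "k \<noteq> 0" and R: "R > 0" and C: "C > 0"
    and H: "H holomorphic_on {w. R < norm w}"
    and H_asymp: "\<And>w. R < norm w \<Longrightarrow> norm (H w - w + k / w) \<le> C / (norm w)\<^sup>2"
    and h_H: "\<And>w. R < norm w \<Longrightarrow> Im w > 0 \<Longrightarrow> h w = H w"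
    and T_H: "\<And>x. R < \<bar>x\<bar> \<Longrightarrow> of_real (T x) = H (of_real x)"
    by (rule expansion_at_infinity) blast
  have "Im k = 0"
  proof (rule ccontr)
    assume "Im k \<noteq> 0"
    define x where "x = R + C / \<bar>Im k\<bar> + 1"
    have "C / \<bar>Im k\<bar> \<ge> 0" using C by simp
    then have x: "x > R" "x > 0" "x > C / \<bar>Im k\<bar>" using R unfolding x_def by linarith+
    have "\<bar>Im k\<bar> / x = \<bar>Im (H (of_real x) - of_real x + k / of_real x)\<bar>"
      using T_H[of x] x R by (simp add: Im_divide_of_real complex_eq_iff)
    also have "\<dots> \<le> norm (H (of_real x) - of_real x + k / of_real x)" by (rule abs_Im_le_cmod)
    also have "\<dots> \<le> C / x\<^sup>2" using H_asymp[of "of_real x"] x by simp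
    finally have "\<bar>Im k\<bar> * x \<le> C" using x by (simp add: field_simps power2_eq_square)
    then show False using x \<open>Im k \<noteq> 0\<close> by (simp add: field_simps)
  qed
  then have k_eq: "k = of_real (Re k)" by (simp add: complex_eq_iff)
  define \<kappa> where "\<kappa> = Re k"
  have H_asymp': "norm (H w - w + of_real \<kappa> / w) \<le> C / (norm w)\<^sup>2" if "R < norm w" for w
    using H_asymp[OF that] k_eq by (simp add: \<kappa>_def)
  have "open {w :: complex. R < norm w}" by (intro open_Collect_less continuous_intros)
  note H_deriv = holomorphic_derivI[OF H this]
  define T' where "T' x = Re (deriv H (of_real x))" for x
  have "parabolic_map h T T' \<kappa> (8 * C) (2 * R)"
  proof
    show "T \<in> borel_measurable borel" by (rule T_borel)
    show "h holomorphic_on {w. Im w > 0}" by (rule h_holomorphic)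
    show "8 * C > 0" "2 * R > 0" using C R by auto
    show "\<kappa> \<noteq> 0" using k k_eq by (auto simp: \<kappa>_def)
    have weak: "y \<le> 8 * C / q" if "y \<le> C / q" "q > 0" for y q
      using that C by (simp add: field_simps)
    show "norm (h w - w + of_real \<kappa> / w) \<le> 8 * C / (norm w)\<^sup>2" if "Im w > 0" "norm w > 2 * R" for w
    proof -
      have w: "R < norm w" using that R by linarith
      have "(norm w)\<^sup>2 > 0" using w R by auto
      then show ?thesis using H_asymp'[OF w] h_H[OF w that(1)] by (intro weak) auto
    qed
    show "\<bar>T x - x + \<kappa> / x\<bar> \<le> 8 * C / x\<^sup>2" if "\<bar>x\<bar> > 2 * R" for x
    proof -
      have x: "R < \<bar>x\<bar>" "x\<^sup>2 > 0" using that R by auto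
      have "of_real (T x - x + \<kappa> / x) = H (of_real x) - of_real x + of_real \<kappa> / of_real x"
        using T_H[OF x(1)] by simp
      then have "\<bar>T x - x + \<kappa> / x\<bar> = norm (H (of_real x) - of_real x + of_real \<kappa> / of_real x)"
        by (metis norm_of_real)
      also have "\<dots> \<le> C / x\<^sup>2" using H_asymp'[of "of_real x"] x by simp
      finally show ?thesis using x(2) by (rule weak)
    qed
    show "(T has_real_derivative T' x) (at x)" if "\<bar>x\<bar> > 2 * R" for x
    proof -
      have x: "R < \<bar>x\<bar>" using that R by linarith
      have "(H has_field_derivative deriv H (of_real x)) (at (of_real x))" by (rule H_deriv) (use x in simp)
      then have "((\<lambda>t. H (of_real t)) has_vector_derivative deriv H (of_real x)) (at x)"
        by (rule has_vector_derivative_real_field)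
      then have "((\<lambda>t. Re (H (of_real t))) has_vector_derivative T' x) (at x)"
        unfolding T'_def by (rule bounded_linear.has_vector_derivative[OF bounded_linear_Re])
      then have d: "((\<lambda>t. Re (H (of_real t))) has_real_derivative T' x) (at x)"
        by (simp add: has_real_derivative_iff_has_vector_derivative)
      have op: "open {x :: real. R < \<bar>x\<bar>}" by (intro open_Collect_less continuous_intros)
      have eq: "Re (H (of_real y)) = T y" if "y \<in> {x. R < \<bar>x\<bar>}" for y
        using T_H[of y] that by (metis Re_complex_of_real mem_Collect_eq)
      show ?thesis by (rule has_field_derivative_transform_within_open[OF d op _ eq]) (use x in auto)
    qed
    show "continuous_on {x. \<bar>x\<bar> > 2 * R} T'"
    proof -
      have "deriv H holomorphic_on {w. R < norm w}"
        by (rule holomorphic_deriv[OF H \<open>open {w. R < norm w}\<close>])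
      then have "continuous_on {x. \<bar>x\<bar> > 2 * R} (\<lambda>x. deriv H (of_real x))"
        by (rule continuous_on_compose2[OF holomorphic_on_imp_continuous_on]) (use R in \<open>auto intro!: continuous_intros\<close>)
      then show ?thesis unfolding T'_def by (rule continuous_on_Re)
    qed
    show "\<bar>T' x - 1 - \<kappa> / x\<^sup>2\<bar> \<le> 8 * C / \<bar>x\<bar> ^ 3" if "\<bar>x\<bar> > 2 * R" for x
    proof -
      define r where "r = \<bar>x\<bar> / 2"
      have r: "R < r" "0 < r" "x \<noteq> 0" using that R by (auto simp: r_def)
      define f where "f w = H w - w + of_real \<kappa> / w" for w
      have far: "r \<le> norm w" if "w \<in> cball (of_real x) r" for w :: complex
      proof -
        have "norm (of_real x :: complex) \<le> norm w + norm (of_real x - w)" by (rule norm_triangle_sub)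
        moreover have "norm (of_real x - w) \<le> r" using that by (simp add: dist_norm)
        ultimately show ?thesis unfolding norm_of_real r_def by linarith
      qed
      have f_hol: "f holomorphic_on cball (of_real x) r"
        unfolding f_def using far r
        by (intro holomorphic_intros holomorphic_on_subset[OF H]) force+
      have "norm ((deriv ^^ 1) f (of_real x)) \<le> fact 1 * (C / r\<^sup>2) / r ^ 1"
      proof (rule Cauchy_inequality)
        show "f holomorphic_on ball (of_real x) r" by (rule holomorphic_on_subset[OF f_hol]) auto
        show "continuous_on (cball (of_real x) r) f" by (rule holomorphic_on_imp_continuous_on[OF f_hol])
        fix w :: complex assume "norm (of_real x - w) = r"
        then have w: "r \<le> norm w" by (intro far) (simp add: dist_norm)
        have "norm (f w) \<le> C / (norm w)\<^sup>2" unfolding f_def by (rule H_asymp') (use w r in linarith)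
        also have "\<dots> \<le> C / r\<^sup>2" using w r C by (intro divide_left_mono power_mono mult_pos_pos zero_less_power) auto
        finally show "norm (f w) \<le> C / r\<^sup>2" .
      qed fact
      also have "fact 1 * (C / r\<^sup>2) / r ^ 1 = 8 * C / \<bar>x\<bar> ^ 3"
        by (simp add: r_def power2_eq_square power3_eq_cube)
      finally have bound: "norm (deriv f (of_real x)) \<le> 8 * C / \<bar>x\<bar> ^ 3" by simp
      have "(H has_field_derivative deriv H (of_real x)) (at (of_real x))"
        by (rule H_deriv) (use that R in simp)
      then have "(f has_field_derivative deriv H (of_real x) - 1 - of_real \<kappa> / (of_real x)\<^sup>2) (at (of_real x))"
        unfolding f_def using r(3) by (auto intro!: derivative_eq_intros simp: power2_eq_square)
      then have "deriv f (of_real x) = deriv H (of_real x) - 1 - of_real \<kappa> / (of_real x)\<^sup>2"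
        by (rule DERIV_imp_deriv)
      then have "T' x - 1 - \<kappa> / x\<^sup>2 = Re (deriv f (of_real x))"
        by (simp add: T'_def Re_divide_of_real flip: of_real_power of_real_divide)
      then show ?thesis using bound abs_Re_le_cmod[of "deriv f (of_real x)"] by linarith
    qed
  qed (fact h_upper distr_cauchy h_iterates)+
  then show ?thesis by blast
qed

end

theorem theorem4p1:
  fixes h g M :: "complex \<Rightarrow> complex" and p :: complex
    and T :: "real \<Rightarrow> real" and lam :: "real measure"
  assumes h: "doubly_parabolic_UHP h g M p"
  defines "T \<equiv> boundary_extension h M p"
    and "lam \<equiv> pushforward_measure M"
  shows "(\<forall>a b :: real. a < b \<longrightarrow>
           (\<forall>\<epsilon>. 0 < \<epsilon> \<and> \<epsilon> < 1 / 2 \<longrightarrow>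
             (AE x in lam. filterlim (\<lambda>n. real (visits T {a..b} n x) / real n powr (1 / 2 - \<epsilon>))
                             at_top sequentially))) \<and>
         (\<forall>a b :: real. a < b \<longrightarrow>
           (\<lambda>n. measure lam (return_set T {a..b} n)) \<lesssim> (\<lambda>n. 1 / (real n * sqrt (real n))) \<and>
           (\<lambda>n. 1 / (real n * sqrt (real n))) \<lesssim>\<^sub>\<infinity> (\<lambda>n. measure lam (return_set T {a..b} n))) \<and>
         (\<exists>a\<^sub>0 b\<^sub>0 :: real. a\<^sub>0 < b\<^sub>0 \<and> (\<forall>a b. {a\<^sub>0..b\<^sub>0} \<subseteq> {a..b} \<longrightarrow>
           (\<lambda>n. measure lborel (excursion_set T (UNIV - {a..b}) n)) \<lesssim> (\<lambda>n. 1 / sqrt (real n)) \<and>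
           (\<lambda>n. 1 / sqrt (real n)) \<lesssim> (\<lambda>n. measure lborel (excursion_set T (UNIV - {a..b}) n))))"
proof -
  have g: "doubly_parabolic g p" and M: "moebius_to_UHP M p"
    and h_eq: "\<And>w. Im w > 0 \<Longrightarrow> h w = M (g (UHP_inverse M p w))"
    using h by (auto simp: doubly_parabolic_UHP_def upper_half_plane_def)
  have p: "norm p = 1" using g by (simp add: doubly_parabolic_def)
  obtain s t where "half_plane_chart M p s t" by (rule moebius_chart[OF M p])
  then interpret half_plane_chart M p s t .
  interpret doubly_parabolic_chart M p s t h g T
  proof
    show "doubly_parabolic g p" by fact
    show "h w = M (g (N w))" if "Im w > 0" for w using h_eq[OF that] UHP_inverse_eq[of w] that by simp
    show "T x = Re (Lim (at_left 1) (\<lambda>r. h (M (of_real r * N (of_real x)))))" for x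
      by (simp add: T_def boundary_extension_def UHP_inverse_eq)
  qed
  obtain T' \<kappa> C R where "parabolic_map h T T' \<kappa> C R" using parabolic_map_exists by blast
  then interpret parabolic_map h T T' \<kappa> C R .
  \<comment> \<open>\<open>lam\<close> thus has a positive density with respect to Lebesgue measure,
    bounded above and away from 0 on bounded sets. Null sets and the rates on \<open>{a..b}\<close>
    carry over.\<close>
  have lam: "lam = cauchy (M 0)" unfolding lam_def pushforward_measure_eq pushforward ..
  have M0: "Im (M 0) > 0" by (rule M_upper) simp
  have visits: "AE x in lam. filterlim (\<lambda>n. real (visits T {a..b} n x) / real n powr (1 / 2 - \<epsilon>)) at_top sequentially"
    if "a < b" "0 < \<epsilon>" "\<epsilon> < 1 / 2" for a b \<epsilon>
    unfolding lam cauchy_def using AE_visits_lborel[OF that] by (subst AE_density) auto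
  have return: "(\<lambda>n. measure lam (return_set T {a..b} n)) \<lesssim> (\<lambda>n. 1 / (real n * sqrt (real n))) \<and>
      (\<lambda>n. 1 / (real n * sqrt (real n))) \<lesssim>\<^sub>\<infinity> (\<lambda>n. measure lam (return_set T {a..b} n))"
    if ab: "a < b" for a b
  proof -
    define \<rho> where "\<rho> = \<bar>a\<bar> + \<bar>b\<bar>"
    define c1 c2 where "c1 = 1 / (pi * Im (M 0))" and "c2 = Im (M 0) / (pi * ((\<rho> + \<bar>Re (M 0)\<bar>)\<^sup>2 + (Im (M 0))\<^sup>2))"
    have c: "c1 > 0" "c2 > 0" using M0 by (auto simp: c1_def c2_def add_nonneg_pos)
    have comparable: "measure lam (return_set T {a..b} n) \<le> c1 * measure lborel (return_set T {a..b} n)"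
      "c2 * measure lborel (return_set T {a..b} n) \<le> measure lam (return_set T {a..b} n)" if n: "n \<ge> 1" for n
    proof -
      have "{x\<in>space borel. x \<in> {a..b} \<and> (\<forall>k. 1 \<le> k \<and> k < n \<longrightarrow> (T ^^ k) x \<notin> {a..b}) \<and> (T ^^ n) x \<in> {a..b}} \<in> sets borel"
        by measurable
      then have "return_set T {a..b} n \<in> sets borel" unfolding return_set_eq[OF n] by (simp add: first_returns_def)
      moreover have "return_set T {a..b} n \<subseteq> {- \<rho>..\<rho>}" by (auto simp: return_set_def \<rho>_def)
      ultimately show "measure lam (return_set T {a..b} n) \<le> c1 * measure lborel (return_set T {a..b} n)"
        "c2 * measure lborel (return_set T {a..b} n) \<le> measure lam (return_set T {a..b} n)"
        unfolding lam c1_def c2_def using measure_cauchy_bounds[OF M0] by blast+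
    qed
    obtain A where A: "A > 0" "\<And>n. n \<ge> 1 \<Longrightarrow> measure lborel (return_set T {a..b} n) \<le> A / (real n * sqrt n)"
      using return_set_upper[OF ab] by metis
    have "measure lam (return_set T {a..b} n) \<le> c1 * A * (1 / (real n * sqrt (real n)))" if n: "n \<ge> 1" for n
    proof -
      have "c1 * measure lborel (return_set T {a..b} n) \<le> c1 * (A / (real n * sqrt n))"
        using A(2)[OF n] c by (intro mult_left_mono) auto
      then show ?thesis using comparable(1)[OF n] by simp
    qed
    moreover have "c1 * A > 0" using c A by simp
    ultimately have "(\<lambda>n. measure lam (return_set T {a..b} n)) \<lesssim> (\<lambda>n. 1 / (real n * sqrt (real n)))"
      unfolding lesssim_def by blast
    moreover obtain B n0 where B: "B > 0" "\<And>n. n \<ge> n0 \<Longrightarrow> B / (real n * sqrt n) \<le> measure lborel (return_set T {a..b} n)"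
      using return_set_lower[OF ab] by metis
    have "1 / (real n * sqrt (real n)) \<le> 1 / (c2 * B) * measure lam (return_set T {a..b} n)" if n: "n \<ge> max 1 n0" for n
    proof -
      have n': "n \<ge> 1" "n \<ge> n0" using n by auto
      have "c2 * (B / (real n * sqrt n)) \<le> c2 * measure lborel (return_set T {a..b} n)"
        using B(2)[OF n'(2)] c by (intro mult_left_mono) auto
      then have "c2 * B * (1 / (real n * sqrt n)) \<le> measure lam (return_set T {a..b} n)"
        using comparable(2)[OF n'(1)] by simp
      then have "1 / (c2 * B) * (c2 * B * (1 / (real n * sqrt n))) \<le> 1 / (c2 * B) * measure lam (return_set T {a..b} n)"
        using c B by (intro mult_left_mono) auto
      then show ?thesis using c B by simp
    qed
    then have "eventually (\<lambda>n. 1 / (real n * sqrt (real n)) \<le> 1 / (c2 * B) * measure lam (return_set T {a..b} n)) sequentially"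
      by (rule eventually_sequentiallyI)
    moreover have "1 / (c2 * B) > 0" using c B by simp
    ultimately show ?thesis unfolding eventually_lesssim_def by blast
  qed
  obtain r where r: "r > 0"
    "\<And>a b. {- r..r} \<subseteq> {a..b} \<Longrightarrow>
      (\<lambda>n. measure lborel (excursion_set T (UNIV - {a..b}) n)) \<lesssim> (\<lambda>n. 1 / sqrt (real n)) \<and>
      (\<lambda>n. 1 / sqrt (real n)) \<lesssim> (\<lambda>n. measure lborel (excursion_set T (UNIV - {a..b}) n))"
    by (rule excursion_set_large) blast
  have "- r < r" using r(1) by simp
  then show ?thesis using visits return r(2) by blast
qed

end
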